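(* Let $\mathbb{F}$ be a field of positive characteristic $p$, let $n$ be a positive integer, $\lambda=(\lambda_1,\ldots,\lambda_\ell)\vdash n$, and let $P$ be a $p$-subgroup of $\mathfrak{S}_n$. (i) $Sc_{\mathfrak{S}_n}(P)\mid S^2M^\lambda$ if and only if $P$ is $\mathfrak{S}_n$-conjugate to $P_M$ for some $M\in\mathcal{R}_\lambda$. Moreover, for any $M\in\mathcal{R}_\lambda$, $[S^2M^\lambda:Sc_{\mathfrak{S}_n}(P_M)]=|[M]_{\mathcal{R}_\lambda}|$. (ii) If $\lambda\ne(n)$ and $\mathcal{X}_\lambda\neq\varnothing$, then $Sc_{\mathfrak{S}_n}(P)\mid\Lambda^2M^\lambda$ if and only if $P$ is $\mathfrak{S}_n$-conjugate to $P_M$ for some $M\in\mathcal{X}_\lambda$. Moreover, for any $M\in\mathcal{X}_\lambda$, $[\Lambda^2M^\lambda:Sc_{\mathfrak{S}_n}(P_M)]=|[M]_{\mathcal{X}_\lambda}|$. (iii) If $\lambda\neq(n)$, then $\mathcal{X}_\lambda=\varnothing$ if and only if $p>2$ and $\ell(\lambda)=2$. If $p>2$ and $\ell(\lambda)=2$, then $[\Lambda^2M^\lambda:Sc_{\mathfrak{S}_n}(Q)]=0$ for any $p$-subgroup $Q$ of $\mathfrak{S}_n$.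
   Context: Modules are finitely generated left modules; $N\mid M$ means $N$ is isomorphic to a direct summand of $M$, and for indecomposable $N$, $[M:N]$ is the multiplicity of $N$ in a decomposition of $M$ into indecomposables. $M^\lambda$ is the Young permutation module: the permutation $\mathbb{F}\mathfrak{S}_n$-module on $\lambda$-tabloids. $S^2,\Lambda^2$ are the symmetric and exterior squares with diagonal action. For a $p$-subgroup $Q$ of a finite group $G$, the Scott module $Sc_G(Q)$ is the indecomposable direct summand (unique up to isomorphism) of the permutation module $(\mathbb{F}_Q)\uparrow^G$ having a trivial submodule and a trivial quotient module. $\ell(\lambda)$ is the number of (non-zero) parts. Matrices. $\mathcal{M}_\lambda$ is the set of non-diagonal $\ell\times\ell$ matrices with entries in $\{0,1,2,\ldots\}$ whose vector of row sums and vector of column sums are both equal to $\lambda=(\lambda_1,\ldots,\lambda_\ell)$. $\mathcal{S}_\lambda=\{M\in\mathcal{M}_\lambda:M=M^t\}$. $\mathcal{N}_\lambda\subseteq\mathcal{M}_\lambda\setminus\mathcal{S}_\lambda$ is a fixed subset containing exactly one matrix of each pair $\{M,M^t\}$ with $M\in\mathcal{M}_\lambda\setminus\mathcal{S}_\lambda$. $D_\lambda=\mathrm{diag}(\lambda_1,\ldots,\lambda_\ell)$ and $\mathcal{R}_\lambda=\mathcal{S}_\lambda\cup\mathcal{N}_\lambda\cup\{D_\lambda\}$. $\mathcal{X}_\lambda=\mathcal{S}_\lambda\cup\mathcal{N}_\lambda$ if $p=2$ and $\mathcal{X}_\lambda=\mathcal{N}_\lambda$ if $p>2$. Subgroups $P_M$.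 $P_{D_\lambda}$ is a Sylow $p$-subgroup of the Young subgroup $\mathfrak{S}_\lambda$. For $S\subseteq\{1,\ldots,n\}$ let $P_S$ be a fixed Sylow $p$-subgroup of the symmetric group on $S$ (trivial if $S=\varnothing$). For $M=(b_{i,j})\in\mathcal{M}_\lambda$ fix pairwise disjoint subsets $s_{i,j}$ of $\{1,\ldots,n\}$ with $|s_{i,j}|=b_{i,j}$. If $p>2$ or $M\ne M^t$, $P_M=\prod_{i,j}P_{s_{i,j}}$. If $p=2$ and $M=M^t$, fix an involution $e_M\in\mathfrak{S}_n$ whose set of moved points is $\{1,\ldots,n\}\setminus\bigcup_ks_{k,k}$ and with $e_M(s_{i,j})=s_{j,i}$ for all $i,j$, and put $P_M=\big(\prod_kP_{s_{k,k}}\times\prod_{i<j}(P_{s_{i,j}}\times e_MP_{s_{i,j}}e_M)\big)\rtimes\langle e_M\rangle$. The $\mathfrak{S}_n$-conjugacy class of $P_M$ does not depend on these choices. For $M,N\in\mathcal{R}_\lambda$ write $M\sim N$ if $P_M$ is $\mathfrak{S}_n$-conjugate to $P_N$; $[M]_{\mathcal{R}_\lambda}$ is the equivalence class of $M$ in $\mathcal{R}_\lambda$, and for $M\in\mathcal{X}_\lambda$, $[M]_{\mathcal{X}_\lambda}=\{X\in\mathcal{X}_\lambda:X\sim M\}$. *)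

theory Defs
  imports
    "HOL-Algebra.Algebra"
    "HOL-Computational_Algebra.Primes"
    "Jordan_Normal_Form.Matrix"
begin

section \<open>Modules over a group algebra\<close>

text \<open>A left module over the group algebra \<open>RG\<close> is an \<open>R\<close>-module together with a linear action
  \<open>act\<close> of \<open>G\<close>. Only \<open>carrier\<close>, \<open>zero\<close>, \<open>add\<close>, \<open>smult\<close> and \<open>act\<close> matter: the fields \<open>mult\<close> and
  \<open>one\<close>, inherited from the ring record underlying modules, play no role.\<close>

record ('f, 'v, 'g) gmod = "('f, 'v) module" +
  act :: "'g \<Rightarrow> 'v \<Rightarrow> 'v"

locale gmodule = G?: group G + V?: module R V
  for G :: "('g, 'a) monoid_scheme" (structure) and R :: "('f, 'b) ring_scheme" (structure)
    and V :: "('f, 'v, 'g, 'c) gmod_scheme" (structure) +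
  assumes act_closed: "\<lbrakk>g \<in> carrier G; v \<in> carrier V\<rbrakk> \<Longrightarrow> act V g v \<in> carrier V"
    and act_add: "\<lbrakk>g \<in> carrier G; v \<in> carrier V; w \<in> carrier V\<rbrakk>
      \<Longrightarrow> act V g (v \<oplus>\<^bsub>V\<^esub> w) = act V g v \<oplus>\<^bsub>V\<^esub> act V g w"
    and act_smult: "\<lbrakk>g \<in> carrier G; a \<in> carrier R; v \<in> carrier V\<rbrakk>
      \<Longrightarrow> act V g (a \<odot>\<^bsub>V\<^esub> v) = a \<odot>\<^bsub>V\<^esub> act V g v"
    and act_one: "v \<in> carrier V \<Longrightarrow> act V \<one>\<^bsub>G\<^esub> v = v"
    and act_mult: "\<lbrakk>g \<in> carrier G; h \<in> carrier G; v \<in> carrier V\<rbrakk>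
      \<Longrightarrow> act V (g \<otimes>\<^bsub>G\<^esub> h) v = act V g (act V h v)"

definition gsubmodule ::
    "('g, 'a) monoid_scheme \<Rightarrow> ('f, 'b) ring_scheme \<Rightarrow> ('f, 'v, 'g) gmod \<Rightarrow> 'v set \<Rightarrow> bool" where
  "gsubmodule G R V U \<longleftrightarrow>
     submodule U R V \<and> (\<forall>g\<in>carrier G. \<forall>u\<in>U. act V g u \<in> U)"

text \<open>The underlying additive group is quotiented as in \<^const>\<open>A_RCOSETS\<close>; scalars act by
  \<open>a (x + U) = a x + U\<close> and the group by \<open>g (x + U) = g x + U\<close>, written here without choosing
  representatives.\<close>

definition quot_gmod :: "('f, 'v, 'g) gmod \<Rightarrow> 'v set \<Rightarrow> ('f, 'v set, 'g) gmod" where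
  "quot_gmod V U =
     \<lparr>carrier = a_rcosets\<^bsub>V\<^esub> U, monoid.mult = undefined, one = undefined,
      ring.zero = U, ring.add = set_add V,
      smult = (\<lambda>a C. \<Union>x\<in>C. U +>\<^bsub>V\<^esub> (a \<odot>\<^bsub>V\<^esub> x)),
      act = (\<lambda>g C. \<Union>x\<in>C. U +>\<^bsub>V\<^esub> act V g x)\<rparr>"

lemma quot_gmod_gmodule:
  fixes G (structure) and R (structure)
  assumes "gmodule G R V" "gsubmodule G R V U"
  shows "gmodule G R (quot_gmod V U)"
    "\<And>v. v \<in> carrier V \<Longrightarrow> g \<in> carrier G \<Longrightarrow> act (quot_gmod V U) g (U +>\<^bsub>V\<^esub> v) = U +>\<^bsub>V\<^esub> act V g v"
    "\<And>v. v \<in> carrier V \<Longrightarrow> a \<in> carrier R \<Longrightarrow> a \<odot>\<^bsub>quot_gmod V U\<^esub> (U +>\<^bsub>V\<^esub> v) = U +>\<^bsub>V\<^esub> (a \<odot>\<^bsub>V\<^esub> v)"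
proof -
  interpret gmodule G R V by fact
  have sub: "submodule U R V" and stab: "\<And>g u. g \<in> carrier G \<Longrightarrow> u \<in> U \<Longrightarrow> act V g u \<in> U"
    using assms(2) by (auto simp: gsubmodule_def)
  interpret U: submodule U R V by fact
  interpret U: abelian_subgroup U V
    using U.subgroup_axioms
    by (intro abelian_subgroupI3) (auto simp: additive_subgroup_def abelian_group_axioms)
  have sub': "U +>\<^bsub>V\<^esub> x = U +>\<^bsub>V\<^esub> y" if "x \<in> U +>\<^bsub>V\<^esub> y" "y \<in> carrier V" for x y
    using that by (metis U.a_repr_independence' )
  have mem: "x \<in> U +>\<^bsub>V\<^esub> y \<longleftrightarrow> (\<exists>u\<in>U. x = u \<oplus>\<^bsub>V\<^esub> y)" for x y
    by (auto simp: a_r_coset_def' )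
  have UV: "u \<in> U \<Longrightarrow> u \<in> carrier V" for u using U.a_subset by blast
  show A: "\<And>v g. v \<in> carrier V \<Longrightarrow> g \<in> carrier G \<Longrightarrow> act (quot_gmod V U) g (U +>\<^bsub>V\<^esub> v) = U +>\<^bsub>V\<^esub> act V g v"
  proof -
    fix v g assume v: "v \<in> carrier V" and g: "g \<in> carrier G"
    have that_eq: "U +>\<^bsub>V\<^esub> act V g x = U +>\<^bsub>V\<^esub> act V g v" if "x \<in> U +>\<^bsub>V\<^esub> v" for x
      using that v g by (intro sub') (auto simp: mem act_add act_closed UV intro!: bexI[OF _ stab])
    show "act (quot_gmod V U) g (U +>\<^bsub>V\<^esub> v) = U +>\<^bsub>V\<^esub> act V g v"
    proof -
      have "act (quot_gmod V U) g (U +>\<^bsub>V\<^esub> v) = (\<Union>x \<in> U +>\<^bsub>V\<^esub> v. U +>\<^bsub>V\<^esub> act V g v)"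
        unfolding quot_gmod_def by (simp add: that_eq cong: SUP_cong)
      then show ?thesis using U.a_rcos_self[OF v] by auto
    qed
  qed
  show B: "\<And>v a. v \<in> carrier V \<Longrightarrow> a \<in> carrier R \<Longrightarrow> a \<odot>\<^bsub>quot_gmod V U\<^esub> (U +>\<^bsub>V\<^esub> v) = U +>\<^bsub>V\<^esub> (a \<odot>\<^bsub>V\<^esub> v)"
  proof -
    fix v a assume v: "v \<in> carrier V" and g: "a \<in> carrier R"
    have that_eq: "U +>\<^bsub>V\<^esub> (a \<odot>\<^bsub>V\<^esub> x) = U +>\<^bsub>V\<^esub> (a \<odot>\<^bsub>V\<^esub> v)" if "x \<in> U +>\<^bsub>V\<^esub> v" for x
      using that v g by (intro sub') (auto simp: mem smult_r_distr UV intro!: bexI[OF _ U.smult_closed])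
    show "a \<odot>\<^bsub>quot_gmod V U\<^esub> (U +>\<^bsub>V\<^esub> v) = U +>\<^bsub>V\<^esub> (a \<odot>\<^bsub>V\<^esub> v)"
    proof -
      have "a \<odot>\<^bsub>quot_gmod V U\<^esub> (U +>\<^bsub>V\<^esub> v) = (\<Union>x \<in> U +>\<^bsub>V\<^esub> v. U +>\<^bsub>V\<^esub> (a \<odot>\<^bsub>V\<^esub> v))"
        unfolding quot_gmod_def by (simp add: that_eq cong: SUP_cong)
      then show ?thesis using U.a_rcos_self[OF v] by auto
    qed
  qed
  let ?Q = "quot_gmod V U"
  have carr: "carrier ?Q = (\<lambda>v. U +>\<^bsub>V\<^esub> v) ` carrier V"
    by (auto simp: quot_gmod_def A_RCOSETS_def' )
  have C: "(U +>\<^bsub>V\<^esub> v) \<oplus>\<^bsub>?Q\<^esub> (U +>\<^bsub>V\<^esub> w) = U +>\<^bsub>V\<^esub> (v \<oplus>\<^bsub>V\<^esub> w)"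
    if "v \<in> carrier V" "w \<in> carrier V" for v w
    using that by (simp add: quot_gmod_def U.a_rcos_sum)
  have Z: "\<zero>\<^bsub>?Q\<^esub> = U +>\<^bsub>V\<^esub> \<zero>\<^bsub>V\<^esub>"
    by (simp add: quot_gmod_def U.a_subset)
  have "abelian_group ?Q"
  proof (rule abelian_groupI)
    fix x assume "x \<in> carrier ?Q"
    then obtain v where v: "v \<in> carrier V" "x = U +>\<^bsub>V\<^esub> v" using carr by auto
    then show "\<exists>y\<in>carrier ?Q. y \<oplus>\<^bsub>?Q\<^esub> x = \<zero>\<^bsub>?Q\<^esub>"
      by (intro bexI[of _ "U +>\<^bsub>V\<^esub> (\<ominus>\<^bsub>V\<^esub> v)"]) (auto simp: carr C Z l_neg)
  qed (auto simp: carr C Z a_ac)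
  moreover have "module R ?Q"
    using \<open>abelian_group ?Q\<close>
    by (intro moduleI) (auto simp: carr B C R.is_cring smult_l_distr smult_r_distr smult_assoc1)
  moreover have "gmodule_axioms G R ?Q"
    by standard (auto simp: carr A B C act_closed act_add act_smult act_one act_mult)
  ultimately show "gmodule G R ?Q"
    by (intro gmodule.intro G.is_group)
qed

definition gmod_iso ::
    "('g, 'a) monoid_scheme \<Rightarrow> ('f, 'b) ring_scheme \<Rightarrow> ('f, 'v, 'g) gmod \<Rightarrow> ('f, 'w, 'g) gmod \<Rightarrow> bool"
  where
  "gmod_iso G R V W \<longleftrightarrow> (\<exists>h. bij_betw h (carrier V) (carrier W)
     \<and> (\<forall>v\<in>carrier V. \<forall>w\<in>carrier V. h (v \<oplus>\<^bsub>V\<^esub> w) = h v \<oplus>\<^bsub>W\<^esub> h w)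
     \<and> (\<forall>a\<in>carrier R. \<forall>v\<in>carrier V. h (a \<odot>\<^bsub>V\<^esub> v) = a \<odot>\<^bsub>W\<^esub> h v)
     \<and> (\<forall>g\<in>carrier G. \<forall>v\<in>carrier V. h (act V g v) = act W g (h v)))"

text \<open>\<open>V\<close> is the internal direct sum of its submodules \<open>U\<close> and \<open>W\<close>.\<close>

definition direct_sum2 ::
    "('g, 'a) monoid_scheme \<Rightarrow> ('f, 'b) ring_scheme \<Rightarrow> ('f, 'v, 'g) gmod \<Rightarrow> 'v set \<Rightarrow> 'v set \<Rightarrow> bool"
  where
  "direct_sum2 G R V U W \<longleftrightarrow> gsubmodule G R V U \<and> gsubmodule G R V W
     \<and> U \<inter> W = {\<zero>\<^bsub>V\<^esub>} \<and> U <+>\<^bsub>V\<^esub> W = carrier V"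

definition indecomposable ::
    "('g, 'a) monoid_scheme \<Rightarrow> ('f, 'b) ring_scheme \<Rightarrow> ('f, 'v, 'g) gmod \<Rightarrow> bool" where
  "indecomposable G R V \<longleftrightarrow> carrier V \<noteq> {\<zero>\<^bsub>V\<^esub>}
     \<and> (\<forall>U W. direct_sum2 G R V U W \<longrightarrow> U = {\<zero>\<^bsub>V\<^esub>} \<or> W = {\<zero>\<^bsub>V\<^esub>})"

text \<open>\<open>N | V\<close>.\<close>

definition is_summand ::
    "('g, 'a) monoid_scheme \<Rightarrow> ('f, 'b) ring_scheme \<Rightarrow> ('f, 'w, 'g) gmod \<Rightarrow> ('f, 'v, 'g) gmod \<Rightarrow> bool"
  where
  "is_summand G R N V \<longleftrightarrow>
     (\<exists>U W. direct_sum2 G R V U W \<and> gmod_iso G R (V\<lparr>carrier := U\<rparr>) N)"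

text \<open>A decomposition into indecomposables is given by the set of its constituents; no constituent
  is lost since nonzero submodules occurring in a direct sum are pairwise distinct.\<close>

definition indec_decomposition ::
    "('g, 'a) monoid_scheme \<Rightarrow> ('f, 'b) ring_scheme \<Rightarrow> ('f, 'v, 'g) gmod \<Rightarrow> 'v set set \<Rightarrow> bool" where
  "indec_decomposition G R V \<U> \<longleftrightarrow> finite \<U>
     \<and> (\<forall>U\<in>\<U>. gsubmodule G R V U \<and> indecomposable G R (V\<lparr>carrier := U\<rparr>))
     \<and> (\<forall>v\<in>carrier V. \<exists>!u. u \<in> (\<Pi>\<^sub>E U\<in>\<U>. U) \<and> v = finsum V u \<U>)"

text \<open>\<open>[V : N]\<close>; by the Krull-Schmidt theorem it does not depend on the decomposition of \<open>V\<close>.\<close>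

definition gmod_mult ::
    "('g, 'a) monoid_scheme \<Rightarrow> ('f, 'b) ring_scheme \<Rightarrow> ('f, 'v, 'g) gmod \<Rightarrow> ('f, 'w, 'g) gmod \<Rightarrow> nat"
  where
  "gmod_mult G R V N = (THE k. \<exists>\<U>. indec_decomposition G R V \<U>
     \<and> k = card {U \<in> \<U>. gmod_iso G R (V\<lparr>carrier := U\<rparr>) N})"

definition trivial_gmod :: "('f, 'b) ring_scheme \<Rightarrow> ('f, 'f, 'g) gmod" where
  "trivial_gmod R =
     \<lparr>carrier = carrier R, monoid.mult = undefined, one = undefined,
      ring.zero = \<zero>\<^bsub>R\<^esub>, ring.add = ring.add R,
      smult = (\<lambda>a v. a \<otimes>\<^bsub>R\<^esub> v), act = (\<lambda>g v. v)\<rparr>"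

definition has_trivial_sub ::
    "('g, 'a) monoid_scheme \<Rightarrow> ('f, 'b) ring_scheme \<Rightarrow> ('f, 'v, 'g) gmod \<Rightarrow> bool" where
  "has_trivial_sub G R V \<longleftrightarrow>
     (\<exists>U. gsubmodule G R V U \<and> gmod_iso G R (V\<lparr>carrier := U\<rparr>) (trivial_gmod R))"

definition has_trivial_quot ::
    "('g, 'a) monoid_scheme \<Rightarrow> ('f, 'b) ring_scheme \<Rightarrow> ('f, 'v, 'g) gmod \<Rightarrow> bool" where
  "has_trivial_quot G R V \<longleftrightarrow>
     (\<exists>U. gsubmodule G R V U \<and> gmod_iso G R (quot_gmod V U) (trivial_gmod R))"


section \<open>Permutation modules, symmetric and exterior squares\<close>

text \<open>The free \<open>R\<close>-module on a set \<open>Y\<close>, on which \<open>G\<close> acts by \<open>\<phi>\<close>. The formal linear combination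
  \<open>\<Sum> f x \<cdot> x\<close> is represented by the finitely supported function \<open>f\<close>, so \<open>g\<close> sends \<open>f\<close> to
  \<open>\<Sum> f x \<cdot> (g x)\<close>, whose coefficient at \<open>x\<close> is \<open>f (g\<^sup>-\<^sup>1 x)\<close>.\<close>

definition perm_gmod ::
    "('g, 'a) monoid_scheme \<Rightarrow> ('f, 'b) ring_scheme \<Rightarrow> 'x set \<Rightarrow> ('g \<Rightarrow> 'x \<Rightarrow> 'x)
      \<Rightarrow> ('f, 'x \<Rightarrow> 'f, 'g) gmod" where
  "perm_gmod G R Y \<phi> =
     \<lparr>carrier = {f. (\<forall>x\<in>Y. f x \<in> carrier R) \<and> (\<forall>x. x \<notin> Y \<longrightarrow> f x = \<zero>\<^bsub>R\<^esub>)
                    \<and> finite {x \<in> Y. f x \<noteq> \<zero>\<^bsub>R\<^esub>}},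
      monoid.mult = undefined, one = undefined,
      ring.zero = (\<lambda>x. \<zero>\<^bsub>R\<^esub>), ring.add = (\<lambda>f h x. f x \<oplus>\<^bsub>R\<^esub> h x),
      smult = (\<lambda>a f x. a \<otimes>\<^bsub>R\<^esub> f x),
      act = (\<lambda>g f x. if x \<in> Y then f (\<phi> (inv\<^bsub>G\<^esub> g) x) else \<zero>\<^bsub>R\<^esub>)\<rparr>"

lemma perm_gmod_gmodule:
  fixes G (structure) and R (structure)
  assumes "group G" "cring R"
    and cl: "\<And>g x. g \<in> carrier G \<Longrightarrow> x \<in> Y \<Longrightarrow> \<phi> g x \<in> Y"
    and one: "\<And>x. x \<in> Y \<Longrightarrow> \<phi> \<one>\<^bsub>G\<^esub> x = x"
    and mul: "\<And>g h x. g \<in> carrier G \<Longrightarrow> h \<in> carrier G \<Longrightarrow> x \<in> Y \<Longrightarrow> \<phi> (g \<otimes>\<^bsub>G\<^esub> h) x = \<phi> g (\<phi> h x)"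
  shows "gmodule G R (perm_gmod G R Y \<phi>)"
proof -
  interpret G: group G by fact
  interpret R: cring R by fact
  let ?V = "perm_gmod G R Y \<phi>"
  have fin_add: "finite {x \<in> Y. f x \<oplus>\<^bsub>R\<^esub> h x \<noteq> \<zero>\<^bsub>R\<^esub>}"
    if "f \<in> carrier ?V" "h \<in> carrier ?V" for f h
  proof (rule finite_subset)
    show "{x \<in> Y. f x \<oplus>\<^bsub>R\<^esub> h x \<noteq> \<zero>\<^bsub>R\<^esub>} \<subseteq> {x \<in> Y. f x \<noteq> \<zero>\<^bsub>R\<^esub>} \<union> {x \<in> Y. h x \<noteq> \<zero>\<^bsub>R\<^esub>}"
      using that by (auto simp: perm_gmod_def)
  qed (use that in \<open>simp add: perm_gmod_def\<close>)
  have fin_sm: "finite {x \<in> Y. a \<otimes>\<^bsub>R\<^esub> f x \<noteq> \<zero>\<^bsub>R\<^esub>}"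
    if "f \<in> carrier ?V" "a \<in> carrier R" for f a
    by (rule finite_subset[of _ "{x \<in> Y. f x \<noteq> \<zero>\<^bsub>R\<^esub>}"]) (use that in \<open>auto simp: perm_gmod_def\<close>)
  have val: "f x \<in> carrier R" if "f \<in> carrier ?V" for f x
    using that by (cases "x \<in> Y") (auto simp: perm_gmod_def)
  have "abelian_group ?V"
  proof (rule abelian_groupI)
    fix f assume f: "f \<in> carrier ?V"
    have "(\<lambda>x. \<ominus>\<^bsub>R\<^esub> f x) \<in> carrier ?V"
    proof -
      have "finite {x \<in> Y. \<ominus>\<^bsub>R\<^esub> f x \<noteq> \<zero>\<^bsub>R\<^esub>}"
        by (rule finite_subset[of _ "{x \<in> Y. f x \<noteq> \<zero>\<^bsub>R\<^esub>}"]) (use f in \<open>auto simp: perm_gmod_def\<close>)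
      then show ?thesis using f by (auto simp: perm_gmod_def)
    qed
    moreover have "(\<lambda>x. \<ominus>\<^bsub>R\<^esub> f x) \<oplus>\<^bsub>?V\<^esub> f = \<zero>\<^bsub>?V\<^esub>"
      using val[OF f] by (auto simp: perm_gmod_def R.l_neg)
    ultimately show "\<exists>y\<in>carrier ?V. y \<oplus>\<^bsub>?V\<^esub> f = \<zero>\<^bsub>?V\<^esub>" by blast
  next
    fix f h assume "f \<in> carrier ?V" "h \<in> carrier ?V"
    with fin_add show "f \<oplus>\<^bsub>?V\<^esub> h \<in> carrier ?V" by (auto simp: perm_gmod_def)
    show "f \<oplus>\<^bsub>?V\<^esub> h = h \<oplus>\<^bsub>?V\<^esub> f"
      using val[OF \<open>f \<in> _\<close>] val[OF \<open>h \<in> _\<close>] by (auto simp: perm_gmod_def R.a_comm)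
  next
    fix f h k assume a: "f \<in> carrier ?V" "h \<in> carrier ?V" "k \<in> carrier ?V"
    show "f \<oplus>\<^bsub>?V\<^esub> h \<oplus>\<^bsub>?V\<^esub> k = f \<oplus>\<^bsub>?V\<^esub> (h \<oplus>\<^bsub>?V\<^esub> k)"
      using val[OF a(1)] val[OF a(2)] val[OF a(3)] by (auto simp: perm_gmod_def R.a_assoc)
  next
    show "\<zero>\<^bsub>?V\<^esub> \<in> carrier ?V" by (simp add: perm_gmod_def)
  next
    fix f assume f: "f \<in> carrier ?V"
    show "\<zero>\<^bsub>?V\<^esub> \<oplus>\<^bsub>?V\<^esub> f = f" using val[OF f] by (simp add: perm_gmod_def)
  qed
  moreover have "module R ?V"
  proof (rule moduleI)
    fix a f assume a: "a \<in> carrier R" "f \<in> carrier ?V"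
    with fin_sm show "a \<odot>\<^bsub>?V\<^esub> f \<in> carrier ?V" by (auto simp: perm_gmod_def)
  next
    fix a b f assume a: "a \<in> carrier R" "b \<in> carrier R" "f \<in> carrier ?V"
    show "(a \<oplus>\<^bsub>R\<^esub> b) \<odot>\<^bsub>?V\<^esub> f = a \<odot>\<^bsub>?V\<^esub> f \<oplus>\<^bsub>?V\<^esub> b \<odot>\<^bsub>?V\<^esub> f"
      using a val[OF a(3)] by (auto simp: perm_gmod_def R.l_distr)
    show "(a \<otimes>\<^bsub>R\<^esub> b) \<odot>\<^bsub>?V\<^esub> f = a \<odot>\<^bsub>?V\<^esub> (b \<odot>\<^bsub>?V\<^esub> f)"
      using a val[OF a(3)] by (auto simp: perm_gmod_def R.m_assoc)
  next
    fix a f h assume a: "a \<in> carrier R" "f \<in> carrier ?V" "h \<in> carrier ?V"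
    show "a \<odot>\<^bsub>?V\<^esub> (f \<oplus>\<^bsub>?V\<^esub> h) = a \<odot>\<^bsub>?V\<^esub> f \<oplus>\<^bsub>?V\<^esub> a \<odot>\<^bsub>?V\<^esub> h"
      using a val[OF a(2)] val[OF a(3)] by (auto simp: perm_gmod_def R.r_distr)
  next
    fix f assume f: "f \<in> carrier ?V"
    show "\<one>\<^bsub>R\<^esub> \<odot>\<^bsub>?V\<^esub> f = f" using val[OF f] by (simp add: perm_gmod_def)
  qed (use \<open>abelian_group ?V\<close> in \<open>auto intro: R.is_cring\<close>)
  moreover have "gmodule_axioms G R ?V"
  proof
    fix g f assume g: "g \<in> carrier G" and f: "f \<in> carrier ?V"
    have "{x \<in> Y. f (\<phi> (inv\<^bsub>G\<^esub> g) x) \<noteq> \<zero>\<^bsub>R\<^esub>} \<subseteq> \<phi> g ` {x \<in> Y. f x \<noteq> \<zero>\<^bsub>R\<^esub>}"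
    proof
      fix x assume x: "x \<in> {x \<in> Y. f (\<phi> (inv\<^bsub>G\<^esub> g) x) \<noteq> \<zero>\<^bsub>R\<^esub>}"
      then have "x = \<phi> g (\<phi> (inv\<^bsub>G\<^esub> g) x)" using g mul[of g "inv\<^bsub>G\<^esub> g" x] one by auto
      then show "x \<in> \<phi> g ` {x \<in> Y. f x \<noteq> \<zero>\<^bsub>R\<^esub>}" using x cl[of "inv\<^bsub>G\<^esub> g" x] g by blast
    qed
    then have "finite {x \<in> Y. f (\<phi> (inv\<^bsub>G\<^esub> g) x) \<noteq> \<zero>\<^bsub>R\<^esub>}"
      using f by (auto intro: finite_subset simp: perm_gmod_def)
    then show "act ?V g f \<in> carrier ?V"
      using val[OF f] by (auto simp: perm_gmod_def elim!: rev_finite_subset)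
  next
    fix f assume "f \<in> carrier ?V"
    then show "act ?V \<one>\<^bsub>G\<^esub> f = f" using one by (auto simp: perm_gmod_def)
  next
    fix g h f assume a: "g \<in> carrier G" "h \<in> carrier G" "f \<in> carrier ?V"
    then show "act ?V (g \<otimes>\<^bsub>G\<^esub> h) f = act ?V g (act ?V h f)"
      using mul cl by (auto simp: perm_gmod_def G.inv_mult_group)
  qed (auto simp: perm_gmod_def)
  ultimately show ?thesis
    by (intro gmodule.intro G.is_group)
qed

definition basis_elt :: "('f, 'b) ring_scheme \<Rightarrow> 'x \<Rightarrow> ('x \<Rightarrow> 'f)" where
  "basis_elt R x = (\<lambda>y. if y = x then \<one>\<^bsub>R\<^esub> else \<zero>\<^bsub>R\<^esub>)"

definition span_of :: "('f, 'b) ring_scheme \<Rightarrow> ('f, 'v, 'g) gmod \<Rightarrow> 'v set \<Rightarrow> 'v set" where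
  "span_of R V S = \<Inter>{U. submodule U R V \<and> S \<subseteq> U}"

text \<open>\<open>V \<otimes> W\<close> is the free module on \<open>V \<times> W\<close> modulo the bilinearity relations, with the diagonal
  action.\<close>

definition free_pair_gmod ::
    "('g, 'a) monoid_scheme \<Rightarrow> ('f, 'b) ring_scheme \<Rightarrow> ('f, 'v, 'g) gmod \<Rightarrow> ('f, 'w, 'g) gmod
      \<Rightarrow> ('f, 'v \<times> 'w \<Rightarrow> 'f, 'g) gmod" where
  "free_pair_gmod G R V W =
     perm_gmod G R (carrier V \<times> carrier W) (\<lambda>g (v, w). (act V g v, act W g w))"

definition bilinear_rels ::
    "('g, 'a) monoid_scheme \<Rightarrow> ('f, 'b) ring_scheme \<Rightarrow> ('f, 'v, 'g) gmod \<Rightarrow> ('f, 'w, 'g) gmod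
      \<Rightarrow> ('v \<times> 'w \<Rightarrow> 'f) set" where
  "bilinear_rels G R V W = (let F = free_pair_gmod G R V W; d = (\<lambda>v w. basis_elt R (v, w)) in
       {d (u \<oplus>\<^bsub>V\<^esub> v) w \<ominus>\<^bsub>F\<^esub> (d u w \<oplus>\<^bsub>F\<^esub> d v w) | u v w.
          u \<in> carrier V \<and> v \<in> carrier V \<and> w \<in> carrier W}
     \<union> {d v (w \<oplus>\<^bsub>W\<^esub> z) \<ominus>\<^bsub>F\<^esub> (d v w \<oplus>\<^bsub>F\<^esub> d v z) | v w z.
          v \<in> carrier V \<and> w \<in> carrier W \<and> z \<in> carrier W}
     \<union> {d (a \<odot>\<^bsub>V\<^esub> v) w \<ominus>\<^bsub>F\<^esub> a \<odot>\<^bsub>F\<^esub> d v w | a v w.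
          a \<in> carrier R \<and> v \<in> carrier V \<and> w \<in> carrier W}
     \<union> {d v (a \<odot>\<^bsub>W\<^esub> w) \<ominus>\<^bsub>F\<^esub> a \<odot>\<^bsub>F\<^esub> d v w | a v w.
          a \<in> carrier R \<and> v \<in> carrier V \<and> w \<in> carrier W})"

definition bilinear_span ::
    "('g, 'a) monoid_scheme \<Rightarrow> ('f, 'b) ring_scheme \<Rightarrow> ('f, 'v, 'g) gmod \<Rightarrow> ('f, 'w, 'g) gmod
      \<Rightarrow> ('v \<times> 'w \<Rightarrow> 'f) set" where
  "bilinear_span G R V W = span_of R (free_pair_gmod G R V W) (bilinear_rels G R V W)"

definition tensor_gmod ::
    "('g, 'a) monoid_scheme \<Rightarrow> ('f, 'b) ring_scheme \<Rightarrow> ('f, 'v, 'g) gmod \<Rightarrow> ('f, 'w, 'g) gmod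
      \<Rightarrow> ('f, ('v \<times> 'w \<Rightarrow> 'f) set, 'g) gmod" where
  "tensor_gmod G R V W = quot_gmod (free_pair_gmod G R V W) (bilinear_span G R V W)"

definition pure_tensor ::
    "('g, 'a) monoid_scheme \<Rightarrow> ('f, 'b) ring_scheme \<Rightarrow> ('f, 'v, 'g) gmod \<Rightarrow> ('f, 'w, 'g) gmod
      \<Rightarrow> 'v \<Rightarrow> 'w \<Rightarrow> ('v \<times> 'w \<Rightarrow> 'f) set" where
  "pure_tensor G R V W v w =
     bilinear_span G R V W +>\<^bsub>free_pair_gmod G R V W\<^esub> basis_elt R (v, w)"

definition sym_square ::
    "('g, 'a) monoid_scheme \<Rightarrow> ('f, 'b) ring_scheme \<Rightarrow> ('f, 'v, 'g) gmod
      \<Rightarrow> ('f, ('v \<times> 'v \<Rightarrow> 'f) set set, 'g) gmod" where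
  "sym_square G R V = (let T = tensor_gmod G R V V in
     quot_gmod T (span_of R T
       {pure_tensor G R V V v w \<ominus>\<^bsub>T\<^esub> pure_tensor G R V V w v | v w.
          v \<in> carrier V \<and> w \<in> carrier V}))"

definition ext_square ::
    "('g, 'a) monoid_scheme \<Rightarrow> ('f, 'b) ring_scheme \<Rightarrow> ('f, 'v, 'g) gmod
      \<Rightarrow> ('f, ('v \<times> 'v \<Rightarrow> 'f) set set, 'g) gmod" where
  "ext_square G R V = (let T = tensor_gmod G R V V in
     quot_gmod T (span_of R T {pure_tensor G R V V v v | v. v \<in> carrier V}))"


section \<open>Scott modules\<close>

text \<open>\<open>(R\<^sub>Q)\<up>\<^sup>G\<close> as the permutation module on the left cosets of \<open>Q\<close>.\<close>

definition coset_gmod ::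
    "('g, 'a) monoid_scheme \<Rightarrow> ('f, 'b) ring_scheme \<Rightarrow> 'g set \<Rightarrow> ('f, 'g set \<Rightarrow> 'f, 'g) gmod" where
  "coset_gmod G R Q = perm_gmod G R (lcosets\<^bsub>G\<^esub> Q) (\<lambda>g C. g <#\<^bsub>G\<^esub> C)"

text \<open>The choice is harmless: the summand is unique up to isomorphism.\<close>

definition scott_module ::
    "('g, 'a) monoid_scheme \<Rightarrow> ('f, 'b) ring_scheme \<Rightarrow> 'g set \<Rightarrow> ('f, 'g set \<Rightarrow> 'f, 'g) gmod" where
  "scott_module G R Q = (let V = coset_gmod G R Q in
     V\<lparr>carrier := SOME U. (\<exists>W. direct_sum2 G R V U W)
        \<and> indecomposable G R (V\<lparr>carrier := U\<rparr>)
        \<and> has_trivial_sub G R (V\<lparr>carrier := U\<rparr>)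
        \<and> has_trivial_quot G R (V\<lparr>carrier := U\<rparr>)\<rparr>)"


section \<open>Characteristic, \<open>p\<close>-subgroups, conjugacy\<close>

text \<open>The order of \<open>\<one>\<close> in the additive group, which is \<open>0\<close> if that order is infinite.\<close>

definition ring_char :: "('f, 'b) ring_scheme \<Rightarrow> nat" where
  "ring_char R = group.ord (add_monoid R) \<one>\<^bsub>R\<^esub>"

definition p_subgroup :: "nat \<Rightarrow> ('g, 'a) monoid_scheme \<Rightarrow> 'g set \<Rightarrow> bool" where
  "p_subgroup p G Q \<longleftrightarrow> subgroup Q G \<and> (\<exists>k. card Q = p ^ k)"

definition sylow_subgroup :: "nat \<Rightarrow> ('g, 'a) monoid_scheme \<Rightarrow> 'g set \<Rightarrow> bool" where
  "sylow_subgroup p G Q \<longleftrightarrow> subgroup Q G \<and> card Q = p ^ multiplicity p (order G)"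

definition conj_subgroup :: "('g, 'a) monoid_scheme \<Rightarrow> 'g \<Rightarrow> 'g set \<Rightarrow> 'g set" where
  "conj_subgroup G g Q = (\<lambda>x. g \<otimes>\<^bsub>G\<^esub> x \<otimes>\<^bsub>G\<^esub> inv\<^bsub>G\<^esub> g) ` Q"

definition conjugate_in :: "('g, 'a) monoid_scheme \<Rightarrow> 'g set \<Rightarrow> 'g set \<Rightarrow> bool" where
  "conjugate_in G P Q \<longleftrightarrow> (\<exists>g\<in>carrier G. conj_subgroup G g P = Q)"


section \<open>Young subgroups and Young permutation modules\<close>

definition is_partition :: "nat list \<Rightarrow> nat \<Rightarrow> bool" where
  "is_partition lam n \<longleftrightarrow> sorted_wrt (\<ge>) lam \<and> (\<forall>x\<in>set lam. 0 < x) \<and> sum_list lam = n"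

definition sym_on :: "nat \<Rightarrow> nat set \<Rightarrow> (nat \<Rightarrow> nat) monoid" where
  "sym_on n S = (sym_group n)\<lparr>carrier := {\<pi>. \<pi> permutes S}\<rparr>"

definition young_group :: "nat \<Rightarrow> nat list \<Rightarrow> (nat \<Rightarrow> nat) monoid" where
  "young_group n lam = (sym_group n)\<lparr>carrier := {\<pi>. \<pi> permutes {1..n} \<and>
     (\<forall>i<length lam. let B = {sum_list (take i lam)<..sum_list (take (Suc i) lam)} in \<pi> ` B = B)}\<rparr>"

text \<open>A tabloid, that is, a tableau up to permutations within its rows, is given by the list of
  the sets of entries of its rows.\<close>

definition tabloids :: "nat \<Rightarrow> nat list \<Rightarrow> nat set list set" where
  "tabloids n lam = {T. length T = length lam
     \<and> (\<forall>i<length lam. card (T ! i) = lam ! i)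
     \<and> (\<forall>i<length lam. \<forall>j<length lam. i \<noteq> j \<longrightarrow> T ! i \<inter> T ! j = {})
     \<and> \<Union>(set T) = {1..n}}"

definition young_module ::
    "('f, 'b) ring_scheme \<Rightarrow> nat \<Rightarrow> nat list \<Rightarrow> ('f, nat set list \<Rightarrow> 'f, nat \<Rightarrow> nat) gmod" where
  "young_module R n lam = perm_gmod (sym_group n) R (tabloids n lam) (\<lambda>\<pi>. map ((`) \<pi>))"


section \<open>Matrices with prescribed margins\<close>

text \<open>Rows and columns are indexed from \<open>0\<close>.\<close>

definition M_mats :: "nat list \<Rightarrow> nat mat set" where
  "M_mats lam = {M \<in> carrier_mat (length lam) (length lam). \<not> diagonal_mat M
     \<and> (\<forall>i<length lam. (\<Sum>j<length lam. M $$ (i, j)) = lam ! i)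
     \<and> (\<forall>j<length lam. (\<Sum>i<length lam. M $$ (i, j)) = lam ! j)}"

definition S_mats :: "nat list \<Rightarrow> nat mat set" where
  "S_mats lam = {M \<in> M_mats lam. M = transpose_mat M}"

definition D_mat :: "nat list \<Rightarrow> nat mat" where
  "D_mat lam = mat_diag (length lam) (\<lambda>i. lam ! i)"

text \<open>Below, \<open>Nl\<close> is a choice of one matrix from each pair \<open>{M, M\<^sup>t}\<close> of nonsymmetric matrices.\<close>

definition N_choice :: "nat list \<Rightarrow> nat mat set \<Rightarrow> bool" where
  "N_choice lam Nl \<longleftrightarrow> Nl \<subseteq> M_mats lam - S_mats lam
     \<and> (\<forall>M \<in> M_mats lam - S_mats lam. card (Nl \<inter> {M, transpose_mat M}) = 1)"

definition R_mats :: "nat list \<Rightarrow> nat mat set \<Rightarrow> nat mat set" where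
  "R_mats lam Nl = S_mats lam \<union> Nl \<union> {D_mat lam}"

definition X_mats :: "nat \<Rightarrow> nat list \<Rightarrow> nat mat set \<Rightarrow> nat mat set" where
  "X_mats p lam Nl = (if p = 2 then S_mats lam \<union> Nl else Nl)"


section \<open>The subgroups \<open>P\<^sub>M\<close>\<close>

text \<open>The choices involved: \<open>PD\<close> is the Sylow subgroup of the Young subgroup, \<open>PS S\<close> the Sylow
  subgroup of the symmetric group on \<open>S\<close>, \<open>s M i j\<close> the disjoint sets of sizes \<open>b\<^sub>i\<^sub>j\<close>, and \<open>e M\<close> the
  involution attached to a symmetric matrix \<open>M\<close>.\<close>

definition admissible_choices ::
    "nat \<Rightarrow> nat \<Rightarrow> nat list \<Rightarrow> (nat \<Rightarrow> nat) set \<Rightarrow> (nat set \<Rightarrow> (nat \<Rightarrow> nat) set)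
      \<Rightarrow> (nat mat \<Rightarrow> nat \<Rightarrow> nat \<Rightarrow> nat set) \<Rightarrow> (nat mat \<Rightarrow> nat \<Rightarrow> nat) \<Rightarrow> bool" where
  "admissible_choices p n lam PD PS s e \<longleftrightarrow>
     sylow_subgroup p (young_group n lam) PD
     \<and> (\<forall>S \<subseteq> {1..n}. sylow_subgroup p (sym_on n S) (PS S))
     \<and> (\<forall>M \<in> M_mats lam.
          (\<forall>i<length lam. \<forall>j<length lam. s M i j \<subseteq> {1..n} \<and> card (s M i j) = M $$ (i, j))
          \<and> (\<forall>i<length lam. \<forall>j<length lam. \<forall>k<length lam. \<forall>l<length lam.
                (i, j) \<noteq> (k, l) \<longrightarrow> s M i j \<inter> s M k l = {}))
     \<and> (p = 2 \<longrightarrow> (\<forall>M \<in> S_mats lam.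
          e M permutes {1..n} \<and> e M \<circ> e M = id
          \<and> {x. e M x \<noteq> x} = {1..n} - (\<Union>k<length lam. s M k k)
          \<and> (\<forall>i<length lam. \<forall>j<length lam. e M ` s M i j = s M j i)))"

text \<open>Internal products of pairwise commuting subgroups are written as the subgroups they generate.
  In the last case the semidirect product is the product set of the base group with \<open>\<langle>e\<^sub>M\<rangle>\<close>.\<close>

definition P_of ::
    "nat \<Rightarrow> nat \<Rightarrow> nat list \<Rightarrow> (nat \<Rightarrow> nat) set \<Rightarrow> (nat set \<Rightarrow> (nat \<Rightarrow> nat) set)
      \<Rightarrow> (nat mat \<Rightarrow> nat \<Rightarrow> nat \<Rightarrow> nat set) \<Rightarrow> (nat mat \<Rightarrow> nat \<Rightarrow> nat) \<Rightarrow> nat mat \<Rightarrow> (nat \<Rightarrow> nat) set"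
  where
  "P_of p n lam PD PS s e M = (let G = sym_group n; l = length lam in
     if M = D_mat lam then PD
     else if p > 2 \<or> M \<noteq> transpose_mat M then
       generate G (\<Union>i<l. \<Union>j<l. PS (s M i j))
     else
       generate G ((\<Union>k<l. PS (s M k k))
         \<union> (\<Union>j<l. \<Union>i<j. PS (s M i j) \<union> (\<lambda>x. e M \<circ> x \<circ> e M) ` PS (s M i j)))
       <#>\<^bsub>G\<^esub> generate G {e M})"

text \<open>The members of a set \<open>Y\<close> of matrices that are equivalent to \<open>M\<close>, where \<open>Q\<close> is \<open>M \<mapsto> P\<^sub>M\<close>.\<close>

definition mat_class :: "nat \<Rightarrow> (nat mat \<Rightarrow> (nat \<Rightarrow> nat) set) \<Rightarrow> nat mat set \<Rightarrow> nat mat \<Rightarrow> nat mat set"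
  where
  "mat_class n Q Y M = {N \<in> Y. conjugate_in (sym_group n) (Q N) (Q M)}"

end

theory Submission
  imports Defs
begin

text \<open>
Let \<open>C\<close> be the permutation module on the cosets of a \<open>p\<close>-subgroup \<open>Q\<close> of a finite group \<open>G\<close>, and let \<open>\<Sigma>\<close> be
the sum of its basis. The vectors of \<open>C\<close> fixed by \<open>G\<close> are the multiples of \<open>\<Sigma>\<close>, and the Scott module of \<open>Q\<close> is
an indecomposable direct summand \<open>S\<close> of \<open>C\<close> that contains \<open>\<Sigma>\<close>. For a module \<open>V\<close>, homomorphisms \<open>f\<close> from \<open>C\<close>
to \<open>V\<close> and \<open>h\<close> from \<open>V\<close> to \<open>C\<close> are paired by the scalar by which \<open>h \<circ> f\<close> multiplies \<open>\<Sigma>\<close>. If this scalar is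
nonzero, then the component in \<open>S\<close> of the restriction of \<open>h \<circ> f\<close> to \<open>S\<close> is not nilpotent, so by Fitting's
lemma it is an automorphism and \<open>f\<close> embeds \<open>S\<close> as a direct summand of \<open>V\<close>. Consequently the multiplicity of
\<open>S\<close> in any decomposition of \<open>V\<close> into indecomposables is the rank of the pairing
(\<open>multiplicity_from_dual_system\<close>).

The symmetric and the exterior square of a permutation module are isomorphic to modules of functions
\<open>u\<close> on pairs of basis elements with \<open>u (y, x) = \<plusminus> u (x, y)\<close>, where in the case of the exterior square only
pairs with \<open>x \<noteq> y\<close> are admitted (\<open>sym_square_iso\<close>, \<open>ext_square_iso\<close>). The fixed vectors of such a module
have a basis of orbit functions, one for each orbit of unordered pairs, except for those orbits on which
the sign forces every fixed vector to vanish. Let \<open>P\<close> be a \<open>p\<close>-subgroup of the stabiliser \<open>H\<close> of an unordered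
pair whose index in \<open>H\<close> is prime to \<open>p\<close>. In characteristic \<open>p\<close>, the sum of an
invariant function over a set on which a \<open>p\<close>-group acts is its sum over the fixed points. Therefore, if a homomorphism from \<open>C\<close> produces a fixed vector with a nonzero
coefficient at that orbit, then a conjugate of \<open>P\<close> lies in \<open>Q\<close>, and if a homomorphism to \<open>C\<close> does not kill the
orbit function, then a conjugate of \<open>Q\<close> lies in \<open>H\<close>. Both happen only if \<open>P\<close> and \<open>Q\<close> are conjugate, and then the
relative trace and an evaluation map pair to \<open>1\<close>. So the rank of the pairing is the number of orbits for
which \<open>P\<close> is conjugate to \<open>Q\<close> (\<open>scott_multiplicity\<close>).

For the Young permutation module the basis consists of tabloids. The orbit of a pair of tabloids is
determined by the matrix of the sizes of the intersections of their rows. These are the matrices whose row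
sums and column sums are the parts of the partition, the diagonal one belonging to the pairs of equal
tabloids, and interchanging the tabloids transposes the matrix. The stabiliser of the ordered pair is the
product of the symmetric groups on the intersections; it has index \<open>2\<close> in the stabiliser of the unordered
pair if the two tabloids are distinct and their matrix is symmetric. In all cases \<open>P\<^sub>M\<close> is contained
in the stabiliser of the unordered pair with index prime to \<open>p\<close> (\<open>PM_properties\<close>). When the sign is not
trivial, the orbits that it kills are those of the symmetric matrices.
\<close>

section \<open>Submodules, homomorphisms and splittings\<close>

text \<open>The record type is the plain one, without further fields, because submodules and quotients are formed
by updating the record.\<close>

locale rep = gmodule G R V
  for G :: "('g, 'a) monoid_scheme" (structure) and R :: "('f, 'b) ring_scheme" (structure)
    and V :: "('f, 'v, 'g) gmod" (structure)

definition ghom ::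
    "('g, 'a) monoid_scheme \<Rightarrow> ('f, 'b) ring_scheme \<Rightarrow> ('f, 'v, 'g) gmod \<Rightarrow> ('f, 'w, 'g) gmod
      \<Rightarrow> ('v \<Rightarrow> 'w) \<Rightarrow> bool" where
  "ghom G R V W h \<longleftrightarrow> (\<forall>v\<in>carrier V. h v \<in> carrier W)
     \<and> (\<forall>v\<in>carrier V. \<forall>w\<in>carrier V. h (v \<oplus>\<^bsub>V\<^esub> w) = h v \<oplus>\<^bsub>W\<^esub> h w)
     \<and> (\<forall>a\<in>carrier R. \<forall>v\<in>carrier V. h (a \<odot>\<^bsub>V\<^esub> v) = a \<odot>\<^bsub>W\<^esub> h v)
     \<and> (\<forall>g\<in>carrier G. \<forall>v\<in>carrier V. h (act V g v) = act W g (h v))"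

lemma gmod_iso_ghom:
  "gmod_iso G R V W \<longleftrightarrow> (\<exists>h. ghom G R V W h \<and> bij_betw h (carrier V) (carrier W))"
proof -
  have "(\<forall>v\<in>carrier V. h v \<in> carrier W)" if "bij_betw h (carrier V) (carrier W)" for h
    using bij_betwE[OF that] .
  then show ?thesis unfolding gmod_iso_def ghom_def by (intro iff_exI) auto
qed

lemma ghomI:
  assumes "\<And>v. v \<in> carrier V \<Longrightarrow> h v \<in> carrier W"
    and "\<And>v w. v \<in> carrier V \<Longrightarrow> w \<in> carrier V \<Longrightarrow> h (v \<oplus>\<^bsub>V\<^esub> w) = h v \<oplus>\<^bsub>W\<^esub> h w"
    and "\<And>a v. a \<in> carrier R \<Longrightarrow> v \<in> carrier V \<Longrightarrow> h (a \<odot>\<^bsub>V\<^esub> v) = a \<odot>\<^bsub>W\<^esub> h v"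
    and "\<And>g v. g \<in> carrier G \<Longrightarrow> v \<in> carrier V \<Longrightarrow> h (act V g v) = act W g (h v)"
  shows "ghom G R V W h"
  using assms by (auto simp: ghom_def)

lemma
  assumes "ghom G R V W h"
  shows ghom_closed: "v \<in> carrier V \<Longrightarrow> h v \<in> carrier W"
    and ghom_add: "v \<in> carrier V \<Longrightarrow> w \<in> carrier V \<Longrightarrow> h (v \<oplus>\<^bsub>V\<^esub> w) = h v \<oplus>\<^bsub>W\<^esub> h w"
    and ghom_smult: "a \<in> carrier R \<Longrightarrow> v \<in> carrier V \<Longrightarrow> h (a \<odot>\<^bsub>V\<^esub> v) = a \<odot>\<^bsub>W\<^esub> h v"
    and ghom_act: "g \<in> carrier G \<Longrightarrow> v \<in> carrier V \<Longrightarrow> h (act V g v) = act W g (h v)"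
  using assms by (auto simp: ghom_def)

lemma ghom_comp:
  "ghom G R V W h \<Longrightarrow> ghom G R W Z k \<Longrightarrow> ghom G R V Z (k \<circ> h)"
  by (auto simp: ghom_def)

lemma ghom_id: "ghom G R V V (\<lambda>v. v)"
  by (auto simp: ghom_def)

lemma ghom_zero:
  assumes "rep G R V" "rep G R W" "ghom G R V W h"
  shows "h \<zero>\<^bsub>V\<^esub> = \<zero>\<^bsub>W\<^esub>"
proof -
  interpret V: rep G R V by fact
  interpret W: rep G R W by fact
  have "h \<zero>\<^bsub>V\<^esub> = h (\<zero>\<^bsub>R\<^esub> \<odot>\<^bsub>V\<^esub> \<zero>\<^bsub>V\<^esub>)" by simp
  also have "\<dots> = \<zero>\<^bsub>R\<^esub> \<odot>\<^bsub>W\<^esub> h \<zero>\<^bsub>V\<^esub>" by (rule ghom_smult[OF assms(3)]) auto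
  also have "\<dots> = \<zero>\<^bsub>W\<^esub>" by (rule W.smult_l_null) (auto intro: ghom_closed[OF assms(3)])
  finally show ?thesis .
qed

lemma ghom_finsum:
  assumes "rep G R V" "rep G R W" "ghom G R V W h" "finite A" "f \<in> A \<rightarrow> carrier V"
  shows "h (finsum V f A) = finsum W (\<lambda>i. h (f i)) A"
proof -
  interpret V: rep G R V by fact
  interpret W: rep G R W by fact
  show ?thesis using assms(4,5)
  proof (induction A)
    case empty
    then show ?case by (simp add: ghom_zero[OF assms(1-3)])
  next
    case (insert i A)
    then have "finsum V f A \<in> carrier V" by auto
    with insert show ?case
      by (simp add: ghom_add[OF assms(3)] Pi_def ghom_closed[OF assms(3)])
  qed
qed

lemma ghom_inv:
  assumes "rep G R V" "ghom G R V W h" "bij_betw h (carrier V) (carrier W)"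
  shows "ghom G R W V (inv_into (carrier V) h)"
proof -
  interpret V: rep G R V by fact
  let ?k = "inv_into (carrier V) h"
  have inj: "inj_on h (carrier V)" and im: "h ` carrier V = carrier W"
    using assms(3) by (auto simp: bij_betw_def)
  have hk: "h (?k w) = w" and kc: "?k w \<in> carrier V" if "w \<in> carrier W" for w
    using that im by (auto simp: f_inv_into_f inv_into_into)
  have kh: "?k w = v" if "h v = w" "v \<in> carrier V" for v w
    using that inj by auto
  note h = ghom_add[OF assms(2)] ghom_smult[OF assms(2)] ghom_act[OF assms(2)]
  show ?thesis
    by (rule ghomI; (rule kh)?) (auto simp: kc hk h V.act_closed)
qed

context rep begin

lemma gsubmoduleI:
  assumes "U \<subseteq> carrier V" "\<zero>\<^bsub>V\<^esub> \<in> U"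
    and "\<And>u w. u \<in> U \<Longrightarrow> w \<in> U \<Longrightarrow> u \<oplus>\<^bsub>V\<^esub> w \<in> U"
    and "\<And>a u. a \<in> carrier R \<Longrightarrow> u \<in> U \<Longrightarrow> a \<odot>\<^bsub>V\<^esub> u \<in> U"
    and "\<And>g u. g \<in> carrier G \<Longrightarrow> u \<in> U \<Longrightarrow> act V g u \<in> U"
  shows "gsubmodule G R V U"
proof -
  have "\<ominus>\<^bsub>V\<^esub> u \<in> U" if "u \<in> U" for u
  proof -
    have u: "u \<in> carrier V" using that assms(1) by blast
    have "\<ominus>\<^bsub>V\<^esub> u = (\<ominus>\<^bsub>R\<^esub> \<one>\<^bsub>R\<^esub>) \<odot>\<^bsub>V\<^esub> u"
      using u smult_l_minus[of "\<one>\<^bsub>R\<^esub>" u] by simp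
    then show ?thesis using assms(4)[of "\<ominus>\<^bsub>R\<^esub> \<one>\<^bsub>R\<^esub>" u] that by simp
  qed
  then have "submodule U R V" by (intro submoduleI assms(1-4))
  then show ?thesis using assms(5) by (simp add: gsubmodule_def)
qed

lemma
  assumes "gsubmodule G R V U"
  shows gsub_carrier: "u \<in> U \<Longrightarrow> u \<in> carrier V"
    and gsub_subset: "U \<subseteq> carrier V"
    and gsub_zero: "\<zero>\<^bsub>V\<^esub> \<in> U"
    and gsub_add: "u \<in> U \<Longrightarrow> w \<in> U \<Longrightarrow> u \<oplus>\<^bsub>V\<^esub> w \<in> U"
    and gsub_minus: "u \<in> U \<Longrightarrow> \<ominus>\<^bsub>V\<^esub> u \<in> U"
    and gsub_diff: "u \<in> U \<Longrightarrow> w \<in> U \<Longrightarrow> u \<ominus>\<^bsub>V\<^esub> w \<in> U"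
    and gsub_smult: "a \<in> carrier R \<Longrightarrow> u \<in> U \<Longrightarrow> a \<odot>\<^bsub>V\<^esub> u \<in> U"
    and gsub_act: "g \<in> carrier G \<Longrightarrow> u \<in> U \<Longrightarrow> act V g u \<in> U"
proof -
  have s: "submodule U R V" using assms by (simp add: gsubmodule_def)
  note E = submoduleE[OF s]
  show "u \<in> U \<Longrightarrow> u \<in> carrier V" "U \<subseteq> carrier V" using E(1) by auto
  show "u \<in> U \<Longrightarrow> w \<in> U \<Longrightarrow> u \<oplus>\<^bsub>V\<^esub> w \<in> U" "u \<in> U \<Longrightarrow> \<ominus>\<^bsub>V\<^esub> u \<in> U"
    "u \<in> U \<Longrightarrow> w \<in> U \<Longrightarrow> u \<ominus>\<^bsub>V\<^esub> w \<in> U" "a \<in> carrier R \<Longrightarrow> u \<in> U \<Longrightarrow> a \<odot>\<^bsub>V\<^esub> u \<in> U"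
    using E by (auto simp: a_minus_def)
  show "\<zero>\<^bsub>V\<^esub> \<in> U" using subgroup.one_closed[OF submodule.axioms(1)[OF s]] by simp
  show "g \<in> carrier G \<Longrightarrow> u \<in> U \<Longrightarrow> act V g u \<in> U" using assms by (auto simp: gsubmodule_def)
qed

lemma gsub_finsum:
  assumes "gsubmodule G R V U" "f \<in> A \<rightarrow> U"
  shows "finsum V f A \<in> U"
  using assms(2)
proof (induction A rule: infinite_finite_induct)
  case (insert x A)
  then have "f \<in> A \<rightarrow> carrier V" "f x \<in> carrier V" using gsub_carrier[OF assms(1)] by auto
  with insert show ?case by (simp add: gsub_add[OF assms(1)])
qed (auto simp: gsub_zero[OF assms(1)])

lemma gsub_rep:
  assumes "gsubmodule G R V U"
  shows "rep G R (V\<lparr>carrier := U\<rparr>)"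
proof -
  interpret submodule U R V using assms by (simp add: gsubmodule_def)
  have "module R (V\<lparr>carrier := U\<rparr>)" by (rule submodule_is_module[OF V.module_axioms])
  moreover have "gmodule_axioms G R (V\<lparr>carrier := U\<rparr>)"
    by standard (auto simp: gsub_act[OF assms] gsub_carrier[OF assms] act_add act_smult act_one act_mult)
  ultimately show ?thesis
    by (intro rep.intro gmodule.intro G.is_group)
qed

lemma carrier_gsub: "gsubmodule G R V (carrier V)"
  by (rule gsubmoduleI) (auto simp: act_closed)

lemma act_zero: "g \<in> carrier G \<Longrightarrow> act V g \<zero>\<^bsub>V\<^esub> = \<zero>\<^bsub>V\<^esub>"
  using act_smult[of g "\<zero>\<^bsub>R\<^esub>" "\<zero>\<^bsub>V\<^esub>"] act_closed[of g "\<zero>\<^bsub>V\<^esub>"] by simp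

lemma zero_gsub: "gsubmodule G R V {\<zero>\<^bsub>V\<^esub>}"
  by (rule gsubmoduleI) (auto simp: act_zero)

lemma ghom_act_self: "ghom G R (V\<lparr>carrier := U\<rparr>) V (\<lambda>v. v)" if "U \<subseteq> carrier V"
  using that by (auto simp: ghom_def)

lemma gsub_gsub:
  assumes "gsubmodule G R V U"
  shows "gsubmodule G R (V\<lparr>carrier := U\<rparr>) Z \<longleftrightarrow> gsubmodule G R V Z \<and> Z \<subseteq> U"
proof -
  interpret U: rep G R "V\<lparr>carrier := U\<rparr>" by (rule gsub_rep[OF assms])
  show ?thesis
  proof
    assume Z: "gsubmodule G R (V\<lparr>carrier := U\<rparr>) Z"
    note E = U.gsub_subset[OF Z] U.gsub_zero[OF Z] U.gsub_add[OF Z] U.gsub_smult[OF Z] U.gsub_act[OF Z]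
    show "gsubmodule G R V Z \<and> Z \<subseteq> U"
      using E gsub_subset[OF assms] by (intro conjI gsubmoduleI) auto
  next
    assume Z: "gsubmodule G R V Z \<and> Z \<subseteq> U"
    then have Z': "gsubmodule G R V Z" by simp
    show "gsubmodule G R (V\<lparr>carrier := U\<rparr>) Z"
      using Z gsub_zero[OF Z'] gsub_add[OF Z'] gsub_smult[OF Z'] gsub_act[OF Z']
      by (intro U.gsubmoduleI) auto
  qed
qed

lemma direct_sum2_iff:
  "direct_sum2 G R V U W \<longleftrightarrow> gsubmodule G R V U \<and> gsubmodule G R V W
     \<and> (\<forall>x. x \<in> U \<longrightarrow> x \<in> W \<longrightarrow> x = \<zero>\<^bsub>V\<^esub>) \<and> (\<forall>v\<in>carrier V. \<exists>u\<in>U. \<exists>w\<in>W. v = u \<oplus>\<^bsub>V\<^esub> w)"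
proof -
  have S: "U <+>\<^bsub>V\<^esub> W = {u \<oplus>\<^bsub>V\<^esub> w | u w. u \<in> U \<and> w \<in> W}"
    by (auto simp: set_add_def set_mult_def)
  show ?thesis
  proof (cases "gsubmodule G R V U \<and> gsubmodule G R V W")
    case True
    then have UW: "gsubmodule G R V U" "gsubmodule G R V W" by auto
    have "U \<inter> W = {\<zero>\<^bsub>V\<^esub>} \<longleftrightarrow> (\<forall>x. x \<in> U \<longrightarrow> x \<in> W \<longrightarrow> x = \<zero>\<^bsub>V\<^esub>)"
      using gsub_zero[OF UW(1)] gsub_zero[OF UW(2)] by blast
    moreover have "U <+>\<^bsub>V\<^esub> W \<subseteq> carrier V"
      unfolding S using gsub_carrier[OF UW(1)] gsub_carrier[OF UW(2)] by auto
    then have "U <+>\<^bsub>V\<^esub> W = carrier V \<longleftrightarrow> (\<forall>v\<in>carrier V. v \<in> U <+>\<^bsub>V\<^esub> W)" by blast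
    moreover have "v \<in> U <+>\<^bsub>V\<^esub> W \<longleftrightarrow> (\<exists>u\<in>U. \<exists>w\<in>W. v = u \<oplus>\<^bsub>V\<^esub> w)" for v
      unfolding S by blast
    ultimately show ?thesis unfolding direct_sum2_def using UW by simp
  next
    case False
    then show ?thesis unfolding direct_sum2_def by blast
  qed
qed

lemma direct_sum2_sub_iff:
  assumes "gsubmodule G R V Z"
  shows "direct_sum2 G R (V\<lparr>carrier := Z\<rparr>) U W \<longleftrightarrow> gsubmodule G R V U \<and> gsubmodule G R V W
     \<and> U \<subseteq> Z \<and> W \<subseteq> Z \<and> (\<forall>x. x \<in> U \<longrightarrow> x \<in> W \<longrightarrow> x = \<zero>\<^bsub>V\<^esub>) \<and> (\<forall>v\<in>Z. \<exists>u\<in>U. \<exists>w\<in>W. v = u \<oplus>\<^bsub>V\<^esub> w)"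
  using rep.direct_sum2_iff[OF gsub_rep[OF assms], of U W] by (auto simp: gsub_gsub[OF assms])

lemma direct_sum2_swap:
  assumes "direct_sum2 G R V U W" shows "direct_sum2 G R V W U"
proof -
  have *: "\<exists>w\<in>W. \<exists>u\<in>U. v = w \<oplus>\<^bsub>V\<^esub> u" if "v \<in> carrier V" for v
    using assms that unfolding direct_sum2_iff by (metis M.a_comm gsub_carrier)
  show ?thesis using assms * unfolding direct_sum2_iff by blast
qed

lemma gsub_cancel:
  assumes "gsubmodule G R V U" "gsubmodule G R V W" "\<And>x. x \<in> U \<Longrightarrow> x \<in> W \<Longrightarrow> x = \<zero>\<^bsub>V\<^esub>"
    "u \<in> U" "u' \<in> U" "w \<in> W" "w' \<in> W" "u \<oplus>\<^bsub>V\<^esub> w = u' \<oplus>\<^bsub>V\<^esub> w'"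
  shows "u = u'" "w = w'"
proof -
  have c: "u \<in> carrier V" "u' \<in> carrier V" "w \<in> carrier V" "w' \<in> carrier V"
    using assms gsub_carrier by blast+
  have "u \<ominus>\<^bsub>V\<^esub> u' = w' \<ominus>\<^bsub>V\<^esub> w"
  proof -
    have "u = u' \<oplus>\<^bsub>V\<^esub> w' \<ominus>\<^bsub>V\<^esub> w" using assms(8) c
      by (metis M.add.inv_solve_right M.minus_eq M.a_closed)
    then have "u \<ominus>\<^bsub>V\<^esub> u' = (u' \<oplus>\<^bsub>V\<^esub> (w' \<ominus>\<^bsub>V\<^esub> w)) \<ominus>\<^bsub>V\<^esub> u'"
      using c by (simp add: M.minus_eq M.a_assoc)
    also have "u' \<oplus>\<^bsub>V\<^esub> (w' \<ominus>\<^bsub>V\<^esub> w) = (w' \<ominus>\<^bsub>V\<^esub> w) \<oplus>\<^bsub>V\<^esub> u'"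
      using c by (simp add: M.a_comm)
    also have "\<dots> \<ominus>\<^bsub>V\<^esub> u' = w' \<ominus>\<^bsub>V\<^esub> w" using c
      by (simp add: M.minus_eq M.a_assoc M.r_neg)
    finally show ?thesis .
  qed
  moreover have "u \<ominus>\<^bsub>V\<^esub> u' \<in> U" "w' \<ominus>\<^bsub>V\<^esub> w \<in> W" using assms gsub_diff by auto
  ultimately have "u \<ominus>\<^bsub>V\<^esub> u' = \<zero>\<^bsub>V\<^esub>" using assms(3) by auto
  then show 1: "u = u'" using c
    by (metis M.add.inv_solve_right M.l_zero M.minus_eq M.zero_closed)
  show "w = w'" using assms(8) c 1 by simp
qed

lemma direct_sum2_projection:
  assumes "direct_sum2 G R V U W"
  obtains \<pi> where "ghom G R V (V\<lparr>carrier := U\<rparr>) \<pi>" "\<And>u. u \<in> U \<Longrightarrow> \<pi> u = u" "\<And>w. w \<in> W \<Longrightarrow> \<pi> w = \<zero>\<^bsub>V\<^esub>"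
proof -
  have U: "gsubmodule G R V U" and W: "gsubmodule G R V W"
    and z: "\<And>x. x \<in> U \<Longrightarrow> x \<in> W \<Longrightarrow> x = \<zero>\<^bsub>V\<^esub>"
    and ex: "\<And>v. v \<in> carrier V \<Longrightarrow> \<exists>u\<in>U. \<exists>w\<in>W. v = u \<oplus>\<^bsub>V\<^esub> w"
    using assms unfolding direct_sum2_iff by auto
  define \<pi> where "\<pi> v = (SOME u. u \<in> U \<and> (\<exists>w\<in>W. v = u \<oplus>\<^bsub>V\<^esub> w))" for v
  have \<pi>: "\<pi> v = u" if "v = u \<oplus>\<^bsub>V\<^esub> w" "u \<in> U" "w \<in> W" for u v w
    unfolding \<pi>_def
  proof (rule some_equality)
    show "u \<in> U \<and> (\<exists>w\<in>W. v = u \<oplus>\<^bsub>V\<^esub> w)" using that by blast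
  next
    fix u' assume "u' \<in> U \<and> (\<exists>w\<in>W. v = u' \<oplus>\<^bsub>V\<^esub> w)"
    then show "u' = u" using gsub_cancel(1)[OF U W z, of u' u] that by blast
  qed
  note cl = gsub_carrier[OF U] gsub_carrier[OF W]
  have "ghom G R V (V\<lparr>carrier := U\<rparr>) \<pi>"
  proof (rule ghomI)
    fix v assume "v \<in> carrier V"
    then obtain u w where v: "u \<in> U" "w \<in> W" "v = u \<oplus>\<^bsub>V\<^esub> w" using ex by blast
    then show "\<pi> v \<in> carrier (V\<lparr>carrier := U\<rparr>)" using \<pi> by simp
    show "\<pi> (act V g v) = act (V\<lparr>carrier := U\<rparr>) g (\<pi> v)" if "g \<in> carrier G" for g
      using \<pi>[OF _ gsub_act[OF U] gsub_act[OF W], of "act V g v" g u g w] \<pi>[OF v(3,1,2)] v that cl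
      by (simp add: act_add)
    show "\<pi> (a \<odot>\<^bsub>V\<^esub> v) = a \<odot>\<^bsub>V\<lparr>carrier := U\<rparr>\<^esub> (\<pi> v)" if "a \<in> carrier R" for a
      using \<pi>[OF _ gsub_smult[OF U] gsub_smult[OF W], of "a \<odot>\<^bsub>V\<^esub> v" a u a w] \<pi>[OF v(3,1,2)] v that cl
      by (simp add: smult_r_distr)
    fix v' assume "v' \<in> carrier V"
    then obtain u' w' where v': "u' \<in> U" "w' \<in> W" "v' = u' \<oplus>\<^bsub>V\<^esub> w'" using ex by blast
    show "\<pi> (v \<oplus>\<^bsub>V\<^esub> v') = \<pi> v \<oplus>\<^bsub>V\<lparr>carrier := U\<rparr>\<^esub> \<pi> v'"
      using \<pi>[OF _ gsub_add[OF U] gsub_add[OF W], of "v \<oplus>\<^bsub>V\<^esub> v'" u u' w w'] \<pi>[OF v(3,1,2)] \<pi>[OF v'(3,1,2)]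
        v v' cl by (simp add: M.a_ac)
  qed
  moreover have "\<pi> u = u" if "u \<in> U" for u using \<pi>[of u u "\<zero>\<^bsub>V\<^esub>"] that gsub_zero[OF W] cl by simp
  moreover have "\<pi> w = \<zero>\<^bsub>V\<^esub>" if "w \<in> W" for w using \<pi>[of w "\<zero>\<^bsub>V\<^esub>" w] that gsub_zero[OF U] cl by simp
  ultimately show ?thesis using that by blast
qed

end

lemma ghom_ker_gsub:
  assumes "rep G R V" "rep G R W" "ghom G R V W h"
  shows "gsubmodule G R V {v \<in> carrier V. h v = \<zero>\<^bsub>W\<^esub>}"
proof -
  interpret V: rep G R V by fact
  interpret W: rep G R W by fact
  note h = assms(3)
  show ?thesis
  proof (rule V.gsubmoduleI)
    show "{v \<in> carrier V. h v = \<zero>\<^bsub>W\<^esub>} \<subseteq> carrier V" by blast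
    show "\<zero>\<^bsub>V\<^esub> \<in> {v \<in> carrier V. h v = \<zero>\<^bsub>W\<^esub>}" using ghom_zero[OF assms] by simp
  next
    fix u w assume "u \<in> {v \<in> carrier V. h v = \<zero>\<^bsub>W\<^esub>}" "w \<in> {v \<in> carrier V. h v = \<zero>\<^bsub>W\<^esub>}"
    then show "u \<oplus>\<^bsub>V\<^esub> w \<in> {v \<in> carrier V. h v = \<zero>\<^bsub>W\<^esub>}" using ghom_add[OF h, of u w] by simp
  next
    fix a u assume "a \<in> carrier R" "u \<in> {v \<in> carrier V. h v = \<zero>\<^bsub>W\<^esub>}"
    then show "a \<odot>\<^bsub>V\<^esub> u \<in> {v \<in> carrier V. h v = \<zero>\<^bsub>W\<^esub>}" using ghom_smult[OF h, of a u] by simp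
  next
    fix g u assume "g \<in> carrier G" "u \<in> {v \<in> carrier V. h v = \<zero>\<^bsub>W\<^esub>}"
    then show "act V g u \<in> {v \<in> carrier V. h v = \<zero>\<^bsub>W\<^esub>}"
      using ghom_act[OF h, of g u] V.act_closed W.act_zero by simp
  qed
qed

lemma ghom_image_gsub:
  assumes "rep G R V" "rep G R W" "ghom G R V W h"
  shows "gsubmodule G R W (h ` carrier V)"
proof -
  interpret V: rep G R V by fact
  interpret W: rep G R W by fact
  note h = assms(3)
  show ?thesis
  proof (rule W.gsubmoduleI)
    show "h ` carrier V \<subseteq> carrier W" using ghom_closed[OF h] by auto
    show "\<zero>\<^bsub>W\<^esub> \<in> h ` carrier V" using ghom_zero[OF assms] by (metis V.M.zero_closed imageI)
  next
    fix u w assume "u \<in> h ` carrier V" "w \<in> h ` carrier V"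
    then show "u \<oplus>\<^bsub>W\<^esub> w \<in> h ` carrier V" using ghom_add[OF h] by (metis (no_types, lifting) V.M.a_closed imageE imageI)
  next
    fix a u assume "a \<in> carrier R" "u \<in> h ` carrier V"
    then show "a \<odot>\<^bsub>W\<^esub> u \<in> h ` carrier V" using ghom_smult[OF h] by (metis (no_types, lifting) V.smult_closed imageE imageI)
  next
    fix g u assume "g \<in> carrier G" "u \<in> h ` carrier V"
    then show "act W g u \<in> h ` carrier V" using ghom_act[OF h] by (metis (no_types, lifting) V.act_closed imageE imageI)
  qed
qed

lemma ghom_diff:
  assumes "rep G R V" "rep G R W" "ghom G R V W h" "v \<in> carrier V" "w \<in> carrier V"
  shows "h (v \<ominus>\<^bsub>V\<^esub> w) = h v \<ominus>\<^bsub>W\<^esub> h w"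
proof -
  interpret V: rep G R V by fact
  interpret W: rep G R W by fact
  have "h (\<ominus>\<^bsub>V\<^esub> w) = \<ominus>\<^bsub>W\<^esub> h w"
    using ghom_smult[OF assms(3), of "\<ominus>\<^bsub>R\<^esub> \<one>\<^bsub>R\<^esub>" w] assms(5) ghom_closed[OF assms(3), of w]
      V.smult_l_minus[of "\<one>\<^bsub>R\<^esub>" w] W.smult_l_minus[of "\<one>\<^bsub>R\<^esub>" "h w"] by simp
  then show ?thesis using assms by (simp add: a_minus_def ghom_add[OF assms(3)])
qed

text \<open>The kernel of \<open>g\<close> is a complement of the image of \<open>f\<close>: if \<open>k\<close> is the inverse of \<open>g \<circ> f\<close>, then
\<open>v - f (k (g v))\<close> lies in the kernel.\<close>

lemma splitting:
  assumes "rep G R V" "rep G R N" "ghom G R N V f" "ghom G R V N g"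
    and bij: "bij_betw (g \<circ> f) (carrier N) (carrier N)"
  shows "direct_sum2 G R V (f ` carrier N) {v \<in> carrier V. g v = \<zero>\<^bsub>N\<^esub>}"
    and "gmod_iso G R (V\<lparr>carrier := f ` carrier N\<rparr>) N"
proof -
  interpret V: rep G R V by fact
  interpret N: rep G R N by fact
  have fc: "f x \<in> carrier V" if "x \<in> carrier N" for x using that by (rule ghom_closed[OF assms(3)])
  have inj: "inj_on (g \<circ> f) (carrier N)" and im: "(g \<circ> f) ` carrier N = carrier N"
    using bij by (auto simp: bij_betw_def)
  show "direct_sum2 G R V (f ` carrier N) {v \<in> carrier V. g v = \<zero>\<^bsub>N\<^esub>}"
    unfolding V.direct_sum2_iff
  proof (intro conjI allI impI ballI)
    show "gsubmodule G R V (f ` carrier N)" by (rule ghom_image_gsub[OF assms(2,1,3)])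
    show "gsubmodule G R V {v \<in> carrier V. g v = \<zero>\<^bsub>N\<^esub>}" by (rule ghom_ker_gsub[OF assms(1,2,4)])
    fix x assume "x \<in> f ` carrier N" and x: "x \<in> {v \<in> carrier V. g v = \<zero>\<^bsub>N\<^esub>}"
    then obtain y where y: "y \<in> carrier N" "x = f y" by auto
    have z: "f \<zero>\<^bsub>N\<^esub> = \<zero>\<^bsub>V\<^esub>" "g \<zero>\<^bsub>V\<^esub> = \<zero>\<^bsub>N\<^esub>"
      by (rule ghom_zero[OF assms(2,1,3)], rule ghom_zero[OF assms(1,2,4)])
    have "(g \<circ> f) y = (g \<circ> f) \<zero>\<^bsub>N\<^esub>"
      using x y(2) by (simp add: z)
    then have "y = \<zero>\<^bsub>N\<^esub>" by (rule inj_onD[OF inj]) (use y in auto)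
    then show "x = \<zero>\<^bsub>V\<^esub>" using y(2) z(1) by simp
  next
    fix v assume v: "v \<in> carrier V"
    then have "g v \<in> (g \<circ> f) ` carrier N" unfolding im by (rule ghom_closed[OF assms(4)])
    then obtain x where x: "x \<in> carrier N" "g v = g (f x)" by auto
    have "g (v \<ominus>\<^bsub>V\<^esub> f x) = \<zero>\<^bsub>N\<^esub>"
      using ghom_diff[OF assms(1,2,4) v fc[OF x(1)]] x(2) ghom_closed[OF assms(4) fc[OF x(1)]]
      by (simp add: N.M.minus_eq N.M.r_neg)
    moreover have "v = f x \<oplus>\<^bsub>V\<^esub> (v \<ominus>\<^bsub>V\<^esub> f x)" using v fc[OF x(1)]
      by (simp add: V.M.minus_eq V.M.a_lcomm V.M.r_neg)
    ultimately show "\<exists>u\<in>f ` carrier N. \<exists>w\<in>{v \<in> carrier V. g v = \<zero>\<^bsub>N\<^esub>}. v = u \<oplus>\<^bsub>V\<^esub> w"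
      using v x fc by blast
  qed
  have "ghom G R (V\<lparr>carrier := f ` carrier N\<rparr>) N g"
    using assms(4) fc by (auto simp: ghom_def)
  moreover have "bij_betw g (f ` carrier N) (carrier N)"
    using inj im by (auto simp: bij_betw_def inj_on_def image_comp)
  ultimately show "gmod_iso G R (V\<lparr>carrier := f ` carrier N\<rparr>) N"
    unfolding gmod_iso_ghom by auto
qed

section \<open>Finite length, Fitting's lemma and decompositions\<close>

text \<open>A rank that increases strictly along inclusions bounds the length of chains of submodules. It is
all that Fitting's lemma and the existence of decompositions need.\<close>

definition finite_length ::
    "('g, 'a) monoid_scheme \<Rightarrow> ('f, 'b) ring_scheme \<Rightarrow> ('f, 'v, 'g) gmod \<Rightarrow> bool" where
  "finite_length G R V \<longleftrightarrow> (\<exists>\<mu> :: 'v set \<Rightarrow> nat. \<forall>U U'.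
     gsubmodule G R V U \<longrightarrow> gsubmodule G R V U' \<longrightarrow> U \<subset> U' \<longrightarrow> \<mu> U < \<mu> U')"

lemma finite_length_sub:
  fixes V :: "('f, 'v, 'g) gmod"
  assumes "rep G R V" "gsubmodule G R V U" "finite_length G R V"
  shows "finite_length G R (V\<lparr>carrier := U\<rparr>)"
proof -
  interpret rep G R V by fact
  obtain \<mu> :: "'v set \<Rightarrow> nat" where \<mu>: "\<forall>U U'. gsubmodule G R V U \<longrightarrow> gsubmodule G R V U' \<longrightarrow> U \<subset> U' \<longrightarrow> \<mu> U < \<mu> U'"
    using assms(3) unfolding finite_length_def by (rule exE)
  show ?thesis unfolding finite_length_def gsub_gsub[OF assms(2)]
    by (rule exI[of _ \<mu>]) (simp add: \<mu>)
qed

lemma ghom_sub_image: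
  assumes "rep G R V" "rep G R W" "ghom G R V W h" "gsubmodule G R V U"
  shows "gsubmodule G R W (h ` U)"
proof -
  interpret rep G R V by fact
  have "ghom G R (V\<lparr>carrier := U\<rparr>) W h"
    using assms(3) gsub_carrier[OF assms(4)] by (auto simp: ghom_def)
  from ghom_image_gsub[OF gsub_rep[OF assms(4)] assms(2) this] show ?thesis by simp
qed

lemma finite_length_iso:
  fixes W :: "('f, 'w, 'g) gmod"
  assumes "rep G R V" "rep G R W" "gmod_iso G R V W" "finite_length G R W"
  shows "finite_length G R V"
proof -
  interpret rep G R V by fact
  obtain h where h: "ghom G R V W h" "bij_betw h (carrier V) (carrier W)"
    using assms(3) unfolding gmod_iso_ghom by blast
  obtain \<mu> :: "'w set \<Rightarrow> nat" where \<mu>: "\<And>U U'. gsubmodule G R W U \<Longrightarrow> gsubmodule G R W U' \<Longrightarrow> U \<subset> U' \<Longrightarrow> \<mu> U < \<mu> U'"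
    using assms(4) unfolding finite_length_def by auto
  have "\<mu> (h ` U) < \<mu> (h ` U')" if sub: "gsubmodule G R V U" "gsubmodule G R V U'" "U \<subset> U'" for U U'
  proof (rule \<mu>)
    show "gsubmodule G R W (h ` U)" "gsubmodule G R W (h ` U')"
      using ghom_sub_image[OF assms(1,2) h(1)] sub by auto
    obtain x where x: "x \<in> U'" "x \<notin> U" using sub(3) by blast
    have "h x \<notin> h ` U"
      using x gsub_carrier[OF sub(2)] gsub_carrier[OF sub(1)] h(2) unfolding bij_betw_def inj_on_def by blast
    then show "h ` U \<subset> h ` U'" using sub(3) x by blast
  qed
  then show ?thesis unfolding finite_length_def by (intro exI[of _ "\<lambda>U. \<mu> (h ` U)"]) blast
qed

lemma gsub_chain_stable:
  fixes V :: "('f, 'v, 'g) gmod"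
  assumes "rep G R V" "finite_length G R V" "\<And>k. gsubmodule G R V (A k)"
    and mono: "(\<forall>k. A (Suc k) \<subseteq> A k) \<or> (\<forall>k. A k \<subseteq> A (Suc k))"
  shows "\<exists>N. \<forall>j\<ge>N. A j = A N"
proof -
  interpret rep G R V by fact
  obtain \<mu> :: "'v set \<Rightarrow> nat" where \<mu>: "\<And>U U'. gsubmodule G R V U \<Longrightarrow> gsubmodule G R V U' \<Longrightarrow> U \<subset> U' \<Longrightarrow> \<mu> U < \<mu> U'"
    using assms(2) unfolding finite_length_def by blast
  show ?thesis using mono
  proof
    assume dec: "\<forall>k. A (Suc k) \<subseteq> A k"
    obtain N where N: "\<And>j. \<mu> (A N) \<le> \<mu> (A j)"
      using ex_has_least_nat[of "\<lambda>_. True" 0 "\<lambda>k. \<mu> (A k)"] by auto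
    have "A j = A N" if "j \<ge> N" for j
    proof (rule ccontr)
      assume "A j \<noteq> A N"
      then have "A j \<subset> A N" using lift_Suc_antimono_le[of A N j] dec that by blast
      from \<mu>[OF assms(3) assms(3) this] N[of j] show False by simp
    qed
    then show ?thesis by blast
  next
    assume inc: "\<forall>k. A k \<subseteq> A (Suc k)"
    let ?c = "\<mu> (carrier V)"
    have le: "\<mu> (A k) \<le> ?c" for k
    proof (cases "A k = carrier V")
      case False
      then have "A k \<subset> carrier V" using gsub_subset[OF assms(3), of k] by blast
      from \<mu>[OF assms(3) carrier_gsub this] show ?thesis by simp
    qed simp
    obtain N where N: "\<And>j. ?c - \<mu> (A N) \<le> ?c - \<mu> (A j)"
      using ex_has_least_nat[of "\<lambda>_. True" 0 "\<lambda>k. ?c - \<mu> (A k)"] by auto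
    have "A j = A N" if "j \<ge> N" for j
    proof (rule ccontr)
      assume "A j \<noteq> A N"
      then have "A N \<subset> A j" using lift_Suc_mono_le[of A N j] inc that by blast
      from \<mu>[OF assms(3) assms(3) this] N[of j] le[of j] show False by simp
    qed
    then show ?thesis by blast
  qed
qed

lemma ghom_funpow: "ghom G R V V h \<Longrightarrow> ghom G R V V (h ^^ k)"
proof (induction k)
  case 0
  then show ?case by (simp add: ghom_id id_def)
next
  case (Suc k)
  then show ?case using ghom_comp[of G R V V "h ^^ k" V h] by (simp add: comp_def)
qed

text \<open>The images and the kernels of the powers of \<open>h\<close> become stationary and then complement each other.
Since \<open>h\<close> is not nilpotent, indecomposability leaves only the case that the kernel vanishes.\<close>

lemma fitting:
  assumes "rep G R V" "finite_length G R V" "indecomposable G R V" "ghom G R V V h"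
    and nonnil: "\<And>k. \<exists>v\<in>carrier V. (h ^^ k) v \<noteq> \<zero>\<^bsub>V\<^esub>"
  shows "bij_betw h (carrier V) (carrier V)"
proof -
  interpret rep G R V by fact
  note hk = ghom_funpow[OF assms(4)]
  note hz = ghom_zero[OF assms(1) assms(1)]
  define I where "I k = (h ^^ k) ` carrier V" for k
  define K where "K k = {v \<in> carrier V. (h ^^ k) v = \<zero>\<^bsub>V\<^esub>}" for k
  have Is: "gsubmodule G R V (I k)" for k unfolding I_def by (rule ghom_image_gsub[OF assms(1,1) hk])
  have Ks: "gsubmodule G R V (K k)" for k unfolding K_def by (rule ghom_ker_gsub[OF assms(1,1) hk])
  have Idec: "\<forall>k. I (Suc k) \<subseteq> I k"
    unfolding I_def using ghom_closed[OF assms(4)] by (auto simp: funpow_swap1)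
  have Kinc: "\<forall>k. K k \<subseteq> K (Suc k)"
    unfolding K_def using hz[OF assms(4)] by auto
  obtain N1 where N1: "\<forall>j\<ge>N1. I j = I N1"
    using gsub_chain_stable[OF assms(1,2) Is disjI1[OF Idec]] by (rule exE)
  obtain N2 where N2: "\<forall>j\<ge>N2. K j = K N2"
    using gsub_chain_stable[OF assms(1,2) Ks disjI2[OF Kinc]] by (rule exE)
  define N where "N = Suc (max N1 N2)"
  have "I N = I N1" "I (N + N) = I N1" "K N = K N2" "K (N + N) = K N2"
    by (rule N1[rule_format] N2[rule_format]; simp add: N_def)+
  then have IN: "I (N + N) = I N" and KN: "K (N + N) = K N" by auto
  have add: "(h ^^ (N + N)) v = (h ^^ N) ((h ^^ N) v)" for v by (simp add: funpow_add)
  have cl: "(h ^^ k) v \<in> carrier V" if "v \<in> carrier V" for k v by (rule ghom_closed[OF hk that])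
  have "direct_sum2 G R V (I N) (K N)"
    unfolding direct_sum2_iff
  proof (intro conjI Is Ks allI impI ballI)
    fix x assume x: "x \<in> I N" "x \<in> K N"
    then obtain v where v: "v \<in> carrier V" "x = (h ^^ N) v" unfolding I_def by blast
    then have "v \<in> K (N + N)" using x(2) by (simp add: K_def add)
    then have "v \<in> K N" unfolding KN .
    then show "x = \<zero>\<^bsub>V\<^esub>" using v by (simp add: K_def)
  next
    fix v assume v: "v \<in> carrier V"
    then have "(h ^^ N) v \<in> I (N + N)" using IN by (auto simp: I_def)
    then obtain w where w: "w \<in> carrier V" "(h ^^ N) v = (h ^^ N) ((h ^^ N) w)"
      unfolding I_def add by blast
    let ?d = "v \<ominus>\<^bsub>V\<^esub> (h ^^ N) w"
    have "(h ^^ N) ?d = \<zero>\<^bsub>V\<^esub>"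
      using ghom_diff[OF assms(1,1) hk v cl[OF w(1)], of N N] w cl[OF cl[OF w(1)]]
      by (simp add: M.minus_eq M.r_neg)
    then have "?d \<in> K N" using v cl[OF w(1)] by (simp add: K_def)
    moreover have "(h ^^ N) w \<in> I N" using w by (simp add: I_def)
    moreover have "v = (h ^^ N) w \<oplus>\<^bsub>V\<^esub> ?d"
      using v cl[OF w(1), of N] by (simp add: M.minus_eq M.a_lcomm M.r_neg)
    ultimately show "\<exists>u\<in>I N. \<exists>w\<in>K N. v = u \<oplus>\<^bsub>V\<^esub> w" by blast
  qed
  then have "I N = {\<zero>\<^bsub>V\<^esub>} \<or> K N = {\<zero>\<^bsub>V\<^esub>}" using assms(3) unfolding indecomposable_def by blast
  moreover have "I N \<noteq> {\<zero>\<^bsub>V\<^esub>}" using nonnil[of N] by (auto simp: I_def)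
  ultimately have K0: "K N = {\<zero>\<^bsub>V\<^esub>}" by blast
  have "inj_on h (carrier V)"
  proof (rule inj_onI)
    fix v w assume vw: "v \<in> carrier V" "w \<in> carrier V" "h v = h w"
    have hc: "h w \<in> carrier V" by (rule ghom_closed[OF assms(4) vw(2)])
    have "h (v \<ominus>\<^bsub>V\<^esub> w) = \<zero>\<^bsub>V\<^esub>"
      using ghom_diff[OF assms(1,1,4) vw(1,2)] vw(3) hc by (simp add: M.minus_eq M.r_neg)
    then have "(h ^^ N) (v \<ominus>\<^bsub>V\<^esub> w) = \<zero>\<^bsub>V\<^esub>"
      using hz[OF hk] unfolding N_def funpow_Suc_right by simp
    then have "v \<ominus>\<^bsub>V\<^esub> w = \<zero>\<^bsub>V\<^esub>" using K0 vw by (auto simp: K_def)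
    then show "v = w" using vw by (metis M.add.inv_solve_right M.l_zero M.minus_eq M.zero_closed)
  qed
  moreover have "h ` carrier V = carrier V"
  proof
    show "h ` carrier V \<subseteq> carrier V" using ghom_closed[OF assms(4)] by blast
    show "carrier V \<subseteq> h ` carrier V"
    proof
      fix v assume v: "v \<in> carrier V"
      then obtain u w where uw: "u \<in> I N" "w \<in> K N" "v = u \<oplus>\<^bsub>V\<^esub> w"
        using \<open>direct_sum2 G R V (I N) (K N)\<close> unfolding direct_sum2_iff by blast
      then have "v = u" using K0 gsub_carrier[OF Is] by simp
      then obtain w where "w \<in> carrier V" "v = (h ^^ N) w" using uw by (auto simp: I_def)
      then have "v = h ((h ^^ max N1 N2) w)" "(h ^^ max N1 N2) w \<in> carrier V" using cl by (auto simp: N_def)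
      then show "v \<in> h ` carrier V" by blast
    qed
  qed
  ultimately show ?thesis by (simp add: bij_betw_def)
qed

lemma Pi_subsetI:
  assumes "u \<in> (\<Pi> Z\<in>\<U>. Z)" "\<And>Z. Z \<in> \<U> \<Longrightarrow> Z \<subseteq> A"
  shows "u \<in> \<U> \<rightarrow> A"
proof
  fix Z assume Z: "Z \<in> \<U>"
  then have "u Z \<in> Z" using assms(1) by (auto simp: Pi_iff)
  then show "u Z \<in> A" by (rule subsetD[OF assms(2)[OF Z]])
qed

context rep begin

lemma act_finsum:
  assumes "finite A" "f \<in> A \<rightarrow> carrier V" "g \<in> carrier G"
  shows "act V g (finsum V f A) = finsum V (\<lambda>i. act V g (f i)) A"
  using assms(1,2)
proof (induction A)
  case empty
  then show ?case using act_zero[OF assms(3)] by simp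
next
  case (insert i A)
  then have "f \<in> A \<rightarrow> carrier V" "f i \<in> carrier V" "(\<lambda>i. act V g (f i)) \<in> A \<rightarrow> carrier V"
    using act_closed[OF assms(3)] by auto
  then show ?case using insert act_add[OF assms(3)] act_closed[OF assms(3)] by simp
qed

text \<open>Induction on the rank: if \<open>U\<close> is decomposable, then its two parts have smaller rank. The constituents are
described by generation and independence inside \<open>V\<close>, so that the families of the two parts can be united.\<close>

lemma decomposition_of_submodules:
  fixes \<mu> :: "'v set \<Rightarrow> nat"
  assumes \<mu>': "\<forall>U U'. gsubmodule G R V U \<longrightarrow> gsubmodule G R V U' \<longrightarrow> U \<subset> U' \<longrightarrow> \<mu> U < \<mu> U'"
    and "gsubmodule G R V U"
  shows "\<exists>\<U>. finite \<U> \<and> (\<forall>Z\<in>\<U>. gsubmodule G R V Z \<and> indecomposable G R (V\<lparr>carrier := Z\<rparr>) \<and> Z \<subseteq> U)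
     \<and> (\<forall>v\<in>U. \<exists>u\<in>(\<Pi> Z\<in>\<U>. Z). v = finsum V u \<U>)
     \<and> (\<forall>u\<in>(\<Pi> Z\<in>\<U>. Z). finsum V u \<U> = \<zero>\<^bsub>V\<^esub> \<longrightarrow> (\<forall>Z\<in>\<U>. u Z = \<zero>\<^bsub>V\<^esub>))"
    (is "\<exists>\<U>. ?P U \<U>")
  using assms(2)
proof (induction "\<mu> U" arbitrary: U rule: less_induct)
  case less
  note U = less.prems
  note \<mu> = \<mu>'[rule_format]
  consider "U = {\<zero>\<^bsub>V\<^esub>}" | "indecomposable G R (V\<lparr>carrier := U\<rparr>)"
    | A B where "U \<noteq> {\<zero>\<^bsub>V\<^esub>}" "direct_sum2 G R (V\<lparr>carrier := U\<rparr>) A B" "A \<noteq> {\<zero>\<^bsub>V\<^esub>}" "B \<noteq> {\<zero>\<^bsub>V\<^esub>}"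
  proof (cases "U = {\<zero>\<^bsub>V\<^esub>}")
    case False
    show ?thesis
    proof (cases "indecomposable G R (V\<lparr>carrier := U\<rparr>)")
      assume "\<not> indecomposable G R (V\<lparr>carrier := U\<rparr>)"
      then obtain A B where "direct_sum2 G R (V\<lparr>carrier := U\<rparr>) A B" "A \<noteq> {\<zero>\<^bsub>V\<^esub>}" "B \<noteq> {\<zero>\<^bsub>V\<^esub>}"
        unfolding indecomposable_def using False by auto
      then show ?thesis using that(3) False by simp
    qed (rule that(2))
  qed (rule that(1))
  then show ?case
  proof cases
    case 1
    then have "?P U {}" by simp
    then show ?thesis by (rule exI)
  next
    case 2
    have f: "finsum V u {U} = u U" if "u \<in> (\<Pi> Z\<in>{U}. Z)" for u
      using that gsub_carrier[OF U] by simp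
    have "\<exists>u\<in>(\<Pi> Z\<in>{U}. Z). v = finsum V u {U}" if "v \<in> U" for v
      using f[of "\<lambda>_. v"] that by (intro bexI[of _ "\<lambda>_. v"]) auto
    then have "?P U {U}" using 2 U f by simp
    then show ?thesis by (rule exI)
  next
    case 3
    then have AB: "gsubmodule G R V A" "gsubmodule G R V B" "A \<subseteq> U" "B \<subseteq> U"
      and z: "\<And>x. x \<in> A \<Longrightarrow> x \<in> B \<Longrightarrow> x = \<zero>\<^bsub>V\<^esub>"
      and ex: "\<And>v. v \<in> U \<Longrightarrow> \<exists>u\<in>A. \<exists>w\<in>B. v = u \<oplus>\<^bsub>V\<^esub> w"
      unfolding direct_sum2_sub_iff[OF U] by auto
    have "A \<noteq> U" using 3(4) z AB gsub_zero[OF AB(2)] by blast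
    moreover have "B \<noteq> U" using 3(3) z AB gsub_zero[OF AB(1)] by blast
    ultimately have lt: "\<mu> A < \<mu> U" "\<mu> B < \<mu> U"
      by (intro \<mu> AB(1,2) U psubsetI AB(3,4); simp)+
    obtain \<A> where PA: "?P A \<A>" using less.hyps[OF lt(1) AB(1)] by (rule exE)
    obtain \<B> where PB: "?P B \<B>" using less.hyps[OF lt(2) AB(2)] by (rule exE)
    note A = PA[THEN conjunct1] PA[THEN conjunct2, THEN conjunct1, rule_format]
      PA[THEN conjunct2, THEN conjunct2, THEN conjunct1, rule_format]
      PA[THEN conjunct2, THEN conjunct2, THEN conjunct2, rule_format]
    note B = PB[THEN conjunct1] PB[THEN conjunct2, THEN conjunct1, rule_format]
      PB[THEN conjunct2, THEN conjunct2, THEN conjunct1, rule_format]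
      PB[THEN conjunct2, THEN conjunct2, THEN conjunct2, rule_format]
    have dis: "\<A> \<inter> \<B> = {}"
    proof (rule ccontr)
      assume "\<A> \<inter> \<B> \<noteq> {}"
      then obtain Z where Z: "Z \<in> \<A>" "Z \<in> \<B>" by blast
      then have "gsubmodule G R V Z" "indecomposable G R (V\<lparr>carrier := Z\<rparr>)" "Z \<subseteq> A" "Z \<subseteq> B"
        using A(2)[OF Z(1)] B(2)[OF Z(2)] by auto
      moreover from this have "Z = {\<zero>\<^bsub>V\<^esub>}" using z gsub_zero[of Z] by blast
      ultimately show False unfolding indecomposable_def by simp
    qed
    have fin: "finite \<A>" "finite \<B>" by (rule A(1), rule B(1))
    have split: "finsum V u (\<A> \<union> \<B>) = finsum V u \<A> \<oplus>\<^bsub>V\<^esub> finsum V u \<B>"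
      and inA: "finsum V u \<A> \<in> A" and inB: "finsum V u \<B> \<in> B"
      if u: "u \<in> (\<Pi> Z\<in>\<A>\<union>\<B>. Z)" for u
    proof -
      have subA: "\<And>Z. Z \<in> \<A> \<Longrightarrow> Z \<subseteq> A" and subB: "\<And>Z. Z \<in> \<B> \<Longrightarrow> Z \<subseteq> B" using A(2) B(2) by auto
      have uA: "u \<in> \<A> \<rightarrow> A" and uB: "u \<in> \<B> \<rightarrow> B"
        by (intro Pi_subsetI subA subB; use u in auto)+
      show "finsum V u \<A> \<in> A" "finsum V u \<B> \<in> B"
        by (rule gsub_finsum[OF AB(1) uA], rule gsub_finsum[OF AB(2) uB])
      have "u \<in> \<A> \<rightarrow> carrier V" "u \<in> \<B> \<rightarrow> carrier V" using uA uB gsub_carrier[OF AB(1)] gsub_carrier[OF AB(2)] by (auto simp: Pi_iff)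
      then show "finsum V u (\<A> \<union> \<B>) = finsum V u \<A> \<oplus>\<^bsub>V\<^esub> finsum V u \<B>"
        using M.finsum_Un_disjoint[OF fin dis] by auto
    qed
    have "?P U (\<A> \<union> \<B>)"
    proof (intro conjI ballI impI)
      show "finite (\<A> \<union> \<B>)" using fin by simp
    next
      fix Z assume "Z \<in> \<A> \<union> \<B>"
      then show "gsubmodule G R V Z" "indecomposable G R (V\<lparr>carrier := Z\<rparr>)" "Z \<subseteq> U" using A(2)[of Z] B(2)[of Z] AB(3,4) by auto
    next
      fix v assume "v \<in> U"
      then obtain a b where ab: "a \<in> A" "b \<in> B" "v = a \<oplus>\<^bsub>V\<^esub> b" using ex by blast
      obtain ua where ua: "ua \<in> (\<Pi> Z\<in>\<A>. Z)" "a = finsum V ua \<A>" using A(3)[OF ab(1)] by blast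
      obtain ub where ub: "ub \<in> (\<Pi> Z\<in>\<B>. Z)" "b = finsum V ub \<B>" using B(3)[OF ab(2)] by blast
      define u where "u Z = (if Z \<in> \<A> then ua Z else ub Z)" for Z
      have uac: "ua \<in> \<A> \<rightarrow> carrier V" and ubc: "ub \<in> \<B> \<rightarrow> carrier V"
        by (rule Pi_subsetI[OF ua(1)], rule gsub_subset, use A(2) in blast)
          (rule Pi_subsetI[OF ub(1)], rule gsub_subset, use B(2) in blast)
      have u: "u \<in> (\<Pi> Z\<in>\<A>\<union>\<B>. Z)" using ua(1) ub(1) by (auto simp: u_def)
      have "finsum V u \<A> = a" unfolding ua(2)
        by (rule M.finsum_cong') (use uac in \<open>auto simp: u_def\<close>)
      moreover have "finsum V u \<B> = b" unfolding ub(2)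
        by (rule M.finsum_cong') (use ubc dis in \<open>auto simp: u_def\<close>)
      ultimately show "\<exists>u\<in>(\<Pi> Z\<in>\<A>\<union>\<B>. Z). v = finsum V u (\<A> \<union> \<B>)"
        using split[OF u] ab(3) u by (intro bexI[OF _ u]) simp
    next
      fix u Z assume u: "u \<in> (\<Pi> Z\<in>\<A>\<union>\<B>. Z)" and 0: "finsum V u (\<A> \<union> \<B>) = \<zero>\<^bsub>V\<^esub>" and Z: "Z \<in> \<A> \<union> \<B>"
      have "finsum V u \<A> \<oplus>\<^bsub>V\<^esub> finsum V u \<B> = \<zero>\<^bsub>V\<^esub> \<oplus>\<^bsub>V\<^esub> \<zero>\<^bsub>V\<^esub>"
        unfolding split[OF u, symmetric] 0 by simp
      note cancel = gsub_cancel[OF AB(1,2) z inA[OF u] gsub_zero[OF AB(1)] inB[OF u] gsub_zero[OF AB(2)] this]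
      have "finsum V u \<A> = \<zero>\<^bsub>V\<^esub>" "finsum V u \<B> = \<zero>\<^bsub>V\<^esub>"
        by (rule cancel(1); assumption) (rule cancel(2); assumption)
      moreover have "u \<in> (\<Pi> Z\<in>\<A>. Z)" "u \<in> (\<Pi> Z\<in>\<B>. Z)" using u by auto
      ultimately show "u Z = \<zero>\<^bsub>V\<^esub>" using Z A(4)[of u Z] B(4)[of u Z] by blast
    qed
    then show ?thesis by (rule exI)
  qed
qed

lemma indec_decomposition_exists:
  assumes "finite_length G R V"
  shows "\<exists>\<U>. indec_decomposition G R V \<U>"
proof -
  obtain \<mu> :: "'v set \<Rightarrow> nat" where \<mu>: "\<forall>U U'. gsubmodule G R V U \<longrightarrow> gsubmodule G R V U' \<longrightarrow> U \<subset> U' \<longrightarrow> \<mu> U < \<mu> U'"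
    using assms unfolding finite_length_def by (rule exE)
  obtain \<U> where fin: "finite \<U>"
    and sub: "\<forall>Z\<in>\<U>. gsubmodule G R V Z \<and> indecomposable G R (V\<lparr>carrier := Z\<rparr>) \<and> Z \<subseteq> carrier V"
    and ex: "\<forall>v\<in>carrier V. \<exists>u\<in>(\<Pi> Z\<in>\<U>. Z). v = finsum V u \<U>"
    and ind: "\<forall>u\<in>(\<Pi> Z\<in>\<U>. Z). finsum V u \<U> = \<zero>\<^bsub>V\<^esub> \<longrightarrow> (\<forall>Z\<in>\<U>. u Z = \<zero>\<^bsub>V\<^esub>)"
    using decomposition_of_submodules[OF \<mu> carrier_gsub]
    by (elim exE conjE) (rule that, assumption+)
  have subg: "\<And>Z. Z \<in> \<U> \<Longrightarrow> gsubmodule G R V Z" using sub by simp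
  have Pc: "u \<in> \<U> \<rightarrow> carrier V" if "u \<in> (\<Pi> Z\<in>\<U>. Z)" for u
    by (rule Pi_subsetI[OF that gsub_subset[OF subg]])
  have "\<exists>!u. u \<in> (\<Pi>\<^sub>E U\<in>\<U>. U) \<and> v = finsum V u \<U>" if v: "v \<in> carrier V" for v
  proof (rule ex_ex1I)
    obtain u where u: "u \<in> (\<Pi> Z\<in>\<U>. Z)" "v = finsum V u \<U>" using ex v by blast
    have "finsum V (restrict u \<U>) \<U> = finsum V u \<U>"
      by (rule M.finsum_cong') (use Pc[OF u(1)] in auto)
    then show "\<exists>u. u \<in> (\<Pi>\<^sub>E U\<in>\<U>. U) \<and> v = finsum V u \<U>"
      using u by (intro exI[of _ "restrict u \<U>"]) auto
  next
    fix u w assume u: "u \<in> (\<Pi>\<^sub>E U\<in>\<U>. U) \<and> v = finsum V u \<U>" and w: "w \<in> (\<Pi>\<^sub>E U\<in>\<U>. U) \<and> v = finsum V w \<U>"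
    define d where "d Z = u Z \<ominus>\<^bsub>V\<^esub> w Z" for Z
    have uP: "u \<in> (\<Pi> Z\<in>\<U>. Z)" and wP: "w \<in> (\<Pi> Z\<in>\<U>. Z)" using u w by (auto simp: PiE_def)
    have d: "d \<in> (\<Pi> Z\<in>\<U>. Z)" using uP wP gsub_diff[OF subg] by (auto simp: d_def Pi_iff)
    note c = Pc[OF uP] Pc[OF wP] Pc[OF d]
    have "finsum V u \<U> = finsum V (\<lambda>Z. d Z \<oplus>\<^bsub>V\<^esub> w Z) \<U>"
    proof (rule M.finsum_cong')
      show "(\<lambda>Z. d Z \<oplus>\<^bsub>V\<^esub> w Z) \<in> \<U> \<rightarrow> carrier V" using c by auto
      fix Z assume "Z \<in> \<U>"
      then have "u Z \<in> carrier V" "w Z \<in> carrier V" using c by auto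
      then show "u Z = d Z \<oplus>\<^bsub>V\<^esub> w Z" by (simp add: d_def M.minus_eq M.a_assoc M.l_neg)
    qed simp
    also have "\<dots> = finsum V d \<U> \<oplus>\<^bsub>V\<^esub> finsum V w \<U>" using c by (simp add: M.finsum_addf)
    finally have "finsum V d \<U> \<oplus>\<^bsub>V\<^esub> v = v" using u w by simp
    moreover have "finsum V d \<U> \<in> carrier V" using c(3) by (rule M.finsum_closed)
    ultimately have "finsum V d \<U> = \<zero>\<^bsub>V\<^esub>" using v by (metis M.add.r_cancel_one)
    then have d0: "\<forall>Z\<in>\<U>. d Z = \<zero>\<^bsub>V\<^esub>" using ind d by blast
    have "u Z = w Z" if Z: "Z \<in> \<U>" for Z
    proof -
      have "u Z \<in> carrier V" "w Z \<in> carrier V" using c Z by auto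
      moreover have "u Z \<ominus>\<^bsub>V\<^esub> w Z = \<zero>\<^bsub>V\<^esub>" using d0 Z by (simp add: d_def)
      ultimately show ?thesis by (metis M.add.inv_solve_right M.l_zero M.minus_eq M.zero_closed)
    qed
    then show "u = w" using u w by (meson PiE_ext)
  qed
  then have "indec_decomposition G R V \<U>" unfolding indec_decomposition_def using fin sub by simp
  then show ?thesis by (rule exI)
qed

text \<open>The components of a vector are linear and equivariant in the vector because they are unique.\<close>

lemma indec_decomposition_projections:
  assumes "indec_decomposition G R V \<U>"
  shows "\<exists>\<pi>. (\<forall>U\<in>\<U>. ghom G R V (V\<lparr>carrier := U\<rparr>) (\<pi> U))
    \<and> (\<forall>U\<in>\<U>. \<forall>U'\<in>\<U>. \<forall>u\<in>U'. \<pi> U u = (if U = U' then u else \<zero>\<^bsub>V\<^esub>))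
    \<and> (\<forall>v\<in>carrier V. v = finsum V (\<lambda>U. \<pi> U v) \<U>)"
proof -
  have fin: "finite \<U>" and sub: "\<And>U. U \<in> \<U> \<Longrightarrow> gsubmodule G R V U"
    and ex1: "\<And>v. v \<in> carrier V \<Longrightarrow> \<exists>!u. u \<in> (\<Pi>\<^sub>E U\<in>\<U>. U) \<and> v = finsum V u \<U>"
    using assms unfolding indec_decomposition_def by auto
  define c where "c v = (THE u. u \<in> (\<Pi>\<^sub>E U\<in>\<U>. U) \<and> v = finsum V u \<U>)" for v
  have c: "c v \<in> (\<Pi>\<^sub>E U\<in>\<U>. U) \<and> v = finsum V (c v) \<U>" if "v \<in> carrier V" for v
    unfolding c_def by (rule theI'[OF ex1[OF that]])
  have Pc: "u \<in> \<U> \<rightarrow> carrier V" if "u \<in> (\<Pi> Z\<in>\<U>. Z)" for u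
    by (rule Pi_subsetI[OF that gsub_subset[OF sub]])
  have uni: "c v U = u U" if "u \<in> (\<Pi> Z\<in>\<U>. Z)" "v = finsum V u \<U>" "U \<in> \<U>" for u v U
  proof -
    have v: "v \<in> carrier V" using that(2) M.finsum_closed[OF Pc[OF that(1)]] by simp
    have "finsum V (restrict u \<U>) \<U> = finsum V u \<U>"
      by (rule M.finsum_cong') (use Pc[OF that(1)] in auto)
    then have "restrict u \<U> \<in> (\<Pi>\<^sub>E U\<in>\<U>. U) \<and> v = finsum V (restrict u \<U>) \<U>" using that by auto
    then have "c v = restrict u \<U>" using ex1[OF v] c[OF v] by blast
    then show ?thesis using that by simp
  qed
  have cP: "c v \<in> (\<Pi> Z\<in>\<U>. Z)" if "v \<in> carrier V" for v using c[OF that] by (auto simp: PiE_def)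
  have cs: "v = finsum V (c v) \<U>" if "v \<in> carrier V" for v using c[OF that] by blast
  define \<pi> where "\<pi> U v = c v U" for U v
  show ?thesis
  proof (rule exI[of _ \<pi>], intro conjI ballI)
    fix U assume U: "U \<in> \<U>"
    show "ghom G R V (V\<lparr>carrier := U\<rparr>) (\<pi> U)"
    proof (rule ghomI)
      fix v assume v: "v \<in> carrier V"
      show "\<pi> U v \<in> carrier (V\<lparr>carrier := U\<rparr>)" using cP[OF v] U by (auto simp: \<pi>_def)
      show "\<pi> U (v \<oplus>\<^bsub>V\<^esub> w) = \<pi> U v \<oplus>\<^bsub>V\<lparr>carrier := U\<rparr>\<^esub> \<pi> U w" if w: "w \<in> carrier V" for w
      proof -
        have "c (v \<oplus>\<^bsub>V\<^esub> w) U = (\<lambda>Z. c v Z \<oplus>\<^bsub>V\<^esub> c w Z) U"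
        proof (rule uni[OF _ _ U])
          show "(\<lambda>Z. c v Z \<oplus>\<^bsub>V\<^esub> c w Z) \<in> (\<Pi> Z\<in>\<U>. Z)" using cP[OF v] cP[OF w] gsub_add[OF sub] by (auto simp: Pi_iff)
          show "v \<oplus>\<^bsub>V\<^esub> w = finsum V (\<lambda>Z. c v Z \<oplus>\<^bsub>V\<^esub> c w Z) \<U>"
            using cs[OF v] cs[OF w] M.finsum_addf[OF Pc[OF cP[OF v]] Pc[OF cP[OF w]]] by simp
        qed
        then show ?thesis by (simp add: \<pi>_def)
      qed
      show "\<pi> U (a \<odot>\<^bsub>V\<^esub> v) = a \<odot>\<^bsub>V\<lparr>carrier := U\<rparr>\<^esub> \<pi> U v" if a: "a \<in> carrier R" for a
      proof -
        have "c (a \<odot>\<^bsub>V\<^esub> v) U = (\<lambda>Z. a \<odot>\<^bsub>V\<^esub> c v Z) U"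
        proof (rule uni[OF _ _ U])
          show "(\<lambda>Z. a \<odot>\<^bsub>V\<^esub> c v Z) \<in> (\<Pi> Z\<in>\<U>. Z)" using cP[OF v] gsub_smult[OF sub] a by (auto simp: Pi_iff)
          show "a \<odot>\<^bsub>V\<^esub> v = finsum V (\<lambda>Z. a \<odot>\<^bsub>V\<^esub> c v Z) \<U>"
            using cs[OF v] finsum_smult_ldistr[OF fin a Pc[OF cP[OF v]]] by simp
        qed
        then show ?thesis by (simp add: \<pi>_def)
      qed
      show "\<pi> U (act V g v) = act (V\<lparr>carrier := U\<rparr>) g (\<pi> U v)" if g: "g \<in> carrier G" for g
      proof -
        have "c (act V g v) U = (\<lambda>Z. act V g (c v Z)) U"
        proof (rule uni[OF _ _ U])
          show "(\<lambda>Z. act V g (c v Z)) \<in> (\<Pi> Z\<in>\<U>. Z)" using cP[OF v] gsub_act[OF sub] g by (auto simp: Pi_iff)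
          show "act V g v = finsum V (\<lambda>Z. act V g (c v Z)) \<U>"
            using cs[OF v] act_finsum[OF fin Pc[OF cP[OF v]] g] by simp
        qed
        then show ?thesis by (simp add: \<pi>_def)
      qed
    qed
  next
    fix U U' u assume UU: "U \<in> \<U>" "U' \<in> \<U>" "u \<in> U'"
    have u: "u \<in> carrier V" using gsub_carrier[OF sub[OF UU(2)] UU(3)] .
    have "c u U = (\<lambda>Z. if U' = Z then u else \<zero>\<^bsub>V\<^esub>) U"
    proof (rule uni[OF _ _ UU(1)])
      show "(\<lambda>Z. if U' = Z then u else \<zero>\<^bsub>V\<^esub>) \<in> (\<Pi> Z\<in>\<U>. Z)" using UU gsub_zero[OF sub] by (auto simp: Pi_iff)
      show "u = finsum V (\<lambda>Z. if U' = Z then u else \<zero>\<^bsub>V\<^esub>) \<U>"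
        using M.finsum_singleton[OF UU(2) fin, of "\<lambda>_. u"] u by simp
    qed
    then show "\<pi> U u = (if U = U' then u else \<zero>\<^bsub>V\<^esub>)" by (simp add: \<pi>_def)
  next
    fix v assume "v \<in> carrier V"
    then show "v = finsum V (\<lambda>U. \<pi> U v) \<U>" using cs unfolding \<pi>_def by simp
  qed
qed

end

section \<open>Multiplicities as ranks of pairings\<close>

text \<open>Induction on the number of equations: an equation with a nonzero coefficient eliminates one unknown.\<close>

lemma (in field) underdetermined_system:
  assumes "finite B" "finite A" "card B < card A" "\<And>b a. b \<in> B \<Longrightarrow> a \<in> A \<Longrightarrow> Y b a \<in> carrier R"
  shows "\<exists>z. z \<in> A \<rightarrow> carrier R \<and> (\<exists>a\<in>A. z a \<noteq> \<zero>) \<and> (\<forall>b\<in>B. (\<Oplus>a\<in>A. Y b a \<otimes> z a) = \<zero>)"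
  using assms
proof (induction B arbitrary: A Y rule: finite_induct)
  case empty
  then obtain a where "a \<in> A" by fastforce
  then show ?case by (intro exI[of _ "\<lambda>_. \<one>"]) auto
next
  case (insert b B)
  show ?case
  proof (cases "\<forall>a\<in>A. Y b a = \<zero>")
    case True
    have "\<exists>z. z \<in> A \<rightarrow> carrier R \<and> (\<exists>a\<in>A. z a \<noteq> \<zero>) \<and> (\<forall>b\<in>B. (\<Oplus>a\<in>A. Y b a \<otimes> z a) = \<zero>)"
      using insert.prems insert.hyps by (intro insert.IH) auto
    then obtain z where z: "z \<in> A \<rightarrow> carrier R" "\<exists>a\<in>A. z a \<noteq> \<zero>" "\<forall>b\<in>B. (\<Oplus>a\<in>A. Y b a \<otimes> z a) = \<zero>" by auto
    have "(\<Oplus>a\<in>A. Y b a \<otimes> z a) = (\<Oplus>a\<in>A. \<zero>)"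
      by (rule finsum_cong') (use True z(1) in \<open>auto simp: Pi_iff\<close>)
    then have "\<forall>b'\<in>insert b B. (\<Oplus>a\<in>A. Y b' a \<otimes> z a) = \<zero>" using z(3) by simp
    then show ?thesis using z(1,2) by (intro exI[of _ z]) simp
  next
    case False
    then obtain a0 where a0: "a0 \<in> A" "Y b a0 \<noteq> \<zero>" by auto
    define A' where "A' = A - {a0}"
    have A: "A = insert a0 A'" "a0 \<notin> A'" "finite A'" using a0 insert.prems by (auto simp: A'_def)
    have Yc: "Y b' a \<in> carrier R" if "b' \<in> insert b B" "a \<in> A" for b' a using insert.prems(3) that by simp
    define q where "q = inv (Y b a0)"
    have q: "q \<in> carrier R" "q \<otimes> Y b a0 = \<one>"
      using a0 Yc[of b a0] by (auto simp: q_def field_Units)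
    define Y' where "Y' b' a = Y b' a \<ominus> (Y b' a0 \<otimes> q) \<otimes> Y b a" for b' a
    have cA': "card B < card A'" using insert.prems insert.hyps A by simp
    have "\<exists>z. z \<in> A' \<rightarrow> carrier R \<and> (\<exists>a\<in>A'. z a \<noteq> \<zero>) \<and> (\<forall>b\<in>B. (\<Oplus>a\<in>A'. Y' b a \<otimes> z a) = \<zero>)"
      by (rule insert.IH[OF A(3) cA']) (use Yc a0 q A(1) in \<open>simp add: Y'_def\<close>)
    then obtain z where z: "z \<in> A' \<rightarrow> carrier R" "\<exists>a\<in>A'. z a \<noteq> \<zero>" "\<forall>b\<in>B. (\<Oplus>a\<in>A'. Y' b a \<otimes> z a) = \<zero>" by auto
    define t where "t b' = (\<Oplus>a\<in>A'. Y b' a \<otimes> z a)" for b'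
    have tP: "(\<lambda>a. Y b' a \<otimes> z a) \<in> A' \<rightarrow> carrier R" if "b' \<in> insert b B" for b'
      using z(1) Yc[OF that] A(1) by (auto simp: Pi_iff)
    have tc: "t b' \<in> carrier R" if "b' \<in> insert b B" for b' unfolding t_def by (rule finsum_closed[OF tP[OF that]])
    define w where "w a = (if a = a0 then \<ominus> (q \<otimes> t b) else z a)" for a
    have sum: "(\<Oplus>a\<in>A. Y b' a \<otimes> w a) = \<ominus> (Y b' a0 \<otimes> (q \<otimes> t b)) \<oplus> t b'" if b': "b' \<in> insert b B" for b'
    proof -
      have "(\<Oplus>a\<in>A'. Y b' a \<otimes> w a) = t b'" unfolding t_def
        by (rule finsum_cong') (use tP[OF b'] A(2) in \<open>auto simp: w_def\<close>)
      moreover have "(\<Oplus>a\<in>A. Y b' a \<otimes> w a) = Y b' a0 \<otimes> w a0 \<oplus> (\<Oplus>a\<in>A'. Y b' a \<otimes> w a)"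
        unfolding A(1)
      proof (rule finsum_insert[OF A(3,2)])
        show "(\<lambda>a. Y b' a \<otimes> w a) \<in> A' \<rightarrow> carrier R"
          using tP[OF b'] A(2) by (auto simp: w_def Pi_iff)
        show "Y b' a0 \<otimes> w a0 \<in> carrier R" using Yc[OF b' a0(1)] q tc[of b] by (simp add: w_def)
      qed
      moreover have "Y b' a0 \<otimes> w a0 = \<ominus> (Y b' a0 \<otimes> (q \<otimes> t b))"
        using Yc[OF b' a0(1)] q tc[of b] by (simp add: w_def r_minus)
      ultimately show ?thesis by simp
    qed
    have "(\<Oplus>a\<in>A. Y b' a \<otimes> w a) = \<zero>" if b': "b' \<in> insert b B" for b'
    proof (cases "b' = b")
      case True
      have "Y b a0 \<otimes> (q \<otimes> t b) = t b"
        using q Yc[of b a0] a0 tc[of b] by (metis insertI1 l_one m_assoc m_comm)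
      then show ?thesis using sum[OF b'] True tc[of b] by (simp add: l_neg)
    next
      case False
      then have bB: "b' \<in> B" using b' by simp
      let ?c = "Y b' a0 \<otimes> q"
      have c: "?c \<in> carrier R" using q Yc[OF b' a0(1)] by simp
      have "\<zero> = (\<Oplus>a\<in>A'. Y' b' a \<otimes> z a)" using z(3) bB by simp
      also have "\<dots> = (\<Oplus>a\<in>A'. Y b' a \<otimes> z a \<oplus> (\<ominus> ?c) \<otimes> (Y b a \<otimes> z a))"
      proof (rule finsum_cong')
        show "(\<lambda>a. Y b' a \<otimes> z a \<oplus> (\<ominus> ?c) \<otimes> (Y b a \<otimes> z a)) \<in> A' \<rightarrow> carrier R"
          using tP[OF b'] tP[of b] c by (auto simp: Pi_iff)
        fix a assume a: "a \<in> A'"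
        have "Y b' a \<in> carrier R" "Y b a \<in> carrier R" "z a \<in> carrier R"
          using Yc[OF b'] Yc[of b] z(1) a A(1) by auto
        then show "Y' b' a \<otimes> z a = Y b' a \<otimes> z a \<oplus> (\<ominus> ?c) \<otimes> (Y b a \<otimes> z a)"
          using c unfolding Y'_def minus_eq by (simp add: l_distr l_minus m_assoc)
      qed simp
      also have "\<dots> = t b' \<oplus> (\<Oplus>a\<in>A'. (\<ominus> ?c) \<otimes> (Y b a \<otimes> z a))"
        unfolding t_def using tP[OF b'] tP[of b] c by (intro finsum_addf) (auto simp: Pi_iff)
      also have "(\<Oplus>a\<in>A'. (\<ominus> ?c) \<otimes> (Y b a \<otimes> z a)) = (\<ominus> ?c) \<otimes> t b"
        unfolding t_def using tP[of b] c A(3) by (intro finsum_rdistr[symmetric]) auto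
      finally have "\<zero> = t b' \<oplus> (\<ominus> ?c) \<otimes> t b" .
      moreover have "(\<ominus> ?c) \<otimes> t b = \<ominus> (Y b' a0 \<otimes> (q \<otimes> t b))"
        using Yc[OF b' a0(1)] q tc[of b] by (simp add: l_minus m_assoc)
      moreover have "Y b' a0 \<otimes> (q \<otimes> t b) \<in> carrier R" using Yc[OF b' a0(1)] q tc[of b] by simp
      ultimately show ?thesis using sum[OF b'] tc[OF b'] by (simp add: a_comm)
    qed
    moreover have "w \<in> A \<rightarrow> carrier R" using z(1) q tc[of b] A(1) by (auto simp: w_def Pi_iff)
    moreover have "\<exists>a\<in>A. w a \<noteq> \<zero>" using z(2) A by (auto simp: w_def)
    ultimately show ?thesis by (intro exI[of _ w]) simp
  qed
qed

text \<open>The pairing between the vectors \<open>T\<close> and the forms \<open>L\<close> has rank \<open>card I\<close>: the families \<open>t\<close> and \<open>l\<close> are dual to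
each other, and every value of the pairing is recovered from its values on them. Neither \<open>T\<close> nor \<open>L\<close> has to
be known to be a subspace.\<close>

definition dual_system ::
    "('f, 'b) ring_scheme \<Rightarrow> 't set \<Rightarrow> ('t \<Rightarrow> 'f) set \<Rightarrow> 'i set \<Rightarrow> ('i \<Rightarrow> 't) \<Rightarrow> ('i \<Rightarrow> 't \<Rightarrow> 'f) \<Rightarrow> bool"
  where
  "dual_system R T L I t l \<longleftrightarrow> finite I \<and> (\<forall>i\<in>I. t i \<in> T \<and> l i \<in> L) \<and> (\<forall>x\<in>T. \<forall>k\<in>L. k x \<in> carrier R)
     \<and> (\<forall>i\<in>I. \<forall>j\<in>I. l i (t j) = (if i = j then \<one>\<^bsub>R\<^esub> else \<zero>\<^bsub>R\<^esub>))
     \<and> (\<forall>x\<in>T. \<forall>k\<in>L. k x = (\<Oplus>\<^bsub>R\<^esub>i\<in>I. k (t i) \<otimes>\<^bsub>R\<^esub> l i x))"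

lemma
  assumes "dual_system R T L I t l"
  shows dual_finite: "finite I"
    and dual_vector: "i \<in> I \<Longrightarrow> t i \<in> T"
    and dual_form: "i \<in> I \<Longrightarrow> l i \<in> L"
    and dual_closed: "x \<in> T \<Longrightarrow> k \<in> L \<Longrightarrow> k x \<in> carrier R"
    and dual_delta: "i \<in> I \<Longrightarrow> j \<in> I \<Longrightarrow> l i (t j) = (if i = j then \<one>\<^bsub>R\<^esub> else \<zero>\<^bsub>R\<^esub>)"
    and dual_expand: "x \<in> T \<Longrightarrow> k \<in> L \<Longrightarrow> k x = (\<Oplus>\<^bsub>R\<^esub>i\<in>I. k (t i) \<otimes>\<^bsub>R\<^esub> l i x)"
  using assms unfolding dual_system_def by auto

lemma (in abelian_monoid) finsum_swap:
  assumes "finite A" "finite B" "\<And>a b. a \<in> A \<Longrightarrow> b \<in> B \<Longrightarrow> f a b \<in> carrier G"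
  shows "(\<Oplus>a\<in>A. \<Oplus>b\<in>B. f a b) = (\<Oplus>b\<in>B. \<Oplus>a\<in>A. f a b)"
  using assms(1,3)
proof (induction A)
  case (insert a A)
  have 1: "(\<lambda>b. f a b) \<in> B \<rightarrow> carrier G" "(\<lambda>b. \<Oplus>a\<in>A. f a b) \<in> B \<rightarrow> carrier G"
    using insert.prems by (auto intro!: finsum_closed)
  have "(\<Oplus>b\<in>B. \<Oplus>a\<in>insert a A. f a b) = (\<Oplus>b\<in>B. f a b \<oplus> (\<Oplus>a\<in>A. f a b))"
  proof (rule finsum_cong')
    fix b assume b: "b \<in> B"
    show "(\<Oplus>a\<in>insert a A. f a b) = f a b \<oplus> (\<Oplus>a\<in>A. f a b)"
      using insert.hyps insert.prems b by (intro finsum_insert) auto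
  qed (use 1 in auto)
  also have "\<dots> = (\<Oplus>b\<in>B. f a b) \<oplus> (\<Oplus>b\<in>B. \<Oplus>a\<in>A. f a b)"
    using 1 by (rule finsum_addf)
  also have "(\<Oplus>b\<in>B. \<Oplus>a\<in>A. f a b) = (\<Oplus>a\<in>A. \<Oplus>b\<in>B. f a b)"
    using insert by simp
  also have "(\<Oplus>b\<in>B. f a b) \<oplus> \<dots> = (\<Oplus>a\<in>insert a A. \<Oplus>b\<in>B. f a b)"
    using insert.hyps insert.prems by (intro finsum_insert[symmetric]) (auto intro!: finsum_closed)
  finally show ?case by simp
qed simp

text \<open>The values of the forms of each system on the vectors of the other one are matrices \<open>A\<close> (of size
\<open>I \<times> J\<close>) and \<open>B\<close> (of size \<open>J \<times> I\<close>) with \<open>A B = 1\<close>. If \<open>J\<close> had fewer elements than \<open>I\<close>, then \<open>B\<close> would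
annihilate a nonzero vector.\<close>

lemma dual_system_card_le:
  assumes "field R" "dual_system R T L I t l" "dual_system R T L J t' l'"
  shows "card I \<le> card J"
proof (rule ccontr)
  assume "\<not> card I \<le> card J"
  then have lt: "card J < card I" by simp
  interpret field R by fact
  note D = assms(2) and E = assms(3)
  have cl: "l i (t' j) \<in> carrier R" "l' j (t i) \<in> carrier R" "l i (t k) \<in> carrier R"
    if "i \<in> I" "j \<in> J" "k \<in> I" for i j k
    using that dual_closed[OF D] dual_vector[OF D] dual_vector[OF E] dual_form[OF D] dual_form[OF E] by auto
  obtain z where z: "z \<in> I \<rightarrow> carrier R" "\<exists>a\<in>I. z a \<noteq> \<zero>\<^bsub>R\<^esub>"
      "\<forall>b\<in>J. (\<Oplus>\<^bsub>R\<^esub>a\<in>I. l' b (t a) \<otimes>\<^bsub>R\<^esub> z a) = \<zero>\<^bsub>R\<^esub>"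
    using underdetermined_system[OF dual_finite[OF E] dual_finite[OF D] lt, of "\<lambda>j i. l' j (t i)"] cl(2) by auto
  have zc: "z k \<in> carrier R" if "k \<in> I" for k using z(1) that by auto
  have "z i = \<zero>\<^bsub>R\<^esub>" if i: "i \<in> I" for i
  proof -
    have "z i = (\<Oplus>\<^bsub>R\<^esub>k\<in>I. if i = k then z k else \<zero>\<^bsub>R\<^esub>)"
      by (rule finsum_singleton[OF i dual_finite[OF D] z(1), symmetric])
    also have "\<dots> = (\<Oplus>\<^bsub>R\<^esub>k\<in>I. \<Oplus>\<^bsub>R\<^esub>j\<in>J. l i (t' j) \<otimes>\<^bsub>R\<^esub> (l' j (t k) \<otimes>\<^bsub>R\<^esub> z k))"
    proof (rule finsum_cong')
      show "(\<lambda>k. \<Oplus>\<^bsub>R\<^esub>j\<in>J. l i (t' j) \<otimes>\<^bsub>R\<^esub> (l' j (t k) \<otimes>\<^bsub>R\<^esub> z k)) \<in> I \<rightarrow> carrier R"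
        using i cl zc by (intro Pi_I finsum_closed) auto
      fix k assume k: "k \<in> I"
      have "(if i = k then z k else \<zero>\<^bsub>R\<^esub>) = l i (t k) \<otimes>\<^bsub>R\<^esub> z k"
        using dual_delta[OF D i k] zc[OF k] by simp
      also have "l i (t k) = (\<Oplus>\<^bsub>R\<^esub>j\<in>J. l i (t' j) \<otimes>\<^bsub>R\<^esub> l' j (t k))"
        by (rule dual_expand[OF E dual_vector[OF D k] dual_form[OF D i]])
      also have "\<dots> \<otimes>\<^bsub>R\<^esub> z k = (\<Oplus>\<^bsub>R\<^esub>j\<in>J. (l i (t' j) \<otimes>\<^bsub>R\<^esub> l' j (t k)) \<otimes>\<^bsub>R\<^esub> z k)"
        using i k cl zc[OF k] dual_finite[OF E] by (intro finsum_ldistr) auto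
      also have "\<dots> = (\<Oplus>\<^bsub>R\<^esub>j\<in>J. l i (t' j) \<otimes>\<^bsub>R\<^esub> (l' j (t k) \<otimes>\<^bsub>R\<^esub> z k))"
        using i k cl zc[OF k] by (intro finsum_cong') (auto simp: m_assoc)
      finally show "(if i = k then z k else \<zero>\<^bsub>R\<^esub>) = \<dots>" .
    qed simp
    also have "\<dots> = (\<Oplus>\<^bsub>R\<^esub>j\<in>J. \<Oplus>\<^bsub>R\<^esub>k\<in>I. l i (t' j) \<otimes>\<^bsub>R\<^esub> (l' j (t k) \<otimes>\<^bsub>R\<^esub> z k))"
      using i cl zc dual_finite[OF D] dual_finite[OF E] by (intro finsum_swap) auto
    also have "\<dots> = (\<Oplus>\<^bsub>R\<^esub>j\<in>J. \<zero>\<^bsub>R\<^esub>)"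
    proof (rule finsum_cong')
      fix j assume j: "j \<in> J"
      have "(\<Oplus>\<^bsub>R\<^esub>k\<in>I. l i (t' j) \<otimes>\<^bsub>R\<^esub> (l' j (t k) \<otimes>\<^bsub>R\<^esub> z k))
          = l i (t' j) \<otimes>\<^bsub>R\<^esub> (\<Oplus>\<^bsub>R\<^esub>k\<in>I. l' j (t k) \<otimes>\<^bsub>R\<^esub> z k)"
        using i j cl zc dual_finite[OF D] by (intro finsum_rdistr[symmetric]) auto
      then show "(\<Oplus>\<^bsub>R\<^esub>k\<in>I. l i (t' j) \<otimes>\<^bsub>R\<^esub> (l' j (t k) \<otimes>\<^bsub>R\<^esub> z k)) = \<zero>\<^bsub>R\<^esub>"
        using z(3) j cl(1)[OF i j i] by simp
    qed auto
    finally show ?thesis by simp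
  qed
  then show False using z(2) by blast
qed

lemma dual_system_card:
  assumes "field R" "dual_system R T L I t l" "dual_system R T L J t' l'"
  shows "card I = card J"
  using dual_system_card_le[OF assms] dual_system_card_le[OF assms(1,3,2)] by simp

lemma dual_system_pairing_nonzero:
  assumes "field R" "dual_system R T L I t l"
  shows "I \<noteq> {} \<longleftrightarrow> (\<exists>x\<in>T. \<exists>k\<in>L. k x \<noteq> \<zero>\<^bsub>R\<^esub>)"
proof -
  interpret field R by fact
  note D = assms(2)
  show ?thesis
  proof
    assume "I \<noteq> {}"
    then obtain i where "i \<in> I" by blast
    then show "\<exists>x\<in>T. \<exists>k\<in>L. k x \<noteq> \<zero>\<^bsub>R\<^esub>"
      using dual_delta[OF D, of i i] dual_vector[OF D, of i] dual_form[OF D, of i] by force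
  next
    assume "\<exists>x\<in>T. \<exists>k\<in>L. k x \<noteq> \<zero>\<^bsub>R\<^esub>"
    then obtain x k where xk: "x \<in> T" "k \<in> L" "k x \<noteq> \<zero>\<^bsub>R\<^esub>" by blast
    show "I \<noteq> {}"
    proof
      assume "I = {}"
      with dual_expand[OF D xk(1,2)] xk(3) show False by simp
    qed
  qed
qed

section \<open>Multiplicities of a summand detected by a fixed vector\<close>

text \<open>These are the properties of a Scott module \<open>S\<close> inside the permutation module \<open>C\<close> on cosets that
determine its multiplicities. There \<open>\<Sigma>\<close> is the sum of the basis, and \<open>ev\<close> is the coefficient of a coset.\<close>

locale fixed_vector_summand = rep G R C + F: field R
  for G :: "('g, 'a) monoid_scheme" (structure) and R :: "('f, 'b) ring_scheme" (structure)
    and C :: "('f, 'c, 'g) gmod" (structure) +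
  fixes \<Sigma> :: 'c and ev :: "'c \<Rightarrow> 'f" and S W :: "'c set"
  assumes \<Sigma>_carrier: "\<Sigma> \<in> carrier C"
    and \<Sigma>_fixed: "g \<in> carrier G \<Longrightarrow> act C g \<Sigma> = \<Sigma>"
    and ev_closed: "v \<in> carrier C \<Longrightarrow> ev v \<in> carrier R"
    and ev_add: "v \<in> carrier C \<Longrightarrow> w \<in> carrier C \<Longrightarrow> ev (v \<oplus>\<^bsub>C\<^esub> w) = ev v \<oplus>\<^bsub>R\<^esub> ev w"
    and ev_smult: "a \<in> carrier R \<Longrightarrow> v \<in> carrier C \<Longrightarrow> ev (a \<odot>\<^bsub>C\<^esub> v) = a \<otimes>\<^bsub>R\<^esub> ev v"
    and ev_\<Sigma>: "ev \<Sigma> = \<one>\<^bsub>R\<^esub>"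
    and fixed_multiple: "v \<in> carrier C \<Longrightarrow> (\<And>g. g \<in> carrier G \<Longrightarrow> act C g v = v) \<Longrightarrow> v = ev v \<odot>\<^bsub>C\<^esub> \<Sigma>"
    and sum: "direct_sum2 G R C S W"
    and indec: "indecomposable G R (C\<lparr>carrier := S\<rparr>)"
    and fin_len: "finite_length G R C"
    and \<Sigma>_S: "\<Sigma> \<in> S"
begin

abbreviation "N \<equiv> C\<lparr>carrier := S\<rparr>"

definition vectors :: "('f, 'v, 'g) gmod \<Rightarrow> 'v set" where
  "vectors V = {f \<Sigma> | f. ghom G R C V f}"

definition forms :: "('f, 'v, 'g) gmod \<Rightarrow> ('v \<Rightarrow> 'f) set" where
  "forms V = {(\<lambda>v. ev (h v)) | h. ghom G R V C h}"

lemma S_sub: "gsubmodule G R C S" using sum unfolding direct_sum2_iff by simp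

lemma N_rep: "rep G R N" by (rule gsub_rep[OF S_sub])

lemma C_rep: "rep G R C" by (rule rep_axioms)

lemma fixed_image:
  assumes "rep G R V" "ghom G R C V f" "ghom G R V C h"
  shows "h (f \<Sigma>) = ev (h (f \<Sigma>)) \<odot>\<^bsub>C\<^esub> \<Sigma>"
proof (rule fixed_multiple)
  have f: "f \<Sigma> \<in> carrier V" by (rule ghom_closed[OF assms(2) \<Sigma>_carrier])
  show "h (f \<Sigma>) \<in> carrier C" by (rule ghom_closed[OF assms(3) f])
  fix g assume g: "g \<in> carrier G"
  have "act V g (f \<Sigma>) = f \<Sigma>" using ghom_act[OF assms(2) g \<Sigma>_carrier] \<Sigma>_fixed[OF g] by simp
  then show "act C g (h (f \<Sigma>)) = h (f \<Sigma>)" using ghom_act[OF assms(3) g f] by simp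
qed

text \<open>The endomorphism \<open>h' \<circ> f\<close> of \<open>S\<close> multiplies \<open>\<Sigma>\<close> by a nonzero scalar, so it is not nilpotent, and Fitting's
lemma turns it into an automorphism.\<close>

lemma nonzero_pairing_splits:
  assumes V: "rep G R V" and f: "ghom G R C V f" and h: "ghom G R V C h"
    and nz: "ev (h (f \<Sigma>)) \<noteq> \<zero>\<^bsub>R\<^esub>"
  shows "\<exists>h'. ghom G R N V f \<and> ghom G R V N h' \<and> bij_betw (h' \<circ> f) S S"
proof -
  obtain e where e: "ghom G R C N e" "\<And>u. u \<in> S \<Longrightarrow> e u = u"
    by (rule direct_sum2_projection[OF sum]) (rule that, assumption, blast)
  have fN: "ghom G R N V f" using f gsub_carrier[OF S_sub] by (auto simp: ghom_def)
  have h': "ghom G R V N (e \<circ> h)" by (rule ghom_comp[OF h e(1)])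
  define k where "k = (e \<circ> h) \<circ> f"
  define a where "a = ev (h (f \<Sigma>))"
  have k: "ghom G R N N k" unfolding k_def by (rule ghom_comp[OF fN h'])
  have a: "a \<in> carrier R" "a \<noteq> \<zero>\<^bsub>R\<^esub>"
    using nz ev_closed ghom_closed[OF h ghom_closed[OF f \<Sigma>_carrier]] by (auto simp: a_def)
  have aS: "a \<odot>\<^bsub>C\<^esub> \<Sigma> \<in> S" by (rule gsub_smult[OF S_sub a(1) \<Sigma>_S])
  have k\<Sigma>: "k \<Sigma> = a \<odot>\<^bsub>C\<^esub> \<Sigma>"
  proof -
    have "k \<Sigma> = e (h (f \<Sigma>))" by (simp add: k_def)
    also have "h (f \<Sigma>) = a \<odot>\<^bsub>C\<^esub> \<Sigma>" unfolding a_def by (rule fixed_image[OF V f h])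
    finally show ?thesis using e(2)[OF aS] by simp
  qed
  have kn: "(k ^^ n) \<Sigma> = (a [^]\<^bsub>R\<^esub> n) \<odot>\<^bsub>C\<^esub> \<Sigma>" for n
  proof (induction n)
    case 0
    then show ?case using \<Sigma>_carrier by simp
  next
    case (Suc n)
    have "(k ^^ Suc n) \<Sigma> = k ((a [^]\<^bsub>R\<^esub> n) \<odot>\<^bsub>C\<^esub> \<Sigma>)" using Suc by simp
    also have "\<dots> = (a [^]\<^bsub>R\<^esub> n) \<odot>\<^bsub>C\<^esub> (a \<odot>\<^bsub>C\<^esub> \<Sigma>)"
      using ghom_smult[OF k, of "a [^]\<^bsub>R\<^esub> n" \<Sigma>] a \<Sigma>_S k\<Sigma> by simp
    also have "\<dots> = (a [^]\<^bsub>R\<^esub> Suc n) \<odot>\<^bsub>C\<^esub> \<Sigma>"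
      using a \<Sigma>_carrier by (simp add: smult_assoc1)
    finally show ?case .
  qed
  have "bij_betw k (carrier N) (carrier N)"
  proof (rule fitting[OF N_rep finite_length_sub[OF C_rep S_sub fin_len] indec k])
    fix n :: nat
    have pc: "a [^]\<^bsub>R\<^esub> m \<in> carrier R" for m :: nat using a by simp
    have "a [^]\<^bsub>R\<^esub> n \<noteq> \<zero>\<^bsub>R\<^esub>"
    proof (induction n)
      case (Suc n)
      then show ?case using F.integral[of "a [^]\<^bsub>R\<^esub> n" a] a pc[of n] by auto
    qed simp
    with pc have pw: "a [^]\<^bsub>R\<^esub> n \<in> carrier R" "a [^]\<^bsub>R\<^esub> n \<noteq> \<zero>\<^bsub>R\<^esub>" by blast+
    have "ev ((k ^^ n) \<Sigma>) = a [^]\<^bsub>R\<^esub> n" unfolding kn using pw \<Sigma>_carrier by (simp add: ev_smult ev_\<Sigma>)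
    moreover have "ev \<zero>\<^bsub>C\<^esub> = \<zero>\<^bsub>R\<^esub>"
      using ev_smult[of "\<zero>\<^bsub>R\<^esub>" \<Sigma>] \<Sigma>_carrier ev_closed[OF \<Sigma>_carrier] by simp
    ultimately have "(k ^^ n) \<Sigma> \<noteq> \<zero>\<^bsub>C\<^esub>" using pw by auto
    then show "\<exists>v\<in>carrier N. (k ^^ n) v \<noteq> \<zero>\<^bsub>N\<^esub>" using \<Sigma>_S by auto
  qed
  then show ?thesis using fN h' by (auto simp: k_def intro!: exI[of _ "e \<circ> h"])
qed

lemma summand_iff_pairing:
  assumes V: "rep G R V"
  shows "is_summand G R N V \<longleftrightarrow> (\<exists>t\<in>vectors V. \<exists>l\<in>forms V. l t \<noteq> \<zero>\<^bsub>R\<^esub>)"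
proof
  interpret V: rep G R V by fact
  assume "is_summand G R N V"
  then obtain U W' where d: "direct_sum2 G R V U W'" and iso: "gmod_iso G R (V\<lparr>carrier := U\<rparr>) N"
    unfolding is_summand_def by blast
  then have U: "gsubmodule G R V U" unfolding V.direct_sum2_iff by simp
  obtain h where h: "ghom G R (V\<lparr>carrier := U\<rparr>) N h" "bij_betw h U S"
    using iso unfolding gmod_iso_ghom by auto
  let ?k = "inv_into U h"
  have k: "ghom G R N (V\<lparr>carrier := U\<rparr>) ?k"
    using ghom_inv[OF V.gsub_rep[OF U] h(1)] h(2) by simp
  obtain e where e: "ghom G R C N e" "\<And>u. u \<in> S \<Longrightarrow> e u = u"
    by (rule direct_sum2_projection[OF sum]) (rule that, assumption, blast)
  obtain \<pi> where \<pi>: "ghom G R V (V\<lparr>carrier := U\<rparr>) \<pi>" "\<And>u. u \<in> U \<Longrightarrow> \<pi> u = u"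
    by (rule V.direct_sum2_projection[OF d]) (rule that, assumption, blast)
  have f: "ghom G R C V (?k \<circ> e)"
    using ghom_comp[OF ghom_comp[OF e(1) k] V.ghom_act_self[OF V.gsub_subset[OF U]]] by (simp add: comp_def)
  have g: "ghom G R V C (h \<circ> \<pi>)"
    using ghom_comp[OF ghom_comp[OF \<pi>(1) h(1)] ghom_act_self[OF gsub_subset[OF S_sub]]] by (simp add: comp_def)
  have "?k \<Sigma> \<in> U" "h (?k \<Sigma>) = \<Sigma>"
    using h(2) \<Sigma>_S by (auto simp: bij_betw_def intro: inv_into_into f_inv_into_f)
  then have "ev ((h \<circ> \<pi>) ((?k \<circ> e) \<Sigma>)) = \<one>\<^bsub>R\<^esub>" using e(2)[OF \<Sigma>_S] \<pi>(2) ev_\<Sigma> by simp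
  moreover have "(?k \<circ> e) \<Sigma> \<in> vectors V" unfolding vectors_def using f by blast
  moreover have "(\<lambda>v. ev ((h \<circ> \<pi>) v)) \<in> forms V" unfolding forms_def using g by blast
  ultimately show "\<exists>t\<in>vectors V. \<exists>l\<in>forms V. l t \<noteq> \<zero>\<^bsub>R\<^esub>"
    by (intro bexI) auto
next
  assume "\<exists>t\<in>vectors V. \<exists>l\<in>forms V. l t \<noteq> \<zero>\<^bsub>R\<^esub>"
  then obtain f h where fh: "ghom G R C V f" "ghom G R V C h" "ev (h (f \<Sigma>)) \<noteq> \<zero>\<^bsub>R\<^esub>"
    unfolding vectors_def forms_def by auto
  from nonzero_pairing_splits[OF V this] obtain h' where "ghom G R N V f" "ghom G R V N h'"
    "bij_betw (h' \<circ> f) (carrier N) (carrier N)" by auto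
  from splitting[OF V N_rep this] show "is_summand G R N V" unfolding is_summand_def by blast
qed

text \<open>The vector \<open>t U\<close> is the copy of \<open>\<Sigma>\<close> in the constituent \<open>U\<close>, and the form \<open>l U\<close> reads off its coefficient. A
constituent that is not isomorphic to \<open>N\<close> contributes nothing to the pairing, since a nonzero
contribution would make \<open>N\<close> a direct summand of it.\<close>

lemma decomposition_dual_system:
  fixes V :: "('f, 'v, 'g) gmod"
  assumes V: "rep G R V" and dec: "indec_decomposition G R V \<U>"
  shows "\<exists>t l. dual_system R (vectors V) (forms V) {U \<in> \<U>. gmod_iso G R (V\<lparr>carrier := U\<rparr>) N} t l"
proof -
  interpret V: rep G R V by fact
  define I where "I = {U \<in> \<U>. gmod_iso G R (V\<lparr>carrier := U\<rparr>) N}"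
  have fin: "finite \<U>" and sub: "\<And>U. U \<in> \<U> \<Longrightarrow> gsubmodule G R V U"
    and ind: "\<And>U. U \<in> \<U> \<Longrightarrow> indecomposable G R (V\<lparr>carrier := U\<rparr>)"
    using dec unfolding indec_decomposition_def by auto
  obtain \<pi> where P: "(\<forall>U\<in>\<U>. ghom G R V (V\<lparr>carrier := U\<rparr>) (\<pi> U))
    \<and> (\<forall>U\<in>\<U>. \<forall>U'\<in>\<U>. \<forall>u\<in>U'. \<pi> U u = (if U = U' then u else \<zero>\<^bsub>V\<^esub>))
    \<and> (\<forall>v\<in>carrier V. v = finsum V (\<lambda>U. \<pi> U v) \<U>)"
    using V.indec_decomposition_projections[OF dec] by (rule exE)
  note \<pi> = P[THEN conjunct1, rule_format]
    and \<pi>\<delta> = P[THEN conjunct2, THEN conjunct1, rule_format]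
    and \<pi>sum = P[THEN conjunct2, THEN conjunct2, rule_format]
  have "\<forall>U. \<exists>h. U \<in> I \<longrightarrow> ghom G R (V\<lparr>carrier := U\<rparr>) N h \<and> bij_betw h U S"
    unfolding I_def gmod_iso_ghom by auto
  then obtain h where h: "\<And>U. U \<in> I \<Longrightarrow> ghom G R (V\<lparr>carrier := U\<rparr>) N (h U)" "\<And>U. U \<in> I \<Longrightarrow> bij_betw (h U) U S"
    by metis
  obtain e where e: "ghom G R C N e" "\<And>u. u \<in> S \<Longrightarrow> e u = u"
    by (rule direct_sum2_projection[OF sum]) (rule that, assumption, blast)
  define k where "k U = inv_into U (h U)" for U
  have IU: "U \<in> \<U>" if "U \<in> I" for U using that by (simp add: I_def)
  have k: "ghom G R N (V\<lparr>carrier := U\<rparr>) (k U)" if "U \<in> I" for U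
    using ghom_inv[OF V.gsub_rep[OF sub[OF IU[OF that]]] h(1)[OF that]] h(2)[OF that] by (simp add: k_def)
  define f where "f U = k U \<circ> e" for U
  define g where "g U = h U \<circ> \<pi> U" for U
  have f: "ghom G R C V (f U)" if "U \<in> I" for U
    using ghom_comp[OF ghom_comp[OF e(1) k[OF that]] V.ghom_act_self[OF V.gsub_subset[OF sub[OF IU[OF that]]]]]
    by (simp add: comp_def f_def)
  have g: "ghom G R V C (g U)" if "U \<in> I" for U
    using ghom_comp[OF ghom_comp[OF \<pi>[OF IU[OF that]] h(1)[OF that]] ghom_act_self[OF gsub_subset[OF S_sub]]]
    by (simp add: comp_def g_def)
  have f\<Sigma>: "f U \<Sigma> \<in> U" "h U (f U \<Sigma>) = \<Sigma>" if "U \<in> I" for U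
    using h(2)[OF that] \<Sigma>_S e(2)[OF \<Sigma>_S]
    by (auto simp: f_def k_def bij_betw_def intro: inv_into_into f_inv_into_f)
  define t where "t U = f U \<Sigma>" for U
  define l where "l U v = ev (g U v)" for U v
  have ev0: "ev \<zero>\<^bsub>C\<^esub> = \<zero>\<^bsub>R\<^esub>"
    using ev_smult[of "\<zero>\<^bsub>R\<^esub>" \<Sigma>] \<Sigma>_carrier ev_closed[OF \<Sigma>_carrier] by simp
  have tv: "t U \<in> vectors V" if "U \<in> I" for U unfolding t_def vectors_def using f[OF that] by blast
  have lv: "l U \<in> forms V" if "U \<in> I" for U unfolding l_def forms_def using g[OF that] by blast
  have cl: "lf v \<in> carrier R" if vl: "v \<in> vectors V" "lf \<in> forms V" for v lf
  proof -
    obtain f0 g0 where "ghom G R C V f0" "v = f0 \<Sigma>" "ghom G R V C g0" "lf = (\<lambda>v. ev (g0 v))"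
      using vl unfolding vectors_def forms_def by auto
    then show ?thesis using ev_closed[OF ghom_closed[of G R V C g0, OF _ ghom_closed[of G R C V f0, OF _ \<Sigma>_carrier]]]
      by simp
  qed
  have delta: "l U (t U') = (if U = U' then \<one>\<^bsub>R\<^esub> else \<zero>\<^bsub>R\<^esub>)" if UU: "U \<in> I" "U' \<in> I" for U U'
  proof (cases "U = U'")
    case True
    then show ?thesis using f\<Sigma>[OF UU(1)] \<pi>\<delta>[OF IU[OF UU(1)] IU[OF UU(1)]] ev_\<Sigma>
      by (simp add: l_def t_def g_def)
  next
    case False
    have "h U \<zero>\<^bsub>V\<^esub> = \<zero>\<^bsub>C\<^esub>"
      using ghom_zero[OF V.gsub_rep[OF sub[OF IU[OF UU(1)]]] N_rep h(1)[OF UU(1)]] by simp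
    then show ?thesis using False f\<Sigma>[OF UU(2)] \<pi>\<delta>[OF IU[OF UU(1)] IU[OF UU(2)]] ev0
      by (simp add: l_def t_def g_def)
  qed
  have expand: "lf v = (\<Oplus>\<^bsub>R\<^esub>U\<in>I. lf (t U) \<otimes>\<^bsub>R\<^esub> l U v)" if v: "v \<in> vectors V" and lf: "lf \<in> forms V" for v lf
  proof -
    obtain f0 where f0: "ghom G R C V f0" "v = f0 \<Sigma>" using v unfolding vectors_def by auto
    obtain g0 where g0: "ghom G R V C g0" "lf = (\<lambda>v. ev (g0 v))" using lf unfolding forms_def by auto
    have vc: "v \<in> carrier V" using ghom_closed[OF f0(1) \<Sigma>_carrier] f0(2) by simp
    have \<pi>c: "\<pi> U v \<in> U" if "U \<in> \<U>" for U using ghom_closed[OF \<pi>[OF that] vc] by simp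
    have \<pi>cV: "\<pi> U v \<in> carrier V" if "U \<in> \<U>" for U using V.gsub_carrier[OF sub[OF that] \<pi>c[OF that]] .
    have "lf v = ev (g0 (finsum V (\<lambda>U. \<pi> U v) \<U>))" using \<pi>sum[OF vc] g0(2) by simp
    also have "g0 (finsum V (\<lambda>U. \<pi> U v) \<U>) = finsum C (\<lambda>U. g0 (\<pi> U v)) \<U>"
      by (rule ghom_finsum[OF V C_rep g0(1) fin]) (use \<pi>cV in auto)
    also have "ev \<dots> = (\<Oplus>\<^bsub>R\<^esub>U\<in>\<U>. ev (g0 (\<pi> U v)))"
    proof -
      have *: "(\<lambda>U. g0 (\<pi> U v)) \<in> \<U> \<rightarrow> carrier C" using \<pi>cV ghom_closed[OF g0(1)] by auto
      have "\<B> \<subseteq> \<U> \<Longrightarrow> ev (finsum C (\<lambda>U. g0 (\<pi> U v)) \<B>) = (\<Oplus>\<^bsub>R\<^esub>U\<in>\<B>. ev (g0 (\<pi> U v)))" if "finite \<B>" for \<B>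
        using that
      proof (induction \<B>)
        case empty
        then show ?case using ev0 by simp
      next
        case (insert U \<B>)
        then have "(\<lambda>U. g0 (\<pi> U v)) \<in> \<B> \<rightarrow> carrier C" "g0 (\<pi> U v) \<in> carrier C"
          "(\<lambda>U. ev (g0 (\<pi> U v))) \<in> \<B> \<rightarrow> carrier R" "ev (g0 (\<pi> U v)) \<in> carrier R" using * ev_closed by auto
        then show ?case using insert by (simp add: ev_add)
      qed
      then show ?thesis using fin by blast
    qed
    also have "\<dots> = (\<Oplus>\<^bsub>R\<^esub>U\<in>I. lf (t U) \<otimes>\<^bsub>R\<^esub> l U v)"
    proof (rule R.add.finprod_mono_neutral_cong_right[OF fin])
      show "I \<subseteq> \<U>" by (auto simp: I_def)
      show "(\<lambda>U. ev (g0 (\<pi> U v))) \<in> \<U> \<rightarrow> carrier R"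
        using \<pi>cV ghom_closed[OF g0(1)] ev_closed by auto
    next
      fix U assume U: "U \<in> \<U> - I"
      show "ev (g0 (\<pi> U v)) = \<zero>\<^bsub>R\<^esub>"
      proof (rule ccontr)
        assume nz: "ev (g0 (\<pi> U v)) \<noteq> \<zero>\<^bsub>R\<^esub>"
        let ?VU = "V\<lparr>carrier := U\<rparr>"
        have UU: "U \<in> \<U>" using U by simp
        have r: "rep G R ?VU" by (rule V.gsub_rep[OF sub[OF UU]])
        define f1 where "f1 = \<pi> U \<circ> f0"
        have f1: "ghom G R C ?VU f1" unfolding f1_def by (rule ghom_comp[OF f0(1) \<pi>[OF UU]])
        have g1: "ghom G R ?VU C g0" using g0(1) V.gsub_carrier[OF sub[OF UU]] by (auto simp: ghom_def)
        have nz': "ev (g0 (f1 \<Sigma>)) \<noteq> \<zero>\<^bsub>R\<^esub>" using nz f0(2) by (simp add: f1_def)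
        from nonzero_pairing_splits[OF r f1 g1 nz'] obtain h' where
          *: "ghom G R N ?VU f1" "ghom G R ?VU N h'" "bij_betw (h' \<circ> f1) (carrier N) (carrier N)"
          by auto
        note sp = splitting[OF r N_rep *]
        have "{v \<in> carrier ?VU. h' v = \<zero>\<^bsub>N\<^esub>} = {\<zero>\<^bsub>V\<^esub>} \<or> f1 ` carrier N = {\<zero>\<^bsub>V\<^esub>}"
          using ind[OF UU] sp(1) unfolding indecomposable_def by auto
        moreover have "f1 ` carrier N \<noteq> {\<zero>\<^bsub>V\<^esub>}"
        proof
          assume z: "f1 ` carrier N = {\<zero>\<^bsub>V\<^esub>}"
          have "f1 \<Sigma> = \<zero>\<^bsub>V\<^esub>" using z \<Sigma>_S by auto
          then show False using nz' ghom_zero[OF V C_rep g0(1)] ev0 by simp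
        qed
        ultimately have z: "{v \<in> U. h' v = \<zero>\<^bsub>C\<^esub>} = {\<zero>\<^bsub>V\<^esub>}" by simp
        have "f1 ` carrier N = U"
        proof
          show "f1 ` carrier N \<subseteq> U" using ghom_closed[OF *(1)] by auto
          show "U \<subseteq> f1 ` carrier N"
          proof
            fix x assume x: "x \<in> U"
            then obtain y w where yw: "y \<in> f1 ` carrier N" "w \<in> U" "h' w = \<zero>\<^bsub>C\<^esub>" "x = y \<oplus>\<^bsub>V\<^esub> w"
              using sp(1)[unfolded rep.direct_sum2_iff[OF r], THEN conjunct2, THEN conjunct2, THEN conjunct2,
                  rule_format, of x] by auto
            have w0: "w = \<zero>\<^bsub>V\<^esub>" using yw(2,3) z by blast
            have "y \<in> U" using yw(1) ghom_closed[OF *(1)] by auto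
            then have "x = y" using yw(4) w0 V.gsub_carrier[OF sub[OF UU]] by simp
            then show "x \<in> f1 ` carrier N" using yw(1) by simp
          qed
        qed
        then have "gmod_iso G R (V\<lparr>carrier := U\<rparr>) N" using sp(2) by simp
        then show False using U by (simp add: I_def)
      qed
    next
      fix U assume U: "U \<in> I"
      have UU: "U \<in> \<U>" using U by (simp add: I_def)
      have "g U (f0 \<Sigma>) = ev (g U (f0 \<Sigma>)) \<odot>\<^bsub>C\<^esub> \<Sigma>" by (rule fixed_image[OF V f0(1) g[OF U]])
      then have 1: "h U (\<pi> U v) = l U v \<odot>\<^bsub>C\<^esub> \<Sigma>" using f0(2) by (simp add: g_def l_def)
      have lc: "l U v \<in> carrier R" by (rule cl[OF v lv[OF U]])
      have "h U (l U v \<odot>\<^bsub>V\<^esub> t U) = l U v \<odot>\<^bsub>C\<^esub> \<Sigma>"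
        using ghom_smult[OF h(1)[OF U] lc, of "t U"] f\<Sigma>[OF U] by (simp add: t_def)
      moreover have "l U v \<odot>\<^bsub>V\<^esub> t U \<in> U"
        using V.gsub_smult[OF sub[OF UU] lc] f\<Sigma>(1)[OF U] by (simp add: t_def)
      ultimately have "\<pi> U v = l U v \<odot>\<^bsub>V\<^esub> t U"
        using inj_onD[OF bij_betw_imp_inj_on[OF h(2)[OF U]], of "\<pi> U v" "l U v \<odot>\<^bsub>V\<^esub> t U"] 1 \<pi>c[OF UU]
        by simp
      moreover have tV: "t U \<in> carrier V" using V.gsub_carrier[OF sub[OF UU] f\<Sigma>(1)[OF U]] by (simp add: t_def)
      ultimately have "g0 (\<pi> U v) = l U v \<odot>\<^bsub>C\<^esub> g0 (t U)" using ghom_smult[OF g0(1) lc] by simp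
      then have "ev (g0 (\<pi> U v)) = l U v \<otimes>\<^bsub>R\<^esub> ev (g0 (t U))"
        using ev_smult[OF lc ghom_closed[OF g0(1) tV]] by simp
      then show "ev (g0 (\<pi> U v)) = lf (t U) \<otimes>\<^bsub>R\<^esub> l U v"
        using g0(2) lc ev_closed[OF ghom_closed[OF g0(1) tV]] by (simp add: R.m_comm)
    qed
    finally show ?thesis .
  qed
  have "dual_system R (vectors V) (forms V) I t l"
    unfolding dual_system_def using fin tv lv cl delta expand by (auto simp: I_def)
  then show ?thesis unfolding I_def by blast
qed

text \<open>Each decomposition yields a dual system indexed by the constituents isomorphic to \<open>N\<close>, and all dual
systems have the same size.\<close>

theorem multiplicity_from_dual_system:
  fixes V :: "('f, 'v, 'g) gmod"
  assumes V: "rep G R V" and len: "finite_length G R V"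
    and dual: "dual_system R (vectors V) (forms V) I t l"
  shows "gmod_mult G R V N = card I"
    and "is_summand G R N V \<longleftrightarrow> I \<noteq> {}"
proof -
  have c: "card {U \<in> \<U>. gmod_iso G R (V\<lparr>carrier := U\<rparr>) N} = card I" if dec: "indec_decomposition G R V \<U>" for \<U>
  proof -
    obtain t' l' where "dual_system R (vectors V) (forms V) {U \<in> \<U>. gmod_iso G R (V\<lparr>carrier := U\<rparr>) N} t' l'"
      using decomposition_dual_system[OF V dec] by blast
    from dual_system_card[OF F.field_axioms this dual] show ?thesis .
  qed
  obtain \<U> where "indec_decomposition G R V \<U>" using rep.indec_decomposition_exists[OF V len] by blast
  then show "gmod_mult G R V N = card I" unfolding gmod_mult_def using c by (intro the_equality) auto
  show "is_summand G R N V \<longleftrightarrow> I \<noteq> {}"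
    unfolding summand_iff_pairing[OF V] dual_system_pairing_nonzero[OF F.field_axioms dual] by simp
qed

end

section \<open>Characteristic \<open>p\<close> and fixed points of \<open>p\<close>-groups\<close>

lemma (in field) add_pow_one_eq_zero:
  assumes "ring_char R = p"
  shows "add_pow R (k::nat) \<one> = \<zero> \<longleftrightarrow> p dvd k"
  using add.pow_eq_id[of \<one> k] assms by (simp add: ring_char_def)

lemma (in field) add_pow_eq_mult:
  assumes "a \<in> carrier R"
  shows "add_pow R (k::nat) a = add_pow R k \<one> \<otimes> a"
  using add_pow_ldistr[of \<one> a k] assms by simp

lemma (in field) add_pow_char:
  assumes "ring_char R = p" "p dvd k" "a \<in> carrier R"
  shows "add_pow R (k::nat) a = \<zero>"
  using add_pow_eq_mult[OF assms(3), of k] add_pow_one_eq_zero[OF assms(1), of k] assms by simp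

lemma (in field) prime_ring_char:
  assumes "ring_char R = p" "p > 0"
  shows "Factorial_Ring.prime p"
proof -
  note z = add_pow_one_eq_zero[OF assms(1)]
  have "p \<noteq> 1" using z[of 1] by auto
  moreover have "a = 1 \<or> a = p" if ap: "a dvd p" for a
  proof -
    obtain b where b: "p = a * b" using ap by blast
    have c: "add_pow R m \<one> \<in> carrier R" for m :: nat by simp
    have "add_pow R a \<one> \<otimes> add_pow R b \<one> = add_pow R p \<one>"
      using add_pow_eq_mult[OF c, of a b] add.nat_pow_pow[of \<one> a b] by (simp add: b mult.commute)
    also have "\<dots> = \<zero>" using z[of p] by simp
    finally have "p dvd a \<or> p dvd b" using integral[OF _ c c] z by blast
    then show ?thesis
    proof
      assume "p dvd a" then show ?thesis using ap by (simp add: dvd_antisym)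
    next
      assume "p dvd b"
      then have "b = p" using b by (simp add: dvd_antisym)
      then show ?thesis using b assms(2) by simp
    qed
  qed
  ultimately show ?thesis using assms(2) by (intro prime_nat_iff[THEN iffD2]) auto
qed

lemma group_action_restrict:
  assumes "group H"
    and cl: "\<And>g x. g \<in> carrier H \<Longrightarrow> x \<in> E \<Longrightarrow> \<phi> g x \<in> E"
    and one: "\<And>x. x \<in> E \<Longrightarrow> \<phi> \<one>\<^bsub>H\<^esub> x = x"
    and mul: "\<And>g h x. g \<in> carrier H \<Longrightarrow> h \<in> carrier H \<Longrightarrow> x \<in> E \<Longrightarrow> \<phi> (g \<otimes>\<^bsub>H\<^esub> h) x = \<phi> g (\<phi> h x)"
  shows "group_action H E (\<lambda>g. restrict (\<phi> g) E)"
proof -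
  interpret H: group H by fact
  have bij: "bij_betw (\<phi> g) E E" if g: "g \<in> carrier H" for g
  proof (rule bij_betw_byWitness[of _ "\<phi> (inv\<^bsub>H\<^esub> g)"])
    show "\<forall>a\<in>E. \<phi> (inv\<^bsub>H\<^esub> g) (\<phi> g a) = a" using mul[of "inv\<^bsub>H\<^esub> g" g] one g by auto
    show "\<forall>a\<in>E. \<phi> g (\<phi> (inv\<^bsub>H\<^esub> g) a) = a" using mul[of g "inv\<^bsub>H\<^esub> g"] one g by auto
  qed (use cl g in auto)
  have inB: "restrict (\<phi> g) E \<in> Bij E" if "g \<in> carrier H" for g
    using bij[OF that] by (auto simp: Bij_def bij_betw_restrict_eq)
  show ?thesis
  proof (intro group_action.intro group_hom.intro group_hom_axioms.intro homI)
    show "group H" by fact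
    show "group (BijGroup E)" by (rule group_BijGroup)
    fix g assume g: "g \<in> carrier H"
    show "restrict (\<phi> g) E \<in> carrier (BijGroup E)" using inB[OF g] by (simp add: BijGroup_def)
    fix h assume h: "h \<in> carrier H"
    show "restrict (\<phi> (g \<otimes>\<^bsub>H\<^esub> h)) E = restrict (\<phi> g) E \<otimes>\<^bsub>BijGroup E\<^esub> restrict (\<phi> h) E"
      using inB[OF g] inB[OF h] mul[OF g h] cl[OF h] by (auto simp: BijGroup_def compose_def fun_eq_iff)
  qed
qed

text \<open>The orbits that are not fixed points have length divisible by \<open>p\<close>, so an invariant function sums
  to zero over each of them.\<close>

lemma p_group_sum:
  fixes H :: "('h, 'm) monoid_scheme"
  assumes R: "field R" "ring_char R = p" "p > 0"
    and H: "group H" "card (carrier H) = p ^ k"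
    and E: "finite E"
    and cl: "\<And>g x. g \<in> carrier H \<Longrightarrow> x \<in> E \<Longrightarrow> \<phi> g x \<in> E"
    and one: "\<And>x. x \<in> E \<Longrightarrow> \<phi> \<one>\<^bsub>H\<^esub> x = x"
    and mul: "\<And>g h x. g \<in> carrier H \<Longrightarrow> h \<in> carrier H \<Longrightarrow> x \<in> E \<Longrightarrow> \<phi> (g \<otimes>\<^bsub>H\<^esub> h) x = \<phi> g (\<phi> h x)"
    and f: "\<And>x. x \<in> E \<Longrightarrow> f x \<in> carrier R"
    and inv: "\<And>g x. g \<in> carrier H \<Longrightarrow> x \<in> E \<Longrightarrow> f (\<phi> g x) = f x"
  shows "(\<Oplus>\<^bsub>R\<^esub>x\<in>E. f x) = (\<Oplus>\<^bsub>R\<^esub>x\<in>{x \<in> E. \<forall>g\<in>carrier H. \<phi> g x = x}. f x)"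
proof -
  interpret R: field R by fact
  interpret H: group H by fact
  let ?\<phi> = "\<lambda>g. restrict (\<phi> g) E"
  interpret A: group_action H E ?\<phi> by (rule group_action_restrict[OF H(1) cl one mul])
  have p: "Factorial_Ring.prime p" by (rule R.prime_ring_char[OF R(2,3)])
  define \<O> where "\<O> = orbits H E ?\<phi>"
  have orb: "orbit H ?\<phi> x = {\<phi> g x | g. g \<in> carrier H}" if "x \<in> E" for x
    using that by (auto simp: orbit_def)
  have self: "x \<in> orbit H ?\<phi> x" if "x \<in> E" for x
    unfolding orb[OF that] using one[OF that] by force
  have sub: "C \<subseteq> E" if "C \<in> \<O>" for C
    using that orb cl by (auto simp: \<O>_def orbits_def)
  have U: "\<Union>\<O> = E"
    using sub self by (auto simp: \<O>_def orbits_def)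
  have finO: "finite \<O>" unfolding \<O>_def orbits_def using E by simp
  have finC: "finite C" if "C \<in> \<O>" for C using finite_subset[OF sub[OF that] E] .
  have disj: "pairwise disjnt \<O>"
    using A.disjoint_union by (auto simp: pairwise_def disjnt_def \<O>_def)
  define P where "P = {C \<in> \<O>. card C = 1}"
  have fixed: "\<Union>P = {x \<in> E. \<forall>g\<in>carrier H. \<phi> g x = x}"
  proof (intro equalityI subsetI)
    fix x assume "x \<in> \<Union>P"
    then obtain C y where C: "x \<in> C" "card C = 1" "y \<in> E" "C = orbit H ?\<phi> y"
      by (auto simp: P_def \<O>_def orbits_def)
    have Cx: "C = {x}" using C(1,2) card_1_singletonE by blast
    then have y: "y = x" using self[OF C(3)] C(4) by simp
    have "\<phi> g x = x" if "g \<in> carrier H" for g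
    proof -
      have "\<phi> g x \<in> C" unfolding C(4) orb[OF C(3)] using that y by blast
      then show ?thesis using Cx by simp
    qed
    then show "x \<in> {x \<in> E. \<forall>g\<in>carrier H. \<phi> g x = x}" using y C(3) by simp
  next
    fix x assume x: "x \<in> {x \<in> E. \<forall>g\<in>carrier H. \<phi> g x = x}"
    then have "orbit H ?\<phi> x = {x}" using orb[of x] H.one_closed by (auto intro!: exI[of _ "\<one>\<^bsub>H\<^esub>"])
    then show "x \<in> \<Union>P" using x by (auto simp: P_def \<O>_def orbits_def)
  qed
  have zero: "(\<Oplus>\<^bsub>R\<^esub>x\<in>C. f x) = \<zero>\<^bsub>R\<^esub>" if C: "C \<in> \<O>" "card C \<noteq> 1" for C
  proof -
    obtain y where y: "y \<in> E" "C = orbit H ?\<phi> y" using C by (auto simp: \<O>_def orbits_def)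
    have "card C * card (stabilizer H ?\<phi> y) = p ^ k"
      using A.orbit_stabilizer_theorem[OF y(1)] y(2) H(2) by (simp add: order_def)
    then have "card C dvd p ^ k" by (metis dvd_triv_left)
    then obtain i where i: "card C = p ^ i" using divides_primepow_nat[OF p] by auto
    with C(2) have "i \<noteq> 0" by auto
    then have d: "p dvd card C" using i by (simp add: dvd_power)
    have "f x = f y" if "x \<in> C" for x using that inv[OF _ y(1)] unfolding y(2) orb[OF y(1)] by auto
    then have "(\<Oplus>\<^bsub>R\<^esub>x\<in>C. f x) = (\<Oplus>\<^bsub>R\<^esub>x\<in>C. f y)"
      by (intro R.finsum_cong') (use f y in auto)
    also have "\<dots> = add_pow R (card C) (f y)"
      using f[OF y(1)] finC[OF C(1)] by (intro R.add.finprod_const) auto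
    also have "\<dots> = \<zero>\<^bsub>R\<^esub>" using R.add_pow_char[OF R(2) d f[OF y(1)]] .
    finally show ?thesis .
  qed
  have fC: "f x \<in> carrier R" if "C \<in> \<O>" "x \<in> C" for C x using f sub[OF that(1)] that(2) by blast
  have "(\<Oplus>\<^bsub>R\<^esub>x\<in>E. f x) = (\<Oplus>\<^bsub>R\<^esub>C\<in>\<O>. \<Oplus>\<^bsub>R\<^esub>x\<in>C. f x)"
    unfolding U[symmetric] using finO finC disj f sub
    by (intro R.add.finprod_Union_disjoint) auto
  also have "\<dots> = (\<Oplus>\<^bsub>R\<^esub>C\<in>P. \<Oplus>\<^bsub>R\<^esub>x\<in>C. f x)"
    using finO finC zero fC
    by (intro R.add.finprod_mono_neutral_cong_right) (auto simp: P_def intro!: R.finsum_closed)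
  also have "\<dots> = (\<Oplus>\<^bsub>R\<^esub>x\<in>\<Union>P. f x)"
  proof (rule R.add.finprod_Union_disjoint[symmetric])
    show "finite P" using finO by (simp add: P_def)
    show "pairwise disjnt P" by (rule pairwise_subset[OF disj]) (auto simp: P_def)
    fix C assume "C \<in> P"
    then have "C \<in> \<O>" by (simp add: P_def)
    then show "finite C \<and> (\<forall>x\<in>C. f x \<in> carrier R)" using finC sub f by blast
  qed
  finally show ?thesis unfolding fixed .
qed

section \<open>Function modules and quotients\<close>

lemma perm_gmod_simps:
  "\<zero>\<^bsub>perm_gmod G R Y \<phi>\<^esub> = (\<lambda>x. \<zero>\<^bsub>R\<^esub>)"
  "f \<oplus>\<^bsub>perm_gmod G R Y \<phi>\<^esub> h = (\<lambda>x. f x \<oplus>\<^bsub>R\<^esub> h x)"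
  "a \<odot>\<^bsub>perm_gmod G R Y \<phi>\<^esub> f = (\<lambda>x. a \<otimes>\<^bsub>R\<^esub> f x)"
  "act (perm_gmod G R Y \<phi>) g f = (\<lambda>x. if x \<in> Y then f (\<phi> (inv\<^bsub>G\<^esub> g) x) else \<zero>\<^bsub>R\<^esub>)"
  by (simp_all add: perm_gmod_def)

lemma perm_gmod_carrier:
  assumes "finite Y"
  shows "f \<in> carrier (perm_gmod G R Y \<phi>) \<longleftrightarrow> (\<forall>x\<in>Y. f x \<in> carrier R) \<and> (\<forall>x. x \<notin> Y \<longrightarrow> f x = \<zero>\<^bsub>R\<^esub>)"
  using assms by (auto simp: perm_gmod_def)

lemma perm_gmod_value:
  assumes "cring R" "f \<in> carrier (perm_gmod G R Y \<phi>)"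
  shows "f x \<in> carrier R"
proof -
  interpret cring R by fact
  show ?thesis using assms(2) by (cases "x \<in> Y") (auto simp: perm_gmod_def)
qed

lemma perm_gmod_supp:
  "f \<in> carrier (perm_gmod G R Y \<phi>) \<longleftrightarrow> (\<forall>x\<in>Y. f x \<in> carrier R) \<and> (\<forall>x. x \<notin> Y \<longrightarrow> f x = \<zero>\<^bsub>R\<^esub>)
     \<and> finite {x \<in> Y. f x \<noteq> \<zero>\<^bsub>R\<^esub>}"
  by (simp add: perm_gmod_def)

lemma basis_elt_in:
  assumes "cring R" "y \<in> Y"
  shows "basis_elt R y \<in> carrier (perm_gmod G R Y \<phi>)"
proof -
  interpret cring R by fact
  have "{x \<in> Y. basis_elt R y x \<noteq> \<zero>\<^bsub>R\<^esub>} \<subseteq> {y}" by (auto simp: basis_elt_def)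
  then show ?thesis using assms(2) finite_subset by (auto simp: perm_gmod_supp basis_elt_def)
qed

lemma perm_gmod_induct:
  fixes Y :: "'x set"
  assumes "rep G R (perm_gmod G R Y \<phi>)" "f \<in> carrier (perm_gmod G R Y \<phi>)"
    and zero: "P \<zero>\<^bsub>perm_gmod G R Y \<phi>\<^esub>"
    and add: "\<And>f h. f \<in> carrier (perm_gmod G R Y \<phi>) \<Longrightarrow> h \<in> carrier (perm_gmod G R Y \<phi>) \<Longrightarrow> P f \<Longrightarrow> P h
      \<Longrightarrow> P (f \<oplus>\<^bsub>perm_gmod G R Y \<phi>\<^esub> h)"
    and smult: "\<And>a f. a \<in> carrier R \<Longrightarrow> f \<in> carrier (perm_gmod G R Y \<phi>) \<Longrightarrow> P f \<Longrightarrow> P (a \<odot>\<^bsub>perm_gmod G R Y \<phi>\<^esub> f)"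
    and basis: "\<And>y. y \<in> Y \<Longrightarrow> P (basis_elt R y)"
  shows "P f"
proof -
  let ?V = "perm_gmod G R Y \<phi>"
  interpret V: rep G R ?V by fact
  have cr: "cring R" by (rule V.R.is_cring)
  have be: "basis_elt R y \<in> carrier ?V" if "y \<in> Y" for y by (rule basis_elt_in[OF cr that])
  have "\<forall>f\<in>carrier ?V. {x \<in> Y. f x \<noteq> \<zero>\<^bsub>R\<^esub>} \<subseteq> A \<longrightarrow> P f" if "finite A" for A
    using that
  proof (induction A)
    case empty
    show ?case
    proof (intro ballI impI)
      fix f assume f: "f \<in> carrier ?V" "{x \<in> Y. f x \<noteq> \<zero>\<^bsub>R\<^esub>} \<subseteq> {}"
      have "f x = \<zero>\<^bsub>R\<^esub>" for x using f by (cases "x \<in> Y") (auto simp: perm_gmod_supp)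
      then have "f = \<zero>\<^bsub>?V\<^esub>" by (auto simp: perm_gmod_simps)
      then show "P f" using zero by simp
    qed
  next
    case (insert y A)
    show ?case
    proof (intro ballI impI)
      fix f assume f: "f \<in> carrier ?V" "{x \<in> Y. f x \<noteq> \<zero>\<^bsub>R\<^esub>} \<subseteq> insert y A"
      show "P f"
      proof (cases "y \<in> Y")
        case False
        then have "{x \<in> Y. f x \<noteq> \<zero>\<^bsub>R\<^esub>} \<subseteq> A" using f(2) by blast
        then show ?thesis using insert.IH f(1) by blast
      next
        case True
        define h where "h = f(y := \<zero>\<^bsub>R\<^esub>)"
        have "{x \<in> Y. h x \<noteq> \<zero>\<^bsub>R\<^esub>} \<subseteq> {x \<in> Y. f x \<noteq> \<zero>\<^bsub>R\<^esub>}" by (auto simp: h_def)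
        then have "finite {x \<in> Y. h x \<noteq> \<zero>\<^bsub>R\<^esub>}"
          by (rule finite_subset) (use f(1) in \<open>simp add: perm_gmod_supp\<close>)
        then have h: "h \<in> carrier ?V"
          using f(1) unfolding perm_gmod_supp by (auto simp: h_def)
        have "{x \<in> Y. h x \<noteq> \<zero>\<^bsub>R\<^esub>} \<subseteq> A" using f(2) by (auto simp: h_def)
        then have Ph: "P h" using insert.IH h by blast
        have fy: "f y \<in> carrier R" by (rule perm_gmod_value[OF cr f(1)])
        have "f = f y \<odot>\<^bsub>?V\<^esub> basis_elt R y \<oplus>\<^bsub>?V\<^esub> h"
          using fy perm_gmod_value[OF cr f(1)] by (auto simp: perm_gmod_simps basis_elt_def h_def fun_eq_iff)
        then show ?thesis
          using add[OF V.smult_closed[OF fy be[OF True]] h smult[OF fy be[OF True] basis[OF True]] Ph] by simp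
      qed
    qed
  qed
  then show ?thesis using assms(2) by (auto simp: perm_gmod_supp)
qed

lemma basis_elt_act:
  assumes "\<phi> g x \<in> Y" "\<phi> (inv\<^bsub>G\<^esub> g) (\<phi> g x) = x" "\<And>y. y \<in> Y \<Longrightarrow> \<phi> g (\<phi> (inv\<^bsub>G\<^esub> g) y) = y"
  shows "act (perm_gmod G R Y \<phi>) g (basis_elt R x) = basis_elt R (\<phi> g x)"
proof
  fix y
  have "\<phi> (inv\<^bsub>G\<^esub> g) y = x \<longleftrightarrow> y = \<phi> g x" if "y \<in> Y" using assms that by metis
  then show "act (perm_gmod G R Y \<phi>) g (basis_elt R x) y = basis_elt R (\<phi> g x) y"
    using assms(1) by (auto simp: perm_gmod_simps basis_elt_def)
qed

text \<open>The universal property of the free module.\<close>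

lemma free_lift:
  fixes Y :: "'x set" and R :: "('f, 'b) ring_scheme"
  assumes "rep G R (perm_gmod G R Y \<phi>)" and W: "rep G R W"
    and cl: "\<And>g x. g \<in> carrier G \<Longrightarrow> x \<in> Y \<Longrightarrow> \<phi> g x \<in> Y"
    and invl: "\<And>g x. g \<in> carrier G \<Longrightarrow> x \<in> Y \<Longrightarrow> \<phi> (inv\<^bsub>G\<^esub> g) (\<phi> g x) = x"
    and invr: "\<And>g x. g \<in> carrier G \<Longrightarrow> x \<in> Y \<Longrightarrow> \<phi> g (\<phi> (inv\<^bsub>G\<^esub> g) x) = x"
    and b: "\<And>y. y \<in> Y \<Longrightarrow> b y \<in> carrier W"
    and bg: "\<And>g y. g \<in> carrier G \<Longrightarrow> y \<in> Y \<Longrightarrow> b (\<phi> g y) = act W g (b y)"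
  shows "\<exists>L. ghom G R (perm_gmod G R Y \<phi>) W L \<and> (\<forall>y\<in>Y. L (basis_elt R y) = b y)"
proof -
  let ?V = "perm_gmod G R Y \<phi>"
  interpret V: rep G R ?V by fact
  interpret W: rep G R W by fact
  have cr: "cring R" by (rule V.R.is_cring)
  note val = perm_gmod_value[OF cr]
  define S where "S f = {x \<in> Y. f x \<noteq> \<zero>\<^bsub>R\<^esub>}" for f :: "'x \<Rightarrow> 'f"
  have Sfin: "finite (S f)" if "f \<in> carrier ?V" for f using that by (auto simp: S_def perm_gmod_supp)
  define L where "L f = finsum W (\<lambda>y. f y \<odot>\<^bsub>W\<^esub> b y) (S f)" for f
  have tc: "(\<lambda>y. f y \<odot>\<^bsub>W\<^esub> b y) \<in> A \<rightarrow> carrier W" if "f \<in> carrier ?V" "A \<subseteq> Y" for f A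
    using val[OF that(1)] b that(2) by blast
  have L: "L f = finsum W (\<lambda>y. f y \<odot>\<^bsub>W\<^esub> b y) A"
    if f: "f \<in> carrier ?V" and A: "finite A" "S f \<subseteq> A" "A \<subseteq> Y" for f A
    unfolding L_def
  proof (rule W.M.add.finprod_mono_neutral_cong_left[OF A(1,2)])
    show "(\<lambda>y. f y \<odot>\<^bsub>W\<^esub> b y) \<in> A \<rightarrow> carrier W" by (rule tc[OF f A(3)])
    fix i assume i: "i \<in> A - S f"
    then have "f i = \<zero>\<^bsub>R\<^esub>" "i \<in> Y" using A(3) by (auto simp: S_def)
    then show "f i \<odot>\<^bsub>W\<^esub> b i = \<zero>\<^bsub>W\<^esub>" using b by simp
  qed simp
  have SY: "S f \<subseteq> Y" for f by (auto simp: S_def)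
  have "ghom G R ?V W L"
  proof (rule ghomI)
    fix f assume f: "f \<in> carrier ?V"
    show "L f \<in> carrier W" unfolding L_def by (rule W.M.finsum_closed[OF tc[OF f SY]])
    show "L (f \<oplus>\<^bsub>?V\<^esub> h) = L f \<oplus>\<^bsub>W\<^esub> L h" if h: "h \<in> carrier ?V" for h
    proof -
      let ?A = "S f \<union> S h"
      have A: "finite ?A" "S f \<subseteq> ?A" "S h \<subseteq> ?A" "?A \<subseteq> Y" "S (f \<oplus>\<^bsub>?V\<^esub> h) \<subseteq> ?A"
        using Sfin[OF f] Sfin[OF h] SY by (auto simp: S_def perm_gmod_simps)
      have "L (f \<oplus>\<^bsub>?V\<^esub> h) = finsum W (\<lambda>y. (f \<oplus>\<^bsub>?V\<^esub> h) y \<odot>\<^bsub>W\<^esub> b y) ?A"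
        by (rule L[OF V.M.a_closed[OF f h] A(1,5,4)])
      also have "\<dots> = finsum W (\<lambda>y. f y \<odot>\<^bsub>W\<^esub> b y \<oplus>\<^bsub>W\<^esub> h y \<odot>\<^bsub>W\<^esub> b y) ?A"
      proof (rule W.M.finsum_cong')
        show "(\<lambda>y. f y \<odot>\<^bsub>W\<^esub> b y \<oplus>\<^bsub>W\<^esub> h y \<odot>\<^bsub>W\<^esub> b y) \<in> ?A \<rightarrow> carrier W"
          using tc[OF f A(4)] tc[OF h A(4)] by auto
        fix y assume "y \<in> ?A"
        then have "y \<in> Y" using A(4) by blast
        then show "(f \<oplus>\<^bsub>?V\<^esub> h) y \<odot>\<^bsub>W\<^esub> b y = f y \<odot>\<^bsub>W\<^esub> b y \<oplus>\<^bsub>W\<^esub> h y \<odot>\<^bsub>W\<^esub> b y"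
          using W.smult_l_distr[OF val[OF f] val[OF h] b] by (simp add: perm_gmod_simps)
      qed simp
      also have "\<dots> = L f \<oplus>\<^bsub>W\<^esub> L h"
        unfolding L[OF f A(1,2,4)] L[OF h A(1,3,4)] by (rule W.M.finsum_addf[OF tc[OF f A(4)] tc[OF h A(4)]])
      finally show ?thesis .
    qed
    show "L (a \<odot>\<^bsub>?V\<^esub> f) = a \<odot>\<^bsub>W\<^esub> L f" if a: "a \<in> carrier R" for a
    proof -
      have S: "S (a \<odot>\<^bsub>?V\<^esub> f) \<subseteq> S f" using a by (auto simp: S_def perm_gmod_simps)
      have "L (a \<odot>\<^bsub>?V\<^esub> f) = finsum W (\<lambda>y. (a \<odot>\<^bsub>?V\<^esub> f) y \<odot>\<^bsub>W\<^esub> b y) (S f)"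
        by (rule L[OF V.smult_closed[OF a f] Sfin[OF f] S SY])
      also have "\<dots> = finsum W (\<lambda>y. a \<odot>\<^bsub>W\<^esub> (f y \<odot>\<^bsub>W\<^esub> b y)) (S f)"
      proof (rule W.M.finsum_cong')
        show "(\<lambda>y. a \<odot>\<^bsub>W\<^esub> (f y \<odot>\<^bsub>W\<^esub> b y)) \<in> S f \<rightarrow> carrier W" using tc[OF f SY] a by auto
        fix y assume "y \<in> S f"
        then have "y \<in> Y" by (simp add: S_def)
        then show "(a \<odot>\<^bsub>?V\<^esub> f) y \<odot>\<^bsub>W\<^esub> b y = a \<odot>\<^bsub>W\<^esub> (f y \<odot>\<^bsub>W\<^esub> b y)"
          using W.smult_assoc1[OF a val[OF f] b] by (simp add: perm_gmod_simps)
      qed simp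
      also have "\<dots> = a \<odot>\<^bsub>W\<^esub> L f"
        unfolding L_def by (rule W.finsum_smult_ldistr[OF Sfin[OF f] a tc[OF f SY], symmetric])
      finally show ?thesis .
    qed
    show "L (act ?V g f) = act W g (L f)" if g: "g \<in> carrier G" for g
    proof -
      have gi: "inv\<^bsub>G\<^esub> g \<in> carrier G" using g by simp
      have gf: "act ?V g f \<in> carrier ?V" by (rule V.act_closed[OF g f])
      let ?A = "\<phi> g ` S f"
      have A: "finite ?A" "?A \<subseteq> Y" using Sfin[OF f] cl[OF g] SY by auto
      have S: "S (act ?V g f) \<subseteq> ?A"
      proof
        fix x assume x: "x \<in> S (act ?V g f)"
        then have "\<phi> (inv\<^bsub>G\<^esub> g) x \<in> S f" "x = \<phi> g (\<phi> (inv\<^bsub>G\<^esub> g) x)"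
          using invr[OF g] cl[OF gi] by (auto simp: S_def perm_gmod_simps split: if_splits)
        then show "x \<in> ?A" by blast
      qed
      have inj: "inj_on (\<phi> g) (S f)"
      proof (rule inj_onI)
        fix x y assume "x \<in> S f" "y \<in> S f" and eq: "\<phi> g x = \<phi> g y"
        then have xy: "x \<in> Y" "y \<in> Y" using SY by blast+
        have "x = \<phi> (inv\<^bsub>G\<^esub> g) (\<phi> g x)" by (rule invl[OF g xy(1), symmetric])
        also have "\<dots> = y" unfolding eq by (rule invl[OF g xy(2)])
        finally show "x = y" .
      qed
      have "L (act ?V g f) = finsum W (\<lambda>y. act ?V g f y \<odot>\<^bsub>W\<^esub> b y) ?A" by (rule L[OF gf A(1) S A(2)])
      also have "\<dots> = finsum W (\<lambda>x. act ?V g f (\<phi> g x) \<odot>\<^bsub>W\<^esub> b (\<phi> g x)) (S f)"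
        by (rule W.M.finsum_reindex[OF tc[OF gf A(2)] inj])
      also have "\<dots> = finsum W (\<lambda>x. act W g (f x \<odot>\<^bsub>W\<^esub> b x)) (S f)"
      proof (rule W.M.finsum_cong')
        show "(\<lambda>x. act W g (f x \<odot>\<^bsub>W\<^esub> b x)) \<in> S f \<rightarrow> carrier W"
          using tc[OF f SY] W.act_closed[OF g] by auto
        fix x assume "x \<in> S f"
        then have x: "x \<in> Y" by (simp add: S_def)
        have "act ?V g f (\<phi> g x) = f x" using cl[OF g x] invl[OF g x] by (simp add: perm_gmod_simps)
        then show "act ?V g f (\<phi> g x) \<odot>\<^bsub>W\<^esub> b (\<phi> g x) = act W g (f x \<odot>\<^bsub>W\<^esub> b x)"
          using bg[OF g x] W.act_smult[OF g val[OF f] b[OF x]] by simp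
      qed simp
      also have "\<dots> = act W g (L f)" unfolding L_def by (rule W.act_finsum[OF Sfin[OF f] tc[OF f SY] g, symmetric])
      finally show ?thesis .
    qed
  qed
  moreover have "L (basis_elt R y) = b y" if y: "y \<in> Y" for y
  proof -
    have "L (basis_elt R y) = finsum W (\<lambda>x. basis_elt R y x \<odot>\<^bsub>W\<^esub> b x) {y}"
      by (rule L[OF basis_elt_in[OF cr y]]) (use y in \<open>auto simp: S_def basis_elt_def\<close>)
    then show ?thesis using b[OF y] by (simp add: basis_elt_def)
  qed
  ultimately show ?thesis by blast
qed

text \<open>Row reduction: a space of functions is determined within a larger one by the positions of the
  leading coefficients of its elements, so their number increases strictly along inclusions.\<close>

lemma perm_gmod_finite_length:
  fixes Y :: "'x set"
  assumes "field R" "finite Y" "rep G R (perm_gmod G R Y \<phi>)"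
  shows "finite_length G R (perm_gmod G R Y \<phi>)"
proof -
  interpret R: field R by fact
  let ?V = "perm_gmod G R Y \<phi>"
  interpret V: rep G R ?V by fact
  obtain xs where xs: "set xs = Y" using finite_list[OF assms(2)] by blast
  define n where "n = length xs"
  define L where "L U = {k. k < n \<and> (\<exists>u\<in>U. u (xs ! k) \<noteq> \<zero>\<^bsub>R\<^esub> \<and> (\<forall>j<k. u (xs ! j) = \<zero>\<^bsub>R\<^esub>))}"
    for U :: "('x \<Rightarrow> 'a) set"
  have "card (L U) < card (L U')"
    if U: "gsubmodule G R ?V U" and U': "gsubmodule G R ?V U'" and sub: "U \<subset> U'" for U U'
  proof (rule psubset_card_mono)
    show "finite (L U')" by (simp add: L_def)
    have le: "L U \<subseteq> L U'" using sub unfolding L_def by blast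
    have val: "u x \<in> carrier R" if "u \<in> U'" for u x
      by (rule perm_gmod_value[OF R.is_cring V.gsub_carrier[OF U' that]])
    have "L U \<noteq> L U'"
    proof
      assume eq: "L U = L U'"
      have red: "\<forall>u\<in>U'. (\<forall>j<n - d. u (xs ! j) = \<zero>\<^bsub>R\<^esub>) \<longrightarrow> u \<in> U" if "d \<le> n" for d
        using that
      proof (induction d)
        case 0
        show ?case
        proof (intro ballI impI)
          fix u assume u: "u \<in> U'" and z: "\<forall>j<n - 0. u (xs ! j) = \<zero>\<^bsub>R\<^esub>"
          have "u x = \<zero>\<^bsub>R\<^esub>" for x
          proof (cases "x \<in> Y")
            case True
            then obtain j where "j < n" "x = xs ! j" using xs by (metis in_set_conv_nth n_def)
            then show ?thesis using z by simp
          next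
            case False
            then show ?thesis using V.gsub_carrier[OF U' u] perm_gmod_carrier[OF assms(2)] by blast
          qed
          then have "u = \<zero>\<^bsub>?V\<^esub>" by (auto simp: perm_gmod_simps)
          then show "u \<in> U" using V.gsub_zero[OF U] by simp
        qed
      next
        case (Suc d)
        define k where "k = n - Suc d"
        have k: "k < n" "n - d = Suc k" using Suc.prems by (auto simp: k_def)
        show ?case
        proof (intro ballI impI)
          fix u assume u: "u \<in> U'" and z: "\<forall>j<n - Suc d. u (xs ! j) = \<zero>\<^bsub>R\<^esub>"
          have IH: "w \<in> U" if "w \<in> U'" "\<forall>j<Suc k. w (xs ! j) = \<zero>\<^bsub>R\<^esub>" for w
            using Suc.IH Suc.prems that k(2) by simp
          show "u \<in> U"
          proof (cases "u (xs ! k) = \<zero>\<^bsub>R\<^esub>")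
            case True
            then show ?thesis using IH[OF u] z by (auto simp: k_def[symmetric] less_Suc_eq)
          next
            case False
            then have "k \<in> L U'" using u z k(1) by (auto simp: L_def k_def)
            then have "k \<in> L U" by (simp only: eq)
            then obtain w where w: "w \<in> U" "w (xs ! k) \<noteq> \<zero>\<^bsub>R\<^esub>" "\<forall>j<k. w (xs ! j) = \<zero>\<^bsub>R\<^esub>"
              unfolding L_def by auto
            have w': "w \<in> U'" using w(1) sub by blast
            define c where "c = u (xs ! k) \<otimes>\<^bsub>R\<^esub> inv\<^bsub>R\<^esub> (w (xs ! k))"
            have iw: "inv\<^bsub>R\<^esub> (w (xs ! k)) \<in> carrier R" "inv\<^bsub>R\<^esub> (w (xs ! k)) \<otimes>\<^bsub>R\<^esub> w (xs ! k) = \<one>\<^bsub>R\<^esub>"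
              using w(2) val[OF w'] by (auto simp: R.field_Units)
            have c: "c \<in> carrier R" "c \<otimes>\<^bsub>R\<^esub> w (xs ! k) = u (xs ! k)"
              using iw val[OF w'] val[OF u] by (auto simp: c_def R.m_assoc)
            define d where "d = u \<oplus>\<^bsub>?V\<^esub> (\<ominus>\<^bsub>R\<^esub> c) \<odot>\<^bsub>?V\<^esub> w"
            have dU': "d \<in> U'"
              unfolding d_def using c(1) u w' by (intro V.gsub_add[OF U'] V.gsub_smult[OF U']) auto
            have dv: "d x = u x \<oplus>\<^bsub>R\<^esub> \<ominus>\<^bsub>R\<^esub> (c \<otimes>\<^bsub>R\<^esub> w x)" for x
              using c(1) val[OF w'] by (simp add: d_def perm_gmod_simps R.l_minus)
            have "d (xs ! j) = \<zero>\<^bsub>R\<^esub>" if "j < Suc k" for j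
            proof (cases "j = k")
              case True
              then show ?thesis using dv[of "xs ! k"] c(2) val[OF u] by (simp add: R.r_neg)
            next
              case False
              then have "u (xs ! j) = \<zero>\<^bsub>R\<^esub>" "w (xs ! j) = \<zero>\<^bsub>R\<^esub>" using that z w(3) by (auto simp: k_def)
              then show ?thesis using dv[of "xs ! j"] c(1) by simp
            qed
            then have "d \<in> U" using IH[OF dU'] by blast
            moreover have "u = d \<oplus>\<^bsub>?V\<^esub> c \<odot>\<^bsub>?V\<^esub> w"
            proof
              fix x
              have "u x \<oplus>\<^bsub>R\<^esub> \<ominus>\<^bsub>R\<^esub> (c \<otimes>\<^bsub>R\<^esub> w x) \<oplus>\<^bsub>R\<^esub> c \<otimes>\<^bsub>R\<^esub> w x = u x"
                using c(1) val[OF u] val[OF w'] by (simp add: R.a_assoc R.l_neg)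
              then show "u x = (d \<oplus>\<^bsub>?V\<^esub> c \<odot>\<^bsub>?V\<^esub> w) x" using dv[of x] by (simp add: perm_gmod_simps)
            qed
            ultimately show ?thesis using V.gsub_add[OF U] V.gsub_smult[OF U c(1) w(1)] by simp
          qed
        qed
      qed
      have "U' \<subseteq> U" using red[of n] by auto
      then show False using sub by blast
    qed
    then show "L U \<subset> L U'" using le by blast
  qed
  then show ?thesis unfolding finite_length_def by (intro exI[of _ "\<lambda>U. card (L U)"]) simp
qed

lemma iso_of_equal_kernels:
  assumes A: "rep G R A" and B: "rep G R B" and D: "rep G R D"
    and k: "ghom G R A B k" "k ` carrier A = carrier B"
    and h: "ghom G R A D h" "h ` carrier A = carrier D"
    and ker: "\<And>a. a \<in> carrier A \<Longrightarrow> k a = \<zero>\<^bsub>B\<^esub> \<longleftrightarrow> h a = \<zero>\<^bsub>D\<^esub>"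
  shows "gmod_iso G R B D"
proof -
  interpret A: rep G R A by fact
  interpret B: rep G R B by fact
  interpret D: rep G R D by fact
  have eq: "k a = k b \<longleftrightarrow> h a = h b" if ab: "a \<in> carrier A" "b \<in> carrier A" for a b
  proof -
    have c: "k a \<in> carrier B" "k b \<in> carrier B" "h a \<in> carrier D" "h b \<in> carrier D"
      using ab ghom_closed[OF k(1)] ghom_closed[OF h(1)] by auto
    have "k a = k b \<longleftrightarrow> k a \<ominus>\<^bsub>B\<^esub> k b = \<zero>\<^bsub>B\<^esub>"
      using c(1,2) by (metis B.M.add.inv_solve_right B.M.l_zero B.M.minus_eq B.M.zero_closed)
    also have "\<dots> \<longleftrightarrow> h a \<ominus>\<^bsub>D\<^esub> h b = \<zero>\<^bsub>D\<^esub>"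
      using ker[of "a \<ominus>\<^bsub>A\<^esub> b"] ghom_diff[OF A B k(1) ab] ghom_diff[OF A D h(1) ab] ab by simp
    also have "\<dots> \<longleftrightarrow> h a = h b"
      using c(3,4) by (metis D.M.add.inv_solve_right D.M.l_zero D.M.minus_eq D.M.zero_closed)
    finally show ?thesis .
  qed
  define r where "r b = (SOME a. a \<in> carrier A \<and> k a = b)" for b
  have r: "r b \<in> carrier A" "k (r b) = b" if "b \<in> carrier B" for b
  proof -
    have "b \<in> k ` carrier A" using that by (simp add: k(2))
    then have "\<exists>a. a \<in> carrier A \<and> k a = b" by auto
    from someI_ex[OF this] show "r b \<in> carrier A" "k (r b) = b" unfolding r_def by auto
  qed
  define m where "m b = h (r b)" for b
  have mk: "m (k a) = h a" if a: "a \<in> carrier A" for a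
    unfolding m_def using eq[OF r(1)[OF ghom_closed[OF k(1) a]] a] r(2)[OF ghom_closed[OF k(1) a]] by simp
  have B_eq: "\<exists>a\<in>carrier A. b = k a" if b: "b \<in> carrier B" for b
    using r[OF b] by (intro bexI[of _ "r b"]) auto
  have "ghom G R B D m"
  proof (rule ghomI)
    fix b assume "b \<in> carrier B"
    then obtain a where a: "a \<in> carrier A" "b = k a" using B_eq[of b] by auto
    show "m b \<in> carrier D" using mk[OF a(1)] a(2) ghom_closed[OF h(1) a(1)] by simp
    show "m (x \<odot>\<^bsub>B\<^esub> b) = x \<odot>\<^bsub>D\<^esub> m b" if x: "x \<in> carrier R" for x
      using mk[OF A.smult_closed[OF x a(1)]] mk[OF a(1)] a(2) ghom_smult[OF k(1) x a(1)] ghom_smult[OF h(1) x a(1)] by simp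
    show "m (act B g b) = act D g (m b)" if g: "g \<in> carrier G" for g
      using mk[OF A.act_closed[OF g a(1)]] mk[OF a(1)] a(2) ghom_act[OF k(1) g a(1)] ghom_act[OF h(1) g a(1)] by simp
    fix b' assume "b' \<in> carrier B"
    then obtain a' where a': "a' \<in> carrier A" "b' = k a'" using B_eq[of b'] by auto
    show "m (b \<oplus>\<^bsub>B\<^esub> b') = m b \<oplus>\<^bsub>D\<^esub> m b'"
      using mk[OF A.M.a_closed[OF a(1) a'(1)]] mk[OF a(1)] mk[OF a'(1)] a(2) a'(2)
        ghom_add[OF k(1) a(1) a'(1)] ghom_add[OF h(1) a(1) a'(1)] by simp
  qed
  moreover have "bij_betw m (carrier B) (carrier D)"
  proof (rule bij_betw_imageI)
    show "inj_on m (carrier B)"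
    proof (rule inj_onI)
      fix b b' assume b: "b \<in> carrier B" "b' \<in> carrier B" "m b = m b'"
      obtain a where a: "a \<in> carrier A" "b = k a" using B_eq[OF b(1)] by auto
      obtain a' where "a' \<in> carrier A" "b' = k a'" using B_eq[OF b(2)] by auto
      with a have a: "a \<in> carrier A" "b = k a" "a' \<in> carrier A" "b' = k a'" by simp_all
      then show "b = b'" using b(3) mk eq[of a a'] by simp
    qed
    have "m ` carrier B = (\<lambda>a. m (k a)) ` carrier A" unfolding k(2)[symmetric] by (simp add: image_image)
    also have "\<dots> = h ` carrier A" using mk by (simp cong: image_cong_simp)
    finally show "m ` carrier B = carrier D" using h(2) by simp
  qed
  ultimately show ?thesis unfolding gmod_iso_ghom by blast
qed

lemma quot_gmod_projection:
  assumes V: "rep G R V" and U: "gsubmodule G R V U"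
  shows "rep G R (quot_gmod V U)" "ghom G R V (quot_gmod V U) (\<lambda>v. U +>\<^bsub>V\<^esub> v)"
    "(\<lambda>v. U +>\<^bsub>V\<^esub> v) ` carrier V = carrier (quot_gmod V U)"
    "\<And>v. v \<in> carrier V \<Longrightarrow> U +>\<^bsub>V\<^esub> v = \<zero>\<^bsub>quot_gmod V U\<^esub> \<longleftrightarrow> v \<in> U"
proof -
  interpret V: rep G R V by fact
  have g: "gmodule G R V" by (rule V.gmodule_axioms)
  interpret S: submodule U R V using U by (simp add: gsubmodule_def)
  interpret S: abelian_subgroup U V
    using S.subgroup_axioms
    by (intro abelian_subgroupI3) (auto simp: additive_subgroup_def V.M.abelian_group_axioms)
  show "rep G R (quot_gmod V U)" by (rule rep.intro[OF quot_gmod_gmodule(1)[OF g U]])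
  show "(\<lambda>v. U +>\<^bsub>V\<^esub> v) ` carrier V = carrier (quot_gmod V U)"
    by (auto simp: quot_gmod_def A_RCOSETS_def')
  then show "ghom G R V (quot_gmod V U) (\<lambda>v. U +>\<^bsub>V\<^esub> v)"
    using quot_gmod_gmodule(2,3)[OF g U]
    by (intro ghomI) (auto simp: quot_gmod_def S.a_rcos_sum)
  show "U +>\<^bsub>V\<^esub> v = \<zero>\<^bsub>quot_gmod V U\<^esub> \<longleftrightarrow> v \<in> U" if v: "v \<in> carrier V" for v
  proof -
    have "\<zero>\<^bsub>quot_gmod V U\<^esub> = U" by (simp add: quot_gmod_def)
    moreover have "U +>\<^bsub>V\<^esub> v = U \<longleftrightarrow> v \<in> U"
      using v S.a_rcos_self[OF v] S.a_rcos_const by blast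
    ultimately show ?thesis by simp
  qed
qed

section \<open>Scott modules\<close>

lemma ghom_restrict:
  assumes "ghom G R V W h" "U \<subseteq> carrier V"
  shows "ghom G R (V\<lparr>carrier := U\<rparr>) W h"
proof -
  have c: "u \<in> carrier V" if "u \<in> U" for u using that assms(2) by (rule subsetD[rotated])
  show ?thesis by (rule ghomI) (simp_all add: c ghom_closed[OF assms(1)] ghom_add[OF assms(1)]
      ghom_smult[OF assms(1)] ghom_act[OF assms(1)])
qed

context rep begin

lemma gsub_sum:
  assumes "gsubmodule G R V A" "gsubmodule G R V B"
  shows "gsubmodule G R V {a \<oplus>\<^bsub>V\<^esub> b | a b. a \<in> A \<and> b \<in> B}"
proof (rule gsubmoduleI)
  note A = gsub_carrier[OF assms(1)] and B = gsub_carrier[OF assms(2)]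
  let ?S = "{a \<oplus>\<^bsub>V\<^esub> b | a b. a \<in> A \<and> b \<in> B}"
  have I: "x \<in> ?S" if "x = a \<oplus>\<^bsub>V\<^esub> b" "a \<in> A" "b \<in> B" for x a b using that by auto
  show "?S \<subseteq> carrier V" using A B by auto
  show "\<zero>\<^bsub>V\<^esub> \<in> ?S" by (rule I[OF _ gsub_zero[OF assms(1)] gsub_zero[OF assms(2)]]) simp
  fix u assume "u \<in> ?S"
  then obtain a b where u: "u = a \<oplus>\<^bsub>V\<^esub> b" "a \<in> A" "b \<in> B" by auto
  show "c \<odot>\<^bsub>V\<^esub> u \<in> ?S" if "c \<in> carrier R" for c
    by (rule I[OF _ gsub_smult[OF assms(1) that u(2)] gsub_smult[OF assms(2) that u(3)]])
      (simp add: u A B that smult_r_distr)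
  show "act V g u \<in> ?S" if "g \<in> carrier G" for g
    by (rule I[OF _ gsub_act[OF assms(1) that u(2)] gsub_act[OF assms(2) that u(3)]])
      (simp add: u A B that act_add)
  fix w assume "w \<in> ?S"
  then obtain a' b' where w: "w = a' \<oplus>\<^bsub>V\<^esub> b'" "a' \<in> A" "b' \<in> B" by auto
  show "u \<oplus>\<^bsub>V\<^esub> w \<in> ?S"
    by (rule I[OF _ gsub_add[OF assms(1) u(2) w(2)] gsub_add[OF assms(2) u(3) w(3)]])
      (simp add: u w A B M.a_ac)
qed

lemma summand_of_summand:
  assumes d: "direct_sum2 G R V U W" and e: "direct_sum2 G R (V\<lparr>carrier := U\<rparr>) A B"
  shows "\<exists>W'. direct_sum2 G R V A W'"
proof -
  have U: "gsubmodule G R V U" "gsubmodule G R V W" "\<And>x. x \<in> U \<Longrightarrow> x \<in> W \<Longrightarrow> x = \<zero>\<^bsub>V\<^esub>"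
    "\<And>v. v \<in> carrier V \<Longrightarrow> \<exists>u\<in>U. \<exists>w\<in>W. v = u \<oplus>\<^bsub>V\<^esub> w"
    using d unfolding direct_sum2_iff by auto
  have AB: "gsubmodule G R V A" "gsubmodule G R V B" "A \<subseteq> U" "B \<subseteq> U"
    "\<And>x. x \<in> A \<Longrightarrow> x \<in> B \<Longrightarrow> x = \<zero>\<^bsub>V\<^esub>" "\<And>v. v \<in> U \<Longrightarrow> \<exists>u\<in>A. \<exists>w\<in>B. v = u \<oplus>\<^bsub>V\<^esub> w"
    using e unfolding direct_sum2_sub_iff[OF U(1)] by auto
  note c = gsub_carrier[OF AB(1)] gsub_carrier[OF AB(2)] gsub_carrier[OF U(2)]
  let ?S = "{b \<oplus>\<^bsub>V\<^esub> w | b w. b \<in> B \<and> w \<in> W}"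
  have "direct_sum2 G R V A ?S"
    unfolding direct_sum2_iff
  proof (intro conjI allI impI ballI AB(1) gsub_sum[OF AB(2) U(2)])
    fix x assume x: "x \<in> A" "x \<in> ?S"
    then obtain b w where bw: "b \<in> B" "w \<in> W" "x = b \<oplus>\<^bsub>V\<^esub> w" by auto
    have "x \<oplus>\<^bsub>V\<^esub> \<zero>\<^bsub>V\<^esub> = b \<oplus>\<^bsub>V\<^esub> w" using c(1)[OF x(1)] bw(3) by simp
    from gsub_cancel(1)[OF U(1,2,3) _ _ gsub_zero[OF U(2)] bw(2) this] have "x = b"
      using x(1) bw(1) AB(3,4) by blast
    then show "x = \<zero>\<^bsub>V\<^esub>" using AB(5)[OF x(1)] bw(1) by simp
  next
    fix v assume "v \<in> carrier V"
    then obtain u w where uw: "u \<in> U" "w \<in> W" "v = u \<oplus>\<^bsub>V\<^esub> w" using U(4)[of v] by auto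
    obtain a b where ab: "a \<in> A" "b \<in> B" "u = a \<oplus>\<^bsub>V\<^esub> b" using AB(6)[OF uw(1)] by auto
    have "v = a \<oplus>\<^bsub>V\<^esub> (b \<oplus>\<^bsub>V\<^esub> w)" using uw ab c by (simp add: M.a_assoc)
    moreover have "b \<oplus>\<^bsub>V\<^esub> w \<in> ?S" using ab uw by auto
    ultimately show "\<exists>a\<in>A. \<exists>s\<in>?S. v = a \<oplus>\<^bsub>V\<^esub> s" using ab(1) by (intro bexI)
  qed
  then show ?thesis by (rule exI)
qed

end

lemma trivial_gmod_rep:
  assumes "group G" "field R"
  shows "rep G R (trivial_gmod R :: ('f, 'f, 'g) gmod)"
proof -
  interpret R: field R by fact
  let ?T = "trivial_gmod R :: ('f, 'f, 'g) gmod"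
  have "abelian_group ?T"
    by (rule abelian_groupI) (auto simp: trivial_gmod_def R.a_ac intro: R.l_neg)
  moreover from this have "module R ?T"
    by (intro moduleI) (auto simp: trivial_gmod_def R.is_cring R.l_distr R.r_distr R.m_assoc)
  moreover have "gmodule_axioms G R ?T" by standard (auto simp: trivial_gmod_def)
  ultimately show ?thesis by (intro rep.intro gmodule.intro assms(1))
qed

lemma finsum_apply:
  fixes V :: "('f, 'x \<Rightarrow> 'f, 'g) gmod"
  assumes "rep G R V" "\<And>v w. v \<oplus>\<^bsub>V\<^esub> w = (\<lambda>x. v x \<oplus>\<^bsub>R\<^esub> w x)" "\<zero>\<^bsub>V\<^esub> = (\<lambda>x. \<zero>\<^bsub>R\<^esub>)"
    and val: "\<And>v x. v \<in> carrier V \<Longrightarrow> v x \<in> carrier R"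
    and "finite A" "f \<in> A \<rightarrow> carrier V"
  shows "finsum V f A x = (\<Oplus>\<^bsub>R\<^esub>a\<in>A. f a x)"
proof -
  interpret rep G R V by fact
  show ?thesis using assms(5,6)
  proof (induction A)
    case empty
    then show ?case by (simp add: assms(3))
  next
    case (insert a A)
    then have c: "f \<in> A \<rightarrow> carrier V" "f a \<in> carrier V" by auto
    then have d: "(\<lambda>a. f a x) \<in> A \<rightarrow> carrier R" "f a x \<in> carrier R" using val by auto
    have "finsum V f (insert a A) = f a \<oplus>\<^bsub>V\<^esub> finsum V f A" using c insert.hyps by simp
    then have "finsum V f (insert a A) x = f a x \<oplus>\<^bsub>R\<^esub> (\<Oplus>\<^bsub>R\<^esub>a\<in>A. f a x)"
      using insert.IH[OF c(1)] by (simp add: assms(2))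
    also have "\<dots> = (\<Oplus>\<^bsub>R\<^esub>a\<in>insert a A. f a x)"
      using insert.hyps d by (intro R.finsum_insert[symmetric]) auto
    finally show ?case .
  qed
qed

locale scott_setting = G: group G + F: field F
  for G :: "('g, 'a) monoid_scheme" (structure) and F :: "('f, 'b) ring_scheme" +
  fixes p :: nat and Q :: "'g set"
  assumes finite_G: "finite (carrier G)"
    and char_F: "ring_char F = p" and p_pos: "p > 0"
    and Q_p: "p_subgroup p G Q"
begin

abbreviation "cosets \<equiv> lcosets Q"
abbreviation "C \<equiv> coset_gmod G F Q"

definition \<Sigma> :: "'g set \<Rightarrow> 'f" where
  "\<Sigma> = (\<lambda>x. if x \<in> cosets then \<one>\<^bsub>F\<^esub> else \<zero>\<^bsub>F\<^esub>)"

lemma Q_sub: "subgroup Q G" using Q_p by (simp add: p_subgroup_def)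

lemma Q_carrier: "q \<in> Q \<Longrightarrow> q \<in> carrier G" using subgroup.mem_carrier[OF Q_sub] .

lemma Q_subset: "Q \<subseteq> carrier G" using Q_carrier by blast

lemma coset_rep: "x \<in> cosets \<Longrightarrow> \<exists>g\<in>carrier G. x = g <# Q"
  by (auto simp: LCOSETS_def)

lemma coset_mem: "g \<in> carrier G \<Longrightarrow> g <# Q \<in> cosets"
  by (auto simp: LCOSETS_def)

lemma Q_mem: "Q \<in> cosets"
  using coset_mem[of "\<one>"] G.lcos_mult_one[OF Q_subset] by simp

lemma coset_act: "g \<in> carrier G \<Longrightarrow> h \<in> carrier G \<Longrightarrow> g <# (h <# Q) = (g \<otimes> h) <# Q"
  by (rule G.lcos_m_assoc[OF Q_subset])

lemma coset_act_closed: "g \<in> carrier G \<Longrightarrow> x \<in> cosets \<Longrightarrow> g <# x \<in> cosets"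
  using coset_rep[of x] coset_act coset_mem by force

lemma coset_act_one: "x \<in> cosets \<Longrightarrow> \<one> <# x = x"
  using coset_rep[of x] coset_act by force

lemma coset_act_mult:
  "g \<in> carrier G \<Longrightarrow> h \<in> carrier G \<Longrightarrow> x \<in> cosets \<Longrightarrow> (g \<otimes> h) <# x = g <# (h <# x)"
  using coset_rep[of x] coset_act by (force simp: G.m_assoc)

lemma coset_act_inv: "g \<in> carrier G \<Longrightarrow> x \<in> cosets \<Longrightarrow> inv g <# (g <# x) = x"
  "g \<in> carrier G \<Longrightarrow> x \<in> cosets \<Longrightarrow> g <# (inv g <# x) = x"
  using coset_act_mult[of "inv g" g x] coset_act_mult[of g "inv g" x] coset_act_one[of x] by auto

lemma coset_eq_iff:
  assumes "g \<in> carrier G" "h \<in> carrier G"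
  shows "g <# Q = h <# Q \<longleftrightarrow> inv g \<otimes> h \<in> Q"
proof
  assume "g <# Q = h <# Q"
  then have "h \<in> g <# Q" using G.lcos_self[OF assms(2) Q_sub] by simp
  then show "inv g \<otimes> h \<in> Q" using subgroup.lcos_module_imp[OF Q_sub G.is_group assms(1)] by simp
next
  assume "inv g \<otimes> h \<in> Q"
  then have "g \<otimes> (inv g \<otimes> h) \<in> g <# Q" unfolding l_coset_def by blast
  then have "h \<in> g <# Q" using assms by (simp add: G.m_assoc[symmetric])
  from G.l_repr_independence[OF this assms(1) Q_sub] show "g <# Q = h <# Q" .
qed

lemma coset_fix: "q \<in> Q \<Longrightarrow> q <# Q = Q"
  using coset_eq_iff[of "\<one>" q] G.lcos_mult_one[OF Q_subset] Q_carrier[of q] by simp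

lemma finite_cosets: "finite cosets"
  unfolding LCOSETS_def using finite_G by simp

lemma C_rep: "rep G F C"
  unfolding coset_gmod_def
  by (intro rep.intro perm_gmod_gmodule G.is_group F.is_cring coset_act_closed coset_act_one coset_act_mult)

lemma C_carrier: "v \<in> carrier C \<longleftrightarrow> (\<forall>x\<in>cosets. v x \<in> carrier F) \<and> (\<forall>x. x \<notin> cosets \<longrightarrow> v x = \<zero>\<^bsub>F\<^esub>)"
  unfolding coset_gmod_def by (rule perm_gmod_carrier[OF finite_cosets])

lemma C_value: "v \<in> carrier C \<Longrightarrow> v x \<in> carrier F"
  unfolding coset_gmod_def by (rule perm_gmod_value[OF F.is_cring])

lemma C_simps:
  "\<zero>\<^bsub>C\<^esub> = (\<lambda>x. \<zero>\<^bsub>F\<^esub>)" "v \<oplus>\<^bsub>C\<^esub> w = (\<lambda>x. v x \<oplus>\<^bsub>F\<^esub> w x)" "a \<odot>\<^bsub>C\<^esub> v = (\<lambda>x. a \<otimes>\<^bsub>F\<^esub> v x)"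
  "act C g v = (\<lambda>x. if x \<in> cosets then v (inv g <# x) else \<zero>\<^bsub>F\<^esub>)"
  by (simp_all add: coset_gmod_def perm_gmod_simps)

lemma \<Sigma>_in: "\<Sigma> \<in> carrier C" unfolding C_carrier \<Sigma>_def by auto

lemma \<Sigma>_act: "g \<in> carrier G \<Longrightarrow> act C g \<Sigma> = \<Sigma>"
  unfolding C_simps \<Sigma>_def using coset_act_closed by auto

lemma fixed_vector:
  assumes "v \<in> carrier C" "\<And>g. g \<in> carrier G \<Longrightarrow> act C g v = v"
  shows "v = v Q \<odot>\<^bsub>C\<^esub> \<Sigma>"
proof
  fix x
  show "v x = (v Q \<odot>\<^bsub>C\<^esub> \<Sigma>) x"
  proof (cases "x \<in> cosets")
    case True
    then obtain g where g: "g \<in> carrier G" "x = g <# Q" using coset_rep by blast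
    have "v x = act C g v x" using assms(2)[OF g(1)] by simp
    also have "\<dots> = v Q" using True g coset_act_inv(1)[OF g(1) Q_mem] by (simp add: C_simps)
    finally show ?thesis using True C_value[OF assms(1)] by (simp add: C_simps \<Sigma>_def)
  next
    case False
    then show ?thesis using assms(1) C_value[OF assms(1)] by (simp add: C_carrier C_simps \<Sigma>_def)
  qed
qed

lemma C_finite_length: "finite_length G F C"
  unfolding coset_gmod_def
  by (rule perm_gmod_finite_length[OF F.field_axioms finite_cosets C_rep[unfolded coset_gmod_def]])

text \<open>A summand of least rank among those that contain \<open>\<Sigma>\<close> is indecomposable: if it splits, then the
components of \<open>\<Sigma>\<close> are fixed vectors, hence multiples of \<open>\<Sigma>\<close>, so one of the two parts contains \<open>\<Sigma>\<close>.\<close>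

lemma \<Sigma>_summand:
  "\<exists>U. (\<exists>W. direct_sum2 G F C U W) \<and> indecomposable G F (C\<lparr>carrier := U\<rparr>) \<and> \<Sigma> \<in> U"
proof -
  interpret C: rep G F C by (rule C_rep)
  obtain \<mu> :: "('g set \<Rightarrow> 'f) set \<Rightarrow> nat" where
    \<mu>: "\<forall>U U'. gsubmodule G F C U \<longrightarrow> gsubmodule G F C U' \<longrightarrow> U \<subset> U' \<longrightarrow> \<mu> U < \<mu> U'"
    using C_finite_length unfolding finite_length_def by (rule exE)
  define P where "P U \<longleftrightarrow> (\<exists>W. direct_sum2 G F C U W) \<and> \<Sigma> \<in> U" for U
  have "direct_sum2 G F C (carrier C) {\<zero>\<^bsub>C\<^esub>}"
    unfolding C.direct_sum2_iff using C.carrier_gsub C.zero_gsub by auto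
  then have "P (carrier C)" unfolding P_def using \<Sigma>_in by blast
  then obtain U where U: "P U" "\<And>U'. P U' \<Longrightarrow> \<mu> U \<le> \<mu> U'"
    using ex_has_least_nat[of P "carrier C" \<mu>] by auto
  obtain W where d: "direct_sum2 G F C U W" and \<Sigma>U: "\<Sigma> \<in> U" using U(1) unfolding P_def by auto
  have gU: "gsubmodule G F C U" using d unfolding C.direct_sum2_iff by simp
  have part: "B = {\<zero>\<^bsub>C\<^esub>}" if e: "direct_sum2 G F (C\<lparr>carrier := U\<rparr>) A B" and \<Sigma>A: "\<Sigma> \<in> A" for A B
  proof -
    have AB: "gsubmodule G F C A" "gsubmodule G F C B" "A \<subseteq> U" "B \<subseteq> U" "\<And>x. x \<in> A \<Longrightarrow> x \<in> B \<Longrightarrow> x = \<zero>\<^bsub>C\<^esub>"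
      using e unfolding C.direct_sum2_sub_iff[OF gU] by auto
    have "P A" unfolding P_def using C.summand_of_summand[OF d e] \<Sigma>A by simp
    then have "\<not> A \<subset> U" using U(2)[of A] \<mu>[rule_format, OF AB(1) gU] by auto
    then have "A = U" using AB(3) by blast
    then show ?thesis using AB(4,5) C.gsub_zero[OF AB(2)] by blast
  qed
  have "indecomposable G F (C\<lparr>carrier := U\<rparr>)"
    unfolding indecomposable_def
  proof (intro conjI allI impI)
    have "\<Sigma> Q \<noteq> \<zero>\<^bsub>C\<^esub> Q" using Q_mem by (simp add: \<Sigma>_def C_simps)
    then show "carrier (C\<lparr>carrier := U\<rparr>) \<noteq> {\<zero>\<^bsub>C\<lparr>carrier := U\<rparr>\<^esub>}" using \<Sigma>U by auto
  next
    fix A B assume e: "direct_sum2 G F (C\<lparr>carrier := U\<rparr>) A B"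
    then have AB: "gsubmodule G F C A" "gsubmodule G F C B" "\<And>x. x \<in> A \<Longrightarrow> x \<in> B \<Longrightarrow> x = \<zero>\<^bsub>C\<^esub>"
      "\<forall>v\<in>U. \<exists>u\<in>A. \<exists>w\<in>B. v = u \<oplus>\<^bsub>C\<^esub> w"
      unfolding C.direct_sum2_sub_iff[OF gU] by auto
    obtain a b where ab: "a \<in> A" "b \<in> B" "\<Sigma> = a \<oplus>\<^bsub>C\<^esub> b" using AB(4) \<Sigma>U by auto
    note ca = C.gsub_carrier[OF AB(1) ab(1)] and cb = C.gsub_carrier[OF AB(2) ab(2)]
    have fxd: "act C g a = a \<and> act C g b = b" if g: "g \<in> carrier G" for g
    proof -
      have "act C g a \<oplus>\<^bsub>C\<^esub> act C g b = a \<oplus>\<^bsub>C\<^esub> b"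
        using C.act_add[OF g ca cb] ab(3) \<Sigma>_act[OF g] by simp
      note cancel = C.gsub_cancel[OF AB(1,2,3) C.gsub_act[OF AB(1) g ab(1)] ab(1) C.gsub_act[OF AB(2) g ab(2)] ab(2) this]
      show ?thesis by (intro conjI; (rule cancel(1) | rule cancel(2)); assumption)
    qed
    have fa: "a = a Q \<odot>\<^bsub>C\<^esub> \<Sigma>" and fb: "b = b Q \<odot>\<^bsub>C\<^esub> \<Sigma>"
      by (rule fixed_vector[OF ca], simp add: fxd, rule fixed_vector[OF cb], simp add: fxd)
    have sc: "\<Sigma> \<in> Z" if Z: "gsubmodule G F C Z" "z \<in> Z" "z = z Q \<odot>\<^bsub>C\<^esub> \<Sigma>" "z Q \<noteq> \<zero>\<^bsub>F\<^esub>" for z Z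
    proof -
      have zc: "z Q \<in> carrier F" by (rule C_value[OF C.gsub_carrier[OF Z(1,2)]])
      have i: "inv\<^bsub>F\<^esub> (z Q) \<in> carrier F" "inv\<^bsub>F\<^esub> (z Q) \<otimes>\<^bsub>F\<^esub> z Q = \<one>\<^bsub>F\<^esub>"
        using zc Z(4) by (auto simp: F.field_Units)
      have "inv\<^bsub>F\<^esub> (z Q) \<odot>\<^bsub>C\<^esub> (z Q \<odot>\<^bsub>C\<^esub> \<Sigma>) = \<Sigma>"
        using C.smult_assoc1[OF i(1) zc \<Sigma>_in] i(2) \<Sigma>_in by simp
      then show ?thesis using C.gsub_smult[OF Z(1) i(1) Z(2)] Z(3) by simp
    qed
    have "\<Sigma> Q = a Q \<oplus>\<^bsub>F\<^esub> b Q" using ab(3) by (simp add: C_simps)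
    moreover have "\<Sigma> Q = \<one>\<^bsub>F\<^esub>" using Q_mem by (simp add: \<Sigma>_def)
    ultimately have "a Q \<oplus>\<^bsub>F\<^esub> b Q \<noteq> \<zero>\<^bsub>F\<^esub>" by (metis F.one_not_zero)
    then have "a Q \<noteq> \<zero>\<^bsub>F\<^esub> \<or> b Q \<noteq> \<zero>\<^bsub>F\<^esub>" by auto
    then have "\<Sigma> \<in> A \<or> \<Sigma> \<in> B" using sc[OF AB(1) ab(1) fa] sc[OF AB(2) ab(2) fb] by blast
    then show "A = {\<zero>\<^bsub>C\<lparr>carrier := U\<rparr>\<^esub>} \<or> B = {\<zero>\<^bsub>C\<lparr>carrier := U\<rparr>\<^esub>}"
      using part[OF e] part[OF rep.direct_sum2_swap[OF C.gsub_rep[OF gU] e]] by auto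
  qed
  then show ?thesis using d \<Sigma>U by blast
qed

definition aug :: "('g set \<Rightarrow> 'f) \<Rightarrow> 'f" where "aug v = (\<Oplus>\<^bsub>F\<^esub>x\<in>cosets. v x)"

lemma coset_bij: "g \<in> carrier G \<Longrightarrow> bij_betw (\<lambda>x. g <# x) cosets cosets"
  by (rule bij_betw_byWitness[of _ "\<lambda>x. inv g <# x"])
    (auto simp: coset_act_inv coset_act_closed)

lemma aug_ghom: "ghom G F C (trivial_gmod F) aug"
proof (rule ghomI)
  fix v assume v: "v \<in> carrier C"
  have vP: "v \<in> A \<rightarrow> carrier F" for A using C_value[OF v] by auto
  show "aug v \<in> carrier (trivial_gmod F)" unfolding aug_def trivial_gmod_def using vP by auto
  show "aug (v \<oplus>\<^bsub>C\<^esub> w) = aug v \<oplus>\<^bsub>trivial_gmod F\<^esub> aug w" if w: "w \<in> carrier C" for w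
    unfolding aug_def trivial_gmod_def C_simps using vP C_value[OF w] by (simp add: F.finsum_addf)
  show "aug (a \<odot>\<^bsub>C\<^esub> v) = a \<odot>\<^bsub>trivial_gmod F\<^esub> aug v" if a: "a \<in> carrier F" for a
    unfolding aug_def trivial_gmod_def C_simps using vP a finite_cosets by (simp add: F.finsum_rdistr)
  show "aug (act C g v) = act (trivial_gmod F) g (aug v)" if g: "g \<in> carrier G" for g
  proof -
    have gi: "inv g \<in> carrier G" using g by simp
    note b = coset_bij[OF gi]
    have "aug (act C g v) = (\<Oplus>\<^bsub>F\<^esub>x\<in>cosets. v (inv g <# x))"
      unfolding aug_def C_simps by (rule F.finsum_cong') (use C_value[OF v] in auto)
    also have "\<dots> = (\<Oplus>\<^bsub>F\<^esub>x\<in>(\<lambda>x. inv g <# x) ` cosets. v x)"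
      by (rule F.finsum_reindex[symmetric]) (use vP bij_betw_imp_inj_on[OF b] in auto)
    also have "\<dots> = aug v" unfolding bij_betw_imp_surj_on[OF b] aug_def ..
    finally show ?thesis by (simp add: trivial_gmod_def)
  qed
qed

abbreviation "fixed_cosets \<equiv> {x \<in> cosets. \<forall>q\<in>Q. q <# x = x}"

lemma Q_invariant_sum:
  assumes "\<And>x. x \<in> cosets \<Longrightarrow> f x \<in> carrier F"
    and "\<And>q x. q \<in> Q \<Longrightarrow> x \<in> cosets \<Longrightarrow> f (q <# x) = f x"
  shows "(\<Oplus>\<^bsub>F\<^esub>x\<in>cosets. f x) = (\<Oplus>\<^bsub>F\<^esub>x\<in>fixed_cosets. f x)"
proof -
  let ?H = "G\<lparr>carrier := Q\<rparr>"
  have H: "group ?H" by (rule G.subgroup_imp_group[OF Q_sub])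
  obtain k where k: "card Q = p ^ k" using Q_p by (auto simp: p_subgroup_def)
  have "(\<Oplus>\<^bsub>F\<^esub>x\<in>cosets. f x) = (\<Oplus>\<^bsub>F\<^esub>x\<in>{x \<in> cosets. \<forall>q\<in>carrier ?H. q <# x = x}. f x)"
    by (rule p_group_sum[OF F.field_axioms char_F p_pos H, of k])
      (use k finite_cosets assms coset_act_closed coset_act_one coset_act_mult Q_carrier in auto)
  then show ?thesis by simp
qed

definition crep :: "'g set \<Rightarrow> 'g" where "crep x = (SOME g. g \<in> carrier G \<and> x = g <# Q)"

lemma crep: "x \<in> cosets \<Longrightarrow> crep x \<in> carrier G" "x \<in> cosets \<Longrightarrow> crep x <# Q = x"
proof -
  assume "x \<in> cosets"
  then have "\<exists>g. g \<in> carrier G \<and> x = g <# Q" using coset_rep[of x] by auto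
  from someI_ex[OF this] show "crep x \<in> carrier G" "crep x <# Q = x" unfolding crep_def by auto
qed

text \<open>The coset \<open>g Q\<close> is fixed by \<open>Q\<close> if and only if \<open>g\<close> normalises \<open>Q\<close>, because \<open>Q\<close> is finite.\<close>

lemma fixed_coset_inverse:
  assumes g: "g \<in> carrier G" and fxd: "g <# Q \<in> fixed_cosets"
  shows "inv g <# Q \<in> fixed_cosets"
proof -
  have conj: "inv g \<otimes> q \<otimes> g \<in> Q" if q: "q \<in> Q" for q
  proof -
    have "(q \<otimes> g) <# Q = g <# Q" using fxd q coset_act[OF Q_carrier[OF q] g] by auto
    then show ?thesis using coset_eq_iff[OF g, of "q \<otimes> g"] g Q_carrier[OF q] by (simp add: G.m_assoc)
  qed
  define c where "c q = inv g \<otimes> q \<otimes> g" for q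
  have conj_back: "g \<otimes> c q \<otimes> inv g = q" if "q \<in> carrier G" for q
  proof -
    have "g \<otimes> (inv g \<otimes> q) = q" using g that by (simp add: G.m_assoc[symmetric])
    then show ?thesis using g that by (simp add: c_def G.m_assoc)
  qed
  have "inj_on c Q"
  proof (rule inj_onI)
    fix q q' assume "q \<in> Q" "q' \<in> Q" "c q = c q'"
    then show "q = q'" using conj_back[OF Q_carrier] by metis
  qed
  moreover have "c ` Q \<subseteq> Q" using conj by (auto simp: c_def)
  moreover have "finite Q" using finite_subset[OF Q_subset finite_G] .
  ultimately have im: "c ` Q = Q" by (simp add: endo_inj_surj)
  have "q <# (inv g <# Q) = inv g <# Q" if q: "q \<in> Q" for q
  proof -
    obtain q' where q': "q' \<in> Q" "q = c q'" using im q by blast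
    have qc: "q \<in> carrier G" "q' \<in> carrier G" using Q_carrier q q' by auto
    have "g \<otimes> (q \<otimes> inv g) = q'" using conj_back[OF qc(2)] q'(2) g qc by (simp add: G.m_assoc)
    then have "inv (inv g) \<otimes> (q \<otimes> inv g) \<in> Q" using q'(1) g by simp
    then have "inv g <# Q = (q \<otimes> inv g) <# Q"
      using coset_eq_iff[of "inv g" "q \<otimes> inv g"] g qc by simp
    then show ?thesis using coset_act[OF qc(1), of "inv g"] g by simp
  qed
  then show ?thesis using coset_mem g by simp
qed

lemma basis_in: "x \<in> cosets \<Longrightarrow> basis_elt F x \<in> carrier C"
  unfolding coset_gmod_def by (rule basis_elt_in[OF F.is_cring])

lemma basis_act: "g \<in> carrier G \<Longrightarrow> x \<in> cosets \<Longrightarrow> basis_elt F (g <# x) = act C g (basis_elt F x)"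
  unfolding coset_gmod_def by (rule basis_elt_act[symmetric]) (auto simp: coset_act_closed coset_act_inv)

lemma \<Sigma>_sum: "\<Sigma> = finsum C (basis_elt F) cosets"
proof
  fix y
  have d: "basis_elt F \<in> cosets \<rightarrow> carrier C" using basis_in by auto
  have "finsum C (basis_elt F) cosets y = (\<Oplus>\<^bsub>F\<^esub>x\<in>cosets. basis_elt F x y)"
    by (rule finsum_apply[OF C_rep]) (use C_value finite_cosets d in \<open>auto simp: C_simps\<close>)
  also have "\<dots> = \<Sigma> y"
  proof (cases "y \<in> cosets")
    case True
    then show ?thesis
      using F.finsum_singleton[OF True finite_cosets, of "\<lambda>_. \<one>\<^bsub>F\<^esub>"] by (simp add: \<Sigma>_def basis_elt_def)
  next
    case False
    then have "(\<Oplus>\<^bsub>F\<^esub>x\<in>cosets. basis_elt F x y) = (\<Oplus>\<^bsub>F\<^esub>x\<in>cosets. \<zero>\<^bsub>F\<^esub>)"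
      by (intro F.finsum_cong') (auto simp: basis_elt_def)
    then show ?thesis using False by (simp add: \<Sigma>_def)
  qed
  finally show "\<Sigma> y = finsum C (basis_elt F) cosets y" by simp
qed

text \<open>If \<open>u\<close> is the projection of the
  coset \<open>Q\<close>, then both the coefficient of \<open>Q\<close> in \<open>\<Sigma> = \<Sum> g u\<close> and the augmentation of \<open>u\<close> reduce
  modulo \<open>p\<close> to a sum over the cosets fixed by \<open>Q\<close>; inversion matches the two sums.\<close>

lemma aug_nonzero:
  assumes d: "direct_sum2 G F C U W" and \<Sigma>U: "\<Sigma> \<in> U"
  shows "\<exists>u\<in>U. aug u = \<one>\<^bsub>F\<^esub>"
proof -
  interpret C: rep G F C by (rule C_rep)
  obtain \<pi> where \<pi>: "ghom G F C (C\<lparr>carrier := U\<rparr>) \<pi>" "\<And>u. u \<in> U \<Longrightarrow> \<pi> u = u"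
    by (rule C.direct_sum2_projection[OF d]) (rule that, assumption, blast)
  have U: "gsubmodule G F C U" using d unfolding C.direct_sum2_iff by simp
  define u where "u = \<pi> (basis_elt F Q)"
  define b where "b x = \<pi> (basis_elt F x) Q" for x
  have \<pi>c: "\<pi> v \<in> U" if "v \<in> carrier C" for v using ghom_closed[OF \<pi>(1) that] by simp
  have uU: "u \<in> U" unfolding u_def by (rule \<pi>c[OF basis_in[OF Q_mem]])
  have uC: "u \<in> carrier C" by (rule C.gsub_carrier[OF U uU])
  have \<pi>act: "\<pi> (basis_elt F (g <# x)) y = \<pi> (basis_elt F x) (inv g <# y)"
    if "g \<in> carrier G" "x \<in> cosets" "y \<in> cosets" for g x y
    unfolding basis_act[OF that(1,2)] using ghom_act[OF \<pi>(1) that(1) basis_in[OF that(2)]] that(3) by (simp add: C_simps)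
  have bc: "b x \<in> carrier F" if "x \<in> cosets" for x
    unfolding b_def by (rule C_value[OF C.gsub_carrier[OF U \<pi>c[OF basis_in[OF that]]]])
  have bu: "b (g <# Q) = u (inv g <# Q)" if "g \<in> carrier G" for g
    unfolding b_def u_def by (rule \<pi>act[OF that Q_mem Q_mem])
  have binv: "b (q <# x) = b x" if "q \<in> Q" "x \<in> cosets" for q x
    unfolding b_def using \<pi>act[OF Q_carrier[OF that(1)] that(2) Q_mem]
      coset_fix[OF subgroup.m_inv_closed[OF Q_sub that(1)]] by simp
  have uinv: "u (q <# x) = u x" if q: "q \<in> Q" and x: "x \<in> cosets" for q x
  proof -
    have "inv q \<in> Q" using subgroup.m_inv_closed[OF Q_sub q] .
    from coset_fix[OF this] \<pi>act[OF Q_carrier[OF this] Q_mem x] show ?thesis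
      using Q_carrier[OF q] by (simp add: u_def)
  qed
  have "\<Sigma> = \<pi> (finsum C (basis_elt F) cosets)" using \<pi>(2)[OF \<Sigma>U] \<Sigma>_sum by simp
  also have "\<dots> = finsum (C\<lparr>carrier := U\<rparr>) (\<lambda>x. \<pi> (basis_elt F x)) cosets"
    by (rule ghom_finsum[OF C_rep C.gsub_rep[OF U] \<pi>(1) finite_cosets]) (use basis_in in auto)
  finally have "\<Sigma> Q = finsum (C\<lparr>carrier := U\<rparr>) (\<lambda>x. \<pi> (basis_elt F x)) cosets Q" by simp
  also have "\<dots> = (\<Oplus>\<^bsub>F\<^esub>x\<in>cosets. b x)"
    unfolding b_def
    by (rule finsum_apply[OF C.gsub_rep[OF U]])
      (use \<pi>c[OF basis_in] C_value[OF C.gsub_carrier[OF U]] finite_cosets in \<open>auto simp: C_simps\<close>)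
  also have "\<dots> = (\<Oplus>\<^bsub>F\<^esub>x\<in>fixed_cosets. b x)" by (rule Q_invariant_sum[OF bc binv])
  finally have 1: "(\<Oplus>\<^bsub>F\<^esub>x\<in>fixed_cosets. b x) = \<one>\<^bsub>F\<^esub>" using Q_mem by (simp add: \<Sigma>_def)
  note r = crep(1) crep(2)[symmetric]
  define i where "i x = inv (crep x) <# Q" for x
  have ic: "i x \<in> fixed_cosets" if x: "x \<in> fixed_cosets" for x
  proof -
    have "x \<in> cosets" using x by simp
    note rx = r[OF this]
    show ?thesis unfolding i_def by (rule fixed_coset_inverse[OF rx(1)]) (use x rx(2) in simp)
  qed
  have ii: "i (i x) = x" if x: "x \<in> fixed_cosets" for x
  proof -
    have xc: "x \<in> cosets" using x by simp
    note rx = r[OF xc]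
    have ixc: "i x \<in> cosets" using ic[OF x] by simp
    note rix = r[OF ixc]
    have ri: "inv (crep x) \<in> carrier G" using rx by simp
    have "inv (inv (crep x)) \<otimes> crep (i x) \<in> Q"
      using coset_eq_iff[OF ri rix(1)] rix(2) unfolding i_def by simp
    then have q: "crep x \<otimes> crep (i x) \<in> Q" using rx by simp
    define q where "q = crep x \<otimes> crep (i x)"
    have qQ: "q \<in> Q" using q by (simp add: q_def)
    have "inv (crep (i x)) = inv q \<otimes> crep x"
      using rx(1) rix(1) by (simp add: q_def G.inv_mult_group G.m_assoc)
    then have "i (i x) = (inv q \<otimes> crep x) <# Q" by (simp add: i_def)
    also have "\<dots> = inv q <# (crep x <# Q)" using rx(1) Q_carrier[OF qQ] by (simp add: coset_act)
    also have "\<dots> = x" using rx(2) x subgroup.m_inv_closed[OF Q_sub qQ] by simp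
    finally show ?thesis .
  qed
  have bi: "bij_betw i fixed_cosets fixed_cosets"
    by (rule bij_betw_byWitness[of _ i]) (use ic ii in blast)+
  have bx: "b x = u (i x)" if "x \<in> fixed_cosets" for x
  proof -
    have "x \<in> cosets" using that by simp
    note rx = r[OF this]
    show ?thesis using bu[OF rx(1)] rx(2) by (simp add: i_def)
  qed
  have uP: "u \<in> A \<rightarrow> carrier F" for A using C_value[OF uC] by auto
  have "aug u = (\<Oplus>\<^bsub>F\<^esub>x\<in>fixed_cosets. u x)"
    unfolding aug_def by (rule Q_invariant_sum) (use C_value[OF uC] uinv in auto)
  also have "\<dots> = (\<Oplus>\<^bsub>F\<^esub>x\<in>i ` fixed_cosets. u x)" unfolding bij_betw_imp_surj_on[OF bi] ..
  also have "\<dots> = (\<Oplus>\<^bsub>F\<^esub>x\<in>fixed_cosets. u (i x))"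
    by (rule F.finsum_reindex) (use uP bij_betw_imp_inj_on[OF bi] in auto)
  also have "\<dots> = (\<Oplus>\<^bsub>F\<^esub>x\<in>fixed_cosets. b x)"
    by (rule F.finsum_cong') (use bx bc in auto)
  finally show ?thesis using 1 uU by (intro bexI[of _ u]) simp_all
qed

lemma \<Sigma>_in_trivial_sub:
  assumes U: "gsubmodule G F C U" and t: "has_trivial_sub G F (C\<lparr>carrier := U\<rparr>)"
  shows "\<Sigma> \<in> U"
proof -
  interpret C: rep G F C by (rule C_rep)
  obtain T where T: "gsubmodule G F (C\<lparr>carrier := U\<rparr>) T"
    and iso: "gmod_iso G F (C\<lparr>carrier := U, carrier := T\<rparr>) (trivial_gmod F :: ('f, 'f, 'g) gmod)"
    using t unfolding has_trivial_sub_def by auto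
  have TC: "gsubmodule G F C T" "T \<subseteq> U" using T unfolding C.gsub_gsub[OF U] by auto
  let ?T = "C\<lparr>carrier := T\<rparr>"
  obtain h where h: "ghom G F ?T (trivial_gmod F :: ('f, 'f, 'g) gmod) h" "bij_betw h T (carrier F)"
    using iso unfolding gmod_iso_ghom by (auto simp: trivial_gmod_def)
  have "\<one>\<^bsub>F\<^esub> \<in> h ` T" using bij_betw_imp_surj_on[OF h(2)] by simp
  then obtain v where v: "v \<in> T" "h v = \<one>\<^bsub>F\<^esub>" by auto
  have vC: "v \<in> carrier C" by (rule C.gsub_carrier[OF TC(1) v(1)])
  have "act C g v = v" if g: "g \<in> carrier G" for g
  proof -
    have "h (act C g v) = h v" using ghom_act[OF h(1) g, of v] v(1) by (simp add: trivial_gmod_def)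
    then show ?thesis
      using inj_onD[OF bij_betw_imp_inj_on[OF h(2)], of "act C g v" v] C.gsub_act[OF TC(1) g v(1)] v(1) by simp
  qed
  from fixed_vector[OF vC this] have vs: "v = v Q \<odot>\<^bsub>C\<^esub> \<Sigma>" .
  have vQ: "v Q \<in> carrier F" by (rule C_value[OF vC])
  have "v Q \<noteq> \<zero>\<^bsub>F\<^esub>"
  proof
    assume "v Q = \<zero>\<^bsub>F\<^esub>"
    then have "v = \<zero>\<^bsub>C\<^esub>" using vs \<Sigma>_in by simp
    then have "h v = \<zero>\<^bsub>F\<^esub>"
      using ghom_zero[OF C.gsub_rep[OF TC(1)] trivial_gmod_rep[OF G.is_group F.field_axioms] h(1)]
      by (simp add: trivial_gmod_def)
    then show False using v(2) by simp
  qed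
  then have i: "inv\<^bsub>F\<^esub> (v Q) \<in> carrier F" "inv\<^bsub>F\<^esub> (v Q) \<otimes>\<^bsub>F\<^esub> v Q = \<one>\<^bsub>F\<^esub>"
    using vQ by (auto simp: F.field_Units)
  have "inv\<^bsub>F\<^esub> (v Q) \<odot>\<^bsub>C\<^esub> (v Q \<odot>\<^bsub>C\<^esub> \<Sigma>) = \<Sigma>"
    using C.smult_assoc1[OF i(1) vQ \<Sigma>_in] i(2) \<Sigma>_in by simp
  then have "\<Sigma> \<in> T" using C.gsub_smult[OF TC(1) i(1) v(1)] vs by simp
  then show ?thesis using TC(2) by blast
qed

lemma has_trivial_sub_\<Sigma>:
  assumes U: "gsubmodule G F C U" and \<Sigma>U: "\<Sigma> \<in> U"
  shows "has_trivial_sub G F (C\<lparr>carrier := U\<rparr>)"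
proof -
  interpret C: rep G F C by (rule C_rep)
  let ?T = "{a \<odot>\<^bsub>C\<^esub> \<Sigma> | a. a \<in> carrier F}"
  have val: "(a \<odot>\<^bsub>C\<^esub> \<Sigma>) Q = a" if "a \<in> carrier F" for a using that Q_mem by (simp add: C_simps \<Sigma>_def)
  have I: "v \<in> ?T" if "v = a \<odot>\<^bsub>C\<^esub> \<Sigma>" "a \<in> carrier F" for v a using that by auto
  have T: "gsubmodule G F C ?T"
  proof (rule C.gsubmoduleI)
    show "?T \<subseteq> carrier C" using \<Sigma>_in by auto
    show "\<zero>\<^bsub>C\<^esub> \<in> ?T" by (rule I[of _ "\<zero>\<^bsub>F\<^esub>"]) (use \<Sigma>_in in auto)
  next
    fix u w assume "u \<in> ?T" "w \<in> ?T"
    then obtain a b where "u = a \<odot>\<^bsub>C\<^esub> \<Sigma>" "a \<in> carrier F" "w = b \<odot>\<^bsub>C\<^esub> \<Sigma>" "b \<in> carrier F" by auto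
    then show "u \<oplus>\<^bsub>C\<^esub> w \<in> ?T" by (intro I[of _ "a \<oplus>\<^bsub>F\<^esub> b"]) (auto simp: C.smult_l_distr \<Sigma>_in)
  next
    fix a u assume a: "a \<in> carrier F" and "u \<in> ?T"
    then obtain b where "u = b \<odot>\<^bsub>C\<^esub> \<Sigma>" "b \<in> carrier F" by auto
    then show "a \<odot>\<^bsub>C\<^esub> u \<in> ?T" using a by (intro I[of _ "a \<otimes>\<^bsub>F\<^esub> b"]) (auto simp: C.smult_assoc1 \<Sigma>_in)
  next
    fix g u assume g: "g \<in> carrier G" and "u \<in> ?T"
    then obtain b where b: "u = b \<odot>\<^bsub>C\<^esub> \<Sigma>" "b \<in> carrier F" by auto
    then show "act C g u \<in> ?T" using C.act_smult[OF g b(2) \<Sigma>_in] \<Sigma>_act[OF g] by (intro I[of _ b]) auto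
  qed
  have TU: "?T \<subseteq> U" using C.gsub_smult[OF U _ \<Sigma>U] by auto
  have "ghom G F (C\<lparr>carrier := ?T\<rparr>) (trivial_gmod F :: ('f, 'f, 'g) gmod) (\<lambda>v. v Q)"
  proof (rule ghomI)
    fix v assume "v \<in> carrier (C\<lparr>carrier := ?T\<rparr>)"
    then obtain a where v: "v = a \<odot>\<^bsub>C\<^esub> \<Sigma>" "a \<in> carrier F" by auto
    show "v Q \<in> carrier (trivial_gmod F :: ('f, 'f, 'g) gmod)" using v val by (simp add: trivial_gmod_def)
    show "act (C\<lparr>carrier := ?T\<rparr>) g v Q = act (trivial_gmod F) g (v Q)" if g: "g \<in> carrier G" for g
      using C.act_smult[OF g v(2) \<Sigma>_in] \<Sigma>_act[OF g] v(1) by (simp add: trivial_gmod_def)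
  qed (auto simp: trivial_gmod_def C_simps)
  moreover have "bij_betw (\<lambda>v. v Q) ?T (carrier F)"
    by (rule bij_betw_byWitness[of _ "\<lambda>a. a \<odot>\<^bsub>C\<^esub> \<Sigma>"]) (use val in auto)
  ultimately have "gmod_iso G F (C\<lparr>carrier := U, carrier := ?T\<rparr>) (trivial_gmod F)"
    unfolding gmod_iso_ghom by (intro exI[of _ "\<lambda>v. v Q"]) (simp add: trivial_gmod_def)
  moreover have "gsubmodule G F (C\<lparr>carrier := U\<rparr>) ?T" unfolding C.gsub_gsub[OF U] using T TU by simp
  ultimately show ?thesis unfolding has_trivial_sub_def by (intro exI[of _ ?T]) simp
qed

text \<open>The augmentation maps the summand onto the trivial module.\<close>

lemma has_trivial_quot_\<Sigma>:
  assumes d: "direct_sum2 G F C U W" and \<Sigma>U: "\<Sigma> \<in> U"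
  shows "has_trivial_quot G F (C\<lparr>carrier := U\<rparr>)"
proof -
  interpret C: rep G F C by (rule C_rep)
  have U: "gsubmodule G F C U" using d unfolding C.direct_sum2_iff by simp
  let ?U = "C\<lparr>carrier := U\<rparr>" and ?T = "trivial_gmod F :: ('f, 'f, 'g) gmod"
  have rU: "rep G F ?U" by (rule C.gsub_rep[OF U])
  have rT: "rep G F ?T" by (rule trivial_gmod_rep[OF G.is_group F.field_axioms])
  have h: "ghom G F ?U ?T aug" by (rule ghom_restrict[OF aug_ghom C.gsub_subset[OF U]])
  define K where "K = {v \<in> carrier ?U. aug v = \<zero>\<^bsub>?T\<^esub>}"
  have K: "gsubmodule G F ?U K" unfolding K_def by (rule ghom_ker_gsub[OF rU rT h])
  obtain u where u: "u \<in> U" "aug u = \<one>\<^bsub>F\<^esub>" using aug_nonzero[OF d \<Sigma>U] by auto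
  have "aug ` carrier ?U = carrier ?T"
  proof
    show "aug ` carrier ?U \<subseteq> carrier ?T" using ghom_closed[OF h] by auto
    show "carrier ?T \<subseteq> aug ` carrier ?U"
    proof
      fix a assume "a \<in> carrier ?T"
      then have a: "a \<in> carrier F" by (simp add: trivial_gmod_def)
      have "aug (a \<odot>\<^bsub>C\<^esub> u) = a \<otimes>\<^bsub>F\<^esub> aug u"
        using ghom_smult[OF aug_ghom a C.gsub_carrier[OF U u(1)]] by (simp add: trivial_gmod_def)
      then have e: "a = aug (a \<odot>\<^bsub>C\<^esub> u)" unfolding u(2) using a by simp
      have "a \<odot>\<^bsub>C\<^esub> u \<in> carrier ?U" using C.gsub_smult[OF U a u(1)] by simp
      then show "a \<in> aug ` carrier ?U" by (rule image_eqI[of a aug, OF e])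
    qed
  qed
  from iso_of_equal_kernels[OF rU quot_gmod_projection(1)[OF rU K] rT quot_gmod_projection(2,3)[OF rU K] h this]
  have "gmod_iso G F (quot_gmod ?U K) ?T"
    using quot_gmod_projection(4)[OF rU K] by (auto simp: K_def)
  then show ?thesis unfolding has_trivial_quot_def using K by (intro exI[of _ K]) simp
qed

text \<open>A summand has a trivial submodule if and only if it contains \<open>\<Sigma>\<close>, which spans the fixed vectors. So any
choice of the Scott module is an indecomposable summand that contains \<open>\<Sigma>\<close>.\<close>

theorem scott_module_frame:
  obtains S W where "scott_module G F Q = C\<lparr>carrier := S\<rparr>"
    "fixed_vector_summand G F C \<Sigma> (\<lambda>v. v Q) S W"
proof -
  interpret C: rep G F C by (rule C_rep)
  define P where "P U \<longleftrightarrow> (\<exists>W. direct_sum2 G F C U W) \<and> indecomposable G F (C\<lparr>carrier := U\<rparr>)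
        \<and> has_trivial_sub G F (C\<lparr>carrier := U\<rparr>) \<and> has_trivial_quot G F (C\<lparr>carrier := U\<rparr>)" for U
  obtain U W where U: "direct_sum2 G F C U W" "indecomposable G F (C\<lparr>carrier := U\<rparr>)" "\<Sigma> \<in> U"
    using \<Sigma>_summand by blast
  have "gsubmodule G F C U" using U(1) unfolding C.direct_sum2_iff by simp
  then have PU: "P U" unfolding P_def
    using U(1,2) has_trivial_sub_\<Sigma>[OF _ U(3)] has_trivial_quot_\<Sigma>[OF U(1,3)] by auto
  define S where "S = (SOME U. P U)"
  have PS: "P S" unfolding S_def by (rule someI[of P, OF PU])
  obtain W' where d: "direct_sum2 G F C S W'" and i: "indecomposable G F (C\<lparr>carrier := S\<rparr>)"
    and t: "has_trivial_sub G F (C\<lparr>carrier := S\<rparr>)"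
    using PS unfolding P_def by auto
  have gS: "gsubmodule G F C S" using d unfolding C.direct_sum2_iff by simp
  have "scott_module G F Q = C\<lparr>carrier := S\<rparr>" unfolding scott_module_def S_def P_def Let_def ..
  moreover have "fixed_vector_summand G F C \<Sigma> (\<lambda>v. v Q) S W'"
  proof (intro fixed_vector_summand.intro fixed_vector_summand_axioms.intro C_rep F.field_axioms d i C_finite_length
      \<Sigma>_in \<Sigma>_act fixed_vector C_value \<Sigma>_in_trivial_sub[OF gS t])
  qed (auto simp: C_simps \<Sigma>_def Q_mem)
  ultimately show ?thesis by (rule that)
qed

end

section \<open>Signed permutation modules\<close>

lemma (in fixed_vector_summand) dual_system_iso:
  assumes V: "rep G R V" and M: "rep G R M" and \<phi>: "ghom G R V M \<phi>" "bij_betw \<phi> (carrier V) (carrier M)"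
    and dual: "dual_system R (vectors M) (forms M) I t l"
  shows "dual_system R (vectors V) (forms V) I (\<lambda>i. inv_into (carrier V) \<phi> (t i)) (\<lambda>i v. l i (\<phi> v))"
proof -
  let ?\<psi> = "inv_into (carrier V) \<phi>"
  have \<psi>: "ghom G R M V ?\<psi>" by (rule ghom_inv[OF V \<phi>])
  have \<phi>\<psi>: "\<phi> (?\<psi> m) = m" if "m \<in> carrier M" for m
    using that bij_betw_imp_surj_on[OF \<phi>(2)] by (simp add: f_inv_into_f)
  have \<psi>\<phi>: "?\<psi> (\<phi> v) = v" if "v \<in> carrier V" for v
    using that bij_betw_imp_inj_on[OF \<phi>(2)] by simp
  have vM: "m \<in> carrier M" if "m \<in> vectors M" for m
    using that ghom_closed[OF _ \<Sigma>_carrier] unfolding vectors_def by auto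
  have vV: "m \<in> carrier V" if "m \<in> vectors V" for m
    using that ghom_closed[OF _ \<Sigma>_carrier] unfolding vectors_def by auto
  have up: "\<phi> v \<in> vectors M" if a: "v \<in> vectors V" for v
  proof -
    obtain f where f: "ghom G R C V f" "v = f \<Sigma>" using a unfolding vectors_def by auto
    have "\<phi> v = (\<phi> \<circ> f) \<Sigma>" using f by simp
    then show ?thesis unfolding vectors_def using ghom_comp[OF f(1) \<phi>(1)] by blast
  qed
  have down: "?\<psi> m \<in> vectors V" if a: "m \<in> vectors M" for m
  proof -
    obtain f where f: "ghom G R C M f" "m = f \<Sigma>" using a unfolding vectors_def by auto
    have "?\<psi> m = (?\<psi> \<circ> f) \<Sigma>" using f by simp
    then show ?thesis unfolding vectors_def using ghom_comp[OF f(1) \<psi>] by blast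
  qed
  have fup: "(\<lambda>m. k (?\<psi> m)) \<in> forms M" if a: "k \<in> forms V" for k
  proof -
    obtain h where h: "ghom G R V C h" "k = (\<lambda>v. ev (h v))" using a unfolding forms_def by auto
    show ?thesis unfolding forms_def using ghom_comp[OF \<psi> h(1)] h(2) by (auto simp: comp_def)
  qed
  have fdown: "(\<lambda>v. k (\<phi> v)) \<in> forms V" if a: "k \<in> forms M" for k
  proof -
    obtain h where h: "ghom G R M C h" "k = (\<lambda>v. ev (h v))" using a unfolding forms_def by auto
    show ?thesis unfolding forms_def using ghom_comp[OF \<phi>(1) h(1)] h(2) by (auto simp: comp_def)
  qed
  note D = dual
  show ?thesis
    unfolding dual_system_def
  proof (intro conjI ballI)
    show "finite I" by (rule dual_finite[OF D])
    fix i assume i: "i \<in> I"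
    show "?\<psi> (t i) \<in> vectors V" by (rule down[OF dual_vector[OF D i]])
    show "(\<lambda>v. l i (\<phi> v)) \<in> forms V" by (rule fdown[OF dual_form[OF D i]])
    fix j assume j: "j \<in> I"
    show "l i (\<phi> (?\<psi> (t j))) = (if i = j then \<one>\<^bsub>R\<^esub> else \<zero>\<^bsub>R\<^esub>)"
      using \<phi>\<psi>[OF vM[OF dual_vector[OF D j]]] dual_delta[OF D i j] by simp
  next
    fix x k assume x: "x \<in> vectors V" and k: "k \<in> forms V"
    have kx: "k x = k (?\<psi> (\<phi> x))" using \<psi>\<phi>[OF vV[OF x]] by simp
    show "k x \<in> carrier R" unfolding kx by (rule dual_closed[OF D up[OF x] fup[OF k]])
    show "k x = (\<Oplus>\<^bsub>R\<^esub>i\<in>I. k (?\<psi> (t i)) \<otimes>\<^bsub>R\<^esub> l i (\<phi> x))"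
      unfolding kx by (rule dual_expand[OF D up[OF x] fup[OF k]])
  qed
qed

text \<open>In the applications \<open>Z\<close> consists of pairs of basis elements, \<open>\<tau>\<close> interchanges the members of a pair, and \<open>s\<close>
is \<open>\<one>\<close> for the symmetric and \<open>\<ominus> \<one>\<close> for the exterior square. The module \<open>M\<close> consists of the functions on
\<open>Z\<close> that are multiplied by \<open>s\<close> when \<open>\<tau>\<close> is applied to the argument.\<close>

locale signed_perm = G: group G + F: field F
  for G :: "('g, 'a) monoid_scheme" and F :: "('f, 'b) ring_scheme" (structure) +
  fixes Z :: "'z set" and \<psi> :: "'g \<Rightarrow> 'z \<Rightarrow> 'z" and \<tau> :: "'z \<Rightarrow> 'z" and s :: 'f
  assumes finite_group: "finite (carrier G)" and finite_Z: "finite Z"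
    and \<psi>_closed: "g \<in> carrier G \<Longrightarrow> z \<in> Z \<Longrightarrow> \<psi> g z \<in> Z"
    and \<psi>_one: "z \<in> Z \<Longrightarrow> \<psi> \<one>\<^bsub>G\<^esub> z = z"
    and \<psi>_mult: "g \<in> carrier G \<Longrightarrow> h \<in> carrier G \<Longrightarrow> z \<in> Z \<Longrightarrow> \<psi> (g \<otimes>\<^bsub>G\<^esub> h) z = \<psi> g (\<psi> h z)"
    and \<tau>_closed: "z \<in> Z \<Longrightarrow> \<tau> z \<in> Z"
    and \<tau>_\<tau>: "z \<in> Z \<Longrightarrow> \<tau> (\<tau> z) = z"
    and \<psi>_\<tau>: "g \<in> carrier G \<Longrightarrow> z \<in> Z \<Longrightarrow> \<psi> g (\<tau> z) = \<tau> (\<psi> g z)"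
    and s_closed: "s \<in> carrier F" and s_s: "s \<otimes> s = \<one>"
    and s_free: "s \<noteq> \<one> \<Longrightarrow> z \<in> Z \<Longrightarrow> \<tau> z \<noteq> z"
begin

abbreviation "FZ \<equiv> perm_gmod G F Z \<psi>"

definition M :: "('f, 'z \<Rightarrow> 'f, 'g) gmod" where
  "M = FZ\<lparr>carrier := {f \<in> carrier FZ. \<forall>z\<in>Z. f (\<tau> z) = s \<otimes> f z}\<rparr>"

lemma FZ_rep: "rep G F FZ"
  by (intro rep.intro perm_gmod_gmodule G.is_group F.is_cring \<psi>_closed \<psi>_one \<psi>_mult)

lemma FZ_carrier: "f \<in> carrier FZ \<longleftrightarrow> (\<forall>x\<in>Z. f x \<in> carrier F) \<and> (\<forall>x. x \<notin> Z \<longrightarrow> f x = \<zero>)"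
  by (rule perm_gmod_carrier[OF finite_Z])

lemma FZ_value: "f \<in> carrier FZ \<Longrightarrow> f x \<in> carrier F"
  by (rule perm_gmod_value[OF F.is_cring])

lemma M_gsub: "gsubmodule G F FZ (carrier M)"
proof -
  interpret FZ: rep G F FZ by (rule FZ_rep)
  show ?thesis
  proof (rule FZ.gsubmoduleI)
    show "carrier M \<subseteq> carrier FZ" by (auto simp: M_def)
    show "\<zero>\<^bsub>FZ\<^esub> \<in> carrier M" using s_closed by (auto simp: M_def FZ_carrier perm_gmod_simps)
  next
    fix u w assume "u \<in> carrier M" "w \<in> carrier M"
    then show "u \<oplus>\<^bsub>FZ\<^esub> w \<in> carrier M"
      using s_closed FZ_value FZ.M.a_closed[of u w] by (simp add: M_def perm_gmod_simps F.r_distr)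
  next
    fix a u assume "a \<in> carrier F" "u \<in> carrier M"
    then show "a \<odot>\<^bsub>FZ\<^esub> u \<in> carrier M"
      using s_closed FZ_value FZ.smult_closed[of a u] by (simp add: M_def perm_gmod_simps F.m_lcomm)
  next
    fix g u assume g: "g \<in> carrier G" and "u \<in> carrier M"
    then show "act FZ g u \<in> carrier M"
      using FZ.act_closed[of g u] \<psi>_closed[of "inv\<^bsub>G\<^esub> g"] \<tau>_closed
      by (simp add: M_def perm_gmod_simps \<psi>_\<tau>)
  qed
qed

lemma M_rep: "rep G F M"
  using rep.gsub_rep[OF FZ_rep M_gsub] by (simp add: M_def)

lemma M_simps:
  "\<zero>\<^bsub>M\<^esub> = (\<lambda>x. \<zero>)" "v \<oplus>\<^bsub>M\<^esub> w = (\<lambda>x. v x \<oplus> w x)" "a \<odot>\<^bsub>M\<^esub> v = (\<lambda>x. a \<otimes> v x)"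
  "act M g v = (\<lambda>x. if x \<in> Z then v (\<psi> (inv\<^bsub>G\<^esub> g) x) else \<zero>)"
  by (simp_all add: M_def perm_gmod_simps)

lemma M_carrier:
  "f \<in> carrier M \<longleftrightarrow> (\<forall>x\<in>Z. f x \<in> carrier F) \<and> (\<forall>x. x \<notin> Z \<longrightarrow> f x = \<zero>) \<and> (\<forall>z\<in>Z. f (\<tau> z) = s \<otimes> f z)"
  by (simp add: M_def FZ_carrier)

lemma M_value: "f \<in> carrier M \<Longrightarrow> f x \<in> carrier F"
  using FZ_value by (simp add: M_def)

lemma M_finite_length: "finite_length G F M"
  using finite_length_sub[OF FZ_rep M_gsub perm_gmod_finite_length[OF F.field_axioms finite_Z FZ_rep]]
  by (simp add: M_def)

definition bas :: "'z \<Rightarrow> 'z \<Rightarrow> 'f" where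
  "bas z = (\<lambda>y. if y = z then \<one> else if y = \<tau> z then s else \<zero>)"

lemma bas_in: "z \<in> Z \<Longrightarrow> bas z \<in> carrier M"
proof -
  assume z: "z \<in> Z"
  have s1: "s = \<one>" if "\<tau> z = z" using s_free z that by blast
  have "bas z (\<tau> y) = s \<otimes> bas z y" if y: "y \<in> Z" for y
  proof -
    have "\<tau> y = z \<longleftrightarrow> y = \<tau> z" "\<tau> y = \<tau> z \<longleftrightarrow> y = z" using \<tau>_\<tau> y z by metis+
    then show ?thesis using s_closed s_s s1 by (auto simp: bas_def)
  qed
  then show ?thesis using z \<tau>_closed[OF z] s_closed by (auto simp: M_carrier bas_def)
qed

lemma \<psi>_inv: "g \<in> carrier G \<Longrightarrow> z \<in> Z \<Longrightarrow> \<psi> (inv\<^bsub>G\<^esub> g) (\<psi> g z) = z"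
  "g \<in> carrier G \<Longrightarrow> z \<in> Z \<Longrightarrow> \<psi> g (\<psi> (inv\<^bsub>G\<^esub> g) z) = z"
  using \<psi>_mult[of "inv\<^bsub>G\<^esub> g" g z] \<psi>_mult[of g "inv\<^bsub>G\<^esub> g" z] \<psi>_one[of z] by auto

lemma bas_act: "g \<in> carrier G \<Longrightarrow> z \<in> Z \<Longrightarrow> act M g (bas z) = bas (\<psi> g z)"
proof
  fix y assume g: "g \<in> carrier G" and z: "z \<in> Z"
  show "act M g (bas z) y = bas (\<psi> g z) y"
  proof (cases "y \<in> Z")
    case True
    have "\<psi> (inv\<^bsub>G\<^esub> g) y = z \<longleftrightarrow> y = \<psi> g z" "\<psi> (inv\<^bsub>G\<^esub> g) y = \<tau> z \<longleftrightarrow> y = \<psi> g (\<tau> z)"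
      using True g z \<psi>_inv[OF g z] \<psi>_inv[OF g True] \<psi>_inv[OF g \<tau>_closed[OF z]] by auto
    then show ?thesis using True g z by (simp add: M_simps bas_def \<psi>_\<tau>)
  next
    case False
    then have "y \<noteq> \<psi> g z" "y \<noteq> \<tau> (\<psi> g z)" using \<psi>_closed[OF g z] \<tau>_closed by auto
    then show ?thesis using False by (simp add: M_simps bas_def)
  qed
qed

definition orb :: "'z \<Rightarrow> 'z set" where "orb z = {\<psi> g z | g. g \<in> carrier G}"

text \<open>If some group element interchanges \<open>z\<close> and \<open>\<tau> z\<close>, then the value of a fixed vector at \<open>z\<close> equals \<open>s\<close> times
itself, so that it vanishes unless \<open>s = \<one>\<close>.\<close>

definition good :: "'z \<Rightarrow> bool" where "good z \<longleftrightarrow> z \<in> Z \<and> (s = \<one> \<or> \<tau> z \<notin> orb z)"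

definition orbit_fun :: "'z \<Rightarrow> 'z \<Rightarrow> 'f" where
  "orbit_fun z = (\<lambda>y. if y \<in> Z then (if y \<in> orb z then \<one> else if \<tau> y \<in> orb z then s else \<zero>) else \<zero>)"

definition stab :: "'z \<Rightarrow> 'g set" where "stab z = {g \<in> carrier G. \<psi> g z = z \<or> \<psi> g z = \<tau> z}"

lemma orb_Z: "z \<in> Z \<Longrightarrow> y \<in> orb z \<Longrightarrow> y \<in> Z" by (auto simp: orb_def \<psi>_closed)

lemma orb_self: "z \<in> Z \<Longrightarrow> z \<in> orb z"
  unfolding orb_def using \<psi>_one[of z] G.one_closed by force

lemma orb_act: "g \<in> carrier G \<Longrightarrow> z \<in> Z \<Longrightarrow> y \<in> Z \<Longrightarrow> \<psi> g y \<in> orb z \<longleftrightarrow> y \<in> orb z"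
proof
  assume g: "g \<in> carrier G" and z: "z \<in> Z" and y: "y \<in> Z"
  show "y \<in> orb z" if "\<psi> g y \<in> orb z"
  proof -
    obtain h where h: "h \<in> carrier G" "\<psi> g y = \<psi> h z" using \<open>\<psi> g y \<in> orb z\<close> by (auto simp: orb_def)
    then have "y = \<psi> (inv\<^bsub>G\<^esub> g \<otimes>\<^bsub>G\<^esub> h) z" using \<psi>_mult[of "inv\<^bsub>G\<^esub> g" h z] g z \<psi>_inv(1)[OF g y] by simp
    then show ?thesis unfolding orb_def using g h by blast
  qed
  show "\<psi> g y \<in> orb z" if "y \<in> orb z"
  proof -
    obtain h where h: "h \<in> carrier G" "y = \<psi> h z" using \<open>y \<in> orb z\<close> by (auto simp: orb_def)
    then have "\<psi> g y = \<psi> (g \<otimes>\<^bsub>G\<^esub> h) z" using \<psi>_mult[of g h z] g z by simp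
    then show ?thesis unfolding orb_def using g h by blast
  qed
qed

lemma orb_\<tau>_disjoint:
  assumes "good z" "s \<noteq> \<one>" "y \<in> orb z"
  shows "\<tau> y \<notin> orb z"
proof
  assume t: "\<tau> y \<in> orb z"
  have z: "z \<in> Z" using assms by (simp add: good_def)
  obtain g where g: "g \<in> carrier G" "y = \<psi> g z" using assms(3) by (auto simp: orb_def)
  then have "\<psi> g (\<tau> z) \<in> orb z" using t \<psi>_\<tau>[OF g(1) z] by simp
  then have "\<tau> z \<in> orb z" using orb_act[OF g(1) z \<tau>_closed[OF z]] by simp
  then show False using assms by (simp add: good_def)
qed

lemma orbit_fun_in: "good z \<Longrightarrow> orbit_fun z \<in> carrier M"
proof -
  assume z: "good z"
  have "orbit_fun z (\<tau> y) = s \<otimes> orbit_fun z y" if y: "y \<in> Z" for y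
  proof (cases "s = \<one>")
    case True
    then show ?thesis unfolding orbit_fun_def using y \<tau>_\<tau>[OF y] \<tau>_closed[OF y] by auto
  next
    case False
    then show ?thesis using y \<tau>_\<tau>[OF y] \<tau>_closed[OF y] orb_\<tau>_disjoint[OF z False] s_s s_closed
      by (auto simp: orbit_fun_def)
  qed
  then show ?thesis using s_closed by (auto simp: M_carrier orbit_fun_def)
qed

lemma orbit_fun_act: "good z \<Longrightarrow> g \<in> carrier G \<Longrightarrow> act M g (orbit_fun z) = orbit_fun z"
  using orb_act[of "inv\<^bsub>G\<^esub> g" z] \<psi>_closed[of "inv\<^bsub>G\<^esub> g"] \<tau>_closed
  by (auto simp: M_simps orbit_fun_def good_def fun_eq_iff \<psi>_\<tau>[symmetric])

lemma fixed_orb: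
  assumes "t \<in> carrier M" "\<And>g. g \<in> carrier G \<Longrightarrow> act M g t = t" "z \<in> Z" "y \<in> orb z"
  shows "t y = t z"
proof -
  obtain g where g: "g \<in> carrier G" "y = \<psi> g z" using assms(4) by (auto simp: orb_def)
  have "t y = act M g t y" using assms(2)[OF g(1)] by simp
  then show ?thesis using g assms(3) \<psi>_closed \<psi>_inv(1) by (simp add: M_simps)
qed

lemma fixed_bad:
  assumes t: "t \<in> carrier M" "\<And>g. g \<in> carrier G \<Longrightarrow> act M g t = t" and z: "z \<in> Z" "\<not> good z"
  shows "t z = \<zero>"
proof -
  have s: "s \<noteq> \<one>" "\<tau> z \<in> orb z" using z by (auto simp: good_def)
  have tz: "t z \<in> carrier F" by (rule M_value[OF t(1)])
  have eq: "s \<otimes> t z = t z" using fixed_orb[OF t z(1) s(2)] t(1) z(1) by (simp add: M_carrier)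
  have "(\<one> \<ominus> s) \<otimes> t z = t z \<ominus> s \<otimes> t z"
    using s_closed tz by (simp add: F.minus_eq F.l_distr F.l_minus)
  also have "\<dots> = \<zero>" unfolding eq using tz by (simp add: F.minus_eq F.r_neg)
  finally have "\<one> \<ominus> s = \<zero> \<or> t z = \<zero>"
    using F.integral[OF _ _ tz] s_closed by blast
  moreover have "\<one> \<ominus> s \<noteq> \<zero>" using s(1) s_closed by (metis F.one_closed F.r_right_minus_eq)
  ultimately show ?thesis by blast
qed

end

context scott_setting begin

lemma crep_coset:
  assumes "g \<in> carrier G"
  obtains q where "q \<in> Q" "crep (g <# Q) = g \<otimes> q"
proof
  note c = crep[OF coset_mem[OF assms]]
  show "inv g \<otimes> crep (g <# Q) \<in> Q" using coset_eq_iff[OF assms c(1)] c(2) by simp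
  show "crep (g <# Q) = g \<otimes> (inv g \<otimes> crep (g <# Q))"
    using assms c(1) by (simp add: G.m_assoc[symmetric])
qed

text \<open>Frobenius reciprocity: a vector fixed by \<open>Q\<close> extends to a homomorphism from \<open>C\<close>.\<close>

lemma ghom_from_fixed_vector:
  assumes V: "rep G F V" and u: "u \<in> carrier V" and fxd: "\<And>q. q \<in> Q \<Longrightarrow> act V q u = u"
  obtains f where "ghom G F C V f" "f \<Sigma> = finsum V (\<lambda>x. act V (crep x) u) cosets"
proof -
  interpret V: rep G F V by fact
  define w where "w x = act V (crep x) u" for x
  have wc: "w x \<in> carrier V" if "x \<in> cosets" for x unfolding w_def by (rule V.act_closed[OF crep(1)[OF that] u])
  have wg: "w (g <# x) = act V g (w x)" if g: "g \<in> carrier G" and x: "x \<in> cosets" for g x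
  proof -
    have gx: "g <# x = (g \<otimes> crep x) <# Q" using coset_act[OF g crep(1)[OF x]] crep(2)[OF x] by simp
    obtain q where q: "q \<in> Q" "crep ((g \<otimes> crep x) <# Q) = g \<otimes> crep x \<otimes> q"
      using crep_coset[of "g \<otimes> crep x"] g crep(1)[OF x] by blast
    show ?thesis unfolding w_def gx q(2)
      using g crep(1)[OF x] Q_carrier[OF q(1)] u fxd[OF q(1)] by (simp add: V.act_mult)
  qed
  have "\<exists>f. ghom G F C V f \<and> (\<forall>x\<in>cosets. f (basis_elt F x) = w x)"
    unfolding coset_gmod_def
    by (rule free_lift[OF C_rep[unfolded coset_gmod_def] V]) (auto simp: coset_act_closed coset_act_inv wc wg)
  then obtain f where f: "ghom G F C V f" "\<And>x. x \<in> cosets \<Longrightarrow> f (basis_elt F x) = w x" by blast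
  have "f \<Sigma> = finsum V (\<lambda>x. f (basis_elt F x)) cosets"
    unfolding \<Sigma>_sum by (rule ghom_finsum[OF C_rep V f(1) finite_cosets]) (use basis_in in auto)
  also have "\<dots> = finsum V w cosets" by (rule V.M.finsum_cong') (use f(2) wc in auto)
  finally show ?thesis using that f(1) unfolding w_def by blast
qed

end

locale signed_perm_scott = signed_perm G F Z \<psi> \<tau> s + scott_setting G F p Q
  for G :: "('g, 'a) monoid_scheme" (structure) and F :: "('f, 'b) ring_scheme"
    and Z :: "'z set" and \<psi> :: "'g \<Rightarrow> 'z \<Rightarrow> 'z" and \<tau> :: "'z \<Rightarrow> 'z" and s :: 'f
    and p :: nat and Q :: "'g set"
begin

lemma stab_subgroup: "z \<in> Z \<Longrightarrow> subgroup (stab z) G"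
proof
  assume z: "z \<in> Z"
  note tz = \<tau>_closed[OF z] \<tau>_\<tau>[OF z]
  show "stab z \<subseteq> carrier G" by (auto simp: stab_def)
  show "\<one> \<in> stab z" using z \<psi>_one by (simp add: stab_def)
  fix g assume g: "g \<in> stab z"
  then have gc: "g \<in> carrier G" by (simp add: stab_def)
  show "inv g \<in> stab z"
  proof (cases "\<psi> g z = z")
    case True
    then show ?thesis using \<psi>_inv(1)[OF gc z] gc by (simp add: stab_def)
  next
    case False
    then have "\<psi> g z = \<tau> z" using g by (simp add: stab_def)
    then have "\<psi> g (\<tau> z) = z" using \<psi>_\<tau>[OF gc z] tz by simp
    then have "\<psi> (inv g) z = \<tau> z" using \<psi>_inv(1)[OF gc tz(1)] by simp
    then show ?thesis using gc by (simp add: stab_def)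
  qed
  fix h assume h: "h \<in> stab z"
  then have hc: "h \<in> carrier G" by (simp add: stab_def)
  have "\<psi> (g \<otimes> h) z = \<psi> g (\<psi> h z)" by (rule \<psi>_mult[OF gc hc z])
  then show "g \<otimes> h \<in> stab z" using g h gc hc \<psi>_\<tau>[OF gc z] tz by (auto simp: stab_def)
qed

lemma orb_stab: "z \<in> Z \<Longrightarrow> g \<in> stab z \<Longrightarrow> v \<in> carrier M \<Longrightarrow> good z \<Longrightarrow> v (\<psi> g z) = v z"
proof -
  assume z: "z \<in> Z" and g: "g \<in> stab z" and v: "v \<in> carrier M" and gd: "good z"
  show ?thesis
  proof (cases "\<psi> g z = z")
    case False
    then have t: "\<psi> g z = \<tau> z" using g by (simp add: stab_def)
    then have "\<tau> z \<in> orb z" using g by (auto simp: orb_def stab_def intro!: exI[of _ g])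
    then have "s = \<one>\<^bsub>F\<^esub>" using gd by (simp add: good_def)
    moreover have "v (\<tau> z) = s \<otimes>\<^bsub>F\<^esub> v z" using v z by (simp only: M_carrier)
    ultimately show ?thesis using t M_value[OF v] by simp
  qed simp
qed

text \<open>A nonzero coefficient at \<open>z\<close> of the image of \<open>\<Sigma>\<close> bounds \<open>Q\<close> from below: the coefficient is a sum
  over the cosets of \<open>Q\<close> of a function invariant under the \<open>p\<close>-group \<open>P\<close>.\<close>

lemma coefficient_nonzero:
  assumes f: "ghom G F C M f" and z: "good z" and nz: "f \<Sigma> z \<noteq> \<zero>\<^bsub>F\<^esub>"
    and P: "subgroup P G" "P \<subseteq> stab z" "card P = p ^ k"
  shows "\<exists>g\<in>carrier G. \<forall>h\<in>P. inv g \<otimes> h \<otimes> g \<in> Q"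
proof -
  have zZ: "z \<in> Z" using z by (simp add: good_def)
  define a where "a x = f (basis_elt F x) z" for x
  have fM: "f (basis_elt F x) \<in> carrier M" if "x \<in> cosets" for x by (rule ghom_closed[OF f basis_in[OF that]])
  have ac: "a x \<in> carrier F" if "x \<in> cosets" for x unfolding a_def by (rule M_value[OF fM[OF that]])
  have ai: "a (h <# x) = a x" if h: "h \<in> P" and x: "x \<in> cosets" for h x
  proof -
    have hc: "h \<in> carrier G" using subgroup.mem_carrier[OF P(1) h] .
    have hs: "inv h \<in> stab z" using subgroup.m_inv_closed[OF P(1) h] P(2) by blast
    have "a (h <# x) = act M h (f (basis_elt F x)) z" unfolding a_def basis_act[OF hc x] using ghom_act[OF f hc basis_in[OF x]] by simp
    also have "\<dots> = f (basis_elt F x) (\<psi> (inv h) z)" using zZ by (simp add: M_simps)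
    also have "\<dots> = a x" unfolding a_def by (rule orb_stab[OF zZ hs fM[OF x] z])
    finally show ?thesis .
  qed
  have "f \<Sigma> = finsum M (\<lambda>x. f (basis_elt F x)) cosets"
    unfolding \<Sigma>_sum by (rule ghom_finsum[OF C_rep M_rep f finite_cosets]) (use basis_in in auto)
  then have "f \<Sigma> z = finsum M (\<lambda>x. f (basis_elt F x)) cosets z" by simp
  also have "\<dots> = (\<Oplus>\<^bsub>F\<^esub>x\<in>cosets. a x)"
    unfolding a_def
    by (rule finsum_apply[OF M_rep]) (use fM M_value finite_cosets in \<open>auto simp: M_simps\<close>)
  also have "\<dots> = (\<Oplus>\<^bsub>F\<^esub>x\<in>{x \<in> cosets. \<forall>h\<in>carrier (G\<lparr>carrier := P\<rparr>). h <# x = x}. a x)"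
    by (rule p_group_sum[OF F.field_axioms char_F p_pos G.subgroup_imp_group[OF P(1)], of k])
      (use P(3) finite_cosets ac ai coset_act_closed coset_act_one coset_act_mult subgroup.mem_carrier[OF P(1)] in auto)
  finally have "{x \<in> cosets. \<forall>h\<in>carrier (G\<lparr>carrier := P\<rparr>). h <# x = x} \<noteq> {}"
    using nz by (metis (no_types, lifting) F.finsum_empty)
  then obtain x where x: "x \<in> cosets" "\<forall>h\<in>P. h <# x = x" by auto
  obtain g where g: "g \<in> carrier G" "x = g <# Q" using coset_rep[OF x(1)] by auto
  have "inv g \<otimes> h \<otimes> g \<in> Q" if h: "h \<in> P" for h
  proof -
    have hc: "h \<in> carrier G" using subgroup.mem_carrier[OF P(1) h] .
    have "g <# Q = (h \<otimes> g) <# Q" using x(2) h g coset_act[OF hc g(1)] by simp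
    then show ?thesis using coset_eq_iff[OF g(1), of "h \<otimes> g"] g(1) hc by (simp add: G.m_assoc)
  qed
  then show ?thesis using g(1) by blast
qed

text \<open>The functions \<open>bas\<close> belong to the pairs \<open>{z, \<tau> z}\<close>. The sum runs over their set rather than over the orbit
of \<open>z\<close>, which could count them twice if it is closed under \<open>\<tau>\<close>.\<close>

lemma orbit_fun_sum:
  assumes z: "good z"
  shows "orbit_fun z = finsum M (\<lambda>b. b) (bas ` orb z)"
proof
  fix y
  have zZ: "z \<in> Z" using z by (simp add: good_def)
  have fin: "finite (bas ` orb z)" using finite_subset[OF _ finite_Z, of "orb z"] orb_Z[OF zZ] by blast
  have cl: "b \<in> carrier M" if "b \<in> bas ` orb z" for b using that bas_in orb_Z[OF zZ] by auto
  have val: "finsum M (\<lambda>b. b) (bas ` orb z) y = (\<Oplus>\<^bsub>F\<^esub>b\<in>bas ` orb z. b y)"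
    by (rule finsum_apply[OF M_rep]) (use cl M_value fin in \<open>auto simp: M_simps\<close>)
  have single: "(\<Oplus>\<^bsub>F\<^esub>b\<in>bas ` orb z. b y) = bas w y"
    if w: "w \<in> orb z" and other: "\<And>y'. y' \<in> orb z \<Longrightarrow> bas y' \<noteq> bas w \<Longrightarrow> bas y' y = \<zero>\<^bsub>F\<^esub>" for w
  proof -
    have "(\<Oplus>\<^bsub>F\<^esub>b\<in>bas ` orb z. b y) = (\<Oplus>\<^bsub>F\<^esub>b\<in>{bas w}. b y)"
      by (rule F.add.finprod_mono_neutral_cong_right[OF fin]) (use w other cl M_value in auto)
    then show ?thesis using cl[of "bas w"] w M_value by simp
  qed
  consider (a) "y \<in> orb z" | (b) "y \<notin> orb z" "y \<in> Z" "\<tau> y \<in> orb z" | (c) "y \<notin> orb z" "y \<in> Z \<longrightarrow> \<tau> y \<notin> orb z" by blast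
  then have "(\<Oplus>\<^bsub>F\<^esub>b\<in>bas ` orb z. b y) = orbit_fun z y"
  proof cases
    case a
    have yZ: "y \<in> Z" by (rule orb_Z[OF zZ a])
    have "(\<Oplus>\<^bsub>F\<^esub>b\<in>bas ` orb z. b y) = bas y y"
    proof (rule single[OF a])
      fix y' assume y': "y' \<in> orb z" "bas y' \<noteq> bas y"
      have y'Z: "y' \<in> Z" by (rule orb_Z[OF zZ y'(1)])
      show "bas y' y = \<zero>\<^bsub>F\<^esub>"
      proof (rule ccontr)
        assume "bas y' y \<noteq> \<zero>\<^bsub>F\<^esub>"
        then have t: "y = \<tau> y'" using y'(2) by (auto simp: bas_def split: if_splits)
        then have "s = \<one>\<^bsub>F\<^esub>" using orb_\<tau>_disjoint[OF z _ y'(1)] a by blast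
        then have "bas y' = bas y" unfolding bas_def using t \<tau>_\<tau>[OF y'Z] by auto
        then show False using y'(2) by simp
      qed
    qed
    then show ?thesis using a yZ by (simp add: bas_def orbit_fun_def)
  next
    case b
    have "(\<Oplus>\<^bsub>F\<^esub>b\<in>bas ` orb z. b y) = bas (\<tau> y) y"
    proof (rule single[OF b(3)])
      fix y' assume y': "y' \<in> orb z" "bas y' \<noteq> bas (\<tau> y)"
      have "y \<noteq> y'" using b(1) y'(1) by blast
      moreover have "y \<noteq> \<tau> y'" using y'(2) \<tau>_\<tau>[OF orb_Z[OF zZ y'(1)]] by auto
      ultimately show "bas y' y = \<zero>\<^bsub>F\<^esub>" by (simp add: bas_def)
    qed
    then show ?thesis using b \<tau>_\<tau>[OF b(2)] by (auto simp: bas_def orbit_fun_def)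
  next
    case c
    have "(\<Oplus>\<^bsub>F\<^esub>b\<in>bas ` orb z. b y) = (\<Oplus>\<^bsub>F\<^esub>b\<in>bas ` orb z. \<zero>\<^bsub>F\<^esub>)"
    proof (rule F.finsum_cong')
      fix b assume "b \<in> bas ` orb z"
      then obtain y' where y': "y' \<in> orb z" "b = bas y'" by auto
      have y'Z: "y' \<in> Z" by (rule orb_Z[OF zZ y'(1)])
      have "y \<noteq> y'" using c(1) y'(1) by blast
      moreover have "y \<noteq> \<tau> y'" using c(2) \<tau>_closed[OF y'Z] \<tau>_\<tau>[OF y'Z] y'(1) by auto
      ultimately show "b y = \<zero>\<^bsub>F\<^esub>" by (simp add: bas_def y'(2))
    qed auto
    then show ?thesis using c by (auto simp: orbit_fun_def)
  qed
  then show "orbit_fun z y = finsum M (\<lambda>b. b) (bas ` orb z) y" using val by simp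
qed

text \<open>The value is a sum, over the functions \<open>bas\<close> of the orbit, of a function that is invariant under the
\<open>p\<close>-group \<open>Q\<close>. A summand fixed by \<open>Q\<close> exhibits \<open>Q\<close> inside a stabiliser.\<close>

lemma form_nonzero:
  assumes h: "ghom G F M C h" and z: "good z" and nz: "h (orbit_fun z) Q \<noteq> \<zero>\<^bsub>F\<^esub>"
  shows "\<exists>g\<in>carrier G. \<forall>q\<in>Q. inv g \<otimes> q \<otimes> g \<in> stab z"
proof -
  have zZ: "z \<in> Z" using z by (simp add: good_def)
  define B where "B = bas ` orb z"
  have fin: "finite B" unfolding B_def using finite_subset[OF _ finite_Z, of "orb z"] orb_Z[OF zZ] by blast
  have cl: "b \<in> carrier M" if "b \<in> B" for b using that bas_in orb_Z[OF zZ] by (auto simp: B_def)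
  obtain k where k: "card Q = p ^ k" using Q_p by (auto simp: p_subgroup_def)
  interpret M: rep G F M by (rule M_rep)
  have Bact: "act M g b \<in> B" if g: "g \<in> carrier G" and b: "b \<in> B" for g b
  proof -
    obtain y where y: "y \<in> orb z" "b = bas y" using b by (auto simp: B_def)
    then show ?thesis using bas_act[OF g orb_Z[OF zZ y(1)]] orb_act[OF g zZ orb_Z[OF zZ y(1)]] by (simp add: B_def)
  qed
  have hB: "h b \<in> carrier C" if "b \<in> B" for b by (rule ghom_closed[OF h cl[OF that]])
  have inv: "h (act M q b) Q = h b Q" if q: "q \<in> Q" and b: "b \<in> B" for q b
  proof -
    have "h (act M q b) Q = act C q (h b) Q" using ghom_act[OF h Q_carrier[OF q] cl[OF b]] by simp
    also have "\<dots> = h b Q" using Q_mem coset_fix[OF subgroup.m_inv_closed[OF Q_sub q]] by (simp add: C_simps)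
    finally show ?thesis .
  qed
  have "h (orbit_fun z) = finsum C (\<lambda>b. h b) B"
    unfolding orbit_fun_sum[OF z] B_def[symmetric]
    by (rule ghom_finsum[OF M_rep C_rep h fin]) (use cl in auto)
  then have "h (orbit_fun z) Q = finsum C (\<lambda>b. h b) B Q" by simp
  also have "\<dots> = (\<Oplus>\<^bsub>F\<^esub>b\<in>B. h b Q)"
    by (rule finsum_apply[OF C_rep]) (use hB C_value fin in \<open>auto simp: C_simps\<close>)
  also have "\<dots> = (\<Oplus>\<^bsub>F\<^esub>b\<in>{b \<in> B. \<forall>q\<in>carrier (G\<lparr>carrier := Q\<rparr>). act M q b = b}. h b Q)"
    by (rule p_group_sum[OF F.field_axioms char_F p_pos G.subgroup_imp_group[OF Q_sub], of k])
      (use k fin inv Bact Q_carrier hB C_value cl M.act_one M.act_mult in auto)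
  finally have "{b \<in> B. \<forall>q\<in>carrier (G\<lparr>carrier := Q\<rparr>). act M q b = b} \<noteq> {}"
    using nz by (metis (no_types, lifting) F.finsum_empty)
  then obtain b where b: "b \<in> B" "\<forall>q\<in>Q. act M q b = b" by auto
  obtain g where g: "g \<in> carrier G" "b = bas (\<psi> g z)" using b(1) by (auto simp: B_def orb_def)
  have gz: "\<psi> g z \<in> Z" by (rule \<psi>_closed[OF g(1) zZ])
  have "inv g \<otimes> q \<otimes> g \<in> stab z" if q: "q \<in> Q" for q
  proof -
    have qc: "q \<in> carrier G" by (rule Q_carrier[OF q])
    have "bas (\<psi> q (\<psi> g z)) = bas (\<psi> g z)" using b(2) q g(2) bas_act[OF qc gz] by simp
    then have "bas (\<psi> g z) (\<psi> q (\<psi> g z)) \<noteq> \<zero>\<^bsub>F\<^esub>"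
      by (metis F.one_not_zero bas_def)
    then have "\<psi> q (\<psi> g z) = \<psi> g z \<or> \<psi> q (\<psi> g z) = \<tau> (\<psi> g z)" by (auto simp: bas_def split: if_splits)
    then have "\<psi> (inv g) (\<psi> q (\<psi> g z)) = z \<or> \<psi> (inv g) (\<psi> q (\<psi> g z)) = \<tau> z"
      using \<psi>_inv(1)[OF g(1) zZ] \<psi>_\<tau>[of "inv g" "\<psi> g z"] g(1) gz by auto
    moreover have "\<psi> (inv g \<otimes> q \<otimes> g) z = \<psi> (inv g) (\<psi> q (\<psi> g z))"
      using g(1) qc zZ gz \<psi>_closed by (simp add: \<psi>_mult)
    ultimately show ?thesis using g(1) qc by (simp add: stab_def)
  qed
  then show ?thesis using g(1) by blast
qed

text \<open>If \<open>Q\<close> is a Sylow subgroup of a conjugate of the stabiliser of \<open>z\<close>, then the relative trace from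
  \<open>Q\<close> of the basis vector there is a nonzero multiple of the orbit function.\<close>

lemma orbit_fun_in_image:
  assumes z: "good z" and x0: "x0 \<in> carrier G"
    and sub: "\<And>q. q \<in> Q \<Longrightarrow> inv x0 \<otimes> q \<otimes> x0 \<in> stab z"
    and idx: "\<not> p dvd card (stab z) div card Q"
  shows "\<exists>f. ghom G F C M f \<and> f \<Sigma> = orbit_fun z"
proof -
  interpret M: rep G F M by (rule M_rep)
  have zZ: "z \<in> Z" using z by (simp add: good_def)
  interpret H: subgroup "stab z" G by (rule stab_subgroup[OF zZ])
  define y where "y = \<psi> x0 z"
  have yZ: "y \<in> Z" unfolding y_def by (rule \<psi>_closed[OF x0 zZ])
  have bfix: "act M q (bas y) = bas y" if q: "q \<in> Q" for q
  proof -
    have qc: "q \<in> carrier G" by (rule Q_carrier[OF q])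
    let ?h = "inv x0 \<otimes> q \<otimes> x0"
    have h: "?h \<in> stab z" by (rule sub[OF q])
    have "x0 \<otimes> ?h = q \<otimes> x0" using x0 qc by (simp add: G.m_assoc[symmetric])
    then have qy: "\<psi> q y = \<psi> x0 (\<psi> ?h z)"
      unfolding y_def using \<psi>_mult[OF qc x0 zZ] \<psi>_mult[OF x0 _ zZ, of ?h] H.mem_carrier[OF h] by simp
    show ?thesis
    proof (cases "\<psi> ?h z = z")
      case True
      then show ?thesis using bas_act[OF qc yZ] qy by (simp add: y_def)
    next
      case False
      then have t: "\<psi> ?h z = \<tau> z" using h unfolding stab_def by blast
      have "\<tau> z \<in> orb z" unfolding orb_def t[symmetric] using H.mem_carrier[OF h] by blast
      then have s1: "s = \<one>\<^bsub>F\<^esub>" using z by (simp add: good_def)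
      have "\<psi> q y = \<tau> y" using qy t \<psi>_\<tau>[OF x0 zZ] by (simp add: y_def)
      moreover have "bas (\<tau> y) = bas y" unfolding bas_def using s1 \<tau>_\<tau>[OF yZ] by auto
      ultimately show ?thesis using bas_act[OF qc yZ] by simp
    qed
  qed
  obtain f where f: "ghom G F C M f" "f \<Sigma> = finsum M (\<lambda>x. act M (crep x) (bas y)) cosets"
    using ghom_from_fixed_vector[OF M_rep bas_in[OF yZ] bfix] by blast
  define t where "t = f \<Sigma>"
  have tM: "t \<in> carrier M" unfolding t_def by (rule ghom_closed[OF f(1) \<Sigma>_in])
  have tfix: "act M g t = t" if "g \<in> carrier G" for g
    unfolding t_def using ghom_act[OF f(1) that \<Sigma>_in] \<Sigma>_act[OF that] by simp
  have actb: "act M (crep x) (bas y) = bas (\<psi> (crep x) y)" if "x \<in> cosets" for x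
    by (rule bas_act[OF crep(1)[OF that] yZ])
  have gy: "\<psi> g y \<in> orb z" if "g \<in> carrier G" for g
    using orb_act[OF that zZ yZ] orb_act[OF x0 zZ zZ] orb_self[OF zZ] by (simp add: y_def)
  have tval: "t w = (\<Oplus>\<^bsub>F\<^esub>x\<in>cosets. bas (\<psi> (crep x) y) w)" for w
  proof -
    have "t w = (\<Oplus>\<^bsub>F\<^esub>x\<in>cosets. act M (crep x) (bas y) w)"
      unfolding t_def f(2)
      by (rule finsum_apply[OF M_rep]) (use M.act_closed[OF crep(1) bas_in[OF yZ]] M_value finite_cosets in \<open>auto simp: M_simps\<close>)
    also have "\<dots> = (\<Oplus>\<^bsub>F\<^esub>x\<in>cosets. bas (\<psi> (crep x) y) w)"
      by (rule F.finsum_cong') (use actb M_value[OF bas_in[OF \<psi>_closed[OF crep(1) yZ]]] in auto)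
    finally show ?thesis .
  qed
  (* The coefficient of t at z counts the cosets of Q in a translate of the stabiliser of z. *)
  define A where "A = {x \<in> cosets. crep x \<otimes> x0 \<in> stab z}"
  have fA: "finite A" using finite_cosets by (simp add: A_def)
  have "card Q * card A = card (\<Union>A)"
  proof (rule card_partition)
    show "finite A" by (rule fA)
    have "\<Union>A \<subseteq> carrier G" using G.lcosets_part_G[OF Q_sub] by (auto simp: A_def)
    then show "finite (\<Union>A)" using finite_G finite_subset by blast
    show "card c = card Q" if "c \<in> A" for c
      using G.l_card_cosets_equal[OF _ Q_subset finite_G, of c] that by (simp add: A_def)
    show "c1 \<inter> c2 = {}" if "c1 \<in> A" "c2 \<in> A" "c1 \<noteq> c2" for c1 c2
      using G.lcos_disjoint[OF Q_sub] that by (simp add: A_def)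
  qed
  also have "\<Union>A = (\<lambda>h. h \<otimes> inv x0) ` stab z"
  proof (intro equalityI subsetI)
    fix g assume "g \<in> \<Union>A"
    then obtain x where x: "x \<in> cosets" "crep x \<otimes> x0 \<in> stab z" "g \<in> x" by (auto simp: A_def)
    then have "g \<in> crep x <# Q" using crep(2)[OF x(1)] by simp
    then obtain q where q: "q \<in> Q" "g = crep x \<otimes> q" by (auto simp: l_coset_def)
    note c = crep(1)[OF x(1)] Q_carrier[OF q(1)] x0
    have "g \<otimes> x0 = (crep x \<otimes> x0) \<otimes> (inv x0 \<otimes> q \<otimes> x0)"
    proof -
      have "x0 \<otimes> (inv x0 \<otimes> q \<otimes> x0) = q \<otimes> x0" using c by (simp add: G.m_assoc[symmetric])
      then show ?thesis using c q(2) by (simp add: G.m_assoc)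
    qed
    then have "g \<otimes> x0 \<in> stab z" using H.m_closed[OF x(2) sub[OF q(1)]] by simp
    moreover have "g = (g \<otimes> x0) \<otimes> inv x0" using c q(2) by (simp add: G.m_assoc)
    ultimately show "g \<in> (\<lambda>h. h \<otimes> inv x0) ` stab z" by blast
  next
    fix g assume "g \<in> (\<lambda>h. h \<otimes> inv x0) ` stab z"
    then obtain h where h: "h \<in> stab z" "g = h \<otimes> inv x0" by auto
    have hc: "h \<in> carrier G" by (rule H.mem_carrier[OF h(1)])
    have gc: "g \<in> carrier G" using hc x0 h(2) by simp
    obtain q where q: "q \<in> Q" "crep (g <# Q) = g \<otimes> q" using crep_coset[OF gc] by blast
    have "crep (g <# Q) \<otimes> x0 = h \<otimes> (inv x0 \<otimes> q \<otimes> x0)"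
      unfolding q(2) using hc x0 Q_carrier[OF q(1)] by (simp add: h(2) G.m_assoc)
    then have "crep (g <# Q) \<otimes> x0 \<in> stab z" using H.m_closed[OF h(1) sub[OF q(1)]] by simp
    then have "g <# Q \<in> A" using coset_mem[OF gc] by (simp add: A_def)
    moreover have "g \<in> g <# Q" by (rule G.lcos_self[OF gc Q_sub])
    ultimately show "g \<in> \<Union>A" by blast
  qed
  also have "card \<dots> = card (stab z)"
    by (rule card_image, rule inj_onI) (use x0 H.mem_carrier in auto)
  finally have "card (stab z) div card Q = card A"
    using finite_subset[OF Q_subset finite_G] Q_mem subgroup.one_closed[OF Q_sub]
    by (metis card_gt_0_iff empty_iff mult.commute nonzero_mult_div_cancel_left not_gr_zero)
  with idx have nd: "\<not> p dvd card A" by simp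
  have bz: "bas (\<psi> (crep x) y) z = (if x \<in> A then \<one>\<^bsub>F\<^esub> else \<zero>\<^bsub>F\<^esub>)" if x: "x \<in> cosets" for x
  proof -
    let ?g = "crep x \<otimes> x0"
    have g: "?g \<in> carrier G" using crep(1)[OF x] x0 by simp
    have w: "\<psi> (crep x) y = \<psi> ?g z" unfolding y_def using \<psi>_mult[OF crep(1)[OF x] x0 zZ] by simp
    have wZ: "\<psi> ?g z \<in> Z" by (rule \<psi>_closed[OF g zZ])
    have m: "x \<in> A \<longleftrightarrow> \<psi> ?g z = z \<or> \<psi> ?g z = \<tau> z" unfolding A_def stab_def using x g by blast
    show ?thesis
    proof (cases "\<psi> ?g z = z")
      case True
      then show ?thesis using m w by (simp add: bas_def)
    next
      case False
      have e: "z = \<tau> (\<psi> ?g z) \<longleftrightarrow> \<psi> ?g z = \<tau> z" using \<tau>_\<tau>[OF zZ] \<tau>_\<tau>[OF wZ] by metis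
      have "s = \<one>\<^bsub>F\<^esub>" if "\<psi> ?g z = \<tau> z"
      proof -
        have "\<psi> ?g z \<in> orb z" unfolding orb_def using g by blast
        then show ?thesis using that z by (simp add: good_def)
      qed
      then show ?thesis using m w False e by (auto simp: bas_def)
    qed
  qed
  have "t z = (\<Oplus>\<^bsub>F\<^esub>x\<in>cosets. if x \<in> A then \<one>\<^bsub>F\<^esub> else \<zero>\<^bsub>F\<^esub>)"
    unfolding tval by (rule F.finsum_cong') (use bz in auto)
  also have "\<dots> = (\<Oplus>\<^bsub>F\<^esub>x\<in>A. \<one>\<^bsub>F\<^esub>)"
    by (rule F.add.finprod_mono_neutral_cong_right[OF finite_cosets]) (auto simp: A_def)
  also have "\<dots> = add_pow F (card A) \<one>\<^bsub>F\<^esub>" using fA by (intro F.add.finprod_const) auto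
  finally have tz: "t z \<noteq> \<zero>\<^bsub>F\<^esub>" using F.add_pow_one_eq_zero[OF char_F, of "card A"] nd by simp
  have tzc: "t z \<in> carrier F" by (rule M_value[OF tM])
  have t_eq: "t = t z \<odot>\<^bsub>M\<^esub> orbit_fun z"
  proof
    fix w
    consider (a) "w \<in> orb z" | (b) "w \<notin> orb z" "w \<in> Z" "\<tau> w \<in> orb z" | (c) "w \<notin> orb z" "w \<in> Z \<longrightarrow> \<tau> w \<notin> orb z" by blast
    then show "t w = (t z \<odot>\<^bsub>M\<^esub> orbit_fun z) w"
    proof cases
      case a
      then show ?thesis using fixed_orb[OF tM tfix zZ a] orb_Z[OF zZ a] tzc by (simp add: M_simps orbit_fun_def)
    next
      case b
      have "t w = s \<otimes>\<^bsub>F\<^esub> t (\<tau> w)" using tM \<tau>_closed[OF b(2)] \<tau>_\<tau>[OF b(2)] by (metis M_carrier)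
      then show ?thesis using b fixed_orb[OF tM tfix zZ b(3)] tzc s_closed
        by (simp add: M_simps orbit_fun_def F.m_comm)
    next
      case c
      have "t w = (\<Oplus>\<^bsub>F\<^esub>x\<in>cosets. \<zero>\<^bsub>F\<^esub>)"
        unfolding tval
      proof (rule F.finsum_cong')
        fix x assume x: "x \<in> cosets"
        have 1: "\<psi> (crep x) y \<in> orb z" by (rule gy[OF crep(1)[OF x]])
        have 2: "\<psi> (crep x) y \<in> Z" by (rule orb_Z[OF zZ 1])
        have "w \<noteq> \<psi> (crep x) y" using 1 c(1) by blast
        moreover have "w \<noteq> \<tau> (\<psi> (crep x) y)" using c(2) 1 \<tau>_closed[OF 2] \<tau>_\<tau>[OF 2] by auto
        ultimately show "bas (\<psi> (crep x) y) w = \<zero>\<^bsub>F\<^esub>" by (simp add: bas_def)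
      qed auto
      then show ?thesis using c tzc by (auto simp: M_simps orbit_fun_def)
    qed
  qed
  have i: "inv\<^bsub>F\<^esub> (t z) \<in> carrier F" "inv\<^bsub>F\<^esub> (t z) \<otimes>\<^bsub>F\<^esub> t z = \<one>\<^bsub>F\<^esub>"
    using tz tzc by (auto simp: F.field_Units)
  define f' where "f' v = inv\<^bsub>F\<^esub> (t z) \<odot>\<^bsub>M\<^esub> f v" for v
  note fc = ghom_closed[OF f(1)]
  have "ghom G F C M f'"
    by (rule ghomI)
      (simp_all add: f'_def i fc ghom_add[OF f(1)] ghom_smult[OF f(1)] ghom_act[OF f(1)] M.smult_r_distr
        M.act_smult M.smult_assoc1[symmetric] F.m_comm)
  moreover have "f' \<Sigma> = orbit_fun z"
  proof -
    have "f' \<Sigma> = inv\<^bsub>F\<^esub> (t z) \<odot>\<^bsub>M\<^esub> (t z \<odot>\<^bsub>M\<^esub> orbit_fun z)" using t_eq by (simp add: f'_def t_def)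
    also have "\<dots> = orbit_fun z"
      using M.smult_assoc1[OF i(1) tzc orbit_fun_in[OF z]] i(2) orbit_fun_in[OF z] by simp
    finally show ?thesis .
  qed
  ultimately show ?thesis by blast
qed

text \<open>Evaluation at \<open>\<psi> x0 z\<close> is invariant under \<open>Q\<close>, so it is the coefficient of the coset \<open>Q\<close> of a homomorphism
to \<open>C\<close>.\<close>

lemma evaluation_form:
  assumes z: "good z" and x0: "x0 \<in> carrier G"
    and sub: "\<And>q. q \<in> Q \<Longrightarrow> inv x0 \<otimes> q \<otimes> x0 \<in> stab z"
  shows "\<exists>h. ghom G F M C h \<and> (\<forall>v\<in>carrier M. h v Q = v (\<psi> x0 z))"
proof -
  have zZ: "z \<in> Z" using z by (simp add: good_def)
  interpret M: rep G F M by (rule M_rep)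
  interpret H: subgroup "stab z" G by (rule stab_subgroup[OF zZ])
  define y where "y = \<psi> x0 z"
  have yZ: "y \<in> Z" unfolding y_def by (rule \<psi>_closed[OF x0 zZ])
  have vq: "v (\<psi> (g \<otimes> q) y) = v (\<psi> g y)" if v: "v \<in> carrier M" and g: "g \<in> carrier G" and q: "q \<in> Q" for v g q
  proof -
    have qc: "q \<in> carrier G" by (rule Q_carrier[OF q])
    let ?h = "inv x0 \<otimes> q \<otimes> x0"
    have h: "?h \<in> stab z" by (rule sub[OF q])
    define v' where "v' = act M (inv (g \<otimes> x0)) v"
    have gx: "g \<otimes> x0 \<in> carrier G" using g x0 by simp
    have v': "v' \<in> carrier M" unfolding v'_def using gx v by (intro M.act_closed) auto
    have val: "v' w = v (\<psi> (g \<otimes> x0) w)" if "w \<in> Z" for w using that gx by (simp add: v'_def M_simps)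
    have "(g \<otimes> x0) \<otimes> ?h = (g \<otimes> q) \<otimes> x0"
    proof -
      have "x0 \<otimes> ?h = q \<otimes> x0" using x0 qc by (simp add: G.m_assoc[symmetric])
      then show ?thesis using g x0 qc by (simp add: G.m_assoc)
    qed
    then have "\<psi> (g \<otimes> q) y = \<psi> (g \<otimes> x0) (\<psi> ?h z)"
      unfolding y_def using \<psi>_mult[of "g \<otimes> q" x0 z] \<psi>_mult[OF gx H.mem_carrier[OF h] zZ] g qc x0 zZ by simp
    then have "v (\<psi> (g \<otimes> q) y) = v' (\<psi> ?h z)" using val[OF \<psi>_closed[OF H.mem_carrier[OF h] zZ]] by simp
    also have "\<dots> = v' z" by (rule orb_stab[OF zZ h v' z])
    also have "\<dots> = v (\<psi> g y)" using val[OF zZ] \<psi>_mult[OF g x0 zZ] by (simp add: y_def)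
    finally show ?thesis .
  qed
  define h where "h v = (\<lambda>x. if x \<in> cosets then v (\<psi> (crep x) y) else \<zero>\<^bsub>F\<^esub>)" for v :: "'z \<Rightarrow> 'f"
  have hg: "h v (g <# Q) = v (\<psi> g y)" if v: "v \<in> carrier M" and g: "g \<in> carrier G" for v g
  proof -
    obtain q where q: "q \<in> Q" "crep (g <# Q) = g \<otimes> q" using crep_coset[OF g] by blast
    show ?thesis using vq[OF v g q(1)] q(2) coset_mem[OF g] by (simp add: h_def)
  qed
  have "ghom G F M C h"
  proof (rule ghomI)
    fix v assume v: "v \<in> carrier M"
    show "h v \<in> carrier C" using M_value[OF v] by (auto simp: h_def C_carrier)
    show "h (v \<oplus>\<^bsub>M\<^esub> w) = h v \<oplus>\<^bsub>C\<^esub> h w" for w by (auto simp: h_def C_simps M_simps)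
    show "h (a \<odot>\<^bsub>M\<^esub> v) = a \<odot>\<^bsub>C\<^esub> h v" if "a \<in> carrier F" for a using that by (auto simp: h_def C_simps M_simps)
    show "h (act M g v) = act C g (h v)" if g: "g \<in> carrier G" for g
    proof
      fix x
      show "h (act M g v) x = act C g (h v) x"
      proof (cases "x \<in> cosets")
        case True
        then obtain k where k: "k \<in> carrier G" "x = k <# Q" using coset_rep[OF True] by auto
        have gk: "inv g \<otimes> k \<in> carrier G" using g k by simp
        have "act C g (h v) x = h v ((inv g \<otimes> k) <# Q)"
          using True k g coset_act[of "inv g" k] by (simp add: C_simps)
        also have "\<dots> = v (\<psi> (inv g) (\<psi> k y))" using hg[OF v gk] g k(1) yZ by (simp add: \<psi>_mult)
        also have "\<dots> = h (act M g v) x"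
          using hg[OF M.act_closed[OF g v] k(1)] k(2) \<psi>_closed[OF k(1) yZ] by (simp add: M_simps)
        finally show ?thesis by simp
      next
        case False
        then show ?thesis by (simp add: h_def C_simps)
      qed
    qed
  qed
  moreover have "h v Q = v y" if "v \<in> carrier M" for v
    using hg[OF that G.one_closed] G.lcos_mult_one[OF Q_subset] \<psi>_one[OF yZ] by simp
  ultimately show ?thesis unfolding y_def by blast
qed

end

lemma (in group) card_conj_subgroup:
  assumes "g \<in> carrier G" "H \<subseteq> carrier G"
  shows "card (conj_subgroup G g H) = card H"
  unfolding conj_subgroup_def
proof (rule card_image, rule inj_onI)
  fix x y assume xy: "x \<in> H" "y \<in> H" "g \<otimes> x \<otimes> inv g = g \<otimes> y \<otimes> inv g"
  then have "x \<in> carrier G" "y \<in> carrier G" using assms(2) by auto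
  then show "x = y" using xy(3) assms(1) by simp
qed

lemma (in group) conj_subgroup_subgroup:
  assumes "g \<in> carrier G" "subgroup H G"
  shows "subgroup (conj_subgroup G g H) G"
proof
  interpret H: subgroup H G by fact
  note c = H.mem_carrier
  show "conj_subgroup G g H \<subseteq> carrier G" using assms(1) c by (auto simp: conj_subgroup_def)
  have "\<one> = g \<otimes> \<one> \<otimes> inv g" using assms(1) by simp
  then show "\<one> \<in> conj_subgroup G g H" unfolding conj_subgroup_def using H.one_closed by blast
  fix x assume "x \<in> conj_subgroup G g H"
  then obtain h where h: "h \<in> H" "x = g \<otimes> h \<otimes> inv g" by (auto simp: conj_subgroup_def)
  have "inv x = g \<otimes> inv h \<otimes> inv g" using h c[OF h(1)] assms(1) by (simp add: inv_mult_group m_assoc)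
  then show "inv x \<in> conj_subgroup G g H" unfolding conj_subgroup_def using H.m_inv_closed[OF h(1)] by blast
  fix y assume "y \<in> conj_subgroup G g H"
  then obtain k where k: "k \<in> H" "y = g \<otimes> k \<otimes> inv g" by (auto simp: conj_subgroup_def)
  have "inv g \<otimes> (g \<otimes> (k \<otimes> inv g)) = k \<otimes> inv g" using c[OF k(1)] assms(1) by (simp add: m_assoc[symmetric])
  then have "x \<otimes> y = g \<otimes> (h \<otimes> k) \<otimes> inv g"
    using h k c[OF h(1)] c[OF k(1)] assms(1) by (simp add: m_assoc)
  then show "x \<otimes> y \<in> conj_subgroup G g H" unfolding conj_subgroup_def using H.m_closed[OF h(1) k(1)] by blast
qed

context signed_perm_scott begin

text \<open>The order of \<open>Q\<close> is a power of \<open>p\<close> that divides the order of the stabiliser, so it divides the order of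
\<open>P\<close>, whose index is prime to \<open>p\<close>. Hence a conjugate of \<open>P\<close> contained in \<open>Q\<close> is all of \<open>Q\<close>.\<close>

lemma conjugate_of_subconjugate:
  assumes z: "z \<in> Z" and P: "subgroup P G" "P \<subseteq> stab z" "card P = p ^ k" "\<not> p dvd card (stab z) div card P"
    and g: "g \<in> carrier G" "\<And>h. h \<in> P \<Longrightarrow> inv g \<otimes> h \<otimes> g \<in> Q"
    and g': "g' \<in> carrier G" "\<And>q. q \<in> Q \<Longrightarrow> inv g' \<otimes> q \<otimes> g' \<in> stab z"
  shows "conjugate_in G P Q"
proof -
  have pr: "Factorial_Ring.prime p" by (rule F.prime_ring_char[OF char_F p_pos])
  have st: "subgroup (stab z) G" by (rule stab_subgroup[OF z])
  have sub: "card H dvd card (stab z)" if H: "subgroup H G" "H \<subseteq> stab z" for H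
  proof -
    have "subgroup H (G\<lparr>carrier := stab z\<rparr>)" by (rule G.subgroup_incl[OF H(1) st H(2)])
    from group.lagrange[OF G.subgroup_imp_group[OF st] this] show ?thesis by (simp add: order_def) (metis dvd_triv_right)
  qed
  let ?A = "conj_subgroup G (inv g) P" and ?B = "conj_subgroup G (inv g') Q"
  have A: "?A \<subseteq> Q" using g by (auto simp: conj_subgroup_def)
  have B: "?B \<subseteq> stab z" using g' by (auto simp: conj_subgroup_def)
  have cA: "card ?A = card P" by (rule G.card_conj_subgroup) (use g subgroup.subset[OF P(1)] in auto)
  have "card ?B = card Q" by (rule G.card_conj_subgroup) (use g' Q_subset in auto)
  then have "card Q dvd card (stab z)" using sub[OF G.conj_subgroup_subgroup[OF _ Q_sub] B] g' by simp
  moreover have "card (stab z) = card P * (card (stab z) div card P)" using sub[OF P(1,2)] by simp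
  ultimately have d: "card Q dvd card P * (card (stab z) div card P)" by simp
  obtain b where b: "card Q = p ^ b" using Q_p by (auto simp: p_subgroup_def)
  have "coprime (p ^ b) (card (stab z) div card P)"
    using prime_imp_coprime[OF pr P(4)] by (simp add: coprime_power_left_iff)
  then have "card Q dvd card P" using d unfolding b by (simp add: coprime_dvd_mult_left_iff)
  then have "card Q \<le> card P" using P(3) p_pos by (intro dvd_imp_le) auto
  then have "?A = Q" using card_seteq[OF finite_subset[OF Q_subset finite_G] A] cA by simp
  then show ?thesis unfolding conjugate_in_def using g(1) by blast
qed

text \<open>Every fixed vector \<open>t\<close> is the combination of the orbit functions \<open>w i\<close> with the coefficients \<open>t (zz i)\<close>, so a
form \<open>l\<close> takes the value \<open>\<Sum> t (zz i) \<cdot> l (w i)\<close> on it. The \<open>i\<close>-th term can be nonzero only if \<open>P i\<close> is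
subconjugate to \<open>Q\<close> and \<open>Q\<close> to the stabiliser of \<open>zz i\<close>, that is, if \<open>Q\<close> is conjugate to \<open>P i\<close>. For the
remaining indices the orbit functions and the evaluations at \<open>zz i\<close> do arise from homomorphisms, and they
form a dual system.\<close>

theorem scott_multiplicity:
  fixes I :: "'i set" and zz :: "'i \<Rightarrow> 'z" and P :: "'i \<Rightarrow> 'g set" and V :: "('f, 'v, 'g) gmod"
  assumes fin: "finite I" and gd: "\<And>i. i \<in> I \<Longrightarrow> good (zz i)"
    and dist: "\<And>i j. i \<in> I \<Longrightarrow> j \<in> I \<Longrightarrow> i \<noteq> j \<Longrightarrow> zz j \<notin> orb (zz i) \<and> \<tau> (zz j) \<notin> orb (zz i)"
    and cover: "\<And>y. good y \<Longrightarrow> \<exists>i\<in>I. y \<in> orb (zz i) \<or> \<tau> y \<in> orb (zz i)"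
    and P: "\<And>i. i \<in> I \<Longrightarrow> subgroup (P i) G" "\<And>i. i \<in> I \<Longrightarrow> P i \<subseteq> stab (zz i)"
      "\<And>i. i \<in> I \<Longrightarrow> \<exists>k. card (P i) = p ^ k"
      "\<And>i. i \<in> I \<Longrightarrow> \<not> p dvd card (stab (zz i)) div card (P i)"
    and V: "rep G F V" and iso: "gmod_iso G F V M"
  shows "gmod_mult G F V (scott_module G F Q) = card {i \<in> I. conjugate_in G (P i) Q}"
    and "is_summand G F (scott_module G F Q) V \<longleftrightarrow> (\<exists>i\<in>I. conjugate_in G (P i) Q)"
proof -
  interpret M: rep G F M by (rule M_rep)
  obtain S W where sc: "scott_module G F Q = C\<lparr>carrier := S\<rparr>"
    and frame: "fixed_vector_summand G F C \<Sigma> (\<lambda>v. v Q) S W" by (rule scott_module_frame)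
  interpret B: fixed_vector_summand G F C \<Sigma> "\<lambda>v. v Q" S W by (rule frame)
  define K where "K = {i \<in> I. conjugate_in G (P i) Q}"
  define w where "w i = orbit_fun (zz i)" for i
  have zZ: "zz i \<in> Z" if "i \<in> I" for i using gd[OF that] by (simp add: good_def)
  have wM: "w i \<in> carrier M" if "i \<in> I" for i unfolding w_def by (rule orbit_fun_in[OF gd[OF that]])
  have wfix: "act M g (w i) = w i" if "i \<in> I" "g \<in> carrier G" for i g
    unfolding w_def by (rule orbit_fun_act[OF gd[OF that(1)] that(2)])
  have w\<delta>: "w i (zz j) = (if i = j then \<one>\<^bsub>F\<^esub> else \<zero>\<^bsub>F\<^esub>)" if ij: "i \<in> I" "j \<in> I" for i j
  proof (cases "i = j")
    case True
    then show ?thesis using orb_self[OF zZ[OF ij(1)]] zZ[OF ij(1)] by (simp add: w_def orbit_fun_def)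
  next
    case False
    then show ?thesis using dist[OF ij False] by (simp add: w_def orbit_fun_def)
  qed
  have expand: "t = finsum M (\<lambda>i. t (zz i) \<odot>\<^bsub>M\<^esub> w i) I"
    if t: "t \<in> carrier M" and tfix: "\<And>g. g \<in> carrier G \<Longrightarrow> act M g t = t" for t
  proof -
    define e where "e = finsum M (\<lambda>i. t (zz i) \<odot>\<^bsub>M\<^esub> w i) I"
    have ec: "(\<lambda>i. t (zz i) \<odot>\<^bsub>M\<^esub> w i) \<in> I \<rightarrow> carrier M" using wM M_value[OF t] by auto
    have eM: "e \<in> carrier M" unfolding e_def by (rule M.M.finsum_closed[OF ec])
    have efix: "act M g e = e" if g: "g \<in> carrier G" for g
    proof -
      have "act M g e = finsum M (\<lambda>i. act M g (t (zz i) \<odot>\<^bsub>M\<^esub> w i)) I"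
        unfolding e_def by (rule M.act_finsum[OF fin ec g])
      also have "\<dots> = e" unfolding e_def
        by (rule M.M.finsum_cong') (use ec wM M_value[OF t] wfix g M.act_smult in auto)
      finally show ?thesis .
    qed
    have ez: "e (zz j) = t (zz j)" if j: "j \<in> I" for j
    proof -
      have "e (zz j) = (\<Oplus>\<^bsub>F\<^esub>i\<in>I. (t (zz i) \<odot>\<^bsub>M\<^esub> w i) (zz j))"
        unfolding e_def
        by (rule finsum_apply[OF M_rep]) (use ec M_value fin in \<open>auto simp: M_simps\<close>)
      also have "\<dots> = (\<Oplus>\<^bsub>F\<^esub>i\<in>I. if j = i then t (zz i) else \<zero>\<^bsub>F\<^esub>)"
        by (rule F.finsum_cong') (use w\<delta> j M_value[OF t] in \<open>auto simp: M_simps\<close>)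
      also have "\<dots> = t (zz j)" using F.finsum_singleton[OF j fin, of "\<lambda>i. t (zz i)"] M_value[OF t] by simp
      finally show ?thesis .
    qed
    have "t y = e y" for y
    proof (cases "y \<in> Z")
      case True
      show ?thesis
      proof (cases "good y")
        case True
        then obtain i where i: "i \<in> I" "y \<in> orb (zz i) \<or> \<tau> y \<in> orb (zz i)" using cover by auto
        from i(2) show ?thesis
        proof
          assume "y \<in> orb (zz i)"
          then show ?thesis using fixed_orb[OF t tfix zZ[OF i(1)]] fixed_orb[OF eM efix zZ[OF i(1)]] ez[OF i(1)] by simp
        next
          assume "\<tau> y \<in> orb (zz i)"
          then have "t (\<tau> y) = e (\<tau> y)"
            using fixed_orb[OF t tfix zZ[OF i(1)]] fixed_orb[OF eM efix zZ[OF i(1)]] ez[OF i(1)] by simp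
          moreover have "v y = s \<otimes>\<^bsub>F\<^esub> v (\<tau> y)" if "v \<in> carrier M" for v
            using that \<tau>_closed[OF \<open>y \<in> Z\<close>] \<tau>_\<tau>[OF \<open>y \<in> Z\<close>] by (metis M_carrier)
          ultimately show ?thesis using t eM by metis
        qed
      next
        case False
        show ?thesis using fixed_bad[OF t tfix \<open>y \<in> Z\<close> False] fixed_bad[OF eM efix \<open>y \<in> Z\<close> False] by simp
      qed
    next
      case False
      then show ?thesis using t eM by (simp add: M_carrier)
    qed
    then show ?thesis unfolding e_def[symmetric] by blast
  qed
  have conjK: "\<exists>x\<in>carrier G. (\<forall>q\<in>Q. inv x \<otimes> q \<otimes> x \<in> stab (zz i)) \<and> card Q = card (P i)"
    if i: "i \<in> K" for i
  proof -
    have iI: "i \<in> I" using i by (simp add: K_def)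
    obtain x where x: "x \<in> carrier G" "conj_subgroup G x (P i) = Q"
      using i by (auto simp: K_def conjugate_in_def)
    have "inv x \<otimes> q \<otimes> x \<in> stab (zz i)" if "q \<in> Q" for q
    proof -
      obtain h where h: "h \<in> P i" "q = x \<otimes> h \<otimes> inv x"
        using \<open>q \<in> Q\<close> unfolding x(2)[symmetric] conj_subgroup_def by auto
      have hc: "h \<in> carrier G" using subgroup.mem_carrier[OF P(1)[OF iI] h(1)] .
      have "inv x \<otimes> (x \<otimes> h) = h" using hc x(1) by (simp add: G.m_assoc[symmetric])
      then have "inv x \<otimes> q \<otimes> x = h" using hc x(1) by (simp add: h(2) G.m_assoc)
      then show ?thesis using h(1) P(2)[OF iI] by auto
    qed
    moreover have "card Q = card (P i)"
      using G.card_conj_subgroup[OF x(1) subgroup.subset[OF P(1)[OF iI]]] x(2) by simp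
    ultimately show ?thesis using x(1) by blast
  qed
  have "\<forall>i. \<exists>h. i \<in> K \<longrightarrow> ghom G F M C h \<and> (\<forall>t\<in>carrier M. (\<forall>g\<in>carrier G. act M g t = t) \<longrightarrow> h t Q = t (zz i))"
  proof
    fix i
    show "\<exists>h. i \<in> K \<longrightarrow> ghom G F M C h \<and> (\<forall>t\<in>carrier M. (\<forall>g\<in>carrier G. act M g t = t) \<longrightarrow> h t Q = t (zz i))"
    proof (cases "i \<in> K")
      case True
      then have iI: "i \<in> I" by (simp add: K_def)
      obtain x where x: "x \<in> carrier G" "\<And>q. q \<in> Q \<Longrightarrow> inv x \<otimes> q \<otimes> x \<in> stab (zz i)"
        using conjK[OF True] by auto
      obtain h where h: "ghom G F M C h" "\<forall>v\<in>carrier M. h v Q = v (\<psi> x (zz i))"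
        using evaluation_form[OF gd[OF iI] x] by auto
      have "h t Q = t (zz i)" if t: "t \<in> carrier M" "\<forall>g\<in>carrier G. act M g t = t" for t
      proof -
        have "\<psi> x (zz i) \<in> orb (zz i)" unfolding orb_def using x(1) by blast
        then show ?thesis using h(2) t fixed_orb[OF t(1) _ zZ[OF iI]] by simp
      qed
      then show ?thesis using h(1) by blast
    qed simp
  qed
  then obtain h where h: "\<And>i. i \<in> K \<Longrightarrow> ghom G F M C (h i)"
    "\<And>i t. i \<in> K \<Longrightarrow> t \<in> carrier M \<Longrightarrow> (\<And>g. g \<in> carrier G \<Longrightarrow> act M g t = t) \<Longrightarrow> h i t Q = t (zz i)"
    by metis
  have KI: "i \<in> I" if "i \<in> K" for i using that by (simp add: K_def)
  have vec: "t \<in> carrier M \<and> (\<forall>g\<in>carrier G. act M g t = t)" if t: "t \<in> B.vectors M" for t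
  proof -
    obtain f where f: "ghom G F C M f" "t = f \<Sigma>" using t unfolding B.vectors_def by auto
    show ?thesis using ghom_closed[OF f(1) \<Sigma>_in] ghom_act[OF f(1) _ \<Sigma>_in] \<Sigma>_act f(2) by simp
  qed
  have "dual_system F (B.vectors M) (B.forms M) K w (\<lambda>i v. h i v Q)"
    unfolding dual_system_def
  proof (intro conjI ballI)
    show "finite K" using fin by (simp add: K_def)
    fix i assume i: "i \<in> K"
    obtain x where x: "x \<in> carrier G" "\<And>q. q \<in> Q \<Longrightarrow> inv x \<otimes> q \<otimes> x \<in> stab (zz i)" "card Q = card (P i)"
      using conjK[OF i] by auto
    have "\<not> p dvd card (stab (zz i)) div card Q" using P(4)[OF KI[OF i]] x(3) by simp
    have "\<exists>f. ghom G F C M f \<and> f \<Sigma> = orbit_fun (zz i)"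
      by (rule orbit_fun_in_image[OF gd[OF KI[OF i]] x(1) _ \<open>\<not> p dvd _\<close>]) (rule x(2))
    then obtain f where "ghom G F C M f" "f \<Sigma> = w i" unfolding w_def by auto
    then show "w i \<in> B.vectors M" unfolding B.vectors_def by (intro CollectI exI[of _ f]) simp
    show "(\<lambda>v. h i v Q) \<in> B.forms M" unfolding B.forms_def using h(1)[OF i] by blast
    fix j assume j: "j \<in> K"
    show "h i (w j) Q = (if i = j then \<one>\<^bsub>F\<^esub> else \<zero>\<^bsub>F\<^esub>)"
      using h(2)[OF i wM[OF KI[OF j]] wfix[OF KI[OF j]]] w\<delta>[OF KI[OF j] KI[OF i]] by auto
  next
    fix t l assume t: "t \<in> B.vectors M" and l: "l \<in> B.forms M"
    obtain f where f: "ghom G F C M f" "t = f \<Sigma>" using t unfolding B.vectors_def by auto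
    obtain k where k: "ghom G F M C k" "l = (\<lambda>v. k v Q)" using l unfolding B.forms_def by auto
    have tM: "t \<in> carrier M" and tfix: "\<And>g. g \<in> carrier G \<Longrightarrow> act M g t = t" using vec[OF t] by auto
    show "l t \<in> carrier F" unfolding k(2) by (rule C_value[OF ghom_closed[OF k(1) tM]])
    have kc: "k (w i) Q \<in> carrier F" if "i \<in> I" for i by (rule C_value[OF ghom_closed[OF k(1) wM[OF that]]])
    have tc: "t y \<in> carrier F" for y by (rule M_value[OF tM])
    have ec: "(\<lambda>i. t (zz i) \<odot>\<^bsub>M\<^esub> w i) \<in> I \<rightarrow> carrier M" using wM tc by auto
    have "k t = k (finsum M (\<lambda>i. t (zz i) \<odot>\<^bsub>M\<^esub> w i) I)" using expand[OF tM tfix] by simp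
    also have "\<dots> = finsum C (\<lambda>i. k (t (zz i) \<odot>\<^bsub>M\<^esub> w i)) I" by (rule ghom_finsum[OF M_rep C_rep k(1) fin ec])
    finally have "l t = finsum C (\<lambda>i. k (t (zz i) \<odot>\<^bsub>M\<^esub> w i)) I Q" by (simp add: k(2))
    also have "\<dots> = (\<Oplus>\<^bsub>F\<^esub>i\<in>I. k (t (zz i) \<odot>\<^bsub>M\<^esub> w i) Q)"
      by (rule finsum_apply[OF C_rep]) (use ghom_closed[OF k(1)] ec C_value fin in \<open>auto simp: C_simps\<close>)
    also have "\<dots> = (\<Oplus>\<^bsub>F\<^esub>i\<in>K. l (w i) \<otimes>\<^bsub>F\<^esub> h i t Q)"
    proof (rule F.add.finprod_mono_neutral_cong_right[OF fin])
      show "K \<subseteq> I" by (auto simp: K_def)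
      show "(\<lambda>i. k (t (zz i) \<odot>\<^bsub>M\<^esub> w i) Q) \<in> I \<rightarrow> carrier F"
        using ghom_closed[OF k(1)] ec C_value by auto
    next
      fix i assume i: "i \<in> K"
      show "k (t (zz i) \<odot>\<^bsub>M\<^esub> w i) Q = l (w i) \<otimes>\<^bsub>F\<^esub> h i t Q"
        using ghom_smult[OF k(1) tc wM[OF KI[OF i]]] h(2)[OF i tM tfix] tc kc[OF KI[OF i]]
        by (simp add: C_simps k(2) F.m_comm)
    next
      fix i assume i: "i \<in> I - K"
      then have iI: "i \<in> I" by simp
      have val: "k (t (zz i) \<odot>\<^bsub>M\<^esub> w i) Q = t (zz i) \<otimes>\<^bsub>F\<^esub> k (w i) Q"
        using ghom_smult[OF k(1) tc wM[OF iI]] by (simp add: C_simps)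
      show "k (t (zz i) \<odot>\<^bsub>M\<^esub> w i) Q = \<zero>\<^bsub>F\<^esub>"
      proof (rule ccontr)
        assume nz: "k (t (zz i) \<odot>\<^bsub>M\<^esub> w i) Q \<noteq> \<zero>\<^bsub>F\<^esub>"
        have n1: "f \<Sigma> (zz i) \<noteq> \<zero>\<^bsub>F\<^esub>" and n2: "k (orbit_fun (zz i)) Q \<noteq> \<zero>\<^bsub>F\<^esub>"
          using nz val tc kc[OF iI] f(2) by (auto simp: w_def)
        obtain m where m: "card (P i) = p ^ m" using P(3)[OF iI] by auto
        obtain g where g: "g \<in> carrier G" "\<And>h. h \<in> P i \<Longrightarrow> inv g \<otimes> h \<otimes> g \<in> Q"
          using coefficient_nonzero[OF f(1) gd[OF iI] n1 P(1,2)[OF iI] m] by auto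
        obtain g' where g': "g' \<in> carrier G" "\<And>q. q \<in> Q \<Longrightarrow> inv g' \<otimes> q \<otimes> g' \<in> stab (zz i)"
          using form_nonzero[OF k(1) gd[OF iI] n2] by auto
        from conjugate_of_subconjugate[OF zZ[OF iI] P(1,2)[OF iI] m P(4)[OF iI] g g'] i
        show False by (simp add: K_def)
      qed
    qed
    finally show "l t = (\<Oplus>\<^bsub>F\<^esub>i\<in>K. l (w i) \<otimes>\<^bsub>F\<^esub> h i t Q)" .
  qed
  note dM = this
  obtain \<phi> where \<phi>: "ghom G F V M \<phi>" "bij_betw \<phi> (carrier V) (carrier M)"
    using iso unfolding gmod_iso_ghom by auto
  note dV = B.dual_system_iso[OF V M_rep \<phi> dM]
  note res = B.multiplicity_from_dual_system[OF V finite_length_iso[OF V M_rep iso M_finite_length] dV]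
  show "gmod_mult G F V (scott_module G F Q) = card {i \<in> I. conjugate_in G (P i) Q}"
    using res(1) unfolding sc K_def .
  show "is_summand G F (scott_module G F Q) V \<longleftrightarrow> (\<exists>i\<in>I. conjugate_in G (P i) Q)"
    using res(2) unfolding sc K_def by auto
qed

end

section \<open>Symmetric and exterior squares of permutation modules\<close>

lemma span_of_superset: "S \<subseteq> span_of R V S"
  by (auto simp: span_of_def)

lemma span_of_least:
  assumes "gsubmodule G R V U" "S \<subseteq> U"
  shows "span_of R V S \<subseteq> U"
  using assms by (auto simp: span_of_def gsubmodule_def)

lemma (in rep) span_of_gsubmodule:
  assumes S: "S \<subseteq> carrier V" and stable: "\<And>g r. g \<in> carrier G \<Longrightarrow> r \<in> S \<Longrightarrow> act V g r \<in> S"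
  shows "gsubmodule G R V (span_of R V S)"
proof (rule gsubmoduleI)
  let ?S = "span_of R V S"
  have sc: "submodule (carrier V) R V" by (rule carrier_is_submodule)
  show "?S \<subseteq> carrier V" unfolding span_of_def using sc S by blast
  have zero: "\<zero>\<^bsub>V\<^esub> \<in> U" if "submodule U R V" for U
    using subgroup.one_closed[OF submodule.axioms(1)[OF that]] by simp
  show "\<zero>\<^bsub>V\<^esub> \<in> ?S" unfolding span_of_def using zero by blast
  fix u assume u: "u \<in> ?S"
  show "u \<oplus>\<^bsub>V\<^esub> w \<in> ?S" if "w \<in> ?S" for w
    using u that submoduleE(5) unfolding span_of_def by blast
  show "a \<odot>\<^bsub>V\<^esub> u \<in> ?S" if "a \<in> carrier R" for a
    using u that submoduleE(4) unfolding span_of_def by blast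
  show "act V g u \<in> ?S" if g: "g \<in> carrier G" for g
  proof -
    have "act V g u \<in> U" if U: "submodule U R V" "S \<subseteq> U" for U
    proof -
      let ?U = "{x \<in> carrier V. act V g x \<in> U}"
      have "submodule ?U R V"
      proof (rule submoduleI)
        show "?U \<subseteq> carrier V" by blast
        show "\<zero>\<^bsub>V\<^esub> \<in> ?U" using zero[OF U(1)] act_zero[OF g] by simp
      next
        fix x y assume "x \<in> ?U" "y \<in> ?U"
        then show "x \<oplus>\<^bsub>V\<^esub> y \<in> ?U" using submoduleE(5)[OF U(1)] act_add[OF g] by simp
      next
        fix a x assume "a \<in> carrier R" "x \<in> ?U"
        then show "a \<odot>\<^bsub>V\<^esub> x \<in> ?U" using submoduleE(4)[OF U(1)] act_smult[OF g] by simp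
      next
        fix x assume x: "x \<in> ?U"
        have "\<ominus>\<^bsub>V\<^esub> x = (\<ominus>\<^bsub>R\<^esub> \<one>\<^bsub>R\<^esub>) \<odot>\<^bsub>V\<^esub> x" using x smult_l_minus[of "\<one>\<^bsub>R\<^esub>" x] by simp
        then show "\<ominus>\<^bsub>V\<^esub> x \<in> ?U"
          using x submoduleE(4)[OF U(1), of "\<ominus>\<^bsub>R\<^esub> \<one>\<^bsub>R\<^esub>"] act_smult[OF g, of "\<ominus>\<^bsub>R\<^esub> \<one>\<^bsub>R\<^esub>" x] by simp
      qed
      moreover have "S \<subseteq> ?U" using S stable[OF g] U(2) by blast
      ultimately have "u \<in> ?U" using u unfolding span_of_def by blast
      then show ?thesis by simp
    qed
    then show ?thesis unfolding span_of_def by blast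
  qed
qed

lemma (in rep) act_diff:
  assumes "g \<in> carrier G" "v \<in> carrier V" "w \<in> carrier V"
  shows "act V g (v \<ominus>\<^bsub>V\<^esub> w) = act V g v \<ominus>\<^bsub>V\<^esub> act V g w"
proof -
  have "\<ominus>\<^bsub>V\<^esub> u = (\<ominus>\<^bsub>R\<^esub> \<one>\<^bsub>R\<^esub>) \<odot>\<^bsub>V\<^esub> u" if "u \<in> carrier V" for u
    using that smult_l_minus[of "\<one>\<^bsub>R\<^esub>" u] by simp
  then show ?thesis using assms by (simp add: M.minus_eq act_add act_smult act_closed)
qed

text \<open>Both squares are quotients of the free module on pairs of vectors. The quotient map and the map
  \<open>\<Theta>\<close> to the signed permutation module on pairs of basis elements, induced by the bilinear map
  \<open>\<beta>\<close>, are shown to have the same kernel.\<close>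

locale pair_model = G: group G + F: field F
  for G :: "('g, 'a) monoid_scheme" and F :: "('f, 'b) ring_scheme" (structure) +
  fixes Y :: "'x set" and \<phi> :: "'g \<Rightarrow> 'x \<Rightarrow> 'x" and Z :: "('x \<times> 'x) set" and s :: 'f
  assumes fin_G: "finite (carrier G)" and fin_Y: "finite Y"
    and \<phi>_closed: "g \<in> carrier G \<Longrightarrow> x \<in> Y \<Longrightarrow> \<phi> g x \<in> Y"
    and \<phi>_one: "x \<in> Y \<Longrightarrow> \<phi> \<one>\<^bsub>G\<^esub> x = x"
    and \<phi>_mult: "g \<in> carrier G \<Longrightarrow> h \<in> carrier G \<Longrightarrow> x \<in> Y \<Longrightarrow> \<phi> (g \<otimes>\<^bsub>G\<^esub> h) x = \<phi> g (\<phi> h x)"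
    and Z_sub: "Z \<subseteq> Y \<times> Y" and Z_swap: "(x, y) \<in> Z \<Longrightarrow> (y, x) \<in> Z"
    and Z_act: "g \<in> carrier G \<Longrightarrow> (x, y) \<in> Z \<Longrightarrow> (\<phi> g x, \<phi> g y) \<in> Z"
    and s_cl: "s \<in> carrier F" and s_sq: "s \<otimes> s = \<one>"
    and s_diag: "s \<noteq> \<one> \<Longrightarrow> (x, x) \<notin> Z"
begin

sublocale signed_perm G F Z "\<lambda>g. map_prod (\<phi> g) (\<phi> g)" prod.swap s
proof unfold_locales
  show "finite (carrier G)" by (rule fin_G)
  show "finite Z" using finite_subset[OF Z_sub] fin_Y by simp
  show "s \<in> carrier F" "s \<otimes> s = \<one>" by (rule s_cl, rule s_sq)
next
  fix g z assume "g \<in> carrier G" "z \<in> Z"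
  then show "map_prod (\<phi> g) (\<phi> g) z \<in> Z" using Z_act by (cases z) simp
next
  fix z assume "z \<in> Z"
  then show "map_prod (\<phi> \<one>\<^bsub>G\<^esub>) (\<phi> \<one>\<^bsub>G\<^esub>) z = z" using Z_sub \<phi>_one by (cases z) auto
next
  fix g h z assume "g \<in> carrier G" "h \<in> carrier G" "z \<in> Z"
  then show "map_prod (\<phi> (g \<otimes>\<^bsub>G\<^esub> h)) (\<phi> (g \<otimes>\<^bsub>G\<^esub> h)) z = map_prod (\<phi> g) (\<phi> g) (map_prod (\<phi> h) (\<phi> h) z)"
    using Z_sub \<phi>_mult by (cases z) auto
next
  fix z assume "z \<in> Z"
  then show "prod.swap z \<in> Z" using Z_swap by (cases z) simp
next
  fix z :: "'x \<times> 'x" show "prod.swap (prod.swap z) = z" by simp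
next
  fix g and z :: "'x \<times> 'x"
  show "map_prod (\<phi> g) (\<phi> g) (prod.swap z) = prod.swap (map_prod (\<phi> g) (\<phi> g) z)" by (cases z) simp
next
  fix z assume "s \<noteq> \<one>" "z \<in> Z"
  then show "prod.swap z \<noteq> z" using s_diag by (cases z) auto
qed

abbreviation "V \<equiv> perm_gmod G F Y \<phi>"
abbreviation "FP \<equiv> free_pair_gmod G F V V"
abbreviation "T \<equiv> tensor_gmod G F V V"
abbreviation "d v w \<equiv> basis_elt F (v, w)"

lemma V_rep: "rep G F V"
  by (intro rep.intro perm_gmod_gmodule G.is_group F.is_cring \<phi>_closed \<phi>_one \<phi>_mult)

lemma \<phi>_inv: "g \<in> carrier G \<Longrightarrow> x \<in> Y \<Longrightarrow> \<phi> (inv\<^bsub>G\<^esub> g) (\<phi> g x) = x"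
  "g \<in> carrier G \<Longrightarrow> x \<in> Y \<Longrightarrow> \<phi> g (\<phi> (inv\<^bsub>G\<^esub> g) x) = x"
  using \<phi>_mult[of "inv\<^bsub>G\<^esub> g" g x] \<phi>_mult[of g "inv\<^bsub>G\<^esub> g" x] \<phi>_one[of x] by auto

lemma V_value: "v \<in> carrier V \<Longrightarrow> v x \<in> carrier F"
  by (rule perm_gmod_value[OF F.is_cring])

lemma V_basis: "x \<in> Y \<Longrightarrow> basis_elt F x \<in> carrier V"
  by (rule basis_elt_in[OF F.is_cring])

lemma V_act_inv:
  "g \<in> carrier G \<Longrightarrow> v \<in> carrier V \<Longrightarrow> act V (inv\<^bsub>G\<^esub> g) (act V g v) = v"
  "g \<in> carrier G \<Longrightarrow> v \<in> carrier V \<Longrightarrow> act V g (act V (inv\<^bsub>G\<^esub> g) v) = v"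
proof -
  interpret V: rep G F V by (rule V_rep)
  show "g \<in> carrier G \<Longrightarrow> v \<in> carrier V \<Longrightarrow> act V (inv\<^bsub>G\<^esub> g) (act V g v) = v"
    "g \<in> carrier G \<Longrightarrow> v \<in> carrier V \<Longrightarrow> act V g (act V (inv\<^bsub>G\<^esub> g) v) = v"
    using V.act_mult[of "inv\<^bsub>G\<^esub> g" g v] V.act_mult[of g "inv\<^bsub>G\<^esub> g" v] V.act_one[of v] by auto
qed

lemma FP_rep: "rep G F FP"
proof -
  interpret V: rep G F V by (rule V_rep)
  show ?thesis unfolding free_pair_gmod_def
    by (intro rep.intro perm_gmod_gmodule G.is_group F.is_cring)
      (auto simp: V.act_closed V.act_one V.act_mult)
qed

lemma d_in: "v \<in> carrier V \<Longrightarrow> w \<in> carrier V \<Longrightarrow> d v w \<in> carrier FP"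
  unfolding free_pair_gmod_def by (rule basis_elt_in[OF F.is_cring]) simp

lemma d_act:
  assumes g: "g \<in> carrier G" and v: "v \<in> carrier V" and w: "w \<in> carrier V"
  shows "act FP g (d v w) = d (act V g v) (act V g w)"
proof -
  interpret V: rep G F V by (rule V_rep)
  have "act FP g (d v w) = basis_elt F ((\<lambda>(v, w). (act V g v, act V g w)) (v, w))"
    unfolding free_pair_gmod_def
    by (rule basis_elt_act) (use g v w V.act_closed V_act_inv in auto)
  then show ?thesis by simp
qed

definition BR where "BR = bilinear_rels G F V V"
definition BS where "BS = bilinear_span G F V V"

lemma BR_cases:
  assumes "r \<in> BR"
  obtains (1) u v w where "u \<in> carrier V" "v \<in> carrier V" "w \<in> carrier V"
      "r = d (u \<oplus>\<^bsub>V\<^esub> v) w \<ominus>\<^bsub>FP\<^esub> (d u w \<oplus>\<^bsub>FP\<^esub> d v w)"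
    | (2) v w z where "v \<in> carrier V" "w \<in> carrier V" "z \<in> carrier V"
      "r = d v (w \<oplus>\<^bsub>V\<^esub> z) \<ominus>\<^bsub>FP\<^esub> (d v w \<oplus>\<^bsub>FP\<^esub> d v z)"
    | (3) a v w where "a \<in> carrier F" "v \<in> carrier V" "w \<in> carrier V"
      "r = d (a \<odot>\<^bsub>V\<^esub> v) w \<ominus>\<^bsub>FP\<^esub> a \<odot>\<^bsub>FP\<^esub> d v w"
    | (4) a v w where "a \<in> carrier F" "v \<in> carrier V" "w \<in> carrier V"
      "r = d v (a \<odot>\<^bsub>V\<^esub> w) \<ominus>\<^bsub>FP\<^esub> a \<odot>\<^bsub>FP\<^esub> d v w"
proof -
  from assms consider
      (a) "r \<in> {d (u \<oplus>\<^bsub>V\<^esub> v) w \<ominus>\<^bsub>FP\<^esub> (d u w \<oplus>\<^bsub>FP\<^esub> d v w) | u v w.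
          u \<in> carrier V \<and> v \<in> carrier V \<and> w \<in> carrier V}"
    | (b) "r \<in> {d v (w \<oplus>\<^bsub>V\<^esub> z) \<ominus>\<^bsub>FP\<^esub> (d v w \<oplus>\<^bsub>FP\<^esub> d v z) | v w z.
          v \<in> carrier V \<and> w \<in> carrier V \<and> z \<in> carrier V}"
    | (c) "r \<in> {d (a \<odot>\<^bsub>V\<^esub> v) w \<ominus>\<^bsub>FP\<^esub> a \<odot>\<^bsub>FP\<^esub> d v w | a v w.
          a \<in> carrier F \<and> v \<in> carrier V \<and> w \<in> carrier V}"
    | (d) "r \<in> {d v (a \<odot>\<^bsub>V\<^esub> w) \<ominus>\<^bsub>FP\<^esub> a \<odot>\<^bsub>FP\<^esub> d v w | a v w.
          a \<in> carrier F \<and> v \<in> carrier V \<and> w \<in> carrier V}"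
    unfolding BR_def bilinear_rels_def Let_def by blast
  then show ?thesis
  proof cases
    case a then show ?thesis using 1 by auto
  next
    case b then show ?thesis using 2 by auto
  next
    case c then show ?thesis using 3 by auto
  next
    case d then show ?thesis using 4 by auto
  qed
qed

lemma BR_intros:
  "u \<in> carrier V \<Longrightarrow> v \<in> carrier V \<Longrightarrow> w \<in> carrier V \<Longrightarrow> d (u \<oplus>\<^bsub>V\<^esub> v) w \<ominus>\<^bsub>FP\<^esub> (d u w \<oplus>\<^bsub>FP\<^esub> d v w) \<in> BR"
  "v \<in> carrier V \<Longrightarrow> w \<in> carrier V \<Longrightarrow> z \<in> carrier V \<Longrightarrow> d v (w \<oplus>\<^bsub>V\<^esub> z) \<ominus>\<^bsub>FP\<^esub> (d v w \<oplus>\<^bsub>FP\<^esub> d v z) \<in> BR"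
  "a \<in> carrier F \<Longrightarrow> v \<in> carrier V \<Longrightarrow> w \<in> carrier V \<Longrightarrow> d (a \<odot>\<^bsub>V\<^esub> v) w \<ominus>\<^bsub>FP\<^esub> a \<odot>\<^bsub>FP\<^esub> d v w \<in> BR"
  "a \<in> carrier F \<Longrightarrow> v \<in> carrier V \<Longrightarrow> w \<in> carrier V \<Longrightarrow> d v (a \<odot>\<^bsub>V\<^esub> w) \<ominus>\<^bsub>FP\<^esub> a \<odot>\<^bsub>FP\<^esub> d v w \<in> BR"
  unfolding BR_def bilinear_rels_def Let_def by blast+

lemma BR_carrier: "BR \<subseteq> carrier FP"
proof
  interpret V: rep G F V by (rule V_rep)
  interpret FP: rep G F FP by (rule FP_rep)
  fix r assume "r \<in> BR"
  then show "r \<in> carrier FP"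
    by (cases rule: BR_cases) (auto intro!: d_in FP.M.minus_closed FP.M.a_closed FP.smult_closed V.M.a_closed V.smult_closed)
qed

lemma BR_stable:
  assumes g: "g \<in> carrier G" and r: "r \<in> BR"
  shows "act FP g r \<in> BR"
proof -
  interpret V: rep G F V by (rule V_rep)
  interpret FP: rep G F FP by (rule FP_rep)
  note diff = FP.act_diff[OF g]
  note c = V.act_closed[OF g]
  from r show ?thesis
  proof (cases rule: BR_cases)
    case (1 u v w)
    have "act FP g r = d (act V g u \<oplus>\<^bsub>V\<^esub> act V g v) (act V g w) \<ominus>\<^bsub>FP\<^esub>
        (d (act V g u) (act V g w) \<oplus>\<^bsub>FP\<^esub> d (act V g v) (act V g w))"
      unfolding 1(4) using 1(1-3)
      by (simp add: diff d_in FP.act_add[OF g] d_act[OF g] V.act_add[OF g])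
    then show ?thesis using BR_intros(1)[OF c[OF 1(1)] c[OF 1(2)] c[OF 1(3)]] by simp
  next
    case (2 v w z)
    have "act FP g r = d (act V g v) (act V g w \<oplus>\<^bsub>V\<^esub> act V g z) \<ominus>\<^bsub>FP\<^esub>
        (d (act V g v) (act V g w) \<oplus>\<^bsub>FP\<^esub> d (act V g v) (act V g z))"
      unfolding 2(4) using 2(1-3)
      by (simp add: diff d_in FP.act_add[OF g] d_act[OF g] V.act_add[OF g])
    then show ?thesis using BR_intros(2)[OF c[OF 2(1)] c[OF 2(2)] c[OF 2(3)]] by simp
  next
    case (3 a v w)
    have "act FP g r = d (a \<odot>\<^bsub>V\<^esub> act V g v) (act V g w) \<ominus>\<^bsub>FP\<^esub> a \<odot>\<^bsub>FP\<^esub> d (act V g v) (act V g w)"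
      unfolding 3(4) using 3(1-3)
      by (simp add: diff d_in FP.act_smult[OF g] d_act[OF g] V.act_smult[OF g])
    then show ?thesis using BR_intros(3)[OF 3(1) c[OF 3(2)] c[OF 3(3)]] by simp
  next
    case (4 a v w)
    have "act FP g r = d (act V g v) (a \<odot>\<^bsub>V\<^esub> act V g w) \<ominus>\<^bsub>FP\<^esub> a \<odot>\<^bsub>FP\<^esub> d (act V g v) (act V g w)"
      unfolding 4(4) using 4(1-3)
      by (simp add: diff d_in FP.act_smult[OF g] d_act[OF g] V.act_smult[OF g])
    then show ?thesis using BR_intros(4)[OF 4(1) c[OF 4(2)] c[OF 4(3)]] by simp
  qed
qed

lemma BS_gsub: "gsubmodule G F FP BS"
  unfolding BS_def bilinear_span_def BR_def[symmetric]
  by (rule rep.span_of_gsubmodule[OF FP_rep BR_carrier BR_stable])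

lemma T_eq: "T = quot_gmod FP BS"
  by (simp add: tensor_gmod_def BS_def)

lemmas T_rep = quot_gmod_projection(1)[OF FP_rep BS_gsub, folded T_eq]
lemmas T_proj = quot_gmod_projection(2)[OF FP_rep BS_gsub, folded T_eq]
lemmas T_surj = quot_gmod_projection(3)[OF FP_rep BS_gsub, folded T_eq]
lemmas T_ker = quot_gmod_projection(4)[OF FP_rep BS_gsub, folded T_eq]

lemma pure_tensor_eq: "pure_tensor G F V V v w = BS +>\<^bsub>FP\<^esub> d v w"
  by (simp add: pure_tensor_def BS_def)

text \<open>The values on the diagonal are not symmetrised: otherwise the image of \<open>\<Theta>\<close> would consist of functions that
vanish on the diagonal in characteristic \<open>2\<close>.\<close>

definition \<beta> :: "('x \<Rightarrow> 'f) \<Rightarrow> ('x \<Rightarrow> 'f) \<Rightarrow> 'x \<times> 'x \<Rightarrow> 'f" where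
  "\<beta> v w = (\<lambda>(x, y). if (x, y) \<in> Z then (if x = y then v x \<otimes> w x
      else v x \<otimes> w y \<oplus> s \<otimes> (v y \<otimes> w x)) else \<zero>)"

lemma \<beta>_in:
  assumes v: "v \<in> carrier V" and w: "w \<in> carrier V"
  shows "\<beta> v w \<in> carrier M"
  unfolding M_carrier
proof (intro conjI ballI allI impI)
  fix z assume z: "z \<in> Z"
  obtain x y where xy: "z = (x, y)" by (cases z)
  note c = V_value[OF v] V_value[OF w] s_cl
  show cl: "\<beta> v w z \<in> carrier F" using c by (simp add: \<beta>_def xy)
  have z': "(y, x) \<in> Z" using Z_swap z xy by simp
  show "\<beta> v w (prod.swap z) = s \<otimes> \<beta> v w z"
  proof (cases "x = y")
    case True
    then have s1: "s = \<one>" using s_diag z xy by auto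
    have "s \<otimes> \<beta> v w z = \<beta> v w z" unfolding s1 using cl s1 by simp
    moreover have "prod.swap z = z" using True xy by simp
    ultimately show ?thesis by simp
  next
    case False
    have "s \<otimes> (s \<otimes> (v y \<otimes> w x)) = v y \<otimes> w x"
      using c s_sq by (simp add: F.m_assoc[symmetric])
    then show ?thesis using False z z' c by (simp add: \<beta>_def xy F.r_distr F.a_comm)
  qed
qed (auto simp: \<beta>_def split: prod.splits)

lemma \<beta>_act:
  assumes g: "g \<in> carrier G" and v: "v \<in> carrier V" and w: "w \<in> carrier V"
  shows "\<beta> (act V g v) (act V g w) = act M g (\<beta> v w)"
proof
  fix z :: "'x \<times> 'x"
  obtain x y where z: "z = (x, y)" by (cases z)
  have gi: "inv\<^bsub>G\<^esub> g \<in> carrier G" using g by simp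
  show "\<beta> (act V g v) (act V g w) z = act M g (\<beta> v w) z"
  proof (cases "(x, y) \<in> Z")
    case True
    then have Yx: "x \<in> Y" "y \<in> Y" using Z_sub by auto
    have "\<phi> (inv\<^bsub>G\<^esub> g) x = \<phi> (inv\<^bsub>G\<^esub> g) y \<longleftrightarrow> x = y"
      using \<phi>_inv(2)[OF g Yx(1)] \<phi>_inv(2)[OF g Yx(2)] by metis
    then show ?thesis using True Yx Z_act[OF gi True] by (simp add: z \<beta>_def M_simps perm_gmod_simps(4))
  next
    case False
    then show ?thesis by (simp add: z \<beta>_def M_simps)
  qed
qed

lemma \<beta>_add1: "u \<in> carrier V \<Longrightarrow> v \<in> carrier V \<Longrightarrow> w \<in> carrier V \<Longrightarrow> \<beta> (u \<oplus>\<^bsub>V\<^esub> v) w = \<beta> u w \<oplus>\<^bsub>M\<^esub> \<beta> v w"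
  using V_value s_cl
  by (auto simp: \<beta>_def M_simps perm_gmod_simps(2) F.l_distr F.r_distr F.a_ac fun_eq_iff)

lemma \<beta>_add2: "u \<in> carrier V \<Longrightarrow> v \<in> carrier V \<Longrightarrow> w \<in> carrier V \<Longrightarrow> \<beta> u (v \<oplus>\<^bsub>V\<^esub> w) = \<beta> u v \<oplus>\<^bsub>M\<^esub> \<beta> u w"
  using V_value s_cl
  by (auto simp: \<beta>_def M_simps perm_gmod_simps(2) F.r_distr F.a_ac fun_eq_iff)

lemma \<beta>_smult1: "a \<in> carrier F \<Longrightarrow> v \<in> carrier V \<Longrightarrow> w \<in> carrier V \<Longrightarrow> \<beta> (a \<odot>\<^bsub>V\<^esub> v) w = a \<odot>\<^bsub>M\<^esub> \<beta> v w"
  using V_value s_cl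
  by (auto simp: \<beta>_def M_simps perm_gmod_simps(3) F.r_distr F.m_ac fun_eq_iff)

lemma \<beta>_smult2: "a \<in> carrier F \<Longrightarrow> v \<in> carrier V \<Longrightarrow> w \<in> carrier V \<Longrightarrow> \<beta> v (a \<odot>\<^bsub>V\<^esub> w) = a \<odot>\<^bsub>M\<^esub> \<beta> v w"
  using V_value s_cl
  by (auto simp: \<beta>_def M_simps perm_gmod_simps(3) F.r_distr F.m_ac fun_eq_iff)

lemma \<Theta>_exists: "\<exists>\<Theta>. ghom G F FP M \<Theta> \<and> (\<forall>v\<in>carrier V. \<forall>w\<in>carrier V. \<Theta> (d v w) = \<beta> v w)"
proof -
  interpret V: rep G F V by (rule V_rep)
  have "\<exists>L. ghom G F FP M L \<and> (\<forall>y\<in>carrier V \<times> carrier V. L (basis_elt F y) = (\<lambda>(v, w). \<beta> v w) y)"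
    unfolding free_pair_gmod_def
    by (rule free_lift[OF FP_rep[unfolded free_pair_gmod_def] M_rep])
      (auto simp: V.act_closed V_act_inv \<beta>_in \<beta>_act)
  then show ?thesis by auto
qed

definition \<Theta> where "\<Theta> = (SOME \<Theta>. ghom G F FP M \<Theta> \<and> (\<forall>v\<in>carrier V. \<forall>w\<in>carrier V. \<Theta> (d v w) = \<beta> v w))"

lemma \<Theta>: "ghom G F FP M \<Theta>" "v \<in> carrier V \<Longrightarrow> w \<in> carrier V \<Longrightarrow> \<Theta> (d v w) = \<beta> v w"
  using someI_ex[OF \<Theta>_exists] unfolding \<Theta>_def by auto

lemma BS_ker: "BS \<subseteq> {f \<in> carrier FP. \<Theta> f = \<zero>\<^bsub>M\<^esub>}"
  unfolding BS_def bilinear_span_def BR_def[symmetric]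
proof (rule span_of_least[OF ghom_ker_gsub[OF FP_rep M_rep \<Theta>(1)]])
  interpret V: rep G F V by (rule V_rep)
  interpret FP: rep G F FP by (rule FP_rep)
  interpret M: rep G F M by (rule M_rep)
  show "BR \<subseteq> {f \<in> carrier FP. \<Theta> f = \<zero>\<^bsub>M\<^esub>}"
  proof
    fix r assume r: "r \<in> BR"
    have D: "\<Theta> (a \<ominus>\<^bsub>FP\<^esub> b) = \<zero>\<^bsub>M\<^esub>" if "a \<in> carrier FP" "b \<in> carrier FP" "\<Theta> a = \<Theta> b" for a b
      using ghom_diff[OF FP_rep M_rep \<Theta>(1) that(1,2)] that(3) ghom_closed[OF \<Theta>(1) that(2)]
      by (simp add: M.M.minus_eq M.M.r_neg)
    note A = ghom_add[OF \<Theta>(1)] and S = ghom_smult[OF \<Theta>(1)]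
    from r have "\<Theta> r = \<zero>\<^bsub>M\<^esub>"
    proof (cases rule: BR_cases)
      case (1 u v w)
      then show ?thesis unfolding 1(4) by (intro D) (auto simp: d_in A \<Theta>(2) \<beta>_add1)
    next
      case (2 v w z)
      then show ?thesis unfolding 2(4) by (intro D) (auto simp: d_in A \<Theta>(2) \<beta>_add2)
    next
      case (3 a v w)
      then show ?thesis unfolding 3(4) by (intro D) (auto simp: d_in S \<Theta>(2) \<beta>_smult1)
    next
      case (4 a v w)
      then show ?thesis unfolding 4(4) by (intro D) (auto simp: d_in S \<Theta>(2) \<beta>_smult2)
    qed
    then show "r \<in> {f \<in> carrier FP. \<Theta> f = \<zero>\<^bsub>M\<^esub>}" using BR_carrier r by blast
  qed
qed

lemma \<beta>_basis:
  "\<beta> (basis_elt F a) (basis_elt F b) (x, y) = (if (x, y) \<in> Z then (if x = a \<and> y = b then \<one> else if x = b \<and> y = a then s else \<zero>) else \<zero>)"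
proof (cases "(x, y) \<in> Z")
  case Z: True
  have e: "basis_elt F u v = (if v = u then \<one> else \<zero>)" for u v :: 'x by (simp add: basis_elt_def)
  have bool: "(if P then \<one> else \<zero>) \<oplus> s \<otimes> (if Q then \<one> else \<zero>)
      = (if P then \<one> else if Q then s else \<zero>)" if "\<not> (P \<and> Q)" for P Q
    using that s_cl by (cases P; cases Q) simp_all
  show ?thesis
  proof (cases "x = y")
    case True
    have "\<beta> (basis_elt F a) (basis_elt F b) (x, y) = basis_elt F a y \<otimes> basis_elt F b y"
      using Z True by (simp add: \<beta>_def)
    also have "\<dots> = (if y = a \<and> y = b then \<one> else \<zero>)" unfolding e by (cases "y = a"; cases "y = b") simp_all
    finally show ?thesis using Z True by auto
  next
    case False
    have "\<beta> (basis_elt F a) (basis_elt F b) (x, y)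
        = basis_elt F a x \<otimes> basis_elt F b y \<oplus> s \<otimes> (basis_elt F a y \<otimes> basis_elt F b x)"
      using Z False by (simp add: \<beta>_def)
    also have "basis_elt F a x \<otimes> basis_elt F b y = (if x = a \<and> y = b then \<one> else \<zero>)"
      unfolding e by (cases "x = a"; cases "y = b") simp_all
    also have "basis_elt F a y \<otimes> basis_elt F b x = (if y = a \<and> x = b then \<one> else \<zero>)"
      unfolding e by (cases "y = a"; cases "x = b") simp_all
    also have "(if x = a \<and> y = b then \<one> else \<zero>) \<oplus> s \<otimes> (if y = a \<and> x = b then \<one> else \<zero>)
        = (if x = a \<and> y = b then \<one> else if y = a \<and> x = b then s else \<zero>)"
    proof (rule bool)
      show "\<not> ((x = a \<and> y = b) \<and> (y = a \<and> x = b))" using False by blast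
    qed
    finally show ?thesis using Z by (simp only: if_True conj_commute)
  qed
qed (simp add: \<beta>_def)

lemma \<beta>_basis_off: "z \<noteq> (a, b) \<Longrightarrow> z \<noteq> (b, a) \<Longrightarrow> \<beta> (basis_elt F a) (basis_elt F b) z = \<zero>"
  by (cases z) (auto simp only: \<beta>_basis prod.inject if_False split: if_split)

lemma \<beta>_basis_on: "(a, b) \<in> Z \<Longrightarrow> \<beta> (basis_elt F a) (basis_elt F b) (a, b) = \<one>"
  by (simp only: \<beta>_basis if_True simp_thms)

lemma \<beta>_basis_swap: "(b, a) \<in> Z \<Longrightarrow> a \<noteq> b \<Longrightarrow> \<beta> (basis_elt F a) (basis_elt F b) (b, a) = s"
  unfolding \<beta>_basis by (subst if_P, assumption) (subst if_not_P, blast, rule if_P, blast)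

lemma \<beta>_basis_out: "z \<notin> Z \<Longrightarrow> \<beta> (basis_elt F a) (basis_elt F b) z = \<zero>"
  by (cases z) (simp only: \<beta>_basis if_False simp_thms)

end

lemma (in abelian_group) minus_eq_zero_iff:
  assumes "a \<in> carrier G" "b \<in> carrier G" shows "a \<ominus> b = \<zero> \<longleftrightarrow> a = b"
  using assms minus_equality[of a "\<ominus> b"] by (auto simp: minus_eq r_neg)

context pair_model begin

definition rels where "rels D = (\<lambda>f. BS +>\<^bsub>FP\<^esub> f) ` D"

abbreviation "Sq D \<equiv> quot_gmod T (span_of F T (rels D))"

definition \<kappa> where "\<kappa> D f = span_of F T (rels D) +>\<^bsub>T\<^esub> (BS +>\<^bsub>FP\<^esub> f)"

abbreviation "e x \<equiv> basis_elt F x"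

lemma BR_eq:
  assumes ab: "a \<in> carrier FP" "b \<in> carrier FP" "a \<ominus>\<^bsub>FP\<^esub> b \<in> BR"
  shows "BS +>\<^bsub>FP\<^esub> a = BS +>\<^bsub>FP\<^esub> b"
proof -
  interpret FP: rep G F FP by (rule FP_rep)
  interpret T: rep G F T by (rule T_rep)
  have "a \<ominus>\<^bsub>FP\<^esub> b \<in> BS"
    unfolding BS_def bilinear_span_def BR_def[symmetric] by (rule subsetD[OF span_of_superset ab(3)])
  then have "BS +>\<^bsub>FP\<^esub> (a \<ominus>\<^bsub>FP\<^esub> b) = \<zero>\<^bsub>T\<^esub>" using T_ker[of "a \<ominus>\<^bsub>FP\<^esub> b"] ab(1,2) by simp
  then have "(BS +>\<^bsub>FP\<^esub> a) \<ominus>\<^bsub>T\<^esub> (BS +>\<^bsub>FP\<^esub> b) = \<zero>\<^bsub>T\<^esub>" using ghom_diff[OF FP_rep T_rep T_proj ab(1,2)] by simp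
  then show ?thesis
    using T.M.minus_eq_zero_iff[OF ghom_closed[OF T_proj ab(1)] ghom_closed[OF T_proj ab(2)]] by simp
qed

lemma square_rep:
  assumes D: "D \<subseteq> carrier FP" and stable: "\<forall>g\<in>carrier G. \<forall>r\<in>D. act FP g r \<in> D"
  shows "rep G F (Sq D)" "ghom G F FP (Sq D) (\<kappa> D)" "\<kappa> D ` carrier FP = carrier (Sq D)"
    "f \<in> carrier FP \<Longrightarrow> \<kappa> D f = \<zero>\<^bsub>Sq D\<^esub> \<longleftrightarrow> BS +>\<^bsub>FP\<^esub> f \<in> span_of F T (rels D)" "r \<in> D \<Longrightarrow> \<kappa> D r = \<zero>\<^bsub>Sq D\<^esub>"
proof -
  have sub: "gsubmodule G F T (span_of F T (rels D))"
  proof (rule rep.span_of_gsubmodule[OF T_rep])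
    show "rels D \<subseteq> carrier T" unfolding rels_def using ghom_closed[OF T_proj] D by blast
    fix g r assume g: "g \<in> carrier G" and "r \<in> rels D"
    then obtain f where f: "f \<in> D" "r = BS +>\<^bsub>FP\<^esub> f" unfolding rels_def by blast
    then have "act T g r = BS +>\<^bsub>FP\<^esub> act FP g f" using ghom_act[OF T_proj g] D by auto
    then show "act T g r \<in> rels D" unfolding rels_def using stable g f(1) by blast
  qed
  note q = quot_gmod_projection[OF T_rep sub]
  have comp: "\<kappa> D = (\<lambda>t. span_of F T (rels D) +>\<^bsub>T\<^esub> t) \<circ> (\<lambda>f. BS +>\<^bsub>FP\<^esub> f)" by (simp add: \<kappa>_def fun_eq_iff)
  show "rep G F (Sq D)" by (rule q(1))
  show "ghom G F FP (Sq D) (\<kappa> D)" unfolding comp by (rule ghom_comp[OF T_proj q(2)])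
  show "\<kappa> D ` carrier FP = carrier (Sq D)" unfolding comp image_comp[symmetric] T_surj q(3) ..
  have z: "\<kappa> D f = \<zero>\<^bsub>Sq D\<^esub> \<longleftrightarrow> BS +>\<^bsub>FP\<^esub> f \<in> span_of F T (rels D)" if "f \<in> carrier FP" for f
    unfolding \<kappa>_def by (rule q(4)[OF ghom_closed[OF T_proj that]])
  show "f \<in> carrier FP \<Longrightarrow> \<kappa> D f = \<zero>\<^bsub>Sq D\<^esub> \<longleftrightarrow> BS +>\<^bsub>FP\<^esub> f \<in> span_of F T (rels D)" by (rule z)
  assume "r \<in> D"
  moreover from this have "BS +>\<^bsub>FP\<^esub> r \<in> rels D" unfolding rels_def by blast
  ultimately show "\<kappa> D r = \<zero>\<^bsub>Sq D\<^esub>" using z[of r] D span_of_superset[of "rels D" F T] by blast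
qed

lemma \<kappa>_bilinear:
  assumes D: "D \<subseteq> carrier FP" "\<forall>g\<in>carrier G. \<forall>r\<in>D. act FP g r \<in> D"
  shows "u \<in> carrier V \<Longrightarrow> v \<in> carrier V \<Longrightarrow> w \<in> carrier V
      \<Longrightarrow> \<kappa> D (d (u \<oplus>\<^bsub>V\<^esub> v) w) = \<kappa> D (d u w) \<oplus>\<^bsub>Sq D\<^esub> \<kappa> D (d v w)"
    "u \<in> carrier V \<Longrightarrow> v \<in> carrier V \<Longrightarrow> w \<in> carrier V
      \<Longrightarrow> \<kappa> D (d u (v \<oplus>\<^bsub>V\<^esub> w)) = \<kappa> D (d u v) \<oplus>\<^bsub>Sq D\<^esub> \<kappa> D (d u w)"
    "a \<in> carrier F \<Longrightarrow> v \<in> carrier V \<Longrightarrow> w \<in> carrier V \<Longrightarrow> \<kappa> D (d (a \<odot>\<^bsub>V\<^esub> v) w) = a \<odot>\<^bsub>Sq D\<^esub> \<kappa> D (d v w)"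
    "a \<in> carrier F \<Longrightarrow> v \<in> carrier V \<Longrightarrow> w \<in> carrier V \<Longrightarrow> \<kappa> D (d v (a \<odot>\<^bsub>V\<^esub> w)) = a \<odot>\<^bsub>Sq D\<^esub> \<kappa> D (d v w)"
proof -
  interpret V: rep G F V by (rule V_rep)
  interpret FP: rep G F FP by (rule FP_rep)
  note kh = square_rep(2)[OF D]
  note KA = ghom_add[OF kh] and KS = ghom_smult[OF kh]
  have rel: "\<kappa> D a = \<kappa> D b" if "a \<in> carrier FP" "b \<in> carrier FP" "a \<ominus>\<^bsub>FP\<^esub> b \<in> BR" for a b
    using BR_eq[OF that] by (simp add: \<kappa>_def)
  show "u \<in> carrier V \<Longrightarrow> v \<in> carrier V \<Longrightarrow> w \<in> carrier V
      \<Longrightarrow> \<kappa> D (d (u \<oplus>\<^bsub>V\<^esub> v) w) = \<kappa> D (d u w) \<oplus>\<^bsub>Sq D\<^esub> \<kappa> D (d v w)"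
    using rel[OF _ _ BR_intros(1)] by (simp add: d_in KA)
  show "u \<in> carrier V \<Longrightarrow> v \<in> carrier V \<Longrightarrow> w \<in> carrier V
      \<Longrightarrow> \<kappa> D (d u (v \<oplus>\<^bsub>V\<^esub> w)) = \<kappa> D (d u v) \<oplus>\<^bsub>Sq D\<^esub> \<kappa> D (d u w)"
    using rel[OF _ _ BR_intros(2)] by (simp add: d_in KA)
  show "a \<in> carrier F \<Longrightarrow> v \<in> carrier V \<Longrightarrow> w \<in> carrier V \<Longrightarrow> \<kappa> D (d (a \<odot>\<^bsub>V\<^esub> v) w) = a \<odot>\<^bsub>Sq D\<^esub> \<kappa> D (d v w)"
    using rel[OF _ _ BR_intros(3)] by (simp add: d_in KS)
  show "a \<in> carrier F \<Longrightarrow> v \<in> carrier V \<Longrightarrow> w \<in> carrier V \<Longrightarrow> \<kappa> D (d v (a \<odot>\<^bsub>V\<^esub> w)) = a \<odot>\<^bsub>Sq D\<^esub> \<kappa> D (d v w)"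
    using rel[OF _ _ BR_intros(4)] by (simp add: d_in KS)
qed

text \<open>By bilinearity and the relations \<open>sw\<close> and \<open>off\<close>, the quotient map \<open>\<kappa> D\<close> is determined by the values of
\<open>\<Theta>\<close>, so the kernel of \<open>\<Theta>\<close> is contained in that of \<open>\<kappa> D\<close>. The converse holds because \<open>\<Theta>\<close> kills the
relations.\<close>

lemma square_iso:
  assumes D: "D \<subseteq> carrier FP" "\<forall>g\<in>carrier G. \<forall>r\<in>D. act FP g r \<in> D"
    and killed: "\<And>r. r \<in> D \<Longrightarrow> \<Theta> r = \<zero>\<^bsub>M\<^esub>"
    and sw: "\<And>x y. (x, y) \<in> Z \<Longrightarrow> x \<noteq> y \<Longrightarrow> \<kappa> D (d (e x) (e y)) = s \<odot>\<^bsub>Sq D\<^esub> \<kappa> D (d (e y) (e x))"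
    and off: "\<And>x y. x \<in> Y \<Longrightarrow> y \<in> Y \<Longrightarrow> (x, y) \<notin> Z \<Longrightarrow> \<kappa> D (d (e x) (e y)) = \<zero>\<^bsub>Sq D\<^esub>"
  shows "gmod_iso G F (Sq D) M"
proof -
  interpret V: rep G F V by (rule V_rep)
  interpret FP: rep G F FP by (rule FP_rep)
  interpret T: rep G F T by (rule T_rep)
  interpret M: rep G F M by (rule M_rep)
  let ?Q = "Sq D"
  note Qp = square_rep[OF D]
  interpret Q: rep G F ?Q by (rule Qp(1))
  define k where "k = \<kappa> D"
  note kh = Qp(2)[folded k_def] and ks = Qp(3)[folded k_def] and kz = Qp(4)[folded k_def]
  have Tc: "BS +>\<^bsub>FP\<^esub> f \<in> carrier T" if "f \<in> carrier FP" for f by (rule ghom_closed[OF T_proj that])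
  note kc = ghom_closed[OF kh]
  note KA = ghom_add[OF kh] and KS = ghom_smult[OF kh]
  let ?K = "{f \<in> carrier FP. \<Theta> f = \<zero>\<^bsub>M\<^esub>}"
  have Kg: "gsubmodule G F FP ?K" by (rule ghom_ker_gsub[OF FP_rep M_rep \<Theta>(1)])
  have ker1: "\<Theta> f = \<zero>\<^bsub>M\<^esub>" if f: "f \<in> carrier FP" and k0: "k f = \<zero>\<^bsub>?Q\<^esub>" for f
  proof -
    have "rels D \<subseteq> (\<lambda>f. BS +>\<^bsub>FP\<^esub> f) ` ?K" unfolding rels_def using killed D(1) by (intro image_mono) auto
    from span_of_least[OF ghom_sub_image[OF FP_rep T_rep T_proj Kg] this]
    obtain f' where f': "f' \<in> carrier FP" "\<Theta> f' = \<zero>\<^bsub>M\<^esub>" "BS +>\<^bsub>FP\<^esub> f = BS +>\<^bsub>FP\<^esub> f'"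
      using kz[OF f] k0 by auto
    have "BS +>\<^bsub>FP\<^esub> (f \<ominus>\<^bsub>FP\<^esub> f') = \<zero>\<^bsub>T\<^esub>"
      using ghom_diff[OF FP_rep T_rep T_proj f f'(1)] f'(3) Tc[OF f'(1)] by (simp add: T.M.minus_eq T.M.r_neg)
    then have "f \<ominus>\<^bsub>FP\<^esub> f' \<in> BS" using T_ker[of "f \<ominus>\<^bsub>FP\<^esub> f'"] f f'(1) by simp
    then have "\<Theta> (f \<ominus>\<^bsub>FP\<^esub> f') = \<zero>\<^bsub>M\<^esub>" using BS_ker by blast
    then have "\<Theta> f \<ominus>\<^bsub>M\<^esub> \<Theta> f' = \<zero>\<^bsub>M\<^esub>" using ghom_diff[OF FP_rep M_rep \<Theta>(1) f f'(1)] by simp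
    then show ?thesis using f'(2) M.M.minus_eq_zero_iff[OF ghom_closed[OF \<Theta>(1) f] M.M.zero_closed] by simp
  qed
  define c where "c v w = k (d v w)" for v w
  have cc: "c v w \<in> carrier ?Q" if "v \<in> carrier V" "w \<in> carrier V" for v w
    unfolding c_def by (rule kc[OF d_in[OF that]])
  note c_add1 = \<kappa>_bilinear(1)[OF D, folded k_def c_def] and c_add2 = \<kappa>_bilinear(2)[OF D, folded k_def c_def]
    and c_sm1 = \<kappa>_bilinear(3)[OF D, folded k_def c_def] and c_sm2 = \<kappa>_bilinear(4)[OF D, folded k_def c_def]
  have c_z1: "c \<zero>\<^bsub>V\<^esub> w = \<zero>\<^bsub>?Q\<^esub>" if "w \<in> carrier V" for w
    using c_sm1[of "\<zero>" "\<zero>\<^bsub>V\<^esub>" w] cc[of "\<zero>\<^bsub>V\<^esub>" w] that by simp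
  have c_z2: "c w \<zero>\<^bsub>V\<^esub> = \<zero>\<^bsub>?Q\<^esub>" if "w \<in> carrier V" for w
    using c_sm2[of "\<zero>" w "\<zero>\<^bsub>V\<^esub>"] cc[of w "\<zero>\<^bsub>V\<^esub>"] that by simp
  (* HO contains one of (x, y) and (y, x); the arbitrary numbering idx decides which. *)
  obtain idx :: "'x \<Rightarrow> nat" where idx: "inj_on idx Y" using finite_imp_inj_to_nat_seg[OF fin_Y] by auto
  define HO where "HO = {z \<in> Z. idx (fst z) \<le> idx (snd z)}"
  have finO: "finite HO" using finite_Z by (simp add: HO_def)
  have OY: "fst z \<in> Y \<and> snd z \<in> Y" if "z \<in> HO" for z using that Z_sub by (auto simp: HO_def)
  define ce where "ce z = c (e (fst z)) (e (snd z))" for z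
  have cec: "ce z \<in> carrier ?Q" if "z \<in> HO" for z
    unfolding ce_def using OY[OF that] by (intro cc V_basis) auto
  define Rm where "Rm m = finsum ?Q (\<lambda>z. m z \<odot>\<^bsub>?Q\<^esub> ce z) HO" for m :: "'x \<times> 'x \<Rightarrow> 'f"
  have RP: "(\<lambda>z. m z \<odot>\<^bsub>?Q\<^esub> ce z) \<in> HO \<rightarrow> carrier ?Q" if "m \<in> carrier M" for m
    using cec M_value[OF that] by auto
  have R_add: "Rm (m \<oplus>\<^bsub>M\<^esub> m') = Rm m \<oplus>\<^bsub>?Q\<^esub> Rm m'" if m: "m \<in> carrier M" "m' \<in> carrier M" for m m'
  proof -
    have "Rm (m \<oplus>\<^bsub>M\<^esub> m') = finsum ?Q (\<lambda>z. m z \<odot>\<^bsub>?Q\<^esub> ce z \<oplus>\<^bsub>?Q\<^esub> m' z \<odot>\<^bsub>?Q\<^esub> ce z) HO"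
      unfolding Rm_def
    proof (rule Q.M.finsum_cong')
      show "(\<lambda>z. m z \<odot>\<^bsub>?Q\<^esub> ce z \<oplus>\<^bsub>?Q\<^esub> m' z \<odot>\<^bsub>?Q\<^esub> ce z) \<in> HO \<rightarrow> carrier ?Q"
        using RP[OF m(1)] RP[OF m(2)] by auto
      fix z assume "z \<in> HO"
      then show "(m \<oplus>\<^bsub>M\<^esub> m') z \<odot>\<^bsub>?Q\<^esub> ce z = m z \<odot>\<^bsub>?Q\<^esub> ce z \<oplus>\<^bsub>?Q\<^esub> m' z \<odot>\<^bsub>?Q\<^esub> ce z"
        using Q.smult_l_distr[OF M_value[OF m(1)] M_value[OF m(2)] cec] by (simp add: M_simps)
    qed simp
    then show ?thesis unfolding Rm_def using Q.M.finsum_addf[OF RP[OF m(1)] RP[OF m(2)]] by simp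
  qed
  have R_sm: "Rm (a \<odot>\<^bsub>M\<^esub> m) = a \<odot>\<^bsub>?Q\<^esub> Rm m" if a: "a \<in> carrier F" and m: "m \<in> carrier M" for a m
  proof -
    have "Rm (a \<odot>\<^bsub>M\<^esub> m) = finsum ?Q (\<lambda>z. a \<odot>\<^bsub>?Q\<^esub> (m z \<odot>\<^bsub>?Q\<^esub> ce z)) HO"
      unfolding Rm_def
    proof (rule Q.M.finsum_cong')
      show "(\<lambda>z. a \<odot>\<^bsub>?Q\<^esub> (m z \<odot>\<^bsub>?Q\<^esub> ce z)) \<in> HO \<rightarrow> carrier ?Q" using RP[OF m] a by auto
      fix z assume "z \<in> HO"
      then show "(a \<odot>\<^bsub>M\<^esub> m) z \<odot>\<^bsub>?Q\<^esub> ce z = a \<odot>\<^bsub>?Q\<^esub> (m z \<odot>\<^bsub>?Q\<^esub> ce z)"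
        using Q.smult_assoc1[OF a M_value[OF m] cec] by (simp add: M_simps)
    qed simp
    then show ?thesis unfolding Rm_def using Q.finsum_smult_ldistr[OF finO a RP[OF m]] by simp
  qed
  have R_zero: "Rm \<zero>\<^bsub>M\<^esub> = \<zero>\<^bsub>?Q\<^esub>"
    unfolding Rm_def using cec by (intro Q.M.add.finprod_one_eqI) (simp add: M_simps)
  have R_single: "Rm m = m z0 \<odot>\<^bsub>?Q\<^esub> ce z0"
    if m: "m \<in> carrier M" and z0: "z0 \<in> HO" and others: "\<And>z. z \<in> HO \<Longrightarrow> z \<noteq> z0 \<Longrightarrow> m z = \<zero>" for m z0
  proof -
    have "Rm m = finsum ?Q (\<lambda>z. m z \<odot>\<^bsub>?Q\<^esub> ce z) {z0}"
      unfolding Rm_def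
      by (rule Q.M.add.finprod_mono_neutral_cong_right[OF finO]) (use z0 others cec RP[OF m] in auto)
    then show ?thesis using cec[OF z0] M_value[OF m] by simp
  qed
  have eq_basis: "c (e a) (e b) = Rm (\<beta> (e a) (e b))" if a: "a \<in> Y" and b: "b \<in> Y" for a b
  proof (cases "(a, b) \<in> Z")
    case False
    then have nz: "(b, a) \<notin> Z" using Z_swap by blast
    have "\<beta> (e a) (e b) = \<zero>\<^bsub>M\<^esub>"
    proof
      fix z show "\<beta> (e a) (e b) z = \<zero>\<^bsub>M\<^esub> z"
      proof (cases "z \<in> Z")
        case True
        then have "z \<noteq> (a, b)" "z \<noteq> (b, a)" using False nz by blast+
        then show ?thesis by (simp add: \<beta>_basis_off M_simps)
      qed (simp add: \<beta>_basis_out M_simps)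
    qed
    then show ?thesis using off[OF a b False] R_zero by (simp add: c_def k_def)
  next
    case True
    have \<beta>M: "\<beta> (e a) (e b) \<in> carrier M" by (intro \<beta>_in V_basis a b)
    show ?thesis
    proof (cases "idx a \<le> idx b")
      case le: True
      have zO: "(a, b) \<in> HO" using True le by (simp add: HO_def)
      have "Rm (\<beta> (e a) (e b)) = \<beta> (e a) (e b) (a, b) \<odot>\<^bsub>?Q\<^esub> ce (a, b)"
      proof (rule R_single[OF \<beta>M zO])
        fix z assume z: "z \<in> HO" "z \<noteq> (a, b)"
        have "z \<noteq> (b, a)"
        proof
          assume z': "z = (b, a)"
          then have "idx a = idx b" using z(1) le by (simp add: HO_def)
          then have "a = b" using inj_onD[OF idx] a b by blast
          then show False using z(2) z' by simp
        qed
        then show "\<beta> (e a) (e b) z = \<zero>" using z(2) by (intro \<beta>_basis_off)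
      qed
      then show ?thesis using \<beta>_basis_on[OF True] cec[OF zO] by (simp add: ce_def)
    next
      case gt: False
      then have ne: "a \<noteq> b" by auto
      have zO: "(b, a) \<in> HO" using Z_swap[OF True] gt by (simp add: HO_def)
      have "Rm (\<beta> (e a) (e b)) = \<beta> (e a) (e b) (b, a) \<odot>\<^bsub>?Q\<^esub> ce (b, a)"
      proof (rule R_single[OF \<beta>M zO])
        fix z assume z: "z \<in> HO" "z \<noteq> (b, a)"
        have "z \<noteq> (a, b)" using z(1) gt by (auto simp: HO_def)
        then show "\<beta> (e a) (e b) z = \<zero>" using z(2) by (intro \<beta>_basis_off)
      qed
      also have "\<beta> (e a) (e b) (b, a) = s" by (rule \<beta>_basis_swap[OF Z_swap[OF True] ne])
      also have "s \<odot>\<^bsub>?Q\<^esub> ce (b, a) = c (e a) (e b)"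
        using sw[OF True ne] by (simp add: ce_def c_def k_def)
      finally show ?thesis by simp
    qed
  qed
  have eq1: "c (e a) w = Rm (\<beta> (e a) w)" if a: "a \<in> Y" and w: "w \<in> carrier V" for a w
  proof -
    note ea = V_basis[OF a]
    have zb: "\<beta> (e a) \<zero>\<^bsub>V\<^esub> = \<zero>\<^bsub>M\<^esub>"
      using \<beta>_smult2[of "\<zero>" "e a" "\<zero>\<^bsub>V\<^esub>"] ea \<beta>_in[OF ea V.M.zero_closed] by simp
    show ?thesis
    proof (rule perm_gmod_induct[OF V_rep w])
      show "c (e a) \<zero>\<^bsub>V\<^esub> = Rm (\<beta> (e a) \<zero>\<^bsub>V\<^esub>)" using zb R_zero c_z2[OF ea] by simp
    next
      fix f h assume "f \<in> carrier V" "h \<in> carrier V" "c (e a) f = Rm (\<beta> (e a) f)" "c (e a) h = Rm (\<beta> (e a) h)"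
      then show "c (e a) (f \<oplus>\<^bsub>V\<^esub> h) = Rm (\<beta> (e a) (f \<oplus>\<^bsub>V\<^esub> h))"
        using ea by (simp add: c_add2 \<beta>_add2 R_add \<beta>_in)
    next
      fix t f assume "t \<in> carrier F" "f \<in> carrier V" "c (e a) f = Rm (\<beta> (e a) f)"
      then show "c (e a) (t \<odot>\<^bsub>V\<^esub> f) = Rm (\<beta> (e a) (t \<odot>\<^bsub>V\<^esub> f))"
        using ea by (simp add: c_sm2 \<beta>_smult2 R_sm \<beta>_in)
    next
      fix b assume "b \<in> Y"
      then show "c (e a) (e b) = Rm (\<beta> (e a) (e b))" by (rule eq_basis[OF a])
    qed
  qed
  have eq2: "c v w = Rm (\<beta> v w)" if v: "v \<in> carrier V" and w: "w \<in> carrier V" for v w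
  proof -
    have zb: "\<beta> \<zero>\<^bsub>V\<^esub> w = \<zero>\<^bsub>M\<^esub>"
      using \<beta>_smult1[of "\<zero>" "\<zero>\<^bsub>V\<^esub>" w] w \<beta>_in[OF V.M.zero_closed w] by simp
    show ?thesis
    proof (rule perm_gmod_induct[OF V_rep v])
      show "c \<zero>\<^bsub>V\<^esub> w = Rm (\<beta> \<zero>\<^bsub>V\<^esub> w)" using zb R_zero c_z1[OF w] by simp
    next
      fix f h assume "f \<in> carrier V" "h \<in> carrier V" "c f w = Rm (\<beta> f w)" "c h w = Rm (\<beta> h w)"
      then show "c (f \<oplus>\<^bsub>V\<^esub> h) w = Rm (\<beta> (f \<oplus>\<^bsub>V\<^esub> h) w)"
        using w by (simp add: c_add1 \<beta>_add1 R_add \<beta>_in)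
    next
      fix t f assume "t \<in> carrier F" "f \<in> carrier V" "c f w = Rm (\<beta> f w)"
      then show "c (t \<odot>\<^bsub>V\<^esub> f) w = Rm (\<beta> (t \<odot>\<^bsub>V\<^esub> f) w)"
        using w by (simp add: c_sm1 \<beta>_smult1 R_sm \<beta>_in)
    next
      fix a assume "a \<in> Y"
      then show "c (e a) w = Rm (\<beta> (e a) w)" using w by (rule eq1)
    qed
  qed
  have kR: "k f = Rm (\<Theta> f)" if f: "f \<in> carrier FP" for f
  proof -
    have f': "f \<in> carrier (perm_gmod G F (carrier V \<times> carrier V) (\<lambda>g (v, w). (act V g v, act V g w)))"
      using f by (simp add: free_pair_gmod_def)
    note tc = ghom_closed[OF \<Theta>(1)]
    have "k f = Rm (\<Theta> f)"
    proof (rule perm_gmod_induct[OF FP_rep[unfolded free_pair_gmod_def] f', folded free_pair_gmod_def])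
      show "k \<zero>\<^bsub>FP\<^esub> = Rm (\<Theta> \<zero>\<^bsub>FP\<^esub>)"
        using ghom_zero[OF FP_rep Qp(1) kh] ghom_zero[OF FP_rep M_rep \<Theta>(1)] R_zero by simp
    next
      fix f h assume "f \<in> carrier FP" "h \<in> carrier FP" "k f = Rm (\<Theta> f)" "k h = Rm (\<Theta> h)"
      then show "k (f \<oplus>\<^bsub>FP\<^esub> h) = Rm (\<Theta> (f \<oplus>\<^bsub>FP\<^esub> h))" by (simp add: KA ghom_add[OF \<Theta>(1)] R_add tc)
    next
      fix t f assume "t \<in> carrier F" "f \<in> carrier FP" "k f = Rm (\<Theta> f)"
      then show "k (t \<odot>\<^bsub>FP\<^esub> f) = Rm (\<Theta> (t \<odot>\<^bsub>FP\<^esub> f))" by (simp add: KS ghom_smult[OF \<Theta>(1)] R_sm tc)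
    next
      fix z assume "z \<in> carrier V \<times> carrier V"
      then obtain v w where vw: "z = (v, w)" "v \<in> carrier V" "w \<in> carrier V" by auto
      then show "k (basis_elt F z) = Rm (\<Theta> (basis_elt F z))" using eq2[OF vw(2,3)] \<Theta>(2) by (simp add: c_def)
    qed
    then show ?thesis .
  qed
  have surj: "\<Theta> ` carrier FP = carrier M"
  proof
    show "\<Theta> ` carrier FP \<subseteq> carrier M" using ghom_closed[OF \<Theta>(1)] by blast
    show "carrier M \<subseteq> \<Theta> ` carrier FP"
    proof
      fix m assume m: "m \<in> carrier M"
      define de where "de z = d (e (fst z)) (e (snd z))" for z :: "'x \<times> 'x"
      define be where "be z = \<beta> (e (fst z)) (e (snd z))" for z :: "'x \<times> 'x"
      have dec: "de z \<in> carrier FP" if "z \<in> HO" for z unfolding de_def using OY[OF that] by (intro d_in V_basis) auto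
      have bec: "be z \<in> carrier M" if "z \<in> HO" for z unfolding be_def using OY[OF that] by (intro \<beta>_in V_basis) auto
      define f where "f = finsum FP (\<lambda>z. m z \<odot>\<^bsub>FP\<^esub> de z) HO"
      have P: "(\<lambda>z. m z \<odot>\<^bsub>FP\<^esub> de z) \<in> HO \<rightarrow> carrier FP" using dec M_value[OF m] by auto
      have P2: "(\<lambda>z. m z \<odot>\<^bsub>M\<^esub> be z) \<in> HO \<rightarrow> carrier M" using bec M_value[OF m] by auto
      have fc: "f \<in> carrier FP" unfolding f_def by (rule FP.M.finsum_closed[OF P])
      have "\<Theta> f = finsum M (\<lambda>z. \<Theta> (m z \<odot>\<^bsub>FP\<^esub> de z)) HO"
        unfolding f_def by (rule ghom_finsum[OF FP_rep M_rep \<Theta>(1) finO P])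
      also have "\<dots> = finsum M (\<lambda>z. m z \<odot>\<^bsub>M\<^esub> be z) HO"
      proof (rule M.M.finsum_cong')
        fix z assume z: "z \<in> HO"
        show "\<Theta> (m z \<odot>\<^bsub>FP\<^esub> de z) = m z \<odot>\<^bsub>M\<^esub> be z"
          using ghom_smult[OF \<Theta>(1) M_value[OF m] dec[OF z]] OY[OF z] \<Theta>(2)[OF V_basis V_basis]
          by (simp add: de_def be_def)
      qed (use P2 in auto)
      also have "\<dots> = m"
      proof
        fix w
        have "finsum M (\<lambda>z. m z \<odot>\<^bsub>M\<^esub> be z) HO w = (\<Oplus>z\<in>HO. (m z \<odot>\<^bsub>M\<^esub> be z) w)"
          by (rule finsum_apply[OF M_rep]) (use P2 M_value finO in \<open>auto simp: M_simps\<close>)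
        also have "\<dots> = m w"
        proof (cases "w \<in> Z")
          case False
          have "(\<Oplus>z\<in>HO. (m z \<odot>\<^bsub>M\<^esub> be z) w) = (\<Oplus>z\<in>HO. \<zero>)"
          proof (rule F.finsum_cong')
            fix z assume z: "z \<in> HO"
            have "be z w = \<zero>" using bec[OF z] False unfolding M_carrier by blast
            then show "(m z \<odot>\<^bsub>M\<^esub> be z) w = \<zero>" using M_value[OF m] by (simp add: M_simps)
          qed auto
          moreover have "m w = \<zero>" using m False unfolding M_carrier by blast
          ultimately show ?thesis by simp
        next
          case True
          obtain a b where w: "w = (a, b)" by (cases w)
          have abY: "a \<in> Y" "b \<in> Y" using True Z_sub w by auto
          have single: "(\<Oplus>z\<in>HO. (m z \<odot>\<^bsub>M\<^esub> be z) w) = m z0 \<otimes> be z0 w"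
            if z0: "z0 \<in> HO" and oth: "\<And>z. z \<in> HO \<Longrightarrow> z \<noteq> z0 \<Longrightarrow> be z w = \<zero>" for z0
          proof -
            have "(\<Oplus>z\<in>HO. (m z \<odot>\<^bsub>M\<^esub> be z) w) = (\<Oplus>z\<in>{z0}. m z \<otimes> be z w)"
              by (rule F.add.finprod_mono_neutral_cong_right[OF finO])
                (use z0 oth bec M_value M_value[OF m] in \<open>auto simp: M_simps\<close>)
            then show ?thesis using M_value[OF m] M_value[OF bec[OF z0]] by simp
          qed
          have off: "be z w = \<zero>" if "z \<noteq> (a, b)" "z \<noteq> (b, a)" for z
            unfolding be_def w using that by (intro \<beta>_basis_off) (auto simp: prod_eq_iff)
          show ?thesis
          proof (cases "idx a \<le> idx b")
            case le: True
            have zO: "(a, b) \<in> HO" using True le by (simp add: HO_def w)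
            have "(\<Oplus>z\<in>HO. (m z \<odot>\<^bsub>M\<^esub> be z) w) = m (a, b) \<otimes> be (a, b) w"
            proof (rule single[OF zO])
              fix z assume z: "z \<in> HO" "z \<noteq> (a, b)"
              have "z \<noteq> (b, a)"
              proof
                assume z': "z = (b, a)"
                then have "idx a = idx b" using z(1) le by (simp add: HO_def)
                then have "a = b" using inj_onD[OF idx] abY by blast
                then show False using z(2) z' by simp
              qed
              then show "be z w = \<zero>" using z(2) by (intro off)
            qed
            moreover have "be (a, b) w = \<one>" using \<beta>_basis_on True by (simp add: be_def w)
            ultimately show ?thesis using M_value[OF m] by (simp add: w)
          next
            case gt: False
            have ne: "a \<noteq> b" using gt by auto
            have zO: "(b, a) \<in> HO" using Z_swap True gt by (simp add: HO_def w)
            have "(\<Oplus>z\<in>HO. (m z \<odot>\<^bsub>M\<^esub> be z) w) = m (b, a) \<otimes> be (b, a) w"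
            proof (rule single[OF zO])
              fix z assume z: "z \<in> HO" "z \<noteq> (b, a)"
              have "z \<noteq> (a, b)" using z(1) gt by (auto simp: HO_def)
              then show "be z w = \<zero>" using z(2) by (intro off)
            qed
            also have "be (b, a) w = s" unfolding be_def w fst_conv snd_conv
              by (rule \<beta>_basis_swap) (use True w ne in auto)
            also have "m (b, a) = s \<otimes> m w" using m True w unfolding M_carrier by force
            also have "s \<otimes> m w \<otimes> s = (s \<otimes> s) \<otimes> m w"
              using M_value[OF m] s_cl F.m_assoc F.m_comm by simp
            also have "\<dots> = m w" unfolding s_sq using M_value[OF m] by simp
            finally show ?thesis .
          qed
        qed
        finally show "finsum M (\<lambda>z. m z \<odot>\<^bsub>M\<^esub> be z) HO w = m w" .
      qed
      finally show "m \<in> \<Theta> ` carrier FP" using fc by blast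
    qed
  qed
  show ?thesis
  proof (rule iso_of_equal_kernels[OF FP_rep Qp(1) M_rep kh ks \<Theta>(1) surj])
    fix f assume f: "f \<in> carrier FP"
    show "k f = \<zero>\<^bsub>?Q\<^esub> \<longleftrightarrow> \<Theta> f = \<zero>\<^bsub>M\<^esub>"
      using ker1[OF f] kR[OF f] R_zero by auto
  qed
qed

end

context pair_model begin

lemma sym_square_iso:
  assumes Z: "Z = Y \<times> Y" and s: "s = \<one>"
  shows "rep G F (sym_square G F V)" "gmod_iso G F (sym_square G F V) M"
proof -
  interpret V: rep G F V by (rule V_rep)
  interpret FP: rep G F FP by (rule FP_rep)
  interpret M: rep G F M by (rule M_rep)
  define D where "D = {d v w \<ominus>\<^bsub>FP\<^esub> d w v | v w. v \<in> carrier V \<and> w \<in> carrier V}"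
  have DE: thesis if "r \<in> D" "\<And>v w. v \<in> carrier V \<Longrightarrow> w \<in> carrier V \<Longrightarrow> r = d v w \<ominus>\<^bsub>FP\<^esub> d w v \<Longrightarrow> thesis" for r thesis
    using that unfolding D_def by blast
  have DI: "d v w \<ominus>\<^bsub>FP\<^esub> d w v \<in> D" if "v \<in> carrier V" "w \<in> carrier V" for v w
    using that unfolding D_def by blast
  have pt: "pure_tensor G F V V v w \<ominus>\<^bsub>T\<^esub> pure_tensor G F V V w v = BS +>\<^bsub>FP\<^esub> (d v w \<ominus>\<^bsub>FP\<^esub> d w v)"
    if "v \<in> carrier V" "w \<in> carrier V" for v w
    unfolding pure_tensor_eq by (rule ghom_diff[OF FP_rep T_rep T_proj d_in d_in, symmetric]) (rule that)+
  have "rels D = {pure_tensor G F V V v w \<ominus>\<^bsub>T\<^esub> pure_tensor G F V V w v | v w. v \<in> carrier V \<and> w \<in> carrier V}"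
    (is "_ = ?R")
  proof (intro equalityI subsetI)
    fix r assume "r \<in> rels D"
    then obtain f where "f \<in> D" "r = BS +>\<^bsub>FP\<^esub> f" unfolding rels_def by blast
    then obtain v w where vw: "v \<in> carrier V" "w \<in> carrier V" "r = BS +>\<^bsub>FP\<^esub> (d v w \<ominus>\<^bsub>FP\<^esub> d w v)" using DE by metis
    then show "r \<in> ?R" using pt[OF vw(1,2)] by auto
  next
    fix r assume "r \<in> ?R"
    then obtain v w where vw: "v \<in> carrier V" "w \<in> carrier V"
      and r: "r = pure_tensor G F V V v w \<ominus>\<^bsub>T\<^esub> pure_tensor G F V V w v" by blast
    show "r \<in> rels D" unfolding r pt[OF vw] rels_def using DI[OF vw] by blast
  qed
  then have sq: "sym_square G F V = Sq D" by (simp add: sym_square_def Let_def)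
  have D: "D \<subseteq> carrier FP" by (auto elim!: DE intro!: FP.M.minus_closed d_in)
  have stable: "\<forall>g\<in>carrier G. \<forall>r\<in>D. act FP g r \<in> D"
  proof (intro ballI)
    fix g r assume g: "g \<in> carrier G" and "r \<in> D"
    then obtain v w where vw: "v \<in> carrier V" "w \<in> carrier V" "r = d v w \<ominus>\<^bsub>FP\<^esub> d w v" using DE by metis
    have "act FP g r = d (act V g v) (act V g w) \<ominus>\<^bsub>FP\<^esub> d (act V g w) (act V g v)"
      using FP.act_diff[OF g d_in[OF vw(1,2)] d_in[OF vw(2,1)]] d_act[OF g vw(1,2)] d_act[OF g vw(2,1)] vw(3) by simp
    then show "act FP g r \<in> D" using DI[OF V.act_closed[OF g vw(1)] V.act_closed[OF g vw(2)]] by simp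
  qed
  note S = square_rep[OF D stable]
  interpret S: rep G F "Sq D" by (rule S(1))
  show "rep G F (sym_square G F V)" unfolding sq by (rule S(1))
  have comm: "\<beta> v w = \<beta> w v" if vw: "v \<in> carrier V" "w \<in> carrier V" for v w
  proof
    fix z :: "'x \<times> 'x"
    obtain x y where z: "z = (x, y)" by (cases z)
    note c = V_value[OF vw(1)] V_value[OF vw(2)]
    have "s \<otimes> a = a" if "a \<in> carrier F" for a unfolding s using that by simp
    then have B: "v x \<otimes> w y \<oplus> s \<otimes> (v y \<otimes> w x) = w x \<otimes> v y \<oplus> s \<otimes> (w y \<otimes> v x)"
      using c F.m_comm F.a_comm by simp
    have A: "v x \<otimes> w x = w x \<otimes> v x" using c F.m_comm by simp
    show "\<beta> v w z = \<beta> w v z" by (simp only: z \<beta>_def prod.case A B)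
  qed
  show "gmod_iso G F (sym_square G F V) M"
    unfolding sq
  proof (rule square_iso[OF D stable])
    fix r assume "r \<in> D"
    then obtain v w where vw: "v \<in> carrier V" "w \<in> carrier V" and r: "r = d v w \<ominus>\<^bsub>FP\<^esub> d w v" using DE by metis
    have "\<Theta> r = \<beta> v w \<ominus>\<^bsub>M\<^esub> \<beta> w v"
      using ghom_diff[OF FP_rep M_rep \<Theta>(1) d_in[OF vw] d_in[OF vw(2,1)]] \<Theta>(2) vw r by simp
    then show "\<Theta> r = \<zero>\<^bsub>M\<^esub>"
      using comm[OF vw] M.M.minus_eq_zero_iff[OF \<beta>_in[OF vw] \<beta>_in[OF vw(2,1)]] by simp
  next
    fix x y assume xy: "(x, y) \<in> Z"
    then have "x \<in> Y" "y \<in> Y" using Z by auto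
    then have e: "e x \<in> carrier V" "e y \<in> carrier V" by (auto intro: V_basis)
    note c = ghom_closed[OF S(2) d_in[OF e]] ghom_closed[OF S(2) d_in[OF e(2,1)]]
    have "\<kappa> D (d (e x) (e y)) = \<kappa> D (d (e y) (e x))"
      using S(5)[OF DI[OF e]] ghom_diff[OF FP_rep S(1,2) d_in[OF e] d_in[OF e(2,1)]] S.M.minus_eq_zero_iff[OF c] by simp
    then show "\<kappa> D (d (e x) (e y)) = s \<odot>\<^bsub>Sq D\<^esub> \<kappa> D (d (e y) (e x))" unfolding s using c(2) by simp
  next
    fix x y assume "x \<in> Y" "y \<in> Y" "(x, y) \<notin> Z"
    then show "\<kappa> D (d (e x) (e y)) = \<zero>\<^bsub>Sq D\<^esub>" using Z by simp
  qed
qed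

text \<open>Expanding the square of a sum of two basis elements shows that interchanging the factors changes the
sign.\<close>

lemma ext_square_iso:
  assumes Z: "Z = {(x, y) \<in> Y \<times> Y. x \<noteq> y}" and s: "s = \<ominus> \<one>"
  shows "rep G F (ext_square G F V)" "gmod_iso G F (ext_square G F V) M"
proof -
  interpret V: rep G F V by (rule V_rep)
  interpret FP: rep G F FP by (rule FP_rep)
  interpret M: rep G F M by (rule M_rep)
  define D where "D = {d v v | v. v \<in> carrier V}"
  have "rels D = {pure_tensor G F V V v v | v. v \<in> carrier V}" unfolding rels_def D_def pure_tensor_eq by blast
  then have sq: "ext_square G F V = Sq D" by (simp add: ext_square_def Let_def)
  have D: "D \<subseteq> carrier FP" unfolding D_def using d_in by blast
  have stable: "\<forall>g\<in>carrier G. \<forall>r\<in>D. act FP g r \<in> D"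
  proof (intro ballI)
    fix g r assume g: "g \<in> carrier G" and "r \<in> D"
    then obtain v where v: "v \<in> carrier V" "r = d v v" unfolding D_def by blast
    show "act FP g r \<in> D" unfolding v(2) d_act[OF g v(1) v(1)] D_def using V.act_closed[OF g v(1)] by blast
  qed
  note S = square_rep[OF D stable]
  interpret S: rep G F "Sq D" by (rule S(1))
  show "rep G F (ext_square G F V)" unfolding sq by (rule S(1))
  have alt: "\<beta> v v = \<zero>\<^bsub>M\<^esub>" if v: "v \<in> carrier V" for v
  proof
    fix z :: "'x \<times> 'x"
    obtain x y where z: "z = (x, y)" by (cases z)
    note c = V_value[OF v]
    have "v x \<otimes> v y \<oplus> s \<otimes> (v y \<otimes> v x) = \<zero>"
      unfolding s using c[of x] c[of y] F.m_comm[of "v x" "v y"] by (simp add: F.l_minus F.r_neg)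
    moreover have "x \<noteq> y" if "(x, y) \<in> Z" using that unfolding Z by blast
    ultimately show "\<beta> v v z = \<zero>\<^bsub>M\<^esub> z" unfolding z \<beta>_def by (simp add: M_simps)
  qed
  have \<kappa>c: "\<kappa> D (d v w) \<in> carrier (Sq D)" if "v \<in> carrier V" "w \<in> carrier V" for v w
    by (rule ghom_closed[OF S(2) d_in[OF that]])
  have \<kappa>0: "\<kappa> D (d v v) = \<zero>\<^bsub>Sq D\<^esub>" if "v \<in> carrier V" for v
    by (rule S(5)) (use that in \<open>unfold D_def, blast\<close>)
  note \<kappa>a = \<kappa>_bilinear(1,2)[OF D stable]
  show "gmod_iso G F (ext_square G F V) M"
    unfolding sq
  proof (rule square_iso[OF D stable])
    fix r assume "r \<in> D"
    then obtain v where v: "v \<in> carrier V" "r = d v v" unfolding D_def by blast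
    then show "\<Theta> r = \<zero>\<^bsub>M\<^esub>" using \<Theta>(2)[OF v(1) v(1)] alt[OF v(1)] by simp
  next
    fix x y assume xy: "(x, y) \<in> Z"
    then have "x \<in> Y" "y \<in> Y" using Z by auto
    then have e: "e x \<in> carrier V" "e y \<in> carrier V" by (auto intro: V_basis)
    let ?k = "\<lambda>v w. \<kappa> D (d v w)"
    have "\<zero>\<^bsub>Sq D\<^esub> = ?k (e x \<oplus>\<^bsub>V\<^esub> e y) (e x \<oplus>\<^bsub>V\<^esub> e y)" by (rule \<kappa>0[symmetric]) (intro V.M.a_closed e)
    also have "\<dots> = (?k (e x) (e x) \<oplus>\<^bsub>Sq D\<^esub> ?k (e x) (e y)) \<oplus>\<^bsub>Sq D\<^esub> (?k (e y) (e x) \<oplus>\<^bsub>Sq D\<^esub> ?k (e y) (e y))"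
      unfolding \<kappa>a(1)[OF e V.M.a_closed[OF e]] \<kappa>a(2)[OF e(1) e] \<kappa>a(2)[OF e(2) e] ..
    also have "\<dots> = ?k (e x) (e y) \<oplus>\<^bsub>Sq D\<^esub> ?k (e y) (e x)"
      using \<kappa>c[OF e] \<kappa>c[OF e(2,1)] by (simp add: \<kappa>0 e)
    finally have "\<ominus>\<^bsub>Sq D\<^esub> ?k (e y) (e x) = ?k (e x) (e y)"
      using S.M.minus_equality[OF _ \<kappa>c[OF e(2,1)] \<kappa>c[OF e]] by simp
    moreover have "s \<odot>\<^bsub>Sq D\<^esub> ?k (e y) (e x) = \<ominus>\<^bsub>Sq D\<^esub> ?k (e y) (e x)"
      unfolding s using S.smult_l_minus[of "\<one>" "?k (e y) (e x)"] \<kappa>c[OF e(2,1)] by simp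
    ultimately show "\<kappa> D (d (e x) (e y)) = s \<odot>\<^bsub>Sq D\<^esub> \<kappa> D (d (e y) (e x))" by simp
  next
    fix x y assume xy: "x \<in> Y" "y \<in> Y" "(x, y) \<notin> Z"
    then have "y = x" using Z by simp
    then show "\<kappa> D (d (e x) (e y)) = \<zero>\<^bsub>Sq D\<^esub>" using \<kappa>0[OF V_basis[OF xy(1)]] by simp
  qed
qed

end

section \<open>Permutations preserving a family of disjoint sets\<close>

definition part :: "(nat \<Rightarrow> nat) \<Rightarrow> nat set \<Rightarrow> nat \<Rightarrow> nat" where
  "part \<pi> A = (\<lambda>x. if x \<in> A then \<pi> x else x)"

locale block_family =
  fixes n :: nat and K :: "'k set" and A :: "'k \<Rightarrow> nat set"
  assumes finite_K: "finite K"
    and A_disjoint: "i \<in> K \<Longrightarrow> j \<in> K \<Longrightarrow> i \<noteq> j \<Longrightarrow> A i \<inter> A j = {}"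
    and A_union: "(\<Union>i\<in>K. A i) = {1..n}"
begin

definition blocks :: "('k \<Rightarrow> (nat \<Rightarrow> nat) set) \<Rightarrow> (nat \<Rightarrow> nat) set" where
  "blocks H = {\<pi>. \<pi> permutes {1..n} \<and> (\<forall>k\<in>K. \<pi> ` A k = A k \<and> part \<pi> (A k) \<in> H k)}"

lemma A_unique: "x \<in> A i \<Longrightarrow> x \<in> A j \<Longrightarrow> i \<in> K \<Longrightarrow> j \<in> K \<Longrightarrow> i = j"
  using A_disjoint by blast

lemma A_sub: "k \<in> K \<Longrightarrow> A k \<subseteq> {1..n}" using A_union by blast

lemma A_cover: "x \<in> {1..n} \<Longrightarrow> \<exists>k\<in>K. x \<in> A k" using A_union by blast

lemma part_permutes: "\<pi> permutes {1..n} \<Longrightarrow> \<pi> ` B = B \<Longrightarrow> part \<pi> B permutes B"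
proof (rule bij_imp_permutes)
  assume p: "\<pi> permutes {1..n}" and B: "\<pi> ` B = B"
  have "inj_on (part \<pi> B) B"
    using permutes_inj[OF p] by (auto simp: part_def inj_on_def dest: injD)
  moreover have "part \<pi> B ` B = B" using B by (auto simp: part_def)
  ultimately show "bij_betw (part \<pi> B) B B" by (simp add: bij_betw_def)
qed (simp add: part_def)

lemma part_self: "q permutes B \<Longrightarrow> part q B = q"
  by (auto simp: part_def permutes_not_in fun_eq_iff)

lemma image_disjoint_permutes: "q permutes B \<Longrightarrow> A' \<inter> B = {} \<Longrightarrow> q ` A' = A'"
proof -
  assume "q permutes B" "A' \<inter> B = {}"
  then have "q x = x" if "x \<in> A'" for x using that permutes_not_in[of q B x] by blast
  then show ?thesis by (simp cong: image_cong)
qed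

lemma part_disjoint: "q permutes B \<Longrightarrow> A' \<inter> B = {} \<Longrightarrow> part q A' = id"
  using permutes_not_in[of q B] by (auto simp: part_def fun_eq_iff)

text \<open>A permutation preserving all blocks amounts to a family of permutations of the blocks.\<close>

lemma card_blocks:
  assumes H: "\<And>k. k \<in> K \<Longrightarrow> H k \<subseteq> {\<pi>. \<pi> permutes A k}"
  shows "card (blocks H) = (\<Prod>k\<in>K. card (H k))"
proof -
  define f where "f \<pi> = (\<lambda>k\<in>K. part \<pi> (A k))" for \<pi>
  have "bij_betw f (blocks H) (PiE K H)"
    unfolding bij_betw_def
  proof
    show "inj_on f (blocks H)"
    proof (rule inj_onI)
      fix \<pi> \<sigma> assume \<pi>: "\<pi> \<in> blocks H" and \<sigma>: "\<sigma> \<in> blocks H" and eq: "f \<pi> = f \<sigma>"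
      have "\<pi> x = \<sigma> x" for x
      proof (cases "x \<in> {1..n}")
        case True
        then obtain k where k: "k \<in> K" "x \<in> A k" using A_cover by blast
        have "part \<pi> (A k) = part \<sigma> (A k)" using fun_cong[OF eq, of k] k by (simp add: f_def)
        then show ?thesis using k by (auto simp: part_def dest: fun_cong[of _ _ x])
      next
        case False
        then show ?thesis using \<pi> \<sigma> permutes_not_in by (metis (no_types, lifting) blocks_def mem_Collect_eq)
      qed
      then show "\<pi> = \<sigma>" by blast
    qed
    show "f ` blocks H = PiE K H"
    proof
      show "f ` blocks H \<subseteq> PiE K H" by (auto simp: f_def blocks_def)
      show "PiE K H \<subseteq> f ` blocks H"
      proof
        fix g assume g: "g \<in> PiE K H"
        have gp: "g k permutes A k" if "k \<in> K" for k using g H[OF that] that by auto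
        define kk where "kk x = (SOME k. k \<in> K \<and> x \<in> A k)" for x
        have kk: "kk x = k" if "k \<in> K" "x \<in> A k" for k x
        proof -
          have "kk x \<in> K \<and> x \<in> A (kk x)" unfolding kk_def by (rule someI[of _ k]) (use that in simp)
          then show ?thesis using A_unique[of x "kk x" k] that by simp
        qed
        define \<pi> where "\<pi> x = (if x \<in> {1..n} then g (kk x) x else x)" for x
        have \<pi>A: "\<pi> x = g k x" if "k \<in> K" "x \<in> A k" for k x
          using that A_sub[OF that(1)] kk[OF that] by (auto simp: \<pi>_def)
        have im: "\<pi> ` A k = A k" if k: "k \<in> K" for k
          using \<pi>A[OF k] permutes_image[OF gp[OF k]] by (simp cong: image_cong)
        have "\<pi> permutes {1..n}"
        proof (rule bij_imp_permutes)
          have "inj_on \<pi> {1..n}"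
          proof (rule inj_onI)
            fix x y assume xy: "x \<in> {1..n}" "y \<in> {1..n}" "\<pi> x = \<pi> y"
            obtain k l where k: "k \<in> K" "x \<in> A k" and l: "l \<in> K" "y \<in> A l" using A_cover xy by meson
            have "\<pi> x \<in> A k" "\<pi> y \<in> A l" using im[OF k(1)] im[OF l(1)] k l by auto
            then have "k = l" using A_unique xy(3) k(1) l(1) by metis
            then show "x = y" using xy(3) \<pi>A[OF k] \<pi>A[OF l] permutes_inj[OF gp[OF k(1)]] by (auto dest: injD)
          qed
          moreover have "\<pi> ` {1..n} = {1..n}"
          proof -
            have "\<pi> ` (\<Union>i\<in>K. A i) = (\<Union>i\<in>K. A i)" using im by (simp add: image_UN)
            then show ?thesis unfolding A_union .
          qed
          ultimately show "bij_betw \<pi> {1..n} {1..n}" by (simp add: bij_betw_def)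
          show "\<pi> x = x" if "x \<notin> {1..n}" for x using that unfolding \<pi>_def by (rule if_not_P)
        qed
        moreover have pt: "part \<pi> (A k) = g k" if k: "k \<in> K" for k
          using \<pi>A[OF k] permutes_not_in[OF gp[OF k]] by (auto simp: part_def fun_eq_iff)
        ultimately have "\<pi> \<in> blocks H" using im g by (auto simp: blocks_def)
        moreover have "f \<pi> = g" using g pt by (auto simp: f_def fun_eq_iff PiE_def extensional_def)
        ultimately show "g \<in> f ` blocks H" by blast
      qed
    qed
  qed
  then have "card (blocks H) = card (PiE K H)" by (rule bij_betw_same_card)
  then show ?thesis using finite_K by (simp add: card_PiE)
qed

lemma part_comp:
  assumes "\<sigma> ` B = B" shows "part (\<pi> \<circ> \<sigma>) B = part \<pi> B \<circ> part \<sigma> B"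
  using assms by (auto simp: part_def fun_eq_iff)

lemma part_inv:
  assumes p: "\<pi> permutes {1..n}" and B: "\<pi> ` B = B"
  shows "inv' \<pi> ` B = B" "part (inv' \<pi>) B = inv' (part \<pi> B)"
proof -
  have "inv' \<pi> ` (\<pi> ` B) = B" using permutes_inverses(2)[OF p] by (simp add: image_image)
  then show i: "inv' \<pi> ` B = B" using B by simp
  have "part (inv' \<pi>) B \<circ> part \<pi> B = id"
    using part_comp[OF B, of "inv' \<pi>"] permutes_inv_o(2)[OF p] by (simp add: part_def id_def)
  then have "inv' (part \<pi> B) = part (inv' \<pi>) B"
    using permutes_inv_o(1)[OF part_permutes[OF p B]] by (metis (no_types, lifting) comp_assoc comp_id id_comp)
  then show "part (inv' \<pi>) B = inv' (part \<pi> B)" by simp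
qed

abbreviation "Sn \<equiv> sym_group n"

lemma permutes_mono: "q permutes B \<Longrightarrow> B \<subseteq> {1..n} \<Longrightarrow> q permutes {1..n}"
  by (rule permutes_subset)

lemma blocks_subgroup:
  assumes H: "\<And>k. k \<in> K \<Longrightarrow> H k \<subseteq> {\<pi>. \<pi> permutes A k}" "\<And>k. k \<in> K \<Longrightarrow> subgroup (H k) Sn"
  shows "subgroup (blocks H) Sn"
proof
  show "blocks H \<subseteq> carrier Sn" by (auto simp: blocks_def sym_group_def)
  have "part id (A k) = \<one>\<^bsub>Sn\<^esub>" for k by (auto simp: part_def sym_group_def)
  then show "\<one>\<^bsub>Sn\<^esub> \<in> blocks H"
    using subgroup.one_closed[OF H(2)] by (auto simp: blocks_def sym_group_def permutes_id)
  fix \<pi> assume \<pi>: "\<pi> \<in> blocks H"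
  then have p: "\<pi> permutes {1..n}" by (simp add: blocks_def)
  have pk: "\<pi> ` A k = A k" "part \<pi> (A k) \<in> H k" if "k \<in> K" for k using \<pi> that by (auto simp: blocks_def)
  have iv: "inv\<^bsub>Sn\<^esub> \<sigma> = inv' \<sigma>" if "\<sigma> permutes {1..n}" for \<sigma>
    using that by (intro sym_group_inv_equality) (simp add: sym_group_carrier)
  have "inv' \<pi> \<in> blocks H"
    unfolding blocks_def
  proof (intro CollectI conjI ballI)
    show "inv' \<pi> permutes {1..n}" by (rule permutes_inv[OF p])
    fix k assume k: "k \<in> K"
    show "inv' \<pi> ` A k = A k" by (rule part_inv(1)[OF p pk(1)[OF k]])
    have "inv\<^bsub>Sn\<^esub> (part \<pi> (A k)) \<in> H k" by (rule subgroup.m_inv_closed[OF H(2)[OF k] pk(2)[OF k]])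
    then show "part (inv' \<pi>) (A k) \<in> H k"
      using iv[OF permutes_mono[OF part_permutes[OF p pk(1)[OF k]] A_sub[OF k]]] part_inv(2)[OF p pk(1)[OF k]] by simp
  qed
  then show "inv\<^bsub>Sn\<^esub> \<pi> \<in> blocks H" using iv[OF p] by simp
  fix \<sigma> assume \<sigma>: "\<sigma> \<in> blocks H"
  then have s: "\<sigma> permutes {1..n}" by (simp add: blocks_def)
  have sk: "\<sigma> ` A k = A k" "part \<sigma> (A k) \<in> H k" if "k \<in> K" for k using \<sigma> that by (auto simp: blocks_def)
  have "\<pi> \<circ> \<sigma> \<in> blocks H"
    unfolding blocks_def
  proof (intro CollectI conjI ballI)
    show "\<pi> \<circ> \<sigma> permutes {1..n}" by (rule permutes_compose[OF s p])
    fix k assume k: "k \<in> K"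
    show "(\<pi> \<circ> \<sigma>) ` A k = A k" unfolding image_comp[symmetric] sk(1)[OF k] by (rule pk(1)[OF k])
    show "part (\<pi> \<circ> \<sigma>) (A k) \<in> H k"
      using subgroup.m_closed[OF H(2)[OF k] pk(2)[OF k] sk(2)[OF k]] part_comp[OF sk(1)[OF k]]
      by (simp add: sym_group_mult)
  qed
  then show "\<pi> \<otimes>\<^bsub>Sn\<^esub> \<sigma> \<in> blocks H" by (simp add: sym_group_mult)
qed

lemma generate_blocks:
  assumes H: "\<And>k. k \<in> K \<Longrightarrow> H k \<subseteq> {\<pi>. \<pi> permutes A k}" "\<And>k. k \<in> K \<Longrightarrow> subgroup (H k) Sn"
  shows "generate Sn (\<Union>k\<in>K. H k) = blocks H"
proof
  interpret S: group Sn by (rule sym_group_is_group)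
  have one: "id \<in> H k" if "k \<in> K" for k using subgroup.one_closed[OF H(2)[OF that]] by (simp add: sym_group_one)
  have "H k \<subseteq> blocks H" if k: "k \<in> K" for k
  proof
    fix q assume q: "q \<in> H k"
    then have qp: "q permutes A k" using H(1)[OF k] by blast
    have "q ` A j = A j \<and> part q (A j) \<in> H j" if j: "j \<in> K" for j
    proof (cases "j = k")
      case True
      then show ?thesis using permutes_image[OF qp] part_self[OF qp] q by simp
    next
      case False
      then have d: "A j \<inter> A k = {}" using A_disjoint[OF j k] by simp
      then show ?thesis using image_disjoint_permutes[OF qp d] part_disjoint[OF qp d] one[OF j] by simp
    qed
    then show "q \<in> blocks H" using permutes_mono[OF qp A_sub[OF k]] by (simp add: blocks_def)
  qed
  then show "generate Sn (\<Union>k\<in>K. H k) \<subseteq> blocks H"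
    by (intro S.generate_subgroup_incl[OF _ blocks_subgroup[OF H]]) auto
  show "blocks H \<subseteq> generate Sn (\<Union>k\<in>K. H k)"
  proof
    fix \<pi> assume \<pi>: "\<pi> \<in> blocks H"
    then have p: "\<pi> permutes {1..n}" by (simp add: blocks_def)
    have pk: "\<pi> ` A k = A k" "part \<pi> (A k) \<in> H k" if "k \<in> K" for k using \<pi> that by (auto simp: blocks_def)
    have "part \<pi> (\<Union>i\<in>L. A i) \<in> generate Sn (\<Union>k\<in>K. H k)" if "finite L" "L \<subseteq> K" for L
      using that
    proof (induction L)
      case empty
      have "part \<pi> {} = \<one>\<^bsub>Sn\<^esub>" by (auto simp: part_def sym_group_def)
      then show ?case using generate.one by simp
    next
      case (insert k L)
      let ?U = "\<Union>i\<in>L. A i"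
      have d: "x \<notin> A k" if "x \<in> ?U" for x using that insert.hyps insert.prems A_disjoint[of _ k] by blast
      have imU: "\<pi> ` ?U = ?U" unfolding image_UN using pk(1) insert.prems by (intro SUP_cong) auto
      have k: "k \<in> K" using insert.prems by simp
      have "part \<pi> (\<Union>i\<in>insert k L. A i) = part \<pi> (A k) \<circ> part \<pi> ?U"
      proof
        fix x
        have "\<pi> x \<notin> A k" if "x \<in> ?U"
        proof -
          have "\<pi> x \<in> ?U" using imU that by blast
          then show ?thesis using d by blast
        qed
        then show "part \<pi> (\<Union>i\<in>insert k L. A i) x = (part \<pi> (A k) \<circ> part \<pi> ?U) x"
          by (auto simp: part_def)
      qed
      also have "\<dots> = part \<pi> (A k) \<otimes>\<^bsub>Sn\<^esub> part \<pi> ?U" by (simp add: sym_group_mult)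
      also have "\<dots> \<in> generate Sn (\<Union>k\<in>K. H k)"
      proof (rule generate.eng)
        show "part \<pi> (A k) \<in> generate Sn (\<Union>k\<in>K. H k)" using pk(2)[OF k] k by (intro generate.incl) blast
        show "part \<pi> ?U \<in> generate Sn (\<Union>k\<in>K. H k)" using insert by simp
      qed
      finally show ?case .
    qed
    from this[OF finite_K] have "part \<pi> {1..n} \<in> generate Sn (\<Union>k\<in>K. H k)" unfolding A_union by simp
    then show "\<pi> \<in> generate Sn (\<Union>k\<in>K. H k)" using part_self[OF p] by simp
  qed
qed

definition preserving :: "(nat \<Rightarrow> nat) set" where
  "preserving = {\<pi>. \<pi> permutes {1..n} \<and> (\<forall>k\<in>K. \<pi> ` A k = A k)}"

lemma preserving_blocks: "preserving = blocks (\<lambda>k. {\<pi>. \<pi> permutes A k})"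
  unfolding preserving_def blocks_def by (intro Collect_cong conj_cong ball_cong refl) (use part_permutes in blast)

text \<open>Bijections between corresponding blocks are glued to a permutation.\<close>

lemma glue:
  assumes B_disj: "\<And>i j. i \<in> K \<Longrightarrow> j \<in> K \<Longrightarrow> i \<noteq> j \<Longrightarrow> B i \<inter> B j = {}"
    and B_union: "(\<Union>i\<in>K. B i) = {1..n}" and card: "\<And>i. i \<in> K \<Longrightarrow> card (A i) = card (B i)"
  shows "\<exists>\<pi>. \<pi> permutes {1..n} \<and> (\<forall>k\<in>K. \<pi> ` A k = B k)"
proof -
  have fin: "finite (A k)" "finite (B k)" if "k \<in> K" for k
    using finite_subset[of _ "{1..n}"] A_sub[OF that] B_union that by auto
  have "\<forall>k. \<exists>f. k \<in> K \<longrightarrow> bij_betw f (A k) (B k)"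
    using fin card finite_same_card_bij by metis
  then obtain f where f: "\<And>k. k \<in> K \<Longrightarrow> bij_betw (f k) (A k) (B k)" by metis
  define kk where "kk x = (SOME k. k \<in> K \<and> x \<in> A k)" for x
  have kk: "kk x = k" if "k \<in> K" "x \<in> A k" for k x
  proof -
    have "kk x \<in> K \<and> x \<in> A (kk x)" unfolding kk_def by (rule someI[of _ k]) (use that in simp)
    then show ?thesis using A_unique[of x "kk x" k] that by simp
  qed
  define \<pi> where "\<pi> x = (if x \<in> {1..n} then f (kk x) x else x)" for x
  have \<pi>A: "\<pi> x = f k x" if "k \<in> K" "x \<in> A k" for k x
    using that A_sub[OF that(1)] kk[OF that] by (auto simp: \<pi>_def)
  have im: "\<pi> ` A k = B k" if k: "k \<in> K" for k
    using \<pi>A[OF k] bij_betw_imp_surj_on[OF f[OF k]] by (simp cong: image_cong)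
  have "\<pi> permutes {1..n}"
  proof (rule bij_imp_permutes)
    have "inj_on \<pi> {1..n}"
    proof (rule inj_onI)
      fix x y assume xy: "x \<in> {1..n}" "y \<in> {1..n}" "\<pi> x = \<pi> y"
      obtain k l where k: "k \<in> K" "x \<in> A k" and l: "l \<in> K" "y \<in> A l" using A_cover xy by meson
      have "\<pi> x \<in> B k" "\<pi> y \<in> B l" using im[OF k(1)] im[OF l(1)] k l by auto
      then have "k = l" using B_disj[OF k(1) l(1)] xy(3) by auto
      then show "x = y"
        using xy(3) \<pi>A[OF k] \<pi>A[OF l] bij_betw_imp_inj_on[OF f[OF k(1)]] k l by (auto dest: inj_onD)
    qed
    moreover have "\<pi> ` {1..n} = {1..n}"
    proof -
      have "\<pi> ` (\<Union>i\<in>K. A i) = (\<Union>i\<in>K. B i)" using im by (simp add: image_UN)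
      then show ?thesis unfolding A_union B_union .
    qed
    ultimately show "bij_betw \<pi> {1..n} {1..n}" by (simp add: bij_betw_def)
    show "\<pi> x = x" if "x \<notin> {1..n}" for x using that unfolding \<pi>_def by (rule if_not_P)
  qed
  then show ?thesis using im by blast
qed

end

section \<open>Pairs of tabloids\<close>

locale tabloid_pairs =
  fixes n :: nat and lam :: "nat list"
  assumes part: "is_partition lam n"
begin

abbreviation "l \<equiv> length lam"
abbreviation "K \<equiv> {..<l} \<times> {..<l}"
abbreviation "Y \<equiv> tabloids n lam"

abbreviation tact :: "(nat \<Rightarrow> nat) \<Rightarrow> nat set list \<Rightarrow> nat set list" where
  "tact \<pi> \<equiv> map ((`) \<pi>)"

lemma tabD:
  assumes "T \<in> Y"
  shows "length T = l" "i < l \<Longrightarrow> card (T ! i) = lam ! i"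
    "i < l \<Longrightarrow> j < l \<Longrightarrow> i \<noteq> j \<Longrightarrow> T ! i \<inter> T ! j = {}" "(\<Union>i<l. T ! i) = {1..n}"
    "i < l \<Longrightarrow> T ! i \<subseteq> {1..n}"
proof -
  show len: "length T = l" and "i < l \<Longrightarrow> card (T ! i) = lam ! i"
    and "i < l \<Longrightarrow> j < l \<Longrightarrow> i \<noteq> j \<Longrightarrow> T ! i \<inter> T ! j = {}"
    using assms unfolding tabloids_def by blast+
  have "(\<Union>i<l. T ! i) = \<Union>(set T)" unfolding set_conv_nth len by auto
  then show u: "(\<Union>i<l. T ! i) = {1..n}" using assms unfolding tabloids_def by simp
  then show "i < l \<Longrightarrow> T ! i \<subseteq> {1..n}" by blast
qed

lemma tabI:
  assumes len: "length T = l" and c: "\<And>i. i < l \<Longrightarrow> card (T ! i) = lam ! i"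
    and d: "\<And>i j. i < l \<Longrightarrow> j < l \<Longrightarrow> i \<noteq> j \<Longrightarrow> T ! i \<inter> T ! j = {}" and u: "(\<Union>i<l. T ! i) = {1..n}"
  shows "T \<in> Y"
proof -
  have "\<Union>(set T) = (\<Union>i<l. T ! i)" unfolding set_conv_nth len by auto
  then show ?thesis using len c d u unfolding tabloids_def by simp
qed

lemma tab_eqI: "T \<in> Y \<Longrightarrow> U \<in> Y \<Longrightarrow> (\<And>i. i < l \<Longrightarrow> T ! i = U ! i) \<Longrightarrow> T = U"
  by (rule nth_equalityI) (simp_all add: tabD(1))

lemma finite_Y: "finite Y"
proof (rule finite_subset)
  show "Y \<subseteq> {T. set T \<subseteq> Pow {1..n} \<and> length T = l}" unfolding tabloids_def by blast
  show "finite {T. set T \<subseteq> Pow {1..n} \<and> length T = l}" by (rule finite_lists_length_eq) simp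
qed

lemma tact_nth: "T \<in> Y \<Longrightarrow> i < l \<Longrightarrow> tact \<pi> T ! i = \<pi> ` (T ! i)"
  by (simp add: tabD(1))

lemma tact_closed:
  assumes \<pi>: "\<pi> permutes {1..n}" and T: "T \<in> Y"
  shows "tact \<pi> T \<in> Y"
proof (rule tabI)
  note inj = permutes_inj[OF \<pi>]
  show "length (tact \<pi> T) = l" using tabD(1)[OF T] by simp
  show "card (tact \<pi> T ! i) = lam ! i" if "i < l" for i
    using that tact_nth[OF T that] tabD(2)[OF T that] card_image[OF inj_on_subset[OF inj subset_UNIV]] by simp
  show "tact \<pi> T ! i \<inter> tact \<pi> T ! j = {}" if "i < l" "j < l" "i \<noteq> j" for i j
    using tabD(3)[OF T that] tact_nth[OF T that(1)] tact_nth[OF T that(2)] image_Int[OF inj, of "T ! i" "T ! j"] by simp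
  have "(\<Union>i<l. tact \<pi> T ! i) = (\<Union>i<l. \<pi> ` (T ! i))" using tact_nth[OF T] by simp
  also have "\<dots> = {1..n}" unfolding image_UN[symmetric] tabD(4)[OF T] by (rule permutes_image[OF \<pi>])
  finally show "(\<Union>i<l. tact \<pi> T ! i) = {1..n}" .
qed

lemma sum_lam: "(\<Sum>i<l. lam ! i) = n"
  using part unfolding is_partition_def by (simp add: sum_list_sum_nth atLeast0LessThan)

lemma union_by_card:
  assumes "finite I" "\<And>i. i \<in> I \<Longrightarrow> A i \<subseteq> {1..n}" "\<And>i j. i \<in> I \<Longrightarrow> j \<in> I \<Longrightarrow> i \<noteq> j \<Longrightarrow> A i \<inter> A j = {}"
    and "(\<Sum>i\<in>I. card (A i)) = n"
  shows "(\<Union>i\<in>I. A i) = {1..n}"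
proof (rule card_subset_eq)
  show "(\<Union>i\<in>I. A i) \<subseteq> {1..n}" using assms(2) by blast
  have "\<forall>i\<in>I. finite (A i)" using assms(2) finite_subset by blast
  then have "card (\<Union>i\<in>I. A i) = (\<Sum>i\<in>I. card (A i))"
    by (rule card_UN_disjoint[OF assms(1)]) (use assms(3) in blast)
  then show "card (\<Union>i\<in>I. A i) = card {1..n}" using assms(4) by simp
qed simp

text \<open>The matrix of a pair of tabloids is a complete invariant of its orbit, and interchanging the tabloids
transposes it.\<close>

definition mat_of :: "nat set list \<Rightarrow> nat set list \<Rightarrow> nat mat" where
  "mat_of T U = mat l l (\<lambda>(i, j). card (T ! i \<inter> U ! j))"

lemma mat_of_entry: "i < l \<Longrightarrow> j < l \<Longrightarrow> mat_of T U $$ (i, j) = card (T ! i \<inter> U ! j)"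
  by (simp add: mat_of_def)

lemma mat_of_dim: "mat_of T U \<in> carrier_mat l l" "dim_row (mat_of T U) = l" "dim_col (mat_of T U) = l"
  by (simp_all add: mat_of_def)

lemma mat_of_transpose: "mat_of U T = transpose_mat (mat_of T U)"
  by (rule eq_matI) (simp_all add: mat_of_def Int_commute)

lemma row_union: "T \<in> Y \<Longrightarrow> U \<in> Y \<Longrightarrow> i < l \<Longrightarrow> (\<Union>j<l. T ! i \<inter> U ! j) = T ! i"
  using tabD(4)[of U] tabD(5)[of T i] by blast

lemma col_union: "T \<in> Y \<Longrightarrow> U \<in> Y \<Longrightarrow> j < l \<Longrightarrow> (\<Union>i<l. T ! i \<inter> U ! j) = U ! j"
  using tabD(4)[of T] tabD(5)[of U j] by blast

lemma cells: "T \<in> Y \<Longrightarrow> U \<in> Y \<Longrightarrow> block_family n K (\<lambda>(i, j). T ! i \<inter> U ! j)"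
proof
  assume T: "T \<in> Y" and U: "U \<in> Y"
  show "finite K" by simp
  show "(case a of (i, j) \<Rightarrow> T ! i \<inter> U ! j) \<inter> (case b of (i, j) \<Rightarrow> T ! i \<inter> U ! j) = {}"
    if ab: "a \<in> K" "b \<in> K" "a \<noteq> b" for a b
  proof -
    obtain i j i' j' where e: "a = (i, j)" "b = (i', j')" by (cases a, cases b)
    then have "i \<noteq> i' \<or> j \<noteq> j'" "i < l" "j < l" "i' < l" "j' < l" using ab by auto
    then have "T ! i \<inter> T ! i' = {} \<or> U ! j \<inter> U ! j' = {}" using tabD(3)[OF T] tabD(3)[OF U] by blast
    then show ?thesis unfolding e prod.case by blast
  qed
  have "(\<Union>(i, j)\<in>K. T ! i \<inter> U ! j) = (\<Union>i<l. \<Union>j<l. T ! i \<inter> U ! j)" by blast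
  also have "\<dots> = (\<Union>i<l. T ! i)" using row_union[OF T U] by simp
  finally show "(\<Union>(i, j)\<in>K. T ! i \<inter> U ! j) = {1..n}" using tabD(4)[OF T] by simp
qed

lemma finite_part: "T \<in> Y \<Longrightarrow> i < l \<Longrightarrow> finite (T ! i)"
  using tabD(5) finite_subset by blast

lemma mat_of_diag:
  assumes T: "T \<in> Y" and U: "U \<in> Y"
  shows "diagonal_mat (mat_of T U) \<longleftrightarrow> T = U"
proof
  assume d: "diagonal_mat (mat_of T U)"
  show "T = U"
  proof (rule tab_eqI[OF T U])
    fix i assume i: "i < l"
    have "T ! i \<inter> U ! j = {}" if j: "j < l" "j \<noteq> i" for j
      using d i j finite_part[OF T i] mat_of_entry[OF i j(1), of T U] mat_of_dim(2,3)[of T U]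
      unfolding diagonal_mat_def by auto
    then have "T ! i \<subseteq> U ! i" using row_union[OF T U i] by blast
    then show "T ! i = U ! i"
      by (rule card_subset_eq[OF finite_part[OF U i]]) (simp add: tabD(2)[OF T i] tabD(2)[OF U i])
  qed
next
  assume "T = U"
  then show "diagonal_mat (mat_of T U)"
    using tabD(3)[OF T] unfolding diagonal_mat_def mat_of_dim by (simp add: mat_of_entry)
qed

lemma mat_of_self:
  assumes T: "T \<in> Y" shows "mat_of T T = D_mat lam"
proof (rule eq_matI)
  fix i j assume "i < dim_row (D_mat lam)" "j < dim_col (D_mat lam)"
  then have ij: "i < l" "j < l" by (simp_all add: D_mat_def mat_diag_def)
  show "mat_of T T $$ (i, j) = D_mat lam $$ (i, j)"
    using ij tabD(3)[OF T ij] tabD(2)[OF T ij(1)] by (cases "i = j") (simp_all add: mat_of_entry D_mat_def mat_diag_def)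
qed (simp_all add: mat_of_dim D_mat_def mat_diag_def)

lemma mat_of_M_mats:
  assumes T: "T \<in> Y" and U: "U \<in> Y" and ne: "T \<noteq> U"
  shows "mat_of T U \<in> M_mats lam"
proof -
  have r: "(\<Sum>j<l. mat_of T U $$ (i, j)) = lam ! i" if i: "i < l" for i
  proof -
    have "(\<Sum>j<l. mat_of T U $$ (i, j)) = (\<Sum>j\<in>{..<l}. card (T ! i \<inter> U ! j))"
      using i by (intro sum.cong) (simp_all add: mat_of_entry)
    also have "\<dots> = card (\<Union>j<l. T ! i \<inter> U ! j)"
      by (rule card_UN_disjoint[symmetric]) (use finite_part[OF T i] tabD(3)[OF U] in \<open>simp, simp, blast\<close>)
    finally show ?thesis using row_union[OF T U i] tabD(2)[OF T i] by simp
  qed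
  have c: "(\<Sum>i<l. mat_of T U $$ (i, j)) = lam ! j" if j: "j < l" for j
  proof -
    have "(\<Sum>i<l. mat_of T U $$ (i, j)) = (\<Sum>i\<in>{..<l}. card (T ! i \<inter> U ! j))"
      using j by (intro sum.cong) (simp_all add: mat_of_entry)
    also have "\<dots> = card (\<Union>i<l. T ! i \<inter> U ! j)"
      by (rule card_UN_disjoint[symmetric]) (use finite_part[OF U j] tabD(3)[OF T] in \<open>simp, simp, blast\<close>)
    finally show ?thesis using col_union[OF T U j] tabD(2)[OF U j] by simp
  qed
  show ?thesis unfolding M_mats_def using r c mat_of_dim(1) mat_of_diag[OF T U] ne by blast
qed

lemma mat_of_tact:
  assumes \<pi>: "\<pi> permutes {1..n}" and T: "T \<in> Y" and U: "U \<in> Y"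
  shows "mat_of (tact \<pi> T) (tact \<pi> U) = mat_of T U"
proof (rule eq_matI)
  fix i j assume "i < dim_row (mat_of T U)" "j < dim_col (mat_of T U)"
  then have ij: "i < l" "j < l" by (simp_all add: mat_of_dim)
  have "tact \<pi> T ! i \<inter> tact \<pi> U ! j = \<pi> ` (T ! i \<inter> U ! j)"
    using tact_nth[OF T ij(1)] tact_nth[OF U ij(2)] image_Int[OF permutes_inj[OF \<pi>]] by simp
  then show "mat_of (tact \<pi> T) (tact \<pi> U) $$ (i, j) = mat_of T U $$ (i, j)"
    using ij card_image[OF inj_on_subset[OF permutes_inj[OF \<pi>] subset_UNIV]] by (simp add: mat_of_entry)
qed (simp_all add: mat_of_dim)

text \<open>A permutation carries one pair of tabloids to another one if it carries the intersections of
  the rows to each other, and such a permutation exists as soon as these have the same sizes.\<close>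

lemma tact_pair:
  assumes T: "T \<in> Y" "U \<in> Y" and T': "T' \<in> Y" "U' \<in> Y"
    and c: "\<And>i j. i < l \<Longrightarrow> j < l \<Longrightarrow> \<pi> ` (T ! i \<inter> U ! j) = T' ! i \<inter> U' ! j" and \<pi>: "\<pi> permutes {1..n}"
  shows "tact \<pi> T = T'" "tact \<pi> U = U'"
proof -
  show "tact \<pi> T = T'"
  proof (rule tab_eqI[OF tact_closed[OF \<pi> T(1)] T'(1)])
    fix i assume i: "i < l"
    have "tact \<pi> T ! i = \<pi> ` (\<Union>j<l. T ! i \<inter> U ! j)" using tact_nth[OF T(1) i] row_union[OF T i] by simp
    also have "\<dots> = (\<Union>j<l. T' ! i \<inter> U' ! j)" unfolding image_UN using c i by (intro SUP_cong) auto
    finally show "tact \<pi> T ! i = T' ! i" using row_union[OF T' i] by simp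
  qed
  show "tact \<pi> U = U'"
  proof (rule tab_eqI[OF tact_closed[OF \<pi> T(2)] T'(2)])
    fix j assume j: "j < l"
    have "tact \<pi> U ! j = \<pi> ` (\<Union>i<l. T ! i \<inter> U ! j)" using tact_nth[OF T(2) j] col_union[OF T j] by simp
    also have "\<dots> = (\<Union>i<l. T' ! i \<inter> U' ! j)" unfolding image_UN using c j by (intro SUP_cong) auto
    finally show "tact \<pi> U ! j = U' ! j" using col_union[OF T' j] by simp
  qed
qed

lemma same_mat_same_orbit:
  assumes T: "T \<in> Y" "U \<in> Y" and T': "T' \<in> Y" "U' \<in> Y" and eq: "mat_of T U = mat_of T' U'"
  shows "\<exists>\<pi>. \<pi> permutes {1..n} \<and> tact \<pi> T = T' \<and> tact \<pi> U = U'"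
proof -
  interpret B: block_family n K "\<lambda>(i, j). T ! i \<inter> U ! j" by (rule cells[OF T])
  interpret B': block_family n K "\<lambda>(i, j). T' ! i \<inter> U' ! j" by (rule cells[OF T'])
  have "\<exists>\<pi>. \<pi> permutes {1..n} \<and> (\<forall>k\<in>K. \<pi> ` (case k of (i, j) \<Rightarrow> T ! i \<inter> U ! j) = (case k of (i, j) \<Rightarrow> T' ! i \<inter> U' ! j))"
  proof (rule B.glue[OF B'.A_disjoint B'.A_union])
    fix k assume "k \<in> K"
    then obtain i j where k: "k = (i, j)" "i < l" "j < l" by auto
    have "mat_of T U $$ (i, j) = mat_of T' U' $$ (i, j)" unfolding eq ..
    then show "card (case k of (i, j) \<Rightarrow> T ! i \<inter> U ! j) = card (case k of (i, j) \<Rightarrow> T' ! i \<inter> U' ! j)"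
      using k by (simp add: mat_of_entry)
  qed
  then obtain \<pi> where \<pi>: "\<pi> permutes {1..n}" and c: "\<And>k. k \<in> K \<Longrightarrow> \<pi> ` (case k of (i, j) \<Rightarrow> T ! i \<inter> U ! j) = (case k of (i, j) \<Rightarrow> T' ! i \<inter> U' ! j)"
    by blast
  have "\<pi> ` (T ! i \<inter> U ! j) = T' ! i \<inter> U' ! j" if "i < l" "j < l" for i j using c[of "(i, j)"] that by simp
  from tact_pair[OF T T' this \<pi>] \<pi> show ?thesis by blast
qed

lemma realise_mat:
  assumes M: "M \<in> M_mats lam"
    and s: "\<And>i j. i < l \<Longrightarrow> j < l \<Longrightarrow> s i j \<subseteq> {1..n}" "\<And>i j. i < l \<Longrightarrow> j < l \<Longrightarrow> card (s i j) = M $$ (i, j)"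
      "\<And>i j i' j'. i < l \<Longrightarrow> j < l \<Longrightarrow> i' < l \<Longrightarrow> j' < l \<Longrightarrow> (i, j) \<noteq> (i', j') \<Longrightarrow> s i j \<inter> s i' j' = {}"
  defines "T \<equiv> map (\<lambda>i. \<Union>j<l. s i j) [0..<l]" and "U \<equiv> map (\<lambda>j. \<Union>i<l. s i j) [0..<l]"
  shows "T \<in> Y" "U \<in> Y" "\<And>i j. i < l \<Longrightarrow> j < l \<Longrightarrow> T ! i \<inter> U ! j = s i j" "mat_of T U = M" "T \<noteq> U"
    "block_family n K (\<lambda>(i, j). s i j)"
proof -
  have Mc: "M \<in> carrier_mat l l" and nd: "\<not> diagonal_mat M"
    and rs: "\<And>i. i < l \<Longrightarrow> (\<Sum>j<l. M $$ (i, j)) = lam ! i" and cs: "\<And>j. j < l \<Longrightarrow> (\<Sum>i<l. M $$ (i, j)) = lam ! j"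
    using M unfolding M_mats_def by blast+
  have fin: "finite (s i j)" if "i < l" "j < l" for i j using s(1)[OF that] finite_subset by blast
  have Tn: "T ! i = (\<Union>j<l. s i j)" "U ! i = (\<Union>j<l. s j i)" if "i < l" for i
    using that by (simp_all add: T_def U_def)
  have Tc: "card (T ! i) = lam ! i" if i: "i < l" for i
  proof -
    have "card (T ! i) = (\<Sum>j\<in>{..<l}. card (s i j))" unfolding Tn[OF i]
      by (rule card_UN_disjoint) (use fin[OF i] s(3)[OF i _ i] in \<open>simp, simp, blast\<close>)
    also have "\<dots> = (\<Sum>j<l. M $$ (i, j))" using s(2)[OF i] by (intro sum.cong) simp_all
    finally show ?thesis using rs[OF i] by simp
  qed
  have Uc: "card (U ! j) = lam ! j" if j: "j < l" for j
  proof -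
    have "card (U ! j) = (\<Sum>i\<in>{..<l}. card (s i j))" unfolding Tn[OF j]
      by (rule card_UN_disjoint) (use fin[OF _ j] s(3)[OF _ j _ j] in \<open>simp, simp, blast\<close>)
    also have "\<dots> = (\<Sum>i<l. M $$ (i, j))" using s(2)[OF _ j] by (intro sum.cong) simp_all
    finally show ?thesis using cs[OF j] by simp
  qed
  have Td: "T ! i \<inter> T ! j = {}" "U ! i \<inter> U ! j = {}" if ij: "i < l" "j < l" "i \<noteq> j" for i j
    unfolding Tn[OF ij(1)] Tn[OF ij(2)] using s(3) ij by blast+
  have Ts: "T ! i \<subseteq> {1..n}" "U ! i \<subseteq> {1..n}" if i: "i < l" for i
    unfolding Tn[OF i] using s(1) i by blast+
  show T: "T \<in> Y"
  proof (rule tabI)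
    show "(\<Union>i<l. T ! i) = {1..n}"
      by (rule union_by_card) (use Ts Td Tc sum_lam in simp_all)
  qed (use Tc Td in \<open>simp_all add: T_def\<close>)
  show U: "U \<in> Y"
  proof (rule tabI)
    show "(\<Union>i<l. U ! i) = {1..n}"
      by (rule union_by_card) (use Ts Td Uc sum_lam in simp_all)
  qed (use Uc Td in \<open>simp_all add: U_def\<close>)
  show cell: "T ! i \<inter> U ! j = s i j" if ij: "i < l" "j < l" for i j
  proof
    show "s i j \<subseteq> T ! i \<inter> U ! j" unfolding Tn(1)[OF ij(1)] Tn(2)[OF ij(2)] using ij by blast
    show "T ! i \<inter> U ! j \<subseteq> s i j"
    proof
      fix x assume "x \<in> T ! i \<inter> U ! j"
      then obtain j' i' where x: "j' < l" "i' < l" "x \<in> s i j'" "x \<in> s i' j"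
        unfolding Tn(1)[OF ij(1)] Tn(2)[OF ij(2)] by blast
      then have "(i, j') = (i', j)" using s(3)[OF ij(1) x(1) x(2) ij(2)] by blast
      then show "x \<in> s i j" using x by simp
    qed
  qed
  show mo: "mat_of T U = M"
    by (rule eq_matI) (use Mc cell s(2) in \<open>simp_all add: mat_of_entry mat_of_dim\<close>)
  show "T \<noteq> U" using mat_of_diag[OF T U] nd unfolding mo by blast
  have "(\<lambda>(i, j). s i j) k = (\<lambda>(i, j). T ! i \<inter> U ! j) k" if "k \<in> K" for k using that cell by auto
  then show "block_family n K (\<lambda>(i, j). s i j)"
    using cells[OF T U] unfolding block_family_def by simp
qed

text \<open>The tabloid whose rows are the intervals defining the Young subgroup.\<close>

definition T0 :: "nat set list" where
  "T0 = map (\<lambda>i. {sum_list (take i lam)<..sum_list (take (Suc i) lam)}) [0..<l]"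

lemma T0_nth: "i < l \<Longrightarrow> T0 ! i = {sum_list (take i lam)<..sum_list (take (Suc i) lam)}"
  by (simp add: T0_def)

lemma T0_in: "T0 \<in> Y"
proof (rule tabI)
  have suc: "sum_list (take (Suc i) lam) = sum_list (take i lam) + lam ! i" if "i < l" for i
    using that by (simp add: take_Suc_conv_app_nth)
  have mono: "sum_list (take i lam) \<le> sum_list (take j lam)" if "i \<le> j" for i j
  proof -
    have "take j lam = take i lam @ take (j - i) (drop i lam)"
      using take_add[of i "j - i" lam] that by simp
    then show ?thesis by simp
  qed
  show "length T0 = l" by (simp add: T0_def)
  show c: "card (T0 ! i) = lam ! i" if "i < l" for i using suc[OF that] by (simp add: T0_nth[OF that])
  have lt: "T0 ! i \<inter> T0 ! j = {}" if "i < j" "j < l" for i j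
    using mono[of "Suc i" j] that by (auto simp: T0_nth)
  show d: "T0 ! i \<inter> T0 ! j = {}" if "i < l" "j < l" "i \<noteq> j" for i j
    using lt[of i j] lt[of j i] that by (cases "i < j") auto
  have n: "sum_list (take l lam) = n" using part by (simp add: is_partition_def)
  show "(\<Union>i<l. T0 ! i) = {1..n}"
  proof (rule union_by_card)
    fix i assume "i \<in> {..<l}"
    then have i: "i < l" by simp
    then show "T0 ! i \<subseteq> {1..n}" using mono[of "Suc i" l] n by (auto simp: T0_nth)
  qed (use d c sum_lam in simp_all)
qed

lemma young_group_carrier: "carrier (young_group n lam) = {\<pi>. \<pi> permutes {1..n} \<and> tact \<pi> T0 = T0}"
proof -
  have "(\<forall>i<l. \<pi> ` (T0 ! i) = T0 ! i) \<longleftrightarrow> tact \<pi> T0 = T0" if "\<pi> permutes {1..n}" for \<pi>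
    using tab_eqI[OF tact_closed[OF that T0_in] T0_in] tact_nth[OF T0_in, of _ \<pi>] by metis
  then show ?thesis unfolding young_group_def Let_def using T0_nth by auto
qed

lemma part_elt:
  assumes "i < l" obtains x where "x \<in> T0 ! i"
proof -
  have "0 < lam ! i" using part assms by (simp add: is_partition_def)
  then have "card (T0 ! i) \<noteq> 0" using tabD(2)[OF T0_in assms] by simp
  then show ?thesis using that by (metis card.empty all_not_in_conv)
qed

lemma M_mats_nonempty: assumes "2 \<le> l" shows "M_mats lam \<noteq> {}"
proof -
  have l: "0 < l" "1 < l" using assms by auto
  obtain x where x: "x \<in> T0 ! 0" using part_elt[OF l(1)] .
  obtain y where y: "y \<in> T0 ! 1" using part_elt[OF l(2)] .
  have "T0 ! 0 \<inter> T0 ! 1 = {}" by (rule tabD(3)[OF T0_in l]) simp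
  then have xy: "x \<in> {1..n}" "y \<in> {1..n}" "x \<notin> T0 ! 1"
    using x y tabD(5)[OF T0_in l(1)] tabD(5)[OF T0_in l(2)] by blast+
  let ?\<pi> = "transpose x y"
  have \<pi>: "?\<pi> permutes {1..n}" by (rule permutes_swap_id[OF xy(1,2)])
  have "x \<in> tact ?\<pi> T0 ! 1" using tact_nth[OF T0_in, of 1 ?\<pi>] assms y
    by (metis Suc_1 Suc_le_lessD image_eqI transpose_apply_second)
  then have "tact ?\<pi> T0 \<noteq> T0" using xy(3) by metis
  then show ?thesis using mat_of_M_mats[OF T0_in tact_closed[OF \<pi> T0_in]] by (metis empty_iff)
qed

text \<open>The \<open>3\<close>-cycle through an entry of each of the first three rows moves an entry from the first row to
the second one, but none in the opposite direction.\<close>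

lemma nonsymmetric_mat: assumes "3 \<le> l" shows "M_mats lam - S_mats lam \<noteq> {}"
proof -
  have l: "0 < l" "1 < l" "2 < l" using assms by auto
  obtain x where x: "x \<in> T0 ! 0" using part_elt[OF l(1)] .
  obtain y where y: "y \<in> T0 ! 1" using part_elt[OF l(2)] .
  obtain z where z: "z \<in> T0 ! 2" using part_elt[OF l(3)] .
  have d: "T0 ! 0 \<inter> T0 ! 1 = {}" "T0 ! 0 \<inter> T0 ! 2 = {}" "T0 ! 1 \<inter> T0 ! 2 = {}"
    using tabD(3)[OF T0_in] l by auto
  have ne: "x \<noteq> y" "y \<noteq> z" "x \<noteq> z" using x y z d by blast+
  have c: "x \<in> {1..n}" "y \<in> {1..n}" "z \<in> {1..n}"
    using x y z tabD(5)[OF T0_in l(1)] tabD(5)[OF T0_in l(2)] tabD(5)[OF T0_in l(3)] by blast+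
  let ?\<pi> = "transpose x y \<circ> transpose y z"
  have \<pi>: "?\<pi> permutes {1..n}"
    by (rule permutes_compose[OF permutes_swap_id[OF c(2,3)] permutes_swap_id[OF c(1,2)]])
  have v: "?\<pi> x = y" "?\<pi> y = z" "?\<pi> w = w \<or> w \<in> {x, y, z}" for w
    using ne by (auto simp: transpose_def)
  let ?U = "tact ?\<pi> T0"
  have U: "?U \<in> Y" by (rule tact_closed[OF \<pi> T0_in])
  have Un: "?U ! i = ?\<pi> ` (T0 ! i)" if "i < l" for i by (rule tact_nth[OF T0_in that])
  have "y \<in> ?U ! 0" unfolding Un[OF l(1)] using v(1) x by (metis image_eqI)
  then have "y \<in> T0 ! 1 \<inter> ?U ! 0" using y by blast
  then have a: "card (T0 ! 1 \<inter> ?U ! 0) \<noteq> 0" using finite_part[OF T0_in l(2)] by auto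
  have "T0 ! 0 \<inter> ?U ! 1 = {}"
  proof (rule ccontr)
    assume "T0 ! 0 \<inter> ?U ! 1 \<noteq> {}"
    then obtain w where w: "w \<in> T0 ! 1" "?\<pi> w \<in> T0 ! 0" unfolding Un[OF l(2)] by blast
    have "w \<noteq> x" "w \<noteq> z" using w(1) x z d by blast+
    then have "?\<pi> w = w \<or> w = y" using v(3)[of w] by blast
    then show False using w v(2) z d by (metis disjoint_iff)
  qed
  then have b: "card (T0 ! 0 \<inter> ?U ! 1) = 0" by simp
  let ?M = "mat_of T0 ?U"
  have "?M $$ (1, 0) \<noteq> ?M $$ (0, 1)" using a b l by (simp add: mat_of_entry)
  moreover have "transpose_mat ?M $$ (1, 0) = ?M $$ (0, 1)" using l by (simp add: mat_of_dim)
  ultimately have ns: "?M \<noteq> transpose_mat ?M" by metis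
  then have "T0 \<noteq> ?U" using mat_of_transpose[of T0 T0] by metis
  from mat_of_M_mats[OF T0_in U this] have "?M \<in> M_mats lam - S_mats lam"
    using ns unfolding S_mats_def by (simp only: Diff_iff mem_Collect_eq simp_thms)
  then show ?thesis by blast
qed

text \<open>Each off-diagonal entry complements the first diagonal entry to the first part.\<close>

lemma two_parts_symmetric: assumes "l = 2" shows "M_mats lam - S_mats lam = {}"
proof -
  have "M = transpose_mat M" if M: "M \<in> M_mats lam" for M
  proof -
    have Mc: "M \<in> carrier_mat 2 2" and r: "(\<Sum>j<2. M $$ (0, j)) = lam ! 0" and c: "(\<Sum>i<2. M $$ (i, 0)) = lam ! 0"
      using M assms unfolding M_mats_def by auto
    have "M $$ (0, 1) = M $$ (1, 0)" using r c by (simp add: numeral_2_eq_2)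
    then have "M $$ (i, j) = M $$ (j, i)" if "i < 2" "j < 2" for i j using that by (auto simp: less_2_cases_iff)
    then show ?thesis using Mc by (intro eq_matI) auto
  qed
  then show ?thesis unfolding S_mats_def by blast
qed

end

section \<open>The subgroups attached to the matrices\<close>

lemma (in group) generate_involution:
  assumes e: "e \<in> carrier G" "e \<otimes> e = \<one>"
  shows "generate G {e} = {\<one>, e}"
proof
  have i: "inv e = e" using inv_equality[OF e(2) e(1) e(1)] .
  have "subgroup {\<one>, e} G"
    by (rule subgroupI) (use e i in auto)
  then show "generate G {e} \<subseteq> {\<one>, e}" by (rule generate_subgroup_incl[rotated]) simp
  show "{\<one>, e} \<subseteq> generate G {e}" using generate.one[of G "{e}"] generate.incl[of e "{e}" G] by simp
qed

lemma (in group) involution_product: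
  assumes B: "subgroup B G" and e: "e \<in> carrier G" "e \<otimes> e = \<one>" and norm: "\<And>b. b \<in> B \<Longrightarrow> e \<otimes> b \<otimes> e \<in> B"
  shows "B <#> generate G {e} = B \<union> (\<lambda>b. b \<otimes> e) ` B" "subgroup (B <#> generate G {e}) G"
proof -
  interpret B: subgroup B G by fact
  have bc: "b \<in> carrier G" if "b \<in> B" for b using that B.subset by blast
  show eq: "B <#> generate G {e} = B \<union> (\<lambda>b. b \<otimes> e) ` B"
    unfolding generate_involution[OF e] set_mult_def using bc by (auto intro: r_one[symmetric])
  have ie: "inv e = e" by (rule inv_equality[OF e(2) e(1) e(1)])
  let ?P = "B \<union> (\<lambda>b. b \<otimes> e) ` B"
  have eb: "e \<otimes> b = (e \<otimes> b \<otimes> e) \<otimes> e" if "b \<in> B" for b using bc[OF that] e by (simp add: m_assoc)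
  have "subgroup ?P G"
  proof (rule subgroupI)
    show "?P \<subseteq> carrier G" using bc e by auto
    show "?P \<noteq> {}" using B.one_closed by blast
  next
    fix x assume x: "x \<in> ?P"
    show "inv x \<in> ?P"
    proof (cases "x \<in> B")
      case True then show ?thesis by (simp add: B.m_inv_closed)
    next
      case False
      then obtain b where b: "b \<in> B" "x = b \<otimes> e" using x by blast
      have "inv x = (e \<otimes> inv b \<otimes> e) \<otimes> e"
        using eb[OF B.m_inv_closed[OF b(1)]] bc[OF b(1)] e by (simp add: b(2) inv_mult_group ie)
      then show ?thesis using norm[OF B.m_inv_closed[OF b(1)]] by blast
    qed
  next
    fix x y assume x: "x \<in> ?P" and y: "y \<in> ?P"
    consider "x \<in> B" "y \<in> B" | c where "x \<in> B" "c \<in> B" "y = c \<otimes> e" | b where "b \<in> B" "x = b \<otimes> e" "y \<in> B"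
      | b c where "b \<in> B" "x = b \<otimes> e" "c \<in> B" "y = c \<otimes> e" using x y by blast
    then show "x \<otimes> y \<in> ?P"
    proof cases
      case 1 then show ?thesis by (simp add: B.m_closed)
    next
      case 2
      have "x \<otimes> y = (x \<otimes> c) \<otimes> e" using 2 bc e by (simp add: m_assoc)
      then show ?thesis using B.m_closed[OF 2(1,2)] by blast
    next
      case 3
      have "x \<otimes> y = (b \<otimes> (e \<otimes> y \<otimes> e)) \<otimes> e" using 3 bc e by (simp add: m_assoc)
      then show ?thesis using B.m_closed[OF 3(1) norm[OF 3(3)]] by blast
    next
      case 4
      have "x \<otimes> y = b \<otimes> (e \<otimes> c \<otimes> e)" using 4 bc e by (simp add: m_assoc)
      then show ?thesis using B.m_closed[OF 4(1) norm[OF 4(3)]] by simp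
    qed
  qed
  then show "subgroup (B <#> generate G {e}) G" unfolding eq .
qed

lemma (in group) conj_involution_subgroup:
  assumes "subgroup B G" and e: "e \<in> carrier G" "e \<otimes> e = \<one>"
  shows "subgroup ((\<lambda>x. e \<otimes> x \<otimes> e) ` B) G"
  using conj_subgroup_subgroup[OF e(1) assms(1)] inv_equality[OF e(2) e(1) e(1)] by (simp add: conj_subgroup_def)

lemma sylow_index:
  assumes p: "Factorial_Ring.prime p" and Q: "sylow_subgroup p H Q" and fin: "order H \<noteq> 0"
  shows "order H = (order H div card Q) * card Q" "\<not> p dvd order H div card Q" "card Q \<noteq> 0"
proof -
  have c: "card Q = p ^ multiplicity p (order H)" using Q by (simp add: sylow_subgroup_def)
  show "order H = (order H div card Q) * card Q" unfolding c by (simp add: multiplicity_dvd)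
  show "\<not> p dvd order H div card Q" unfolding c
    using p fin by (intro multiplicity_decompose) auto
  show "card Q \<noteq> 0" unfolding c using p by (simp add: prime_gt_0_nat)
qed

lemma symmetric_subgroup:
  assumes "S \<subseteq> {1..n}" shows "subgroup {\<pi>. \<pi> permutes S} (sym_group n)"
proof -
  interpret Sn: group "sym_group n" by (rule sym_group_is_group)
  show ?thesis
  proof (rule Sn.subgroupI)
    show "{\<pi>. \<pi> permutes S} \<subseteq> carrier (sym_group n)"
      using permutes_subset[OF _ assms] by (auto simp: sym_group_def)
    show "{\<pi>. \<pi> permutes S} \<noteq> {}" using permutes_id by blast
    fix q r assume q: "q \<in> {\<pi>. \<pi> permutes S}"
    then have "inv\<^bsub>sym_group n\<^esub> q = inv' q"
      by (intro sym_group_inv_equality) (use permutes_subset[OF _ assms] in \<open>simp add: sym_group_carrier\<close>)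
    then show "inv\<^bsub>sym_group n\<^esub> q \<in> {\<pi>. \<pi> permutes S}" using q by (simp add: permutes_inv)
    assume "r \<in> {\<pi>. \<pi> permutes S}"
    then show "q \<otimes>\<^bsub>sym_group n\<^esub> r \<in> {\<pi>. \<pi> permutes S}" using q by (simp add: sym_group_mult permutes_compose)
  qed
qed

context block_family begin

definition sylow_family :: "nat \<Rightarrow> ('k \<Rightarrow> (nat \<Rightarrow> nat) set) \<Rightarrow> bool" where
  "sylow_family p H \<longleftrightarrow> (\<forall>k\<in>K. H k \<subseteq> {\<pi>. \<pi> permutes A k} \<and> subgroup (H k) Sn
     \<and> card (H k) = p ^ multiplicity p (card {\<pi>. \<pi> permutes A k}))"

text \<open>The index is the product of the indices of the Sylow subgroups in the factors.\<close>

lemma sylow_blocks: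
  assumes p: "Factorial_Ring.prime p" and H: "sylow_family p H"
  shows "generate Sn (\<Union>k\<in>K. H k) = blocks H" "subgroup (blocks H) Sn" "\<exists>m. card (blocks H) = p ^ m"
    "\<exists>c. card preserving = c * card (blocks H) \<and> \<not> p dvd c" "blocks H \<subseteq> preserving"
proof -
  have H: "\<And>k. k \<in> K \<Longrightarrow> H k \<subseteq> {\<pi>. \<pi> permutes A k}" "\<And>k. k \<in> K \<Longrightarrow> subgroup (H k) Sn"
    "\<And>k. k \<in> K \<Longrightarrow> card (H k) = p ^ multiplicity p (card {\<pi>. \<pi> permutes A k})"
    using H unfolding sylow_family_def by blast+
  show "generate Sn (\<Union>k\<in>K. H k) = blocks H" by (rule generate_blocks[OF H(1,2)])
  show "subgroup (blocks H) Sn" by (rule blocks_subgroup[OF H(1,2)])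
  let ?f = "\<lambda>k. card {\<pi>. \<pi> permutes A k}"
  have cb: "card (blocks H) = (\<Prod>k\<in>K. p ^ multiplicity p (?f k))"
    using card_blocks[of H] H by simp
  then show "\<exists>m. card (blocks H) = p ^ m" by (simp add: power_sum[symmetric]) blast
  have f0: "?f k \<noteq> 0" if "k \<in> K" for k
    using card_permutations[OF refl finite_subset[OF A_sub[OF that]]] by simp
  define c where "c k = ?f k div p ^ multiplicity p (?f k)" for k
  have "card preserving = (\<Prod>k\<in>K. ?f k)" unfolding preserving_blocks by (rule card_blocks) simp
  also have "\<dots> = (\<Prod>k\<in>K. c k * p ^ multiplicity p (?f k))"
    unfolding c_def by (intro prod.cong refl) (simp add: multiplicity_dvd)
  also have "\<dots> = (\<Prod>k\<in>K. c k) * card (blocks H)" by (simp add: cb prod.distrib)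
  finally have "card preserving = (\<Prod>k\<in>K. c k) * card (blocks H)" .
  moreover have "\<not> p dvd c k" if "k \<in> K" for k
    unfolding c_def using p f0[OF that] by (intro multiplicity_decompose) auto
  then have "\<not> p dvd (\<Prod>k\<in>K. c k)" using prime_dvd_prod_iff[OF finite_K p] by blast
  ultimately show "\<exists>c. card preserving = c * card (blocks H) \<and> \<not> p dvd c" by blast
  show "blocks H \<subseteq> preserving" unfolding blocks_def preserving_def by blast
qed

end

locale young_choices = tabloid_pairs n lam
  for n :: nat and lam :: "nat list" +
  fixes p :: nat and Nl :: "nat mat set" and PD :: "(nat \<Rightarrow> nat) set" and PS :: "nat set \<Rightarrow> (nat \<Rightarrow> nat) set"
    and s :: "nat mat \<Rightarrow> nat \<Rightarrow> nat \<Rightarrow> nat set" and e :: "nat mat \<Rightarrow> nat \<Rightarrow> nat"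
  assumes p: "Factorial_Ring.prime p" and Nl: "N_choice lam Nl"
    and choices: "admissible_choices p n lam PD PS s e"
begin

abbreviation "Sn \<equiv> sym_group n"
abbreviation "PM \<equiv> P_of p n lam PD PS s e"
abbreviation "RR \<equiv> R_mats lam Nl"
abbreviation "XX \<equiv> X_mats p lam Nl"

lemma PS: 
  assumes "S \<subseteq> {1..n}"
  shows "PS S \<subseteq> {\<pi>. \<pi> permutes S}" "subgroup (PS S) Sn"
    "card (PS S) = p ^ multiplicity p (card {\<pi>. \<pi> permutes S})"
proof -
  interpret Sn: group Sn by (rule sym_group_is_group)
  have sy: "sylow_subgroup p (sym_on n S) (PS S)"
    using choices[unfolded admissible_choices_def, THEN conjunct2, THEN conjunct1] assms by blast
  then have sub: "subgroup (PS S) (Sn\<lparr>carrier := {\<pi>. \<pi> permutes S}\<rparr>)" by (simp add: sylow_subgroup_def sym_on_def)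
  show "PS S \<subseteq> {\<pi>. \<pi> permutes S}" using subgroup.subset[OF sub] by simp
  show "subgroup (PS S) Sn" by (rule Sn.incl_subgroup[OF symmetric_subgroup[OF assms] sub])
  show "card (PS S) = p ^ multiplicity p (card {\<pi>. \<pi> permutes S})"
    using sy by (simp add: sylow_subgroup_def sym_on_def order_def)
qed

lemma s:
  assumes "M \<in> M_mats lam"
  shows "\<And>i j. i < l \<Longrightarrow> j < l \<Longrightarrow> s M i j \<subseteq> {1..n}" "\<And>i j. i < l \<Longrightarrow> j < l \<Longrightarrow> card (s M i j) = M $$ (i, j)"
    "\<And>i j i' j'. i < l \<Longrightarrow> j < l \<Longrightarrow> i' < l \<Longrightarrow> j' < l \<Longrightarrow> (i, j) \<noteq> (i', j') \<Longrightarrow> s M i j \<inter> s M i' j' = {}"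
proof -
  note ch = bspec[OF choices[unfolded admissible_choices_def, THEN conjunct2, THEN conjunct2, THEN conjunct1] assms]
  show "\<And>i j. i < l \<Longrightarrow> j < l \<Longrightarrow> s M i j \<subseteq> {1..n}" "\<And>i j. i < l \<Longrightarrow> j < l \<Longrightarrow> card (s M i j) = M $$ (i, j)"
    using conjunct1[OF ch] by blast+
  show "\<And>i j i' j'. i < l \<Longrightarrow> j < l \<Longrightarrow> i' < l \<Longrightarrow> j' < l \<Longrightarrow> (i, j) \<noteq> (i', j') \<Longrightarrow> s M i j \<inter> s M i' j' = {}"
    using conjunct2[OF ch] by blast
qed

lemma e:
  assumes "p = 2" "M \<in> S_mats lam"
  shows "e M permutes {1..n}" "e M \<circ> e M = id" "{x. e M x \<noteq> x} = {1..n} - (\<Union>k<l. s M k k)"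
    "\<And>i j. i < l \<Longrightarrow> j < l \<Longrightarrow> e M ` s M i j = s M j i"
proof -
  note ch = bspec[OF mp[OF choices[unfolded admissible_choices_def, THEN conjunct2, THEN conjunct2, THEN conjunct2] assms(1)] assms(2)]
  show "e M permutes {1..n}" by (rule conjunct1[OF ch])
  show "e M \<circ> e M = id" by (rule ch[THEN conjunct2, THEN conjunct1])
  show "{x. e M x \<noteq> x} = {1..n} - (\<Union>k<l. s M k k)" by (rule ch[THEN conjunct2, THEN conjunct2, THEN conjunct1])
  show "\<And>i j. i < l \<Longrightarrow> j < l \<Longrightarrow> e M ` s M i j = s M j i"
    using ch[THEN conjunct2, THEN conjunct2, THEN conjunct2] by blast
qed

definition TT :: "nat mat \<Rightarrow> nat set list" where "TT M = map (\<lambda>i. \<Union>j<l. s M i j) [0..<l]"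
definition UU :: "nat mat \<Rightarrow> nat set list" where "UU M = map (\<lambda>j. \<Union>i<l. s M i j) [0..<l]"

lemma TU:
  assumes M: "M \<in> M_mats lam"
  shows "TT M \<in> Y" "UU M \<in> Y" "\<And>i j. i < l \<Longrightarrow> j < l \<Longrightarrow> TT M ! i \<inter> UU M ! j = s M i j"
    "mat_of (TT M) (UU M) = M" "TT M \<noteq> UU M" "block_family n K (\<lambda>(i, j). s M i j)"
  unfolding TT_def UU_def
  by (rule realise_mat(1)[OF M s[OF M]], assumption+) (rule realise_mat(2)[OF M s[OF M]], assumption+,
    rule realise_mat(3)[OF M s[OF M]], assumption+, rule realise_mat(4)[OF M s[OF M]], assumption+,
    rule realise_mat(5)[OF M s[OF M]], assumption+, rule realise_mat(6)[OF M s[OF M]], assumption+)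

definition zz :: "nat mat \<Rightarrow> nat set list \<times> nat set list" where
  "zz M = (if M = D_mat lam then (T0, T0) else (TT M, UU M))"

text \<open>The stabilisers of a pair of tabloids as an unordered and as an ordered pair.\<close>

definition Stab :: "nat set list \<times> nat set list \<Rightarrow> (nat \<Rightarrow> nat) set" where
  "Stab z = {\<pi>. \<pi> permutes {1..n} \<and> (map_prod (tact \<pi>) (tact \<pi>) z = z \<or> map_prod (tact \<pi>) (tact \<pi>) z = prod.swap z)}"

definition Fix :: "nat set list \<times> nat set list \<Rightarrow> (nat \<Rightarrow> nat) set" where
  "Fix z = {\<pi>. \<pi> permutes {1..n} \<and> map_prod (tact \<pi>) (tact \<pi>) z = z}"

lemma Fix_preserving:
  assumes M: "M \<in> M_mats lam"
  shows "Fix (TT M, UU M) = block_family.preserving n K (\<lambda>(i, j). s M i j)"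
proof -
  interpret B: block_family n K "\<lambda>(i, j). s M i j" by (rule TU(6)[OF M])
  note T = TU(1)[OF M] and U = TU(2)[OF M] and cell = TU(3)[OF M]
  show ?thesis
  proof (intro equalityI subsetI)
    fix \<pi> assume "\<pi> \<in> Fix (TT M, UU M)"
    then have \<pi>: "\<pi> permutes {1..n}" "tact \<pi> (TT M) = TT M" "tact \<pi> (UU M) = UU M" by (auto simp: Fix_def)
    have "\<pi> ` s M i j = s M i j" if ij: "i < l" "j < l" for i j
    proof -
      have "\<pi> ` s M i j = \<pi> ` (TT M ! i) \<inter> \<pi> ` (UU M ! j)"
        unfolding cell[OF ij, symmetric] by (rule image_Int[OF permutes_inj[OF \<pi>(1)]])
      also have "\<dots> = TT M ! i \<inter> UU M ! j"
        unfolding tact_nth[OF T ij(1), symmetric] tact_nth[OF U ij(2), symmetric] \<pi>(2,3) ..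
      finally show ?thesis unfolding cell[OF ij] .
    qed
    then show "\<pi> \<in> B.preserving" unfolding B.preserving_def using \<pi>(1) by auto
  next
    fix \<pi> assume "\<pi> \<in> B.preserving"
    then have \<pi>: "\<pi> permutes {1..n}" and k: "\<forall>k\<in>K. \<pi> ` (case k of (i, j) \<Rightarrow> s M i j) = (case k of (i, j) \<Rightarrow> s M i j)"
      unfolding B.preserving_def by auto
    have "\<pi> ` (TT M ! i \<inter> UU M ! j) = TT M ! i \<inter> UU M ! j" if ij: "i < l" "j < l" for i j
      using bspec[OF k, of "(i, j)"] ij unfolding cell[OF ij] by simp
    from tact_pair[OF T U T U this \<pi>] show "\<pi> \<in> Fix (TT M, UU M)" using \<pi> by (simp add: Fix_def)
  qed
qed

lemma finite_perms: "finite {\<pi>. \<pi> permutes {1..n}}"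
  by (rule finite_permutations) simp

lemma tact_comp: "tact (\<pi> \<circ> \<sigma>) T = tact \<pi> (tact \<sigma> T)"
  by (simp add: image_comp)

text \<open>If the matrix of a pair is symmetric, then some permutation interchanges the members of the
  pair, so that the stabilizer of the unordered pair is twice as large as that of the ordered one.\<close>

lemma Stab_cases:
  assumes T: "T \<in> Y" and U: "U \<in> Y" and ne: "T \<noteq> U"
  shows "mat_of T U \<noteq> transpose_mat (mat_of T U) \<Longrightarrow> Stab (T, U) = Fix (T, U)"
    "mat_of T U = transpose_mat (mat_of T U) \<Longrightarrow> card (Stab (T, U)) = 2 * card (Fix (T, U))"
proof -
  show "Stab (T, U) = Fix (T, U)" if ns: "mat_of T U \<noteq> transpose_mat (mat_of T U)"
  proof -
    have "\<not> (tact \<pi> T = U \<and> tact \<pi> U = T)" if "\<pi> permutes {1..n}" for \<pi>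
    proof
      assume "tact \<pi> T = U \<and> tact \<pi> U = T"
      then have "mat_of U T = mat_of T U" using mat_of_tact[OF that T U] by simp
      then show False using ns mat_of_transpose[of U T] by simp
    qed
    then show ?thesis unfolding Stab_def Fix_def by auto
  qed
  assume "mat_of T U = transpose_mat (mat_of T U)"
  then have "mat_of T U = mat_of U T" unfolding mat_of_transpose[of U T] .
  from same_mat_same_orbit[OF T U U T this]
  obtain \<epsilon> where \<epsilon>: "\<epsilon> permutes {1..n}" "tact \<epsilon> T = U" "tact \<epsilon> U = T" by blast
  have \<epsilon>i: "inv' \<epsilon> permutes {1..n}" by (rule permutes_inv[OF \<epsilon>(1)])
  have ii: "\<epsilon> \<circ> inv' \<epsilon> = id" "inv' \<epsilon> \<circ> \<epsilon> = id" using permutes_inv_o[OF \<epsilon>(1)] by auto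
  have i: "tact (inv' \<epsilon>) U = T" "tact (inv' \<epsilon>) T = U"
  proof -
    have "tact (inv' \<epsilon>) (tact \<epsilon> T') = T'" for T' unfolding tact_comp[symmetric] ii(2) by simp
    then show "tact (inv' \<epsilon>) U = T" "tact (inv' \<epsilon>) T = U" using \<epsilon>(2,3) by metis+
  qed
  let ?c = "\<lambda>h. h \<circ> \<epsilon>"
  have "Stab (T, U) = Fix (T, U) \<union> ?c ` Fix (T, U)"
  proof
    show "Fix (T, U) \<union> ?c ` Fix (T, U) \<subseteq> Stab (T, U)"
    proof
      fix \<pi> assume "\<pi> \<in> Fix (T, U) \<union> ?c ` Fix (T, U)"
      then show "\<pi> \<in> Stab (T, U)"
      proof
        assume "\<pi> \<in> ?c ` Fix (T, U)"
        then obtain h where h: "h permutes {1..n}" "tact h T = T" "tact h U = U" "\<pi> = h \<circ> \<epsilon>" unfolding Fix_def by auto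
        have "tact \<pi> T = U" "tact \<pi> U = T" unfolding h(4) tact_comp \<epsilon>(2,3) h(2,3) by simp_all
        then show ?thesis unfolding Stab_def using permutes_compose[OF \<epsilon>(1) h(1)] h(4) by simp
      qed (auto simp: Fix_def Stab_def)
    qed
    show "Stab (T, U) \<subseteq> Fix (T, U) \<union> ?c ` Fix (T, U)"
    proof
      fix \<pi> assume "\<pi> \<in> Stab (T, U)"
      then have \<pi>: "\<pi> permutes {1..n}" and "(tact \<pi> T = T \<and> tact \<pi> U = U) \<or> (tact \<pi> T = U \<and> tact \<pi> U = T)"
        unfolding Stab_def by auto
      then consider "tact \<pi> T = T" "tact \<pi> U = U" | "tact \<pi> T = U" "tact \<pi> U = T" by blast
      then show "\<pi> \<in> Fix (T, U) \<union> ?c ` Fix (T, U)"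
      proof cases
        case 1 then show ?thesis using \<pi> by (simp add: Fix_def)
      next
        case 2
        have "tact (\<pi> \<circ> inv' \<epsilon>) T = T" "tact (\<pi> \<circ> inv' \<epsilon>) U = U" unfolding tact_comp i 2 by simp_all
        then have "\<pi> \<circ> inv' \<epsilon> \<in> Fix (T, U)" unfolding Fix_def using permutes_compose[OF \<epsilon>i \<pi>] by simp
        moreover have "\<pi> = ?c (\<pi> \<circ> inv' \<epsilon>)" unfolding comp_assoc ii(2) by simp
        ultimately show ?thesis by blast
      qed
    qed
  qed
  moreover have "Fix (T, U) \<inter> ?c ` Fix (T, U) = {}"
  proof -
    have "h \<circ> \<epsilon> \<notin> Fix (T, U)" if h: "h \<in> Fix (T, U)" for h
    proof
      assume "h \<circ> \<epsilon> \<in> Fix (T, U)"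
      then have "tact (h \<circ> \<epsilon>) T = T" by (simp add: Fix_def)
      moreover have "tact (h \<circ> \<epsilon>) T = U" unfolding tact_comp \<epsilon>(2) using h by (simp add: Fix_def)
      ultimately show False using ne by simp
    qed
    then show ?thesis by blast
  qed
  moreover have "finite (Fix (T, U))" using finite_perms by (rule finite_subset[rotated]) (auto simp: Fix_def)
  moreover have "card (?c ` Fix (T, U)) = card (Fix (T, U))"
  proof (rule card_image)
    show "inj_on ?c (Fix (T, U))"
    proof (rule inj_onI)
      fix g h assume "g \<circ> \<epsilon> = h \<circ> \<epsilon>"
      then have "(g \<circ> \<epsilon>) \<circ> inv' \<epsilon> = (h \<circ> \<epsilon>) \<circ> inv' \<epsilon>" by simp
      then show "g = h" unfolding comp_assoc ii(1) by simp
    qed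
  qed
  ultimately show "card (Stab (T, U)) = 2 * card (Fix (T, U))" by (simp add: card_Un_disjoint)
qed

end

context young_choices begin

lemma D_not_M_mats: "D_mat lam \<notin> M_mats lam"
  using mat_of_diag[OF T0_in T0_in] mat_of_self[OF T0_in] unfolding M_mats_def by simp

lemma M_not_D: "M \<in> M_mats lam \<Longrightarrow> M \<noteq> D_mat lam"
  using D_not_M_mats by blast

lemma Fix_Stab: "Fix z \<subseteq> Stab z"
  unfolding Fix_def Stab_def by blast

lemma PM_product:
  assumes M: "M \<in> M_mats lam" and odd: "p > 2 \<or> M \<noteq> transpose_mat M"
  shows "subgroup (PM M) Sn" "\<exists>m. card (PM M) = p ^ m" "PM M \<subseteq> Fix (TT M, UU M)"
    "\<exists>c. card (Fix (TT M, UU M)) = c * card (PM M) \<and> \<not> p dvd c"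
proof -
  interpret B: block_family n K "\<lambda>(i, j). s M i j" by (rule TU(6)[OF M])
  define H where "H = (\<lambda>(i, j). PS (s M i j))"
  have fam: "B.sylow_family p H"
    unfolding B.sylow_family_def H_def using PS[OF s(1)[OF M]] by auto
  note HB = B.sylow_blocks[OF p fam]
  have "PM M = generate Sn (\<Union>i<l. \<Union>j<l. PS (s M i j))"
    unfolding P_of_def Let_def using M_not_D[OF M] odd by simp
  also have "(\<Union>i<l. \<Union>j<l. PS (s M i j)) = (\<Union>k\<in>K. H k)" unfolding H_def by blast
  also have "generate Sn (\<Union>k\<in>K. H k) = B.blocks H" by (rule HB(1))
  finally have eq: "PM M = B.blocks H" .
  show "subgroup (PM M) Sn" "\<exists>m. card (PM M) = p ^ m" "PM M \<subseteq> Fix (TT M, UU M)"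
    "\<exists>c. card (Fix (TT M, UU M)) = c * card (PM M) \<and> \<not> p dvd c"
    unfolding eq Fix_preserving[OF M] by (rule HB)+
qed

lemma permutes_conj_involution:
  assumes q: "q permutes S" and e: "f permutes {1..n}" "f \<circ> f = id" and S: "S \<subseteq> {1..n}"
  shows "f \<circ> q \<circ> f permutes f ` S"
proof (rule permutes_superset)
  show "f \<circ> q \<circ> f permutes {1..n}"
    using e(1) permutes_subset[OF q S] by (intro permutes_compose)
  have ff: "f (f x) = x" for x using fun_cong[OF e(2), of x] by simp
  fix x assume x: "x \<in> {1..n} - f ` S"
  have "f x \<notin> S"
  proof
    assume "f x \<in> S"
    then have "f (f x) \<in> f ` S" by blast
    then show False using x ff by simp
  qed
  then show "(f \<circ> q \<circ> f) x = x" using permutes_not_in[OF q] ff by simp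
qed

text \<open>The involution \<open>e M\<close> interchanges the two tabloids. Adjoining it doubles the order of a Sylow subgroup of
the stabiliser of the ordered pair, just as the stabiliser of the unordered pair is twice as large.\<close>

lemma PM_semidirect:
  assumes p2: "p = 2" and M: "M \<in> S_mats lam"
  shows "subgroup (PM M) Sn" "\<exists>m. card (PM M) = p ^ m" "PM M \<subseteq> Stab (TT M, UU M)"
    "\<exists>c. 2 * card (Fix (TT M, UU M)) = c * card (PM M) \<and> \<not> p dvd c"
proof -
  interpret Sn: group Sn by (rule sym_group_is_group)
  have MM: "M \<in> M_mats lam" and sym: "M = transpose_mat M" using M by (simp_all add: S_mats_def)
  interpret B: block_family n K "\<lambda>(i, j). s M i j" by (rule TU(6)[OF MM])
  define f where "f = e M"
  note e' = e[OF p2 M, folded f_def]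
  have ff: "f (f x) = x" for x using fun_cong[OF e'(2), of x] by simp
  have fc: "f \<in> carrier Sn" using e'(1) by (simp add: sym_group_carrier)
  have f2: "f \<otimes>\<^bsub>Sn\<^esub> f = \<one>\<^bsub>Sn\<^esub>" using e'(2) by (simp add: sym_group_mult sym_group_one)
  have conj: "(\<lambda>x. f \<circ> x \<circ> f) = (\<lambda>x. f \<otimes>\<^bsub>Sn\<^esub> x \<otimes>\<^bsub>Sn\<^esub> f)" by (simp add: sym_group_mult)
  have cc: "f \<circ> (f \<circ> x \<circ> f) \<circ> f = x" for x :: "nat \<Rightarrow> nat" using ff by (auto simp: fun_eq_iff)
  have fix_diag: "f x = x" if "x \<in> s M i i" "i < l" for x i
    using e'(3) that by blast
  define H where "H = (\<lambda>(i, j). if i \<le> j then PS (s M i j) else (\<lambda>x. f \<circ> x \<circ> f) ` PS (s M j i))"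
  have fam: "B.sylow_family p H"
    unfolding B.sylow_family_def
  proof
    fix k assume k: "k \<in> K"
    obtain i j where ij: "k = (i, j)" "i < l" "j < l" using k by auto
    show "H k \<subseteq> {\<pi>. \<pi> permutes (case k of (i, j) \<Rightarrow> s M i j)} \<and> subgroup (H k) Sn
      \<and> card (H k) = p ^ multiplicity p (card {\<pi>. \<pi> permutes (case k of (i, j) \<Rightarrow> s M i j)})"
    proof (cases "i \<le> j")
      case True
      then show ?thesis using PS[OF s(1)[OF MM ij(2,3)]] unfolding H_def ij(1) prod.case by simp
    next
      case False
      then have Hk: "H k = (\<lambda>x. f \<circ> x \<circ> f) ` PS (s M j i)" by (simp add: H_def ij(1))
      note P = PS[OF s(1)[OF MM ij(3,2)]] and im = e'(4)[OF ij(3,2)]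
      have "H k \<subseteq> {\<pi>. \<pi> permutes s M i j}"
      proof
        fix y assume "y \<in> H k"
        then obtain x where x: "x \<in> PS (s M j i)" "y = f \<circ> x \<circ> f" unfolding Hk by blast
        then have "x permutes s M j i" using P(1) by blast
        from permutes_conj_involution[OF this e'(1,2) s(1)[OF MM ij(3,2)]]
        show "y \<in> {\<pi>. \<pi> permutes s M i j}" unfolding im x(2) by simp
      qed
      moreover have "subgroup (H k) Sn" unfolding Hk conj
        by (rule Sn.conj_involution_subgroup[OF P(2) fc f2])
      moreover have "card (H k) = card (PS (s M j i))" unfolding Hk
      proof (rule card_image, rule inj_onI)
        fix x y assume "f \<circ> x \<circ> f = f \<circ> y \<circ> f"
        then have "f \<circ> (f \<circ> x \<circ> f) \<circ> f = f \<circ> (f \<circ> y \<circ> f) \<circ> f" by simp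
        then show "x = y" unfolding cc .
      qed
      moreover have "card {\<pi>. \<pi> permutes s M j i} = card {\<pi>. \<pi> permutes s M i j}"
      proof -
        have fin: "finite (s M j i)" "finite (s M i j)" using s(1)[OF MM ij(3,2)] s(1)[OF MM ij(2,3)] finite_subset by blast+
        have "card (s M i j) = card (s M j i)"
          unfolding im[symmetric] by (rule card_image[OF inj_on_subset[OF permutes_inj[OF e'(1)] subset_UNIV]])
        then show ?thesis using card_permutations[OF refl fin(1)] card_permutations[OF refl fin(2)] by simp
      qed
      ultimately show ?thesis using P(3) unfolding ij(1) prod.case by simp
    qed
  qed
  note HB = B.sylow_blocks[OF p fam]
  let ?B = "B.blocks H"
  have un: "(\<Union>k<l. PS (s M k k)) \<union> (\<Union>j<l. \<Union>i<j. PS (s M i j) \<union> (\<lambda>x. f \<circ> x \<circ> f) ` PS (s M i j)) = (\<Union>k\<in>K. H k)"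
    (is "?L = ?R")
  proof
    have sub: "H (i, j) \<subseteq> ?R" if "i < l" "j < l" for i j using that by blast
    have low: "PS (s M i j) \<subseteq> ?R" if "i \<le> j" "j < l" for i j
      using sub[of i j] that by (simp add: H_def)
    have up: "(\<lambda>x. f \<circ> x \<circ> f) ` PS (s M i j) \<subseteq> ?R" if "i < j" "j < l" for i j
      using sub[of j i] that by (simp add: H_def)
    show "?L \<subseteq> ?R"
      by (intro Un_least UN_least; (rule low up; simp)?)
    show "?R \<subseteq> ?L"
    proof
      fix x assume "x \<in> ?R"
      then obtain i j where ij: "i < l" "j < l" "x \<in> H (i, j)" by auto
      consider "i = j" | "i < j" | "j < i" by linarith
      then show "x \<in> ?L"
      proof cases
        case 1 then show ?thesis using ij by (auto simp: H_def)
      next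
        case 2
        then have "x \<in> PS (s M i j)" using ij(3) by (simp add: H_def)
        then show ?thesis using ij 2 by blast
      next
        case 3
        then have "x \<in> (\<lambda>x. f \<circ> x \<circ> f) ` PS (s M j i)" using ij(3) by (simp add: H_def)
        then show ?thesis using ij 3 by blast
      qed
    qed
  qed
  have "PM M = generate Sn ((\<Union>k<l. PS (s M k k)) \<union> (\<Union>j<l. \<Union>i<j. PS (s M i j) \<union> (\<lambda>x. f \<circ> x \<circ> f) ` PS (s M i j)))
      <#>\<^bsub>Sn\<^esub> generate Sn {f}"
    unfolding P_of_def Let_def f_def using M_not_D[OF MM] sym p2 by simp
  also have "\<dots> = ?B <#>\<^bsub>Sn\<^esub> generate Sn {f}" unfolding un HB(1) ..
  finally have PMeq: "PM M = ?B <#>\<^bsub>Sn\<^esub> generate Sn {f}" .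
  have Bsub: "subgroup ?B Sn" by (rule HB(2))
  have norm: "f \<otimes>\<^bsub>Sn\<^esub> b \<otimes>\<^bsub>Sn\<^esub> f \<in> ?B" if b: "b \<in> ?B" for b
  proof -
    have bk: "b ` s M i j = s M i j" "part b (s M i j) \<in> H (i, j)" if "i < l" "j < l" for i j
      using b that unfolding B.blocks_def by auto
    have bp: "b permutes {1..n}" using b unfolding B.blocks_def by blast
    let ?q = "f \<circ> b \<circ> f"
    have "?q ` s M i j = s M i j \<and> part ?q (s M i j) \<in> H (i, j)" if ij: "i < l" "j < l" for i j
    proof
      show "?q ` s M i j = s M i j"
        unfolding image_comp[symmetric] e'(4)[OF ij] bk(1)[OF ij(2,1)] by (rule e'(4)[OF ij(2,1)])
      have mem: "f x \<in> s M j i \<longleftrightarrow> x \<in> s M i j" for x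
        using e'(4)[OF ij] e'(4)[OF ij(2,1)] ff by (metis imageI)
      have pq: "part ?q (s M i j) = f \<circ> part b (s M j i) \<circ> f"
        unfolding part_def using mem ff by (auto simp: fun_eq_iff)
      consider "i = j" | "i < j" | "j < i" by linarith
      then show "part ?q (s M i j) \<in> H (i, j)"
      proof cases
        case 1
        let ?y = "part b (s M i i)"
        have y: "?y \<in> PS (s M i i)" using bk(2)[OF ij(1) ij(1)] by (simp add: H_def)
        then have yp: "?y permutes s M i i" using PS(1)[OF s(1)[OF MM ij(1) ij(1)]] by blast
        have "(f \<circ> ?y \<circ> f) x = ?y x" for x
        proof (cases "x \<in> s M i i")
          case True
          then show ?thesis using fix_diag[OF _ ij(1)] permutes_in_image[OF yp, of x] by simp
        next
          case False
          then have "f x \<notin> s M i i" using mem 1 by simp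
          then show ?thesis using False permutes_not_in[OF yp] ff by simp
        qed
        then have "f \<circ> ?y \<circ> f = ?y" by blast
        then show ?thesis using pq y 1 by (simp add: H_def)
      next
        case 2
        then obtain x where "x \<in> PS (s M i j)" "part b (s M j i) = f \<circ> x \<circ> f"
          using bk(2)[OF ij(2,1)] by (auto simp: H_def)
        then show ?thesis using pq cc 2 by (simp add: H_def)
      next
        case 3
        then show ?thesis using bk(2)[OF ij(2,1)] pq by (auto simp: H_def)
      qed
    qed
    moreover have "?q permutes {1..n}" using e'(1) bp by (intro permutes_compose)
    ultimately have "?q \<in> ?B" unfolding B.blocks_def by auto
    then show ?thesis by (simp add: sym_group_mult)
  qed
  note prod = Sn.involution_product[OF Bsub fc f2 norm]
  show "subgroup (PM M) Sn" unfolding PMeq by (rule prod(2))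
  have PM_un: "PM M = ?B \<union> (\<lambda>b. b \<circ> f) ` ?B" using prod(1) unfolding PMeq by (simp add: sym_group_mult)
  note T = TU(1)[OF MM] and U = TU(2)[OF MM] and cell = TU(3)[OF MM]
  have "f ` (TT M ! i \<inter> UU M ! j) = UU M ! i \<inter> TT M ! j" if ij: "i < l" "j < l" for i j
    unfolding cell[OF ij] e'(4)[OF ij] cell[OF ij(2,1), symmetric] by (rule Int_commute)
  then have fsw: "tact f (TT M) = UU M" "tact f (UU M) = TT M"
    using tact_pair[OF T U U T _ e'(1)] by blast+
  have BF: "?B \<subseteq> Fix (TT M, UU M)" unfolding Fix_preserving[OF MM] by (rule HB(5))
  have bf: "tact (b \<circ> f) (TT M) = UU M" "tact (b \<circ> f) (UU M) = TT M" "b \<circ> f permutes {1..n}" if "b \<in> ?B" for b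
  proof -
    have b: "b permutes {1..n}" "tact b (TT M) = TT M" "tact b (UU M) = UU M" using that BF by (auto simp: Fix_def)
    show "tact (b \<circ> f) (TT M) = UU M" "tact (b \<circ> f) (UU M) = TT M" unfolding tact_comp fsw b(2,3) by simp_all
    show "b \<circ> f permutes {1..n}" by (rule permutes_compose[OF e'(1) b(1)])
  qed
  show "PM M \<subseteq> Stab (TT M, UU M)"
  proof
    fix x assume "x \<in> PM M"
    then show "x \<in> Stab (TT M, UU M)" unfolding PM_un
    proof
      assume "x \<in> (\<lambda>b. b \<circ> f) ` ?B"
      then obtain b where "b \<in> ?B" "x = b \<circ> f" by blast
      then show ?thesis using bf[of b] unfolding Stab_def by simp
    qed (use BF Fix_Stab in blast)
  qed
  have disj: "?B \<inter> (\<lambda>b. b \<circ> f) ` ?B = {}"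
  proof -
    have "b \<circ> f \<notin> ?B" if "b \<in> ?B" for b
    proof
      assume "b \<circ> f \<in> ?B"
      then have "tact (b \<circ> f) (TT M) = TT M" using BF by (auto simp: Fix_def)
      then show False using bf(1)[OF that] TU(5)[OF MM] by simp
    qed
    then show ?thesis by blast
  qed
  have "finite (Fix (TT M, UU M))" using finite_perms by (rule finite_subset[rotated]) (auto simp: Fix_def)
  then have finB: "finite ?B" using BF finite_subset by blast
  have "card ((\<lambda>b. b \<circ> f) ` ?B) = card ?B"
  proof (rule card_image, rule inj_onI)
    fix x y assume "x \<circ> f = y \<circ> f"
    then have "x \<circ> f \<circ> f = y \<circ> f \<circ> f" by simp
    then show "x = y" unfolding comp_assoc e'(2) by simp
  qed
  then have cP: "card (PM M) = 2 * card ?B" unfolding PM_un using finB disj by (simp add: card_Un_disjoint)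
  obtain m where "card ?B = p ^ m" using HB(3) by blast
  then have "card (PM M) = p ^ Suc m" using cP p2 by simp
  then show "\<exists>m. card (PM M) = p ^ m" by blast
  obtain c where "card (Fix (TT M, UU M)) = c * card ?B" "\<not> p dvd c"
    using HB(4) unfolding Fix_preserving[OF MM] by blast
  then show "\<exists>c. 2 * card (Fix (TT M, UU M)) = c * card (PM M) \<and> \<not> p dvd c" using cP by auto
qed

lemma PM_young:
  shows "subgroup (PM (D_mat lam)) Sn" "\<exists>m. card (PM (D_mat lam)) = p ^ m" "PM (D_mat lam) \<subseteq> Stab (T0, T0)"
    "\<exists>c. card (Stab (T0, T0)) = c * card (PM (D_mat lam)) \<and> \<not> p dvd c"
proof -
  interpret Sn: group Sn by (rule sym_group_is_group)
  have P: "PM (D_mat lam) = PD" by (simp add: P_of_def Let_def)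
  have sy: "sylow_subgroup p (young_group n lam) PD" using choices[unfolded admissible_choices_def, THEN conjunct1] .
  have St: "Stab (T0, T0) = carrier (young_group n lam)" unfolding young_group_carrier Stab_def by auto
  let ?Y = "carrier (young_group n lam)"
  have yg: "young_group n lam = Sn\<lparr>carrier := ?Y\<rparr>" by (simp add: young_group_def)
  have Ysub: "subgroup ?Y Sn"
  proof (rule Sn.subgroupI)
    show "?Y \<subseteq> carrier Sn" unfolding young_group_carrier by (auto simp: sym_group_def)
    have "id \<in> ?Y" unfolding young_group_carrier by (simp add: permutes_id)
    then show "?Y \<noteq> {}" by blast
    fix q assume "q \<in> ?Y"
    then have q: "q permutes {1..n}" "tact q T0 = T0" unfolding young_group_carrier by auto
    have i: "inv\<^bsub>Sn\<^esub> q = inv' q" using q(1) by (intro sym_group_inv_equality) (simp add: sym_group_carrier)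
    have "tact (inv' q) (tact q T0) = T0" unfolding tact_comp[symmetric] permutes_inv_o(2)[OF q(1)] by simp
    then show "inv\<^bsub>Sn\<^esub> q \<in> ?Y" unfolding i young_group_carrier using permutes_inv[OF q(1)] q(2) by simp
    fix r assume "r \<in> ?Y"
    then have r: "r permutes {1..n}" "tact r T0 = T0" unfolding young_group_carrier by auto
    have "tact (q \<circ> r) T0 = T0" unfolding tact_comp r(2) q(2) ..
    then show "q \<otimes>\<^bsub>Sn\<^esub> r \<in> ?Y" unfolding young_group_carrier using permutes_compose[OF r(1) q(1)] by (simp add: sym_group_mult)
  qed
  have sub: "subgroup PD (Sn\<lparr>carrier := ?Y\<rparr>)" using sy yg by (simp add: sylow_subgroup_def)
  show "subgroup (PM (D_mat lam)) Sn" unfolding P by (rule Sn.incl_subgroup[OF Ysub sub])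
  show "\<exists>m. card (PM (D_mat lam)) = p ^ m" unfolding P using sy by (auto simp: sylow_subgroup_def)
  show "PM (D_mat lam) \<subseteq> Stab (T0, T0)" unfolding P St using subgroup.subset[OF sub] by simp
  have "finite ?Y" unfolding young_group_carrier using finite_perms by (rule finite_subset[rotated]) auto
  then have "order (young_group n lam) \<noteq> 0"
    unfolding order_def using subgroup.one_closed[OF Ysub] by (auto simp: card_eq_0_iff)
  from sylow_index[OF p sy this] show "\<exists>c. card (Stab (T0, T0)) = c * card (PM (D_mat lam)) \<and> \<not> p dvd c"
    unfolding P St order_def by blast
qed

lemma RR_cases: "M \<in> RR \<Longrightarrow> M = D_mat lam \<or> M \<in> M_mats lam"
  using Nl unfolding R_mats_def S_mats_def N_choice_def by blast

lemma zz: 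
  assumes "M \<in> RR"
  shows "fst (zz M) \<in> Y" "snd (zz M) \<in> Y" "mat_of (fst (zz M)) (snd (zz M)) = M"
    "M \<noteq> D_mat lam \<Longrightarrow> fst (zz M) \<noteq> snd (zz M)"
  using RR_cases[OF assms] T0_in mat_of_self[OF T0_in] TU[of M] by (auto simp: zz_def)

text \<open>For symmetric \<open>M\<close> the stabiliser of the unordered pair is twice as large as that of the ordered one. If
\<open>p > 2\<close>, then this factor does not affect the divisibility of the index by \<open>p\<close>; if \<open>p = 2\<close>, then the order
of \<open>P\<^sub>M\<close> contains the same factor.\<close>

lemma PM_properties:
  assumes M: "M \<in> RR"
  shows "subgroup (PM M) Sn" "\<exists>k. card (PM M) = p ^ k" "PM M \<subseteq> Stab (zz M)"
    "\<not> p dvd card (Stab (zz M)) div card (PM M)"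
proof -
  have main: "subgroup (PM M) Sn \<and> (\<exists>k. card (PM M) = p ^ k) \<and> PM M \<subseteq> Stab (zz M)
    \<and> (\<exists>c. card (Stab (zz M)) = c * card (PM M) \<and> \<not> p dvd c)"
  proof (cases "M = D_mat lam")
    case True
    then show ?thesis using PM_young by (simp add: zz_def)
  next
    case False
    then have MM: "M \<in> M_mats lam" and z: "zz M = (TT M, UU M)" using RR_cases[OF M] by (auto simp: zz_def)
    note St = Stab_cases[OF TU(1,2,5)[OF MM], unfolded TU(4)[OF MM]]
    show ?thesis
    proof (cases "p > 2 \<or> M \<noteq> transpose_mat M")
      case odd: True
      note P = PM_product[OF MM odd]
      obtain c where c: "card (Fix (TT M, UU M)) = c * card (PM M)" "\<not> p dvd c" using P(4) by blast
      have "\<exists>c. card (Stab (zz M)) = c * card (PM M) \<and> \<not> p dvd c"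
      proof (cases "M = transpose_mat M")
        case True
        then have "p > 2" using odd by blast
        then have "\<not> p dvd 2 * c" using c(2) p prime_dvd_mult_iff[OF p] by (auto dest: dvd_imp_le)
        moreover have "card (Stab (zz M)) = (2 * c) * card (PM M)" using St(2)[OF True] c(1) z by simp
        ultimately show ?thesis by blast
      next
        case False
        then show ?thesis using St(1) c z by metis
      qed
      then show ?thesis using P(1,2) subset_trans[OF P(3) Fix_Stab] unfolding z by (intro conjI)
    next
      case False
      then have p2: "p = 2" using prime_ge_2_nat[OF p] by linarith
      have sym: "M = transpose_mat M" using False by blast
      then have S: "M \<in> S_mats lam" using MM by (simp add: S_mats_def)
      show ?thesis using PM_semidirect[OF p2 S] St(2)[OF sym] z by simp
    qed
  qed
  then show "subgroup (PM M) Sn" "\<exists>k. card (PM M) = p ^ k" "PM M \<subseteq> Stab (zz M)" by blast+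
  obtain c k where c: "card (Stab (zz M)) = c * card (PM M)" "\<not> p dvd c" "card (PM M) = p ^ k" using main by blast
  then have "card (Stab (zz M)) div card (PM M) = c" using p by (simp add: prime_gt_0_nat)
  then show "\<not> p dvd card (Stab (zz M)) div card (PM M)" using c(2) by simp
qed

end

section \<open>Multiplicities in the squares of a Young permutation module\<close>

lemma (in group) conjugate_in_commute:
  assumes "P \<subseteq> carrier G" "Q \<subseteq> carrier G"
  shows "conjugate_in G P Q \<longleftrightarrow> conjugate_in G Q P"
proof -
  have "conjugate_in G Q P" if P: "P \<subseteq> carrier G" and c: "conjugate_in G P Q" for P Q
  proof -
    obtain g where g: "g \<in> carrier G" "conj_subgroup G g P = Q" using c unfolding conjugate_in_def by blast
    have "inv g \<otimes> (g \<otimes> x \<otimes> inv g) \<otimes> inv (inv g) = x" if "x \<in> P" for x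
    proof -
      have x: "x \<in> carrier G" using that P by blast
      have "inv g \<otimes> (g \<otimes> (x \<otimes> inv g)) = x \<otimes> inv g" using x g(1) by (simp add: m_assoc[symmetric])
      then show ?thesis using x g(1) by (simp add: m_assoc)
    qed
    then have "conj_subgroup G (inv g) Q = P" unfolding g(2)[symmetric] conj_subgroup_def image_image by simp
    then show ?thesis unfolding conjugate_in_def using g(1) by blast
  qed
  then show ?thesis using assms by blast
qed

lemma (in field) minus_one_eq_one_iff:
  assumes p: "ring_char R = p" "p > 0"
  shows "\<ominus> \<one> = \<one> \<longleftrightarrow> p = 2"
proof -
  have "\<ominus> \<one> = \<one> \<longleftrightarrow> \<one> \<oplus> \<one> = \<zero>" using minus_equality[of \<one> \<one>] r_neg[of \<one>] by auto
  also have "\<one> \<oplus> \<one> = add_pow R (2::nat) \<one>" by (simp add: numeral_2_eq_2)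
  also have "\<dots> = \<zero> \<longleftrightarrow> p dvd 2" by (rule add_pow_one_eq_zero[OF p(1)])
  also have "\<dots> \<longleftrightarrow> p = 2" using primes_dvd_imp_eq[OF prime_ring_char[OF p] two_is_prime_nat] by auto
  finally show ?thesis .
qed

context young_choices begin

text \<open>The set \<open>Nl\<close> contains only one matrix of each pair of transposed nonsymmetric matrices.\<close>

lemma RR_transpose:
  assumes M: "M \<in> RR" and N: "N \<in> RR" and t: "transpose_mat N = M"
  shows "M = N"
proof (cases "N = D_mat lam \<or> N \<in> S_mats lam")
  case True
  then have "N = transpose_mat N"
    using mat_of_transpose[of T0 T0] mat_of_self[OF T0_in] unfolding S_mats_def by auto
  then show ?thesis using t by simp
next
  case False
  then have NN: "N \<in> Nl" using N by (simp add: R_mats_def)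
  then have N': "N \<in> M_mats lam - S_mats lam" using Nl unfolding N_choice_def by blast
  then have ns: "N \<noteq> transpose_mat N" unfolding S_mats_def by blast
  have tM: "transpose_mat M = N" unfolding t[symmetric] by simp
  have "M \<noteq> D_mat lam" using tM ns mat_of_transpose[of T0 T0] mat_of_self[OF T0_in] by metis
  moreover have "M \<notin> S_mats lam"
  proof
    assume "M \<in> S_mats lam"
    then have "M = N" using tM unfolding S_mats_def by simp
    then show False using t ns by simp
  qed
  ultimately have "M \<in> Nl" using M by (simp add: R_mats_def)
  then have sub: "{N, M} \<subseteq> Nl \<inter> {N, transpose_mat N}" using NN t by blast
  have "card (Nl \<inter> {N, transpose_mat N}) = 1" using N' Nl unfolding N_choice_def by blast
  then obtain a where a: "Nl \<inter> {N, transpose_mat N} = {a}" by (rule card_1_singletonE)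
  have "{N, M} \<subseteq> {a}" using sub unfolding a .
  then show ?thesis by simp
qed

lemma Nl_covers:
  assumes "M \<in> M_mats lam - S_mats lam" shows "M \<in> Nl \<or> transpose_mat M \<in> Nl"
proof -
  have "card (Nl \<inter> {M, transpose_mat M}) = 1" using assms Nl unfolding N_choice_def by blast
  then have "Nl \<inter> {M, transpose_mat M} \<noteq> {}" by (metis card.empty zero_neq_one)
  then show ?thesis by blast
qed

lemma Nl_sub: "Nl \<subseteq> M_mats lam - S_mats lam"
  using Nl unfolding N_choice_def by blast

lemma XX_sub: "XX \<subseteq> RR"
  unfolding X_mats_def R_mats_def by auto

lemma XX_M_mats: "M \<in> XX \<Longrightarrow> M \<in> M_mats lam"
  using Nl_sub unfolding X_mats_def S_mats_def by (auto split: if_splits)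

lemma finite_RR: "finite RR"
proof (rule finite_imageD)
  show "finite (zz ` RR)"
    by (rule finite_subset[of _ "Y \<times> Y"]) (intro image_subsetI, simp_all add: mem_Times_iff zz(1,2) finite_Y)
  show "inj_on zz RR" by (rule inj_onI) (metis zz(3))
qed

lemma XX_empty_iff:
  assumes "lam \<noteq> [n]" "n > 0"
  shows "XX = {} \<longleftrightarrow> p > 2 \<and> l = 2"
proof -
  have "l \<noteq> 0" using sum_lam assms(2) by (intro notI) simp
  moreover have "l \<noteq> 1"
  proof
    assume l1: "l = 1"
    then obtain a where a: "lam = [a]" by (metis One_nat_def length_0_conv length_Suc_conv)
    then have "a = n" using part by (simp add: is_partition_def)
    then show False using a assms(1) by simp
  qed
  ultimately have l: "2 \<le> l" by linarith
  have p2: "p = 2 \<or> p > 2" using prime_ge_2_nat[OF p] by linarith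
  show ?thesis
  proof (cases "p = 2")
    case True
    obtain M where "M \<in> M_mats lam" using M_mats_nonempty[OF l] by blast
    then have "XX \<noteq> {}" using Nl_covers[of M] True unfolding X_mats_def by auto
    then show ?thesis using True by simp
  next
    case False
    then have X: "XX = Nl" by (simp add: X_mats_def)
    have "Nl = {} \<longleftrightarrow> M_mats lam - S_mats lam = {}" using Nl_covers Nl_sub by blast
    also have "\<dots> \<longleftrightarrow> l = 2"
    proof
      assume "M_mats lam - S_mats lam = {}"
      then have "\<not> 3 \<le> l" using nonsymmetric_mat by blast
      then show "l = 2" using l by linarith
    qed (rule two_parts_symmetric)
    finally show ?thesis using X False p2 by blast
  qed
qed

lemma tact_simps:
  "T \<in> Y \<Longrightarrow> tact \<one>\<^bsub>Sn\<^esub> T = T" "tact (\<pi> \<otimes>\<^bsub>Sn\<^esub> \<sigma>) T = tact \<pi> (tact \<sigma> T)"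
  by (simp add: sym_group_one) (simp only: sym_group_mult tact_comp)

lemma tact_inj: "\<pi> permutes {1..n} \<Longrightarrow> tact \<pi> T = tact \<pi> U \<longleftrightarrow> T = U"
proof
  assume \<pi>: "\<pi> permutes {1..n}" and eq: "tact \<pi> T = tact \<pi> U"
  have "tact (inv' \<pi>) (tact \<pi> T) = T" for T unfolding tact_comp[symmetric] permutes_inv_o(2)[OF \<pi>] by simp
  then show "T = U" using eq by metis
qed simp

end

locale young_squares = young_choices n lam p Nl PD PS s e + F: field F
  for n :: nat and lam :: "nat list" and p :: nat and Nl :: "nat mat set" and PD :: "(nat \<Rightarrow> nat) set"
    and PS :: "nat set \<Rightarrow> (nat \<Rightarrow> nat) set" and s :: "nat mat \<Rightarrow> nat \<Rightarrow> nat \<Rightarrow> nat set" and e :: "nat mat \<Rightarrow> nat \<Rightarrow> nat"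
    and F :: "('f, 'b) ring_scheme" +
  assumes char: "ring_char F = p"
begin

abbreviation "diag_act \<equiv> \<lambda>\<pi>. map_prod (tact \<pi>) (tact \<pi>)"

lemma pair_model_young:
  assumes "Z = Y \<times> Y \<and> c = \<one>\<^bsub>F\<^esub> \<or> Z = {(T, U) \<in> Y \<times> Y. T \<noteq> U} \<and> c = \<ominus>\<^bsub>F\<^esub> \<one>\<^bsub>F\<^esub>"
  shows "pair_model Sn F Y (\<lambda>\<pi>. tact \<pi>) Z c"
proof -
  interpret Sn: group Sn by (rule sym_group_is_group)
  have perm: "\<pi> permutes {1..n}" if "\<pi> \<in> carrier Sn" for \<pi> using that by (simp add: sym_group_carrier)
  show ?thesis
  proof unfold_locales
    show "finite (carrier Sn)" using finite_perms by (simp add: sym_group_def)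
    show "finite Y" by (rule finite_Y)
    show "c \<in> carrier F" "c \<otimes>\<^bsub>F\<^esub> c = \<one>\<^bsub>F\<^esub>" using assms by (auto simp: F.l_minus F.r_minus)
  next
    fix \<pi> T assume "\<pi> \<in> carrier Sn" "T \<in> Y"
    then show "tact \<pi> T \<in> Y" by (intro tact_closed perm)
  next
    fix T assume "T \<in> Y" then show "tact \<one>\<^bsub>Sn\<^esub> T = T" by (rule tact_simps(1))
  next
    fix \<pi> \<sigma> T show "tact (\<pi> \<otimes>\<^bsub>Sn\<^esub> \<sigma>) T = tact \<pi> (tact \<sigma> T)" by (rule tact_simps(2))
  next
    show "Z \<subseteq> Y \<times> Y" using assms by blast
  next
    fix T U assume "(T, U) \<in> Z" then show "(U, T) \<in> Z" using assms by auto
  next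
    fix \<pi> T U assume \<pi>: "\<pi> \<in> carrier Sn" and "(T, U) \<in> Z"
    then show "(tact \<pi> T, tact \<pi> U) \<in> Z"
      using assms tact_closed[OF perm[OF \<pi>]] tact_inj[OF perm[OF \<pi>]] by blast
  next
    fix T assume "c \<noteq> \<one>\<^bsub>F\<^esub>" then show "(T, T) \<notin> Z" using assms by auto
  qed
qed

text \<open>The pairs \<open>zz M\<close> represent the orbits of unordered pairs of tabloids that carry a fixed vector: the orbit of
a pair is determined by its matrix, and interchanging the tabloids transposes the matrix.\<close>

lemma young_square_multiplicity:
  fixes I :: "nat mat set" and W :: "('f, 'w, nat \<Rightarrow> nat) gmod"
  assumes "pair_model Sn F Y (\<lambda>\<pi>. tact \<pi>) Z c" and W: "rep Sn F W"
    and iso: "gmod_iso Sn F W (signed_perm.M Sn F Z diag_act prod.swap c)"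
    and I: "I \<subseteq> RR" and good_I: "\<And>M. M \<in> I \<Longrightarrow> zz M \<in> Z \<and> (c = \<one>\<^bsub>F\<^esub> \<or> M \<noteq> transpose_mat M)"
    and cover_I: "\<And>T U. (T, U) \<in> Z \<Longrightarrow> c = \<one>\<^bsub>F\<^esub> \<or> mat_of T U \<noteq> transpose_mat (mat_of T U)
      \<Longrightarrow> mat_of T U \<in> I \<or> transpose_mat (mat_of T U) \<in> I"
    and Q: "p_subgroup p Sn Q"
  shows "gmod_mult Sn F W (scott_module Sn F Q) = card {M \<in> I. conjugate_in Sn (PM M) Q}" (is ?mult)
    and "is_summand Sn F (scott_module Sn F Q) W \<longleftrightarrow> (\<exists>M\<in>I. conjugate_in Sn (PM M) Q)" (is ?sum)
proof -
  interpret pm: pair_model Sn F Y "\<lambda>\<pi>. tact \<pi>" Z c by fact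
  interpret sc: signed_perm_scott Sn F Z diag_act prod.swap c p Q
  proof unfold_locales
    show "finite (carrier Sn)" by (rule pm.fin_G)
    show "ring_char F = p" "p_subgroup p Sn Q" by (rule char, rule Q)
    show "p > 0" using p by (rule prime_gt_0_nat)
  qed
  have ZY: "T \<in> Y \<and> U \<in> Y" if "(T, U) \<in> Z" for T U using that pm.Z_sub by blast
  have orb: "(T', U') \<in> pm.orb (T, U) \<longleftrightarrow> mat_of T' U' = mat_of T U"
    if Y: "T \<in> Y" "U \<in> Y" "T' \<in> Y" "U' \<in> Y" for T U T' U'
  proof
    assume "(T', U') \<in> pm.orb (T, U)"
    then obtain \<pi> where "\<pi> permutes {1..n}" "T' = tact \<pi> T" "U' = tact \<pi> U"
      unfolding pm.orb_def by (auto simp: sym_group_carrier)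
    then show "mat_of T' U' = mat_of T U" using mat_of_tact Y by simp
  next
    assume "mat_of T' U' = mat_of T U"
    then obtain \<pi> where \<pi>: "\<pi> permutes {1..n}" "tact \<pi> T = T'" "tact \<pi> U = U'"
      using same_mat_same_orbit[OF Y] by metis
    then have "(T', U') = diag_act \<pi> (T, U)" "\<pi> \<in> carrier Sn" by (simp_all add: sym_group_carrier)
    then show "(T', U') \<in> pm.orb (T, U)" unfolding pm.orb_def by blast
  qed
  have zY: "fst (zz M) \<in> Y" "snd (zz M) \<in> Y" "mat_of (fst (zz M)) (snd (zz M)) = M" if "M \<in> I" for M
    using zz(1-3) that I by blast+
  have orb_zz: "(T, U) \<in> pm.orb (zz M) \<longleftrightarrow> mat_of T U = M" if "M \<in> I" "T \<in> Y" "U \<in> Y" for M T U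
    using orb[OF zY(1,2)[OF that(1)] that(2,3)] zY(3)[OF that(1)] by simp
  have swap_zz: "prod.swap (zz N) \<in> pm.orb (zz M) \<longleftrightarrow> transpose_mat N = M" if "M \<in> I" "N \<in> I" for M N
    using orb_zz[OF that(1) zY(2,1)[OF that(2)]] mat_of_transpose[of "snd (zz N)" "fst (zz N)"] zY(3)[OF that(2)]
    by (simp add: prod.swap_def)
  have stab: "pm.stab z = Stab z" for z unfolding pm.stab_def Stab_def by (auto simp: sym_group_carrier)
  have gd: "pm.good (zz M)" if "M \<in> I" for M
    using good_I[OF that] swap_zz[OF that that] unfolding pm.good_def by auto
  have dist: "zz N \<notin> pm.orb (zz M) \<and> prod.swap (zz N) \<notin> pm.orb (zz M)" if MN: "M \<in> I" "N \<in> I" "M \<noteq> N" for M N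
    using orb_zz[OF MN(1) zY(1,2)[OF MN(2)]] zY(3)[OF MN(2)] swap_zz[OF MN(1,2)] RR_transpose[of M N] I MN by auto
  have cover: "\<exists>M\<in>I. y \<in> pm.orb (zz M) \<or> prod.swap y \<in> pm.orb (zz M)" if y: "pm.good y" for y
  proof -
    obtain T U where yTU: "y = (T, U)" by (cases y)
    have Z: "(T, U) \<in> Z" and alt: "c = \<one>\<^bsub>F\<^esub> \<or> (U, T) \<notin> pm.orb (T, U)" using y unfolding pm.good_def yTU by auto
    note TU = ZY[OF Z, THEN conjunct1] ZY[OF Z, THEN conjunct2]
    have t: "mat_of U T = transpose_mat (mat_of T U)" by (rule mat_of_transpose)
    have "c = \<one>\<^bsub>F\<^esub> \<or> mat_of T U \<noteq> transpose_mat (mat_of T U)"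
      using alt orb[OF TU TU(2,1)] t by metis
    from cover_I[OF Z this] show ?thesis
    proof
      assume m: "mat_of T U \<in> I"
      then have "y \<in> pm.orb (zz (mat_of T U))" using orb_zz[OF m TU] yTU by simp
      then show ?thesis using m by blast
    next
      assume m: "transpose_mat (mat_of T U) \<in> I"
      then have "prod.swap y \<in> pm.orb (zz (transpose_mat (mat_of T U)))" using orb_zz[OF m TU(2,1)] yTU t by simp
      then show ?thesis using m by blast
    qed
  qed
  have PMp: "subgroup (PM M) Sn" "PM M \<subseteq> pm.stab (zz M)" "\<exists>k. card (PM M) = p ^ k"
    "\<not> p dvd card (pm.stab (zz M)) div card (PM M)" if "M \<in> I" for M
    using PM_properties[of M] that I unfolding stab by blast+
  have fin: "finite I" using finite_RR I by (rule finite_subset[rotated])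
  note res = sc.scott_multiplicity[of I zz PM W, OF fin gd dist cover PMp W iso]
  show ?mult by (rule res(1))
  show ?sum by (rule res(2))
qed

abbreviation "Ylam \<equiv> young_module F n lam"

lemma young_module_eq: "Ylam = perm_gmod Sn F Y (\<lambda>\<pi>. tact \<pi>)"
  by (simp add: young_module_def)

lemma sym_square_multiplicity:
  assumes Q: "p_subgroup p Sn Q"
  shows "gmod_mult Sn F (sym_square Sn F Ylam) (scott_module Sn F Q) = card {M \<in> RR. conjugate_in Sn (PM M) Q}" (is ?mult)
    and "is_summand Sn F (scott_module Sn F Q) (sym_square Sn F Ylam) \<longleftrightarrow> (\<exists>M\<in>RR. conjugate_in Sn (PM M) Q)" (is ?sum)
proof -
  have pm: "pair_model Sn F Y (\<lambda>\<pi>. tact \<pi>) (Y \<times> Y) \<one>\<^bsub>F\<^esub>" by (rule pair_model_young) blast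
  interpret pm: pair_model Sn F Y "\<lambda>\<pi>. tact \<pi>" "Y \<times> Y" "\<one>\<^bsub>F\<^esub>" by (rule pm)
  note sq = pm.sym_square_iso[OF refl refl, folded young_module_eq]
  have good: "zz M \<in> Y \<times> Y \<and> (\<one>\<^bsub>F\<^esub> = \<one>\<^bsub>F\<^esub> \<or> M \<noteq> transpose_mat M)" if "M \<in> RR" for M
    using zz(1,2)[OF that] by (simp add: mem_Times_iff)
  have cover: "mat_of T U \<in> RR \<or> transpose_mat (mat_of T U) \<in> RR" if TU: "(T, U) \<in> Y \<times> Y" for T U
  proof (cases "T = U")
    case True
    then show ?thesis using TU mat_of_self unfolding R_mats_def by auto
  next
    case False
    then have "mat_of T U \<in> M_mats lam" using TU mat_of_M_mats by blast
    then show ?thesis using Nl_covers unfolding R_mats_def by blast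
  qed
  note res = young_square_multiplicity[OF pm sq subset_refl good cover Q]
  show ?mult by (rule res(1))
  show ?sum by (rule res(2))
qed

text \<open>For \<open>p > 2\<close> some permutation interchanges the members of a pair with symmetric matrix, so the sign leaves
only the nonsymmetric matrices. For \<open>p = 2\<close> the sign is trivial, and merely the diagonal matrix is lost,
which belongs to the pairs of equal tabloids.\<close>

lemma ext_square_multiplicity:
  assumes Q: "p_subgroup p Sn Q"
  shows "gmod_mult Sn F (ext_square Sn F Ylam) (scott_module Sn F Q) = card {M \<in> XX. conjugate_in Sn (PM M) Q}" (is ?mult)
    and "is_summand Sn F (scott_module Sn F Q) (ext_square Sn F Ylam) \<longleftrightarrow> (\<exists>M\<in>XX. conjugate_in Sn (PM M) Q)" (is ?sum)
proof -
  let ?Z = "{(T, U) \<in> Y \<times> Y. T \<noteq> U}" and ?m = "\<ominus>\<^bsub>F\<^esub> \<one>\<^bsub>F\<^esub>"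
  have pm: "pair_model Sn F Y (\<lambda>\<pi>. tact \<pi>) ?Z ?m" by (rule pair_model_young) blast
  interpret pm: pair_model Sn F Y "\<lambda>\<pi>. tact \<pi>" ?Z ?m by (rule pm)
  note sq = pm.ext_square_iso[OF refl refl, folded young_module_eq]
  have m1: "?m = \<one>\<^bsub>F\<^esub> \<longleftrightarrow> p = 2" by (rule F.minus_one_eq_one_iff[OF char prime_gt_0_nat[OF p]])
  have good: "zz M \<in> ?Z \<and> (?m = \<one>\<^bsub>F\<^esub> \<or> M \<noteq> transpose_mat M)" if M: "M \<in> XX" for M
  proof -
    have R: "M \<in> RR" using M XX_sub by blast
    have "zz M \<in> ?Z" using zz(1,2)[OF R] zz(4)[OF R M_not_D[OF XX_M_mats[OF M]]] by (auto simp: case_prod_beta mem_Times_iff)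
    moreover have "p = 2 \<or> M \<noteq> transpose_mat M"
      using M Nl_sub unfolding X_mats_def S_mats_def by (auto split: if_splits)
    ultimately show ?thesis using m1 by blast
  qed
  have cover: "mat_of T U \<in> XX \<or> transpose_mat (mat_of T U) \<in> XX"
    if TU: "(T, U) \<in> ?Z" and alt: "?m = \<one>\<^bsub>F\<^esub> \<or> mat_of T U \<noteq> transpose_mat (mat_of T U)" for T U
  proof -
    have M: "mat_of T U \<in> M_mats lam" using TU mat_of_M_mats by blast
    show ?thesis
    proof (cases "p = 2")
      case True
      then show ?thesis using Nl_covers[of "mat_of T U"] M unfolding X_mats_def by auto
    next
      case False
      then have "mat_of T U \<in> M_mats lam - S_mats lam" using alt m1 M unfolding S_mats_def by blast
      then show ?thesis using Nl_covers False unfolding X_mats_def by simp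
    qed
  qed
  note res = young_square_multiplicity[OF pm sq XX_sub good cover Q]
  show ?mult by (rule res(1))
  show ?sum by (rule res(2))
qed

lemma PM_p_subgroup: "M \<in> RR \<Longrightarrow> p_subgroup p Sn (PM M)"
  using PM_properties(1,2) unfolding p_subgroup_def by blast

lemma conjugate_PM_commute:
  assumes "p_subgroup p Sn Q" "M \<in> RR"
  shows "conjugate_in Sn Q (PM M) \<longleftrightarrow> conjugate_in Sn (PM M) Q"
proof -
  interpret Sn: group Sn by (rule sym_group_is_group)
  show ?thesis
  proof (rule Sn.conjugate_in_commute)
    show "Q \<subseteq> carrier Sn" using assms(1) subgroup.subset unfolding p_subgroup_def by blast
    show "PM M \<subseteq> carrier Sn" by (rule subgroup.subset[OF PM_properties(1)[OF assms(2)]])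
  qed
qed

end

theorem theorem4:
  fixes F :: "('f, 'b) ring_scheme"
    and p n :: nat and lam :: "nat list" and Nl :: "nat mat set"
    and PD :: "(nat \<Rightarrow> nat) set" and PS :: "nat set \<Rightarrow> (nat \<Rightarrow> nat) set"
    and s :: "nat mat \<Rightarrow> nat \<Rightarrow> nat \<Rightarrow> nat set" and e :: "nat mat \<Rightarrow> nat \<Rightarrow> nat"
    and P :: "(nat \<Rightarrow> nat) set"
  defines "G \<equiv> sym_group n"
    and "V \<equiv> young_module F n lam"
    and "PM \<equiv> P_of p n lam PD PS s e"
    and "RR \<equiv> R_mats lam Nl"
    and "XX \<equiv> X_mats p lam Nl"
  assumes "field F" and "ring_char F = p" and "p > 0"
    and "n > 0" and "is_partition lam n"
    and "N_choice lam Nl"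
    and "admissible_choices p n lam PD PS s e"
    and "p_subgroup p G P"
  shows
    "(is_summand G F (scott_module G F P) (sym_square G F V)
        \<longleftrightarrow> (\<exists>M\<in>RR. conjugate_in G P (PM M)))
     \<and> (\<forall>M\<in>RR. gmod_mult G F (sym_square G F V) (scott_module G F (PM M))
                  = card (mat_class n PM RR M))
     \<and> (lam \<noteq> [n] \<and> XX \<noteq> {} \<longrightarrow>
          (is_summand G F (scott_module G F P) (ext_square G F V)
             \<longleftrightarrow> (\<exists>M\<in>XX. conjugate_in G P (PM M)))
          \<and> (\<forall>M\<in>XX. gmod_mult G F (ext_square G F V) (scott_module G F (PM M))
                       = card (mat_class n PM XX M)))
     \<and> (lam \<noteq> [n] \<longrightarrow> (XX = {} \<longleftrightarrow> p > 2 \<and> length lam = 2))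
     \<and> (p > 2 \<and> length lam = 2 \<longrightarrow>
          (\<forall>Q. p_subgroup p G Q \<longrightarrow>
             gmod_mult G F (ext_square G F V) (scott_module G F Q) = 0))"
proof -
  interpret F: field F by fact
  interpret young_squares n lam p Nl PD PS s e F
  proof (intro young_squares.intro young_choices.intro tabloid_pairs.intro young_choices_axioms.intro young_squares_axioms.intro)
    show "Factorial_Ring.prime p" by (rule F.prime_ring_char) fact+
  qed fact+
  note defs = G_def V_def PM_def RR_def XX_def mat_class_def
  have P: "p_subgroup p (sym_group n) P" using assms(13) unfolding G_def .
  have a: "is_summand G F (scott_module G F P) (sym_square G F V) \<longleftrightarrow> (\<exists>M\<in>RR. conjugate_in G P (PM M))"
    unfolding defs sym_square_multiplicity(2)[OF P] using conjugate_PM_commute[OF P] by blast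
  have b: "\<forall>M\<in>RR. gmod_mult G F (sym_square G F V) (scott_module G F (PM M)) = card (mat_class n PM RR M)"
    unfolding defs using sym_square_multiplicity(1)[OF PM_p_subgroup] by blast
  have c: "is_summand G F (scott_module G F P) (ext_square G F V) \<longleftrightarrow> (\<exists>M\<in>XX. conjugate_in G P (PM M))"
    unfolding defs ext_square_multiplicity(2)[OF P] using conjugate_PM_commute[OF P] XX_sub by blast
  have d: "\<forall>M\<in>XX. gmod_mult G F (ext_square G F V) (scott_module G F (PM M)) = card (mat_class n PM XX M)"
    unfolding defs using ext_square_multiplicity(1)[OF PM_p_subgroup] XX_sub by blast
  have f: "lam \<noteq> [n] \<longrightarrow> (XX = {} \<longleftrightarrow> p > 2 \<and> length lam = 2)"
    unfolding defs using XX_empty_iff \<open>n > 0\<close> by blast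
  have g: "p > 2 \<and> length lam = 2 \<longrightarrow> (\<forall>Q. p_subgroup p G Q \<longrightarrow> gmod_mult G F (ext_square G F V) (scott_module G F Q) = 0)"
  proof (intro impI allI)
    fix Q assume pl: "p > 2 \<and> length lam = 2" and Q: "p_subgroup p G Q"
    then have "XX = {}" using f by force
    then show "gmod_mult G F (ext_square G F V) (scott_module G F Q) = 0"
      using ext_square_multiplicity(1)[of Q] Q unfolding defs by simp
  qed
  show ?thesis using a b c d f g by blast
qed

end
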